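(* Fix $M\in\mathbb{N}$ and a master graph $\mathbf{\Gamma}$ on $\{1,\ldots,M\}$ with adjacency entries $\gamma_{s,t}(\mathbf{\Gamma})$, and let the set of layers be divided into two disjoint classes, $\{1,\ldots,M\}=\mathcal{M}_1\cup\mathcal{M}_2$. Let $n=\sum_{s=1}^Mn_s$ with layer sizes $n_s=n_s(n)\to\infty$ for all $s$, and let $\mathcal{G}_{n_1,\ldots,n_M}(\mathbf{\Gamma})$ be the associated set of multi-layer graphs with layers $\Lambda_1,\ldots,\Lambda_M$. Consider the microcanonical and canonical ensembles $P_{\mathrm{mic}},P_{\mathrm{can}}$ on $\mathcal{G}_{n_1,\ldots,n_M}(\mathbf{\Gamma})$ with the following constraints: for every pair $s,t\in\mathcal{M}_1$ with $\gamma_{s,t}(\mathbf{\Gamma})=1$ the targeted degree sequences are constrained to $\vec{k}^{\,*}_{s\to t}$ and $\vec{k}^{\,*}_{t\to s}$, and for every pair $s\in\mathcal{M}_1$, $t\in\mathcal{M}_2$ with $\gamma_{s,t}(\mathbf{\Gamma})=1$ the $t$-targeted degree sequence of layer $s$ is constrained to $\vec{k}^{\,*}_{s\to t}$ (but the $s$-targeted degree sequence of layer $t$ is not constrained); here $\vec{k}^{\,*}_{s\to t}=(k_i^{*\,t})_{i\in\Lambda_s}$, and the constraints are assumed to be jointly realised by at least one graph in $\mathcal{G}_{n_1,\ldots,n_M}(\mathbf{\Gamma})$. For constrained $s\to t$ put $$L^*_{s,t}=\sum_{i\in\Lambda_s}k_i^{*\,t},\qquad m^*_{s\to t}=\max_{i\in\Lambda_s}k_i^{*\,t},\qquad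 f_{s\to t}^{(n_s)}=n_s^{-1}\sum_{i\in\Lambda_s}\delta_{k_i^{*\,t}}.$$ Suppose that the limits $A_s=\lim_{n_1,\ldots,n_M\to\infty}\frac{n_s}{n}$ exist for all $s=1,\ldots,M$; that for all $s,t\in\mathcal{M}_1$ with $\gamma_{s,t}(\mathbf{\Gamma})=1$ one has $m^*_{s\to t}m^*_{t\to s}=o({L^*_{s,t}}^{2/3})$ if $s\ne t$ and $m^*_{s\to s}=o(n_s^{1/2})$ if $s=t$; and that for all $s\in\mathcal{M}_1$, $t\in\mathcal{M}_1\cup\mathcal{M}_2$ with $\gamma_{s,t}(\mathbf{\Gamma})=1$ there exist probability distributions $f_{s\to t}$ on $\mathbb{N}_0$ such that $\lim_{n_s\to\infty}\|f_{s\to t}^{(n_s)}-f_{s\to t}\|_{\ell^1(g)}=0$. Then $$s_\infty=\lim_{n\to\infty}n^{-1}S_n(P_{\mathrm{mic}}\mid P_{\mathrm{can}})=\sum_{\substack{s\in\mathcal{M}_1,\ t\in\mathcal{M}_1\cup\mathcal{M}_2\\ \gamma_{s,t}(\mathbf{\Gamma})=1}}A_s\,\|f_{s\to t}\|_{\ell^1(g)}.$$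
   Context: $\mathbb{N}_0=\{0,1,2,\ldots\}$; $\delta_k$ is the point measure at $k$; $a=o(b)$ means that for every $\varepsilon>0$, eventually $|a|\le\varepsilon b$. Graphs are simple and undirected, with adjacency entries $g_{i,j}(\mathbf{G})\in\{0,1\}$. The master graph $\mathbf{\Gamma}$ is an undirected graph with node set $\{1,\ldots,M\}$ in which self-loops are allowed but multi-links are not; $\gamma_{s,t}(\mathbf{\Gamma})=\gamma_{t,s}(\mathbf{\Gamma})\in\{0,1\}$ equals $1$ iff there is a link between $s$ and $t$. The set $\mathcal{G}_{n_1,\ldots,n_M}(\mathbf{\Gamma})$ consists of all simple undirected graphs whose node set is the disjoint union of layers $\Lambda_1,\ldots,\Lambda_M$, $|\Lambda_s|=n_s$, and in which a link between a node of $\Lambda_s$ and a node of $\Lambda_t$ ($s=t$ allowed) is permitted only if $\gamma_{s,t}(\mathbf{\Gamma})=1$. The $t$-targeted degree sequence of layer $s$ in $\mathbf{G}$ is $\vec k_{s\to t}(\mathbf{G})=(k_i^t(\mathbf{G}))_{i\in\Lambda_s}$ with $k_i^t(\mathbf{G})=\sum_{j\in\Lambda_t}g_{i,j}(\mathbf{G})$. Ensembles: given a finite set $\mathcal{G}$ of graphs, a vector-valued function $\vec C$ on $\mathcal{G}$ and a value $\vec C^*$ attained by $\vec C$ for at least one graph in $\mathcal{G}$, the microcanonical distribution is $P_{\mathrm{mic}}(\mathbf{G})=1/\Omega_{\vec C^*}$ if $\vec C(\mathbf{G})=\vec C^*$ and $0$ otherwise, where $\Omega_{\vec C^*}=|\{\mathbf{G}\in\mathcal{G}\colon\vec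 C(\mathbf{G})=\vec C^*\}|$. The canonical distribution $P_{\mathrm{can}}$ is the probability distribution on $\mathcal{G}$ that maximises the entropy $-\sum_{\mathbf{G}\in\mathcal{G}}P(\mathbf{G})\ln P(\mathbf{G})$ subject to $\sum_{\mathbf{G}\in\mathcal{G}}P(\mathbf{G})\,\vec C(\mathbf{G})=\vec C^*$; it has the form $P_{\mathrm{can}}(\mathbf{G})=e^{-\vec\theta^*\cdot\vec C(\mathbf{G})}/Z(\vec\theta^* )$ with $Z(\vec\theta)=\sum_{\mathbf{G}\in\mathcal{G}}e^{-\vec\theta\cdot\vec C(\mathbf{G})}$ and $\vec\theta^*$ chosen such that the average of $\vec C$ equals $\vec C^*$. The relative entropy is $S_n(P_{\mathrm{mic}}\mid P_{\mathrm{can}})=\sum_{\mathbf{G}\in\mathcal{G}}P_{\mathrm{mic}}(\mathbf{G})\ln\frac{P_{\mathrm{mic}}(\mathbf{G})}{P_{\mathrm{can}}(\mathbf{G})}$. The function $g\colon\mathbb{N}_0\to[0,\infty)$ is $g(k)=\log\left(\frac{k!}{k^ke^{-k}}\right)$ (so $g(0)=0$), and $\|h\|_{\ell^1(g)}=\sum_{k\in\mathbb{N}_0}|h(k)|\,g(k)$. *)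

theory Defs
  imports "HOL-Probability.Probability" "HOL-Library.Landau_Symbols"
begin

section \<open>Microcanonical and canonical ensembles\<close>

text \<open>
  A vector-valued constraint is a function \<open>C\<close> with \<open>C x c\<close> the component with index \<open>c \<in> I\<close> at \<open>x\<close>;
  \<open>cs\<close> is the prescribed value. All ensembles are distributions on the finite set \<open>X\<close>.
\<close>

definition microcanonical :: "'x set \<Rightarrow> 'c set \<Rightarrow> ('x \<Rightarrow> 'c \<Rightarrow> real) \<Rightarrow> ('c \<Rightarrow> real) \<Rightarrow> 'x pmf" where
  "microcanonical X I C cs = pmf_of_set {x \<in> X. \<forall>c\<in>I. C x c = cs c}"

definition gibbs_entropy :: "'x set \<Rightarrow> 'x pmf \<Rightarrow> real" where
  "gibbs_entropy X P = - (\<Sum>x\<in>X. pmf P x * ln (pmf P x))"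

definition soft_constraint :: "'x set \<Rightarrow> 'c set \<Rightarrow> ('x \<Rightarrow> 'c \<Rightarrow> real) \<Rightarrow> ('c \<Rightarrow> real) \<Rightarrow> 'x pmf \<Rightarrow> bool" where
  "soft_constraint X I C cs P \<longleftrightarrow>
     set_pmf P \<subseteq> X \<and> (\<forall>c\<in>I. (\<Sum>x\<in>X. pmf P x * C x c) = cs c)"

text \<open>
  The maximiser exists and is unique whenever the constraint is attained on the finite set \<open>X\<close>
  (strictly concave function on a nonempty compact convex set). Defining it by maximality rather than
  by the exponential form also covers values of the constraint on the boundary of the
  attainable region (for instance nodes of degree 0), where some Lagrange multipliers are infinite.
\<close>

definition canonical :: "'x set \<Rightarrow> 'c set \<Rightarrow> ('x \<Rightarrow> 'c \<Rightarrow> real) \<Rightarrow> ('c \<Rightarrow> real) \<Rightarrow> 'x pmf" where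
  "canonical X I C cs =
     (THE P. soft_constraint X I C cs P \<and>
             (\<forall>Q. soft_constraint X I C cs Q \<longrightarrow> gibbs_entropy X Q \<le> gibbs_entropy X P))"

text \<open>
  Summands with \<open>pmf P x = 0\<close> vanish, as they should. For the two ensembles above,
  \<open>pmf Q x = 0\<close> implies \<open>pmf P x = 0\<close>, so division by zero plays no role.
\<close>

definition relative_entropy :: "'x set \<Rightarrow> 'x pmf \<Rightarrow> 'x pmf \<Rightarrow> real" where
  "relative_entropy X P Q = (\<Sum>x\<in>X. pmf P x * ln (pmf P x / pmf Q x))"

section \<open>Multi-layer graphs\<close>

definition master_graph :: "nat \<Rightarrow> (nat \<Rightarrow> nat \<Rightarrow> nat) \<Rightarrow> bool" where
  "master_graph M \<gamma> \<longleftrightarrow>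
     (\<forall>s\<in>{1..M}. \<forall>t\<in>{1..M}. \<gamma> s t \<in> {0, 1} \<and> \<gamma> s t = \<gamma> t s)"

text \<open>
  The nodes of layer \<open>s\<close> are the pairs \<open>(s, 0), \<dots>, (s, n s - 1)\<close>, which makes the layers disjoint.
\<close>

type_synonym node = "nat \<times> nat"

definition layer :: "(nat \<Rightarrow> nat) \<Rightarrow> nat \<Rightarrow> node set" where
  "layer n s = {s} \<times> {..<n s}"

text \<open>
  The node set being fixed, a simple undirected graph is given by its set of links, each
  link being a two-element set of nodes.
\<close>

definition multilayer_graphs :: "nat \<Rightarrow> (nat \<Rightarrow> nat \<Rightarrow> nat) \<Rightarrow> (nat \<Rightarrow> nat) \<Rightarrow> node set set set" where
  "multilayer_graphs M \<gamma> n =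
     {G. \<forall>e\<in>G. \<exists>s\<in>{1..M}. \<exists>t\<in>{1..M}. \<gamma> s t = 1 \<and>
            (\<exists>i\<in>layer n s. \<exists>j\<in>layer n t. i \<noteq> j \<and> e = {i, j})}"

definition adj :: "node set set \<Rightarrow> node \<Rightarrow> node \<Rightarrow> nat" where
  "adj G i j = of_bool ({i, j} \<in> G)"

definition targeted_degree :: "(nat \<Rightarrow> nat) \<Rightarrow> node set set \<Rightarrow> nat \<Rightarrow> node \<Rightarrow> nat" where
  "targeted_degree n G t i = (\<Sum>j\<in>layer n t. adj G i j)"

section \<open>Targeted degree constraints\<close>

text \<open>
  The pairs \<open>(s, t)\<close> for which the \<open>t\<close>-targeted degrees of layer \<open>s\<close> are constrained. As \<open>\<gamma>\<close> is symmetric,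
  both \<open>(s, t)\<close> and \<open>(t, s)\<close> occur when \<open>s\<close> and \<open>t\<close> are linked layers of the class \<open>M1\<close>.
\<close>

definition constrained_pairs :: "(nat \<Rightarrow> nat \<Rightarrow> nat) \<Rightarrow> nat set \<Rightarrow> nat set \<Rightarrow> (nat \<times> nat) set" where
  "constrained_pairs \<gamma> M1 M2 = {(s, t). s \<in> M1 \<and> t \<in> M1 \<union> M2 \<and> \<gamma> s t = 1}"

text \<open>
  The component of the constraint with index \<open>(i, t)\<close> is the \<open>t\<close>-targeted degree of the node \<open>i\<close>, with
  prescribed value \<open>k i t\<close>.
\<close>

definition constraint_index ::
  "(nat \<Rightarrow> nat \<Rightarrow> nat) \<Rightarrow> nat set \<Rightarrow> nat set \<Rightarrow> (nat \<Rightarrow> nat) \<Rightarrow> (node \<times> nat) set" where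
  "constraint_index \<gamma> M1 M2 n =
     {(i, t). \<exists>s. (s, t) \<in> constrained_pairs \<gamma> M1 M2 \<and> i \<in> layer n s}"

definition degree_constraint :: "(nat \<Rightarrow> nat) \<Rightarrow> node set set \<Rightarrow> node \<times> nat \<Rightarrow> real" where
  "degree_constraint n G = (\<lambda>(i, t). real (targeted_degree n G t i))"

definition realisable ::
  "nat \<Rightarrow> (nat \<Rightarrow> nat \<Rightarrow> nat) \<Rightarrow> nat set \<Rightarrow> nat set \<Rightarrow> (nat \<Rightarrow> nat) \<Rightarrow> (node \<Rightarrow> nat \<Rightarrow> nat) \<Rightarrow> bool" where
  "realisable M \<gamma> M1 M2 n k \<longleftrightarrow>
     (\<exists>G\<in>multilayer_graphs M \<gamma> n. \<forall>(s, t)\<in>constrained_pairs \<gamma> M1 M2. \<forall>i\<in>layer n s.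
        targeted_degree n G t i = k i t)"

definition P_mic ::
  "nat \<Rightarrow> (nat \<Rightarrow> nat \<Rightarrow> nat) \<Rightarrow> nat set \<Rightarrow> nat set \<Rightarrow> (nat \<Rightarrow> nat) \<Rightarrow> (node \<Rightarrow> nat \<Rightarrow> nat) \<Rightarrow>
     node set set pmf" where
  "P_mic M \<gamma> M1 M2 n k =
     microcanonical (multilayer_graphs M \<gamma> n) (constraint_index \<gamma> M1 M2 n)
       (degree_constraint n) (\<lambda>(i, t). real (k i t))"

definition P_can ::
  "nat \<Rightarrow> (nat \<Rightarrow> nat \<Rightarrow> nat) \<Rightarrow> nat set \<Rightarrow> nat set \<Rightarrow> (nat \<Rightarrow> nat) \<Rightarrow> (node \<Rightarrow> nat \<Rightarrow> nat) \<Rightarrow>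
     node set set pmf" where
  "P_can M \<gamma> M1 M2 n k =
     canonical (multilayer_graphs M \<gamma> n) (constraint_index \<gamma> M1 M2 n)
       (degree_constraint n) (\<lambda>(i, t). real (k i t))"

definition num_links :: "(nat \<Rightarrow> nat) \<Rightarrow> (node \<Rightarrow> nat \<Rightarrow> nat) \<Rightarrow> nat \<Rightarrow> nat \<Rightarrow> nat" where
  "num_links n k s t = (\<Sum>i\<in>layer n s. k i t)"

definition max_degree :: "(nat \<Rightarrow> nat) \<Rightarrow> (node \<Rightarrow> nat \<Rightarrow> nat) \<Rightarrow> nat \<Rightarrow> nat \<Rightarrow> nat" where
  "max_degree n k s t = (MAX i\<in>layer n s. k i t)"

definition empirical_degree_dist ::
  "(nat \<Rightarrow> nat) \<Rightarrow> (node \<Rightarrow> nat \<Rightarrow> nat) \<Rightarrow> nat \<Rightarrow> nat \<Rightarrow> nat \<Rightarrow> real" where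
  "empirical_degree_dist n k s t j = (\<Sum>i\<in>layer n s. of_bool (k i t = j)) / real (n s)"

section \<open>The weighted norm\<close>

definition g :: "nat \<Rightarrow> real" where
  "g k = ln (fact k / (real k ^ k * exp (- real k)))"

text \<open>
  Extended-valued, so that convergence of norms to 0 entails that they are eventually finite.
\<close>

definition l1g_norm :: "(nat \<Rightarrow> real) \<Rightarrow> ennreal" where
  "l1g_norm h = (\<Sum>k. ennreal (\<bar>h k\<bar> * g k))"

end

theory Submission
  imports Defs "HOL-Real_Asymp.Real_Asymp"
begin

text \<open>
  The relative entropy is the entropy of the canonical ensemble minus \<open>ln \<Omega>\<close>, where \<open>\<Omega>\<close> is the number
  of graphs satisfying the constraint. The canonical entropy is the maximum of the sum of the binary
  entropies of the link probabilities over all choices with the right mean degrees. Both terms split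
  over the unordered pairs of linked layers (blocks), so each block contributes a gap of its own.

  If no degree is constrained in a block, the gap vanishes. If one side is constrained, the block consists of independent
  stars and the gap is a sum of \<open>g k + g (N - k) - g N\<close>. Otherwise the binary entropies are compared with
  Poisson ones at \<open>p\<^sub>i\<^sub>j = k\<^sub>i k\<^sub>j / L\<close>, and \<open>\<Omega>\<close> with the configuration model count, \<open>L! / (\<Prod> k\<^sub>i! \<Prod> l\<^sub>j!)\<close> for two layers;
  the quotient of the two leading terms is \<open>exp (\<Sum> g k\<^sub>i + \<Sum> g l\<^sub>j)\<close> up to factors \<open>exp (o(n))\<close>.

  The configuration model bounds \<open>\<Omega>\<close> from above by an induction that removes one link. For the lower bound, links of a fixed
  realisation are removed one at a time, at a node of maximal degree, and a switching argument shows that \<open>\<Omega>\<close>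
  changes by almost the same factor as the configuration model count. Within a single layer this breaks down once
  the number of links is of the order of the squared maximal degree; what is left then contributes only \<open>o(n)\<close>
  by a cruder switching argument which freezes the links between nodes of large degree.
\<close>

section \<open>Maximum entropy\<close>

text \<open>The canonical ensemble enters only as a maximiser, so no Lagrange multipliers are
  computed: upper bounds on a gap must hold for all admissible link probabilities, lower bounds need
  one good choice.

  The order in which links are removed decides whether the lower bound on \<open>\<Omega>\<close> is
  sharp enough. For maximal degrees m, m' on the two sides and L links, a switching has relative
  error of order m m' / L, and in an arbitrary order these errors may add up to m m' times a
  logarithm, which need not be o(n). At a node of maximal degree d the error is d m' / L. As N nodes
  of degree d carry at least d N links, one level of degrees costs O(m'), and all levels O(m m').
  The hypothesis with exponent 2/3 is what makes m m' = o(n).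

  For two layers only the left degrees are lowered level by level, the right ones being merely
  bounded, and left degrees at most 1 give an exact base. A single layer has no such side: a removal
  also lowers the degree at the other end, possibly on the same level. There a potential keeps
  account of the losses, and a separate estimate takes over in the sparse regime.\<close>

definition ent :: "real \<Rightarrow> real" where
  "ent x = - (x * ln x)"

lemma ent_0 [simp]: "ent 0 = 0" and ent_1 [simp]: "ent 1 = 0"
  by (simp_all add: ent_def)

text \<open>Concavity in the form in which the later upper bounds on entropies sum it:
  \<open>ln y \<le> y - 1\<close> at \<open>y = c / x\<close>.\<close>

lemma ent_le_tangent:
  assumes "0 \<le> x" "0 < c"
  shows "ent x \<le> - x * ln c + c - x"
proof (cases "x = 0")
  case False
  then have "x * ln (c / x) \<le> x * (c / x - 1)"
    using assms by (intro mult_left_mono ln_le_minus_one) auto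
  then show ?thesis
    using False assms by (simp add: ent_def ln_div algebra_simps)
qed (use assms in simp)

lemma ent_less_tangent:
  assumes "0 \<le> x" "0 < c" "x \<noteq> c"
  shows "ent x < - x * ln c + c - x"
proof (cases "x = 0")
  case False
  then have "ln (c / x) \<noteq> c / x - 1"
    using assms ln_eq_minus_one[of "c / x"] by auto
  then have "ln (c / x) < c / x - 1"
    using assms False ln_le_minus_one[of "c / x"] by (simp add: order_less_le)
  then have "x * ln (c / x) < x * (c / x - 1)"
    using assms False by (intro mult_strict_left_mono) auto
  then show ?thesis
    using False assms by (simp add: ent_def ln_div algebra_simps)
qed (use assms in simp)

text \<open>Both values are compared with the tangent at the mixture \<open>c\<close>; only
  \<open>c = 0\<close> has no tangent and is treated apart.\<close>

lemma ent_concave: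
  assumes "0 \<le> a" "0 \<le> b" "0 \<le> l" "l \<le> 1"
  shows "(1 - l) * ent a + l * ent b \<le> ent ((1 - l) * a + l * b)"
proof -
  define c where "c = (1 - l) * a + l * b"
  have "0 \<le> c" using assms by (simp add: c_def)
  show ?thesis
  proof (cases "c = 0")
    case True
    then have "(1 - l) * a = 0" "l * b = 0"
      using assms unfolding c_def by (smt (verit) mult_nonneg_nonneg)+
    then have "(1 - l) * ent a = 0" "l * ent b = 0" by (auto simp: ent_def)
    moreover have "ent ((1 - l) * a + l * b) = 0" using True by (simp add: c_def)
    ultimately show ?thesis by linarith
  next
    case False
    then have "0 < c" using \<open>0 \<le> c\<close> by simp
    have "(1 - l) * ent a + l * ent b \<le> (1 - l) * (- a * ln c + c - a) + l * (- b * ln c + c - b)"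
      using assms \<open>0 < c\<close> by (intro add_mono mult_left_mono ent_le_tangent) auto
    also have "\<dots> = ent c" by (simp add: ent_def c_def algebra_simps)
    finally show ?thesis by (simp add: c_def)
  qed
qed

lemma ent_strict_midpoint:
  assumes "0 \<le> a" "0 \<le> b" "a \<noteq> b"
  shows "(ent a + ent b) / 2 < ent ((a + b) / 2)"
proof -
  define c where "c = (a + b) / 2"
  have c: "0 < c" "a \<noteq> c" "b \<noteq> c" using assms by (auto simp: c_def)
  have "ent a + ent b < (- a * ln c + c - a) + (- b * ln c + c - b)"
    using assms c by (intro add_strict_mono ent_less_tangent) auto
  also have "\<dots> = 2 * ent c" by (simp add: ent_def c_def field_simps)
  finally show ?thesis by (simp add: c_def)
qed

lemma continuous_on_ent: "continuous_on {0..1} ent"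
proof -
  have "(ent \<longlongrightarrow> ent x) (at x within {0..1})" if "x \<in> {0..1}" for x
  proof (cases "x = 0")
    case True
    have "((\<lambda>x::real. - (x * ln x)) \<longlongrightarrow> 0) (at_right 0)" by real_asymp
    then have "(ent \<longlongrightarrow> ent x) (at_right 0)" by (simp add: True ent_def[abs_def])
    then have "(ent \<longlongrightarrow> ent x) (at 0 within {0..})" by (simp add: at_within_Ici_at_right)
    then show ?thesis unfolding True
      by (rule tendsto_within_subset) auto
  next
    case False
    then show ?thesis unfolding ent_def using that by (intro tendsto_intros) auto
  qed
  then show ?thesis by (simp add: continuous_on_def)
qed

lemma exists_pmf_of_fun:
  assumes "finite X" "\<And>x. x \<in> X \<Longrightarrow> 0 \<le> p x" "sum p X = 1"
  shows "\<exists>P. set_pmf P \<subseteq> X \<and> (\<forall>x\<in>X. pmf P x = p x)"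
proof -
  define q where "q = (\<lambda>x. if x \<in> X then p x else 0)"
  have "(\<integral>\<^sup>+ x. ennreal (q x) \<partial>count_space UNIV) = (\<Sum>x\<in>X. ennreal (q x))"
    by (subst nn_integral_count_space'[of X]) (use assms in \<open>auto simp: q_def\<close>)
  also have "\<dots> = ennreal (\<Sum>x\<in>X. q x)"
    using assms by (intro sum_ennreal) (auto simp: q_def)
  also have "\<dots> = 1" using assms by (simp add: q_def)
  finally have *: "pmf (embed_pmf q) x = q x" for x
    using assms by (intro pmf_embed_pmf) (auto simp: q_def)
  have "set_pmf (embed_pmf q) \<subseteq> X"
    using * by (auto simp: set_pmf_iff q_def split: if_splits)
  moreover have "\<forall>x\<in>X. pmf (embed_pmf q) x = p x" using * by (simp add: q_def)
  ultimately show ?thesis by blast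
qed

lemma gibbs_entropy_eq: "gibbs_entropy X P = (\<Sum>x\<in>X. ent (pmf P x))"
  by (simp add: gibbs_entropy_def ent_def sum_negf)

lemma soft_constraint_sum:
  assumes "finite X" "soft_constraint X I C cs P"
  shows "(\<Sum>x\<in>X. pmf P x) = 1"
  using assms by (simp add: soft_constraint_def sum_pmf_eq_1)

text \<open>\<open>l\<close> is not confined to the unit interval: stationarity of the maximiser
  uses small negative \<open>l\<close> as well, so nonnegativity of the mixture is assumed
  instead.\<close>

lemma soft_constraint_mix:
  assumes "finite X" "soft_constraint X I C cs P" "soft_constraint X I C cs Q"
    and "\<And>x. x \<in> X \<Longrightarrow> 0 \<le> pmf P x + l * (pmf Q x - pmf P x)"
  shows "\<exists>R. soft_constraint X I C cs R \<and> (\<forall>x\<in>X. pmf R x = pmf P x + l * (pmf Q x - pmf P x))"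
proof -
  have "(\<Sum>x\<in>X. pmf P x + l * (pmf Q x - pmf P x)) = 1"
    using soft_constraint_sum[OF assms(1,2)] soft_constraint_sum[OF assms(1,3)]
    by (simp add: sum.distrib sum_subtractf flip: sum_distrib_left)
  then obtain R where R: "set_pmf R \<subseteq> X" "\<forall>x\<in>X. pmf R x = pmf P x + l * (pmf Q x - pmf P x)"
    using exists_pmf_of_fun[OF assms(1), of "\<lambda>x. pmf P x + l * (pmf Q x - pmf P x)"] assms(4) by blast
  have "(\<Sum>x\<in>X. pmf R x * C x c) = cs c" if "c \<in> I" for c
  proof -
    have "(\<Sum>x\<in>X. pmf R x * C x c)
        = (\<Sum>x\<in>X. pmf P x * C x c + l * (pmf Q x * C x c - pmf P x * C x c))"
      by (intro sum.cong refl) (subst R(2)[rule_format], assumption, simp add: algebra_simps)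
    also have "\<dots> = cs c"
      using assms(2,3) that by (simp add: soft_constraint_def sum.distrib sum_subtractf flip: sum_distrib_left)
    finally show ?thesis .
  qed
  then show ?thesis using R by (auto simp: soft_constraint_def)
qed

definition max_entropy :: "'x set \<Rightarrow> 'c set \<Rightarrow> ('x \<Rightarrow> 'c \<Rightarrow> real) \<Rightarrow> ('c \<Rightarrow> real) \<Rightarrow> 'x pmf \<Rightarrow> bool" where
  "max_entropy X I C cs P \<longleftrightarrow> soft_constraint X I C cs P \<and>
     (\<forall>Q. soft_constraint X I C cs Q \<longrightarrow> gibbs_entropy X Q \<le> gibbs_entropy X P)"

lemma max_entropy_unique:
  assumes "finite X" "max_entropy X I C cs P" "max_entropy X I C cs Q"
  shows "P = Q"
proof (rule ccontr)
  assume "P \<noteq> Q"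
  have sc: "soft_constraint X I C cs P" "soft_constraint X I C cs Q"
    using assms by (auto simp: max_entropy_def)
  obtain x where x: "pmf P x \<noteq> pmf Q x" using \<open>P \<noteq> Q\<close> by (auto simp: pmf_eq_iff)
  have "x \<in> X"
    using x sc by (metis in_mono pmf_eq_0_set_pmf soft_constraint_def)
  have "0 \<le> pmf P x + 1/2 * (pmf Q x - pmf P x)" for x
    using pmf_nonneg[of P x] pmf_nonneg[of Q x] by (simp add: field_simps)
  then obtain R where R: "soft_constraint X I C cs R"
      "\<forall>x\<in>X. pmf R x = pmf P x + 1/2 * (pmf Q x - pmf P x)"
    using soft_constraint_mix[OF assms(1) sc, of "1/2"] by blast
  have R': "pmf R y = (pmf P y + pmf Q y) / 2" if "y \<in> X" for y
    using R(2) that by (simp add: field_simps)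
  have "(\<Sum>y\<in>X. (ent (pmf P y) + ent (pmf Q y)) / 2) < (\<Sum>y\<in>X. ent ((pmf P y + pmf Q y) / 2))"
  proof (rule sum_strict_mono_ex1[OF assms(1)])
    show "\<forall>y\<in>X. (ent (pmf P y) + ent (pmf Q y)) / 2 \<le> ent ((pmf P y + pmf Q y) / 2)"
    proof
      fix y
      show "(ent (pmf P y) + ent (pmf Q y)) / 2 \<le> ent ((pmf P y + pmf Q y) / 2)"
        using ent_strict_midpoint[of "pmf P y" "pmf Q y"] by (cases "pmf P y = pmf Q y") auto
    qed
    show "\<exists>y\<in>X. (ent (pmf P y) + ent (pmf Q y)) / 2 < ent ((pmf P y + pmf Q y) / 2)"
      using x \<open>x \<in> X\<close> ent_strict_midpoint[of "pmf P x" "pmf Q x"] by auto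
  qed
  then have "(gibbs_entropy X P + gibbs_entropy X Q) / 2 < gibbs_entropy X R"
    by (simp add: gibbs_entropy_eq R' sum.distrib cong: sum.cong flip: sum_divide_distrib)
  moreover have "gibbs_entropy X R \<le> gibbs_entropy X P" "gibbs_entropy X R \<le> gibbs_entropy X Q"
    using assms R(1) by (auto simp: max_entropy_def)
  ultimately show False by simp
qed

text \<open>A continuous function on a compact set. The candidates are functions on the whole type
  pinned to 0 outside \<open>X\<close>, so that compactness comes from the product topology although
  the type may be infinite.\<close>

lemma max_entropy_exists:
  fixes X :: "'x set"
  assumes "finite X" "soft_constraint X I C cs P0"
  shows "\<exists>P. max_entropy X I C cs P"
proof -
  define K :: "('x \<Rightarrow> real) set" where "K = (\<Pi>\<^sub>E x\<in>UNIV. if x \<in> X then {0..1} else {0})"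
  define S where "S = K \<inter> {p. sum p X = 1} \<inter> (\<Inter>c\<in>I. {p. (\<Sum>x\<in>X. p x * C x c) = cs c})"
  have "compactin (product_topology (\<lambda>_. euclidean) UNIV) K"
    unfolding K_def by (subst compactin_PiE) auto
  then have "compact K" by (simp add: euclidean_product_topology)
  have coord: "continuous_on A (\<lambda>p :: 'x \<Rightarrow> real. p x)" for A x
    by (rule continuous_on_product_coordinates[THEN continuous_on_subset]) simp
  have "closed {p :: 'x \<Rightarrow> real. sum p X = 1}"
    by (intro closed_Collect_eq continuous_on_sum coord continuous_on_const)
  moreover have "closed {p :: 'x \<Rightarrow> real. (\<Sum>x\<in>X. p x * C x c) = cs c}" for c
    by (intro closed_Collect_eq continuous_on_sum continuous_on_mult coord continuous_on_const)
  ultimately have "compact S" unfolding S_def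
    by (intro compact_Int_closed \<open>compact K\<close> closed_INT ballI) auto
  have mem: "pmf P \<in> S" if P: "soft_constraint X I C cs P" for P
  proof -
    have "pmf P x = 0" if "x \<notin> X" for x
      using P that by (auto simp: soft_constraint_def pmf_eq_0_set_pmf)
    then show ?thesis
      using P soft_constraint_sum[OF assms(1) P]
      by (auto simp: S_def K_def soft_constraint_def pmf_le_1)
  qed
  have "continuous_on S (\<lambda>p. \<Sum>x\<in>X. ent (p x))"
  proof (intro continuous_on_sum)
    fix x assume "x \<in> X"
    show "continuous_on S (\<lambda>p. ent (p x))"
    proof (rule continuous_on_compose2[OF continuous_on_ent coord])
      show "(\<lambda>p. p x) ` S \<subseteq> {0..1}"
        using \<open>x \<in> X\<close> by (auto simp: S_def K_def PiE_def Pi_def split: if_splits)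
    qed
  qed
  then obtain p where p: "p \<in> S" "\<And>q. q \<in> S \<Longrightarrow> (\<Sum>x\<in>X. ent (q x)) \<le> (\<Sum>x\<in>X. ent (p x))"
    using continuous_attains_sup[OF \<open>compact S\<close>] mem[OF assms(2)] by blast
  have p0: "0 \<le> p x" if "x \<in> X" for x
    using p(1) that by (auto simp: S_def K_def PiE_def Pi_def split: if_splits)
  have p1: "sum p X = 1" "\<And>c. c \<in> I \<Longrightarrow> (\<Sum>x\<in>X. p x * C x c) = cs c"
    using p(1) by (auto simp: S_def)
  obtain P where P: "set_pmf P \<subseteq> X" "\<forall>x\<in>X. pmf P x = p x"
    using exists_pmf_of_fun[OF assms(1) p0 p1(1)] by blast
  have "soft_constraint X I C cs P"
    using P p1(2) by (auto simp: soft_constraint_def)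
  moreover have "gibbs_entropy X Q \<le> gibbs_entropy X P" if "soft_constraint X I C cs Q" for Q
    using p(2)[OF mem[OF that]] P by (simp add: gibbs_entropy_eq)
  ultimately show ?thesis by (auto simp: max_entropy_def)
qed

lemma max_entropy_canonical:
  assumes "finite X" "soft_constraint X I C cs P0"
  shows "max_entropy X I C cs (canonical X I C cs)"
proof -
  have "\<exists>!P. max_entropy X I C cs P"
    using max_entropy_exists[OF assms] max_entropy_unique[OF assms(1)] by blast
  from theI'[OF this] show ?thesis
    by (simp add: canonical_def max_entropy_def)
qed

text \<open>\<open>ent\<close> has infinite slope at 0: moving a small share \<open>l\<close> of the
  mass towards \<open>Q\<close> gains order \<open>- l * ln l\<close> at \<open>x0\<close> and loses
  only order \<open>l\<close> elsewhere. So the maximiser charges every point charged by some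
  feasible distribution.\<close>

lemma max_entropy_support:
  assumes fin: "finite X" and P: "max_entropy X I C cs P" and Q: "soft_constraint X I C cs Q"
    and x0: "x0 \<in> X" "0 < pmf Q x0"
  shows "0 < pmf P x0"
proof (rule ccontr)
  assume "\<not> 0 < pmf P x0"
  then have P0: "pmf P x0 = 0" using pmf_nonneg[of P x0] by linarith
  define q where "q = pmf Q x0"
  define D where "D = \<bar>gibbs_entropy X Q - gibbs_entropy X P\<bar> + 1"
  \<comment> \<open>Chosen so that \<open>- q * ln l = D\<close>, which exceeds the entropy
    difference by 1.\<close>
  define l where "l = exp (- (D / q))"
  have "0 < D" "0 < q" using x0 by (auto simp: D_def q_def)
  have l: "0 < l" "l \<le> 1" "- q * ln l = D"
    using \<open>0 < D\<close> \<open>0 < q\<close> by (auto simp: l_def)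
  have scP: "soft_constraint X I C cs P" using P by (simp add: max_entropy_def)
  have mix: "pmf P x + l * (pmf Q x - pmf P x) = (1 - l) * pmf P x + l * pmf Q x" for x
    by (simp add: algebra_simps)
  have "0 \<le> pmf P x + l * (pmf Q x - pmf P x)" for x
    unfolding mix using l by auto
  then obtain R where R: "soft_constraint X I C cs R"
      "\<forall>x\<in>X. pmf R x = (1 - l) * pmf P x + l * pmf Q x"
    using soft_constraint_mix[OF fin scP Q, of l] unfolding mix by blast
  have "(\<Sum>x\<in>X. (1 - l) * ent (pmf P x) + l * ent (pmf Q x) + (if x = x0 then l * D else 0))
      \<le> (\<Sum>x\<in>X. ent (pmf R x))"
  proof (rule sum_mono)
    fix x assume "x \<in> X"
    show "(1 - l) * ent (pmf P x) + l * ent (pmf Q x) + (if x = x0 then l * D else 0) \<le> ent (pmf R x)"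
    proof (cases "x = x0")
      case True
      have "ent (l * q) = l * ent q + l * (- q * ln l)"
        using l(1) \<open>0 < q\<close> by (simp add: ent_def ln_mult algebra_simps)
      also have "\<dots> = l * ent q + l * D" by (simp only: l(3))
      finally show ?thesis using True R(2) x0 P0 by (simp add: q_def)
    next
      case False
      then show ?thesis using R(2) \<open>x \<in> X\<close> l ent_concave[OF pmf_nonneg pmf_nonneg, of l P x Q x] by simp
    qed
  qed
  then have "(1 - l) * gibbs_entropy X P + l * gibbs_entropy X Q + l * D \<le> gibbs_entropy X R"
    using fin x0 by (simp add: gibbs_entropy_eq sum.distrib sum.delta flip: sum_distrib_left)
  also have "\<dots> \<le> gibbs_entropy X P" using P R(1) by (simp add: max_entropy_def)
  finally have "l * (gibbs_entropy X Q - gibbs_entropy X P + D) \<le> 0" by (simp add: algebra_simps)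
  then have "gibbs_entropy X Q - gibbs_entropy X P + D \<le> 0" using l(1) by (simp add: mult_le_0_iff)
  then show False by (simp add: D_def)
qed

text \<open>The maximiser is stationary along the segment towards any other feasible distribution, and
  the segment can be prolonged beyond the maximiser.\<close>

lemma max_entropy_cross_entropy:
  assumes fin: "finite X" and P: "max_entropy X I C cs P" and Q: "soft_constraint X I C cs Q"
  shows "- (\<Sum>x\<in>X. pmf Q x * ln (pmf P x)) = gibbs_entropy X P"
proof -
  define Y where "Y = {x\<in>X. 0 < pmf P x}"
  have scP: "soft_constraint X I C cs P" using P by (simp add: max_entropy_def)
  have finY: "finite Y" and YX: "Y \<subseteq> X" using fin by (auto simp: Y_def)
  have P0: "pmf P x = 0" "pmf Q x = 0" if "x \<in> X - Y" for x
  proof -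
    show 1: "pmf P x = 0" using that pmf_nonneg[of P x] by (simp add: Y_def)
    have "\<not> 0 < pmf Q x"
      using max_entropy_support[OF fin P Q, of x] that 1 by auto
    then show "pmf Q x = 0" using pmf_nonneg[of Q x] by linarith
  qed
  have sumY: "(\<Sum>x\<in>Y. pmf P x) = 1" "(\<Sum>x\<in>Y. pmf Q x) = 1"
    using soft_constraint_sum[OF fin scP] soft_constraint_sum[OF fin Q]
      sum.mono_neutral_left[OF fin YX, of "pmf P"] sum.mono_neutral_left[OF fin YX, of "pmf Q"] P0 by auto
  have "Y \<noteq> {}" using sumY by auto
  \<comment> \<open>On the support \<open>Y\<close> the entropy is differentiable along the segment.
    As \<open>d\<close> is the least mass there, steps of size below \<open>d\<close> stay
    nonnegative in both directions, and the derivative \<open>D\<close> at 0 must vanish.\<close>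
  define d where "d = Min (pmf P ` Y)"
  have d: "0 < d" using finY \<open>Y \<noteq> {}\<close> by (simp add: d_def Y_def)
  have dle: "d \<le> pmf P x" if "x \<in> Y" for x using finY that by (simp add: d_def)
  define \<phi> where "\<phi> = (\<lambda>l. \<Sum>x\<in>Y. ent (pmf P x + l * (pmf Q x - pmf P x)))"
  define D where "D = (\<Sum>x\<in>Y. - ((pmf Q x - pmf P x) * ln (pmf P x) + (pmf Q x - pmf P x)))"
  have "(\<phi> has_real_derivative D) (at 0)"
    unfolding \<phi>_def D_def ent_def
    by (rule DERIV_sum) (auto simp: Y_def intro!: derivative_eq_intros simp: field_simps)
  moreover have "\<forall>l. \<bar>0 - l\<bar> < d \<longrightarrow> \<phi> l \<le> \<phi> 0"
  proof (intro allI impI)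
    fix l :: real assume l: "\<bar>0 - l\<bar> < d"
    have "0 \<le> pmf P x + l * (pmf Q x - pmf P x)" if "x \<in> X" for x
    proof (cases "x \<in> Y")
      case True
      have "\<bar>pmf Q x - pmf P x\<bar> \<le> 1"
        using pmf_nonneg[of P x] pmf_nonneg[of Q x] pmf_le_1[of P x] pmf_le_1[of Q x] by linarith
      then have "\<bar>l * (pmf Q x - pmf P x)\<bar> \<le> d * 1"
        unfolding abs_mult using l by (intro mult_mono) auto
      then show ?thesis using dle[OF True] by linarith
    qed (use that P0 in auto)
    then obtain R where R: "soft_constraint X I C cs R"
      "\<forall>x\<in>X. pmf R x = pmf P x + l * (pmf Q x - pmf P x)"
      using soft_constraint_mix[OF fin scP Q, of l] by blast
    have "\<phi> l = gibbs_entropy X R" unfolding \<phi>_def gibbs_entropy_eq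
      using R(2) P0 YX by (intro sum.mono_neutral_cong_left fin) auto
    also have "\<dots> \<le> gibbs_entropy X P" using P R(1) by (simp add: max_entropy_def)
    also have "\<dots> = \<phi> 0" unfolding \<phi>_def gibbs_entropy_eq
      using P0 YX by (intro sum.mono_neutral_cong_right fin) auto
    finally show "\<phi> l \<le> \<phi> 0" .
  qed
  ultimately have "D = 0" using DERIV_local_max d by blast
  then have "(\<Sum>x\<in>Y. pmf Q x * ln (pmf P x)) = (\<Sum>x\<in>Y. pmf P x * ln (pmf P x))"
    using sumY by (simp add: D_def sum_negf sum.distrib sum_subtractf algebra_simps)
  moreover have "(\<Sum>x\<in>Y. pmf Q x * ln (pmf P x)) = (\<Sum>x\<in>X. pmf Q x * ln (pmf P x))"
    using P0 YX by (intro sum.mono_neutral_left fin) auto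
  moreover have "(\<Sum>x\<in>Y. pmf P x * ln (pmf P x)) = (\<Sum>x\<in>X. pmf P x * ln (pmf P x))"
    using P0 YX by (intro sum.mono_neutral_left fin) auto
  ultimately show ?thesis by (simp add: gibbs_entropy_def)
qed

text \<open>The cross entropy of the microcanonical against the canonical ensemble equals the
  canonical entropy, because the former satisfies the soft constraint. The relative entropy thus
  becomes a difference of entropies.\<close>

lemma relative_entropy_microcanonical_canonical:
  fixes C :: "'x \<Rightarrow> 'c \<Rightarrow> real"
  assumes fin: "finite X" and ne: "\<exists>x\<in>X. \<forall>c\<in>I. C x c = cs c"
  shows "max_entropy X I C cs (canonical X I C cs)"
    and "soft_constraint X I C cs (microcanonical X I C cs)"
    and "gibbs_entropy X (microcanonical X I C cs) = ln (card {x\<in>X. \<forall>c\<in>I. C x c = cs c})"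
    and "relative_entropy X (microcanonical X I C cs) (canonical X I C cs)
       = gibbs_entropy X (canonical X I C cs) - ln (card {x\<in>X. \<forall>c\<in>I. C x c = cs c})"
proof -
  define Z where "Z = {x\<in>X. \<forall>c\<in>I. C x c = cs c}"
  define Q where "Q = microcanonical X I C cs"
  define P where "P = canonical X I C cs"
  have Z: "finite Z" "Z \<noteq> {}" "Z \<subseteq> X" using assms by (auto simp: Z_def)
  have Q: "Q = pmf_of_set Z" by (simp add: Q_def microcanonical_def Z_def)
  have pmfQ: "pmf Q x = indicator Z x / card Z" for x using Z by (simp add: Q pmf_of_set)
  have sumQ: "(\<Sum>x\<in>X. pmf Q x * h x) = (\<Sum>x\<in>Z. h x) / card Z" for h
  proof -
    have "(\<Sum>x\<in>X. pmf Q x * h x) = (\<Sum>x\<in>Z. h x / card Z)"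
      using Z fin by (intro sum.mono_neutral_cong_right) (auto simp: pmfQ)
    then show ?thesis by (simp add: sum_divide_distrib)
  qed
  have cardZ: "0 < card Z" using Z by (simp add: card_gt_0_iff)
  have "(\<Sum>x\<in>X. pmf Q x * C x c) = cs c" if "c \<in> I" for c
  proof -
    have "(\<Sum>x\<in>Z. C x c) = (\<Sum>x\<in>Z. cs c)"
      using that by (intro sum.cong) (auto simp: Z_def)
    then show ?thesis using cardZ by (simp add: sumQ)
  qed
  then have scQ: "soft_constraint X I C cs Q"
    using Z by (simp add: soft_constraint_def Q)
  then show "soft_constraint X I C cs (microcanonical X I C cs)" by (simp add: Q_def)
  have P: "max_entropy X I C cs P"
    unfolding P_def by (rule max_entropy_canonical[OF fin scQ])
  then show "max_entropy X I C cs (canonical X I C cs)" by (simp add: P_def)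
  have HQ: "gibbs_entropy X Q = ln (card Z)"
  proof -
    have "(\<Sum>x\<in>Z. ln (pmf Q x)) = card Z * ln (1 / card Z)" by (simp add: pmfQ)
    then show ?thesis using cardZ by (simp add: gibbs_entropy_def sumQ ln_div)
  qed
  then show "gibbs_entropy X (microcanonical X I C cs) = ln (card {x\<in>X. \<forall>c\<in>I. C x c = cs c})"
    by (simp add: Q_def Z_def)
  have "relative_entropy X Q P = (\<Sum>x\<in>X. pmf Q x * ln (pmf Q x) - pmf Q x * ln (pmf P x))"
    unfolding relative_entropy_def
  proof (rule sum.cong[OF refl])
    fix x assume "x \<in> X"
    show "pmf Q x * ln (pmf Q x / pmf P x) = pmf Q x * ln (pmf Q x) - pmf Q x * ln (pmf P x)"
    proof (cases "pmf Q x = 0")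
      case False
      then have "0 < pmf Q x" using pmf_nonneg[of Q x] by linarith
      then have "0 < pmf P x" using max_entropy_support[OF fin P scQ \<open>x \<in> X\<close>] by simp
      then show ?thesis using \<open>0 < pmf Q x\<close> by (simp add: ln_div algebra_simps)
    qed simp
  qed
  also have "\<dots> = gibbs_entropy X P - gibbs_entropy X Q"
    using max_entropy_cross_entropy[OF fin P scQ] by (simp add: sum_subtractf gibbs_entropy_def)
  finally show "relative_entropy X (microcanonical X I C cs) (canonical X I C cs)
       = gibbs_entropy X (canonical X I C cs) - ln (card {x\<in>X. \<forall>c\<in>I. C x c = cs c})"
    using HQ by (simp add: Q_def P_def Z_def)
qed

section \<open>Entropies of random link sets\<close>

definition binary_entropy :: "real \<Rightarrow> real" where
  "binary_entropy p = ent p + ent (1 - p)"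

definition edge_weight :: "'e set \<Rightarrow> ('e \<Rightarrow> real) \<Rightarrow> 'e set \<Rightarrow> real" where
  "edge_weight E p G = (\<Prod>e\<in>E. if e \<in> G then p e else 1 - p e)"

lemma sum_Pow_prod_if:
  fixes a b :: "'e \<Rightarrow> real"
  assumes "finite E"
  shows "(\<Sum>G\<in>Pow E. \<Prod>e\<in>E. if e \<in> G then a e else b e) = (\<Prod>e\<in>E. a e + b e)"
  unfolding prod_add[OF assms]
proof (rule sum.cong[OF refl])
  fix G assume "G \<in> Pow E"
  then have *: "E \<inter> {e. e \<in> G} = G" "E \<inter> - {e. e \<in> G} = E - G" by auto
  show "(\<Prod>e\<in>E. if e \<in> G then a e else b e) = prod a G * prod b (E - G)"
    by (simp only: prod.If_cases[OF assms] *)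
qed

lemma sum_edge_weight:
  assumes "finite E"
  shows "(\<Sum>G\<in>Pow E. edge_weight E p G) = 1"
  unfolding edge_weight_def by (simp add: sum_Pow_prod_if[OF assms])

lemma sum_edge_weight_mem:
  assumes "finite E" "e0 \<in> E"
  shows "(\<Sum>G\<in>Pow E. edge_weight E p G * of_bool (e0 \<in> G)) = p e0"
proof -
  \<comment> \<open>Setting the factor for an absent \<open>e0\<close> to 0 absorbs the indicator
    into the product.\<close>
  have "edge_weight E p G * of_bool (e0 \<in> G)
      = (\<Prod>e\<in>E. if e \<in> G then p e else (if e = e0 then 0 else 1 - p e))" for G
  proof (cases "e0 \<in> G")
    case True
    then show ?thesis by (auto simp: edge_weight_def intro!: prod.cong)
  next
    case False
    then have "(\<Prod>e\<in>E. if e \<in> G then p e else (if e = e0 then 0 else 1 - p e)) = 0"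
      using assms by (intro prod_zero) auto
    then show ?thesis using False by simp
  qed
  then have "(\<Sum>G\<in>Pow E. edge_weight E p G * of_bool (e0 \<in> G))
      = (\<Prod>e\<in>E. p e + (if e = e0 then 0 else 1 - p e))"
    by (simp add: sum_Pow_prod_if[OF assms(1)])
  also have "\<dots> = (\<Prod>e\<in>E. if e = e0 then p e else 1)"
    by (intro prod.cong) auto
  also have "\<dots> = p e0" using assms by (simp add: prod.delta)
  finally show ?thesis .
qed

text \<open>Valid also where the weight vanishes, as \<open>ln 0 = 0\<close>.\<close>

lemma edge_weight_mult_ln:
  assumes "finite E"
  shows "edge_weight E p G * ln (edge_weight E p G)
    = edge_weight E p G * (\<Sum>e\<in>E. if e \<in> G then ln (p e) else ln (1 - p e))"
proof (cases "edge_weight E p G = 0")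
  case False
  then have *: "\<forall>e\<in>E. (if e \<in> G then p e else 1 - p e) \<noteq> 0"
    unfolding edge_weight_def prod_zero_iff[OF assms] by simp
  have "ln (edge_weight E p G) = (\<Sum>e\<in>E. ln (if e \<in> G then p e else 1 - p e))"
    unfolding edge_weight_def by (rule ln_prod[OF assms]) (use * in blast)
  also have "\<dots> = (\<Sum>e\<in>E. if e \<in> G then ln (p e) else ln (1 - p e))"
    by (intro sum.cong) auto
  finally show ?thesis by simp
qed simp

definition marginal :: "'e set \<Rightarrow> 'e set pmf \<Rightarrow> 'e \<Rightarrow> real" where
  "marginal E P e = (\<Sum>G\<in>Pow E. pmf P G * of_bool (e \<in> G))"

lemma marginal_bounds:
  assumes "finite E" "set_pmf P \<subseteq> Pow E"
  shows "0 \<le> marginal E P e" "marginal E P e \<le> 1"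
proof -
  show "0 \<le> marginal E P e" unfolding marginal_def by (intro sum_nonneg) auto
  have "marginal E P e \<le> (\<Sum>G\<in>Pow E. pmf P G)"
    unfolding marginal_def by (intro sum_mono) auto
  then show "marginal E P e \<le> 1" using sum_pmf_eq_1[OF _ assms(2)] assms(1) by simp
qed

lemma sum_marginal_log:
  assumes "finite E" "set_pmf P \<subseteq> Pow E"
  shows "(\<Sum>G\<in>Pow E. pmf P G * (\<Sum>e\<in>E. if e \<in> G then a e else b e))
    = (\<Sum>e\<in>E. marginal E P e * a e + (1 - marginal E P e) * b e)"
proof -
  have one: "(\<Sum>G\<in>Pow E. pmf P G) = 1" using sum_pmf_eq_1[OF _ assms(2)] assms(1) by simp
  have "(\<Sum>G\<in>Pow E. pmf P G * (\<Sum>e\<in>E. if e \<in> G then a e else b e))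
      = (\<Sum>G\<in>Pow E. \<Sum>e\<in>E. (pmf P G * of_bool (e \<in> G)) * a e
            + (pmf P G - pmf P G * of_bool (e \<in> G)) * b e)"
    unfolding sum_distrib_left by (intro sum.cong refl) auto
  also have "\<dots> = (\<Sum>e\<in>E. marginal E P e * a e + (1 - marginal E P e) * b e)"
    by (subst sum.swap) (simp add: marginal_def sum.distrib sum_subtractf one flip: sum_distrib_right)
  finally show ?thesis .
qed

text \<open>Independent links attain the entropy bound given by their marginals, so the maximisation
  can be carried out over link probabilities alone.\<close>

lemma exists_product_pmf:
  assumes "finite E" "\<And>e. e \<in> E \<Longrightarrow> 0 \<le> p e \<and> p e \<le> 1"
  shows "\<exists>P. set_pmf P \<subseteq> Pow E \<and> (\<forall>e\<in>E. marginal E P e = p e)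
    \<and> gibbs_entropy (Pow E) P = (\<Sum>e\<in>E. binary_entropy (p e))"
proof -
  have "0 \<le> edge_weight E p G" for G
    unfolding edge_weight_def using assms by (intro prod_nonneg) auto
  then obtain P where P: "set_pmf P \<subseteq> Pow E" "\<forall>G\<in>Pow E. pmf P G = edge_weight E p G"
    using exists_pmf_of_fun[of "Pow E" "edge_weight E p"] sum_edge_weight[OF assms(1)] assms(1)
    by auto
  have marg: "\<forall>e\<in>E. marginal E P e = p e"
    using P(2) sum_edge_weight_mem[OF assms(1)] by (simp add: marginal_def)
  have "gibbs_entropy (Pow E) P
      = - (\<Sum>G\<in>Pow E. pmf P G * (\<Sum>e\<in>E. if e \<in> G then ln (p e) else ln (1 - p e)))"
    using P(2) by (simp add: gibbs_entropy_def edge_weight_mult_ln[OF assms(1)])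
  also have "\<dots> = (\<Sum>e\<in>E. binary_entropy (p e))"
    using marg unfolding sum_marginal_log[OF assms(1) P(1)]
    by (simp add: binary_entropy_def ent_def sum_negf sum.distrib sum_subtractf)
  finally show ?thesis using P marg by blast
qed

text \<open>Subadditivity of entropy: Gibbs' inequality against the product distribution
  \<open>w\<close> with the same marginals, whose logarithm is a sum over the links.\<close>

lemma gibbs_entropy_le_marginals:
  assumes "finite E" "set_pmf P \<subseteq> Pow E"
  shows "gibbs_entropy (Pow E) P \<le> (\<Sum>e\<in>E. binary_entropy (marginal E P e))"
proof -
  define p where "p = marginal E P"
  define w where "w = edge_weight E p"
  have p: "0 \<le> p e" "p e \<le> 1" for e using marginal_bounds[OF assms] by (auto simp: p_def)
  have one: "(\<Sum>G\<in>Pow E. pmf P G) = 1" using sum_pmf_eq_1[OF _ assms(2)] assms(1) by simp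
  have w0: "0 \<le> w G" for G unfolding w_def edge_weight_def using p by (intro prod_nonneg) auto
  \<comment> \<open>Absolute continuity: a graph charged by \<open>P\<close> forces positive
    probability for each link it contains and for the absence of each link it lacks.\<close>
  have wpos: "w G \<noteq> 0" if "pmf P G \<noteq> 0" for G
  proof -
    have "G \<in> Pow E" using that assms(2) by (auto simp: set_pmf_iff)
    have "(if e \<in> G then p e else 1 - p e) \<noteq> 0" if "e \<in> E" for e
    proof (cases "e \<in> G")
      case True
      have "0 < pmf P G" using \<open>pmf P G \<noteq> 0\<close> pmf_nonneg[of P G] by linarith
      also have "pmf P G = pmf P G * of_bool (e \<in> G)" using True by simp
      also have "\<dots> \<le> p e" unfolding p_def marginal_def
        using \<open>G \<in> Pow E\<close> assms(1) by (intro member_le_sum) auto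
      finally show ?thesis using True by simp
    next
      case False
      have "0 < pmf P G" using \<open>pmf P G \<noteq> 0\<close> pmf_nonneg[of P G] by linarith
      also have "pmf P G = pmf P G * of_bool (e \<notin> G)" using False by simp
      also have "\<dots> \<le> (\<Sum>G\<in>Pow E. pmf P G * of_bool (e \<notin> G))"
        using \<open>G \<in> Pow E\<close> assms(1) by (intro member_le_sum) auto
      also have "\<dots> = (\<Sum>G\<in>Pow E. pmf P G - pmf P G * of_bool (e \<in> G))"
        by (intro sum.cong) auto
      also have "\<dots> = 1 - p e"
        by (simp add: sum_subtractf p_def marginal_def one)
      finally show ?thesis using False by simp
    qed
    then show ?thesis unfolding w_def edge_weight_def using assms(1) by (simp add: prod_zero_iff)
  qed
  have "gibbs_entropy (Pow E) P \<le> (\<Sum>G\<in>Pow E. - pmf P G * ln (w G) + w G - pmf P G)"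
    unfolding gibbs_entropy_eq
  proof (rule sum_mono)
    fix G assume "G \<in> Pow E"
    show "ent (pmf P G) \<le> - pmf P G * ln (w G) + w G - pmf P G"
    proof (cases "pmf P G = 0")
      case False
      then show ?thesis using wpos[OF False] w0[of G] by (intro ent_le_tangent) auto
    qed (use w0 in simp)
  qed
  also have "\<dots> = - (\<Sum>G\<in>Pow E. pmf P G * ln (w G))"
    using sum_edge_weight[OF assms(1), of p]
    by (simp add: sum.distrib sum_subtractf sum_negf w_def one)
  also have "(\<Sum>G\<in>Pow E. pmf P G * ln (w G))
      = (\<Sum>G\<in>Pow E. pmf P G * (\<Sum>e\<in>E. if e \<in> G then ln (p e) else ln (1 - p e)))"
  proof (rule sum.cong[OF refl])
    fix G
    show "pmf P G * ln (w G) = pmf P G * (\<Sum>e\<in>E. if e \<in> G then ln (p e) else ln (1 - p e))"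
      using wpos[of G] edge_weight_mult_ln[OF assms(1), of p G] by (auto simp: w_def)
  qed
  also have "\<dots> = (\<Sum>e\<in>E. p e * ln (p e) + (1 - p e) * ln (1 - p e))"
    unfolding sum_marginal_log[OF assms] by (simp add: p_def)
  finally show ?thesis
    by (simp add: binary_entropy_def ent_def sum_negf sum.distrib sum_subtractf p_def)
qed

section \<open>Degree classes and the splitting into blocks\<close>

definition vdeg :: "'a set set \<Rightarrow> 'a \<Rightarrow> nat" where
  "vdeg G i = card {e \<in> G. i \<in> e}"

definition degree_class :: "'a set set \<Rightarrow> 'a set \<Rightarrow> ('a \<Rightarrow> nat) \<Rightarrow> 'a set set set" where
  "degree_class E V \<kappa> = {G. G \<subseteq> E \<and> (\<forall>i\<in>V. vdeg G i = \<kappa> i)}"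

text \<open>The soft constraint in terms of link probabilities: a mean degree is a sum of
  marginals.\<close>

definition feasible :: "'a set set \<Rightarrow> 'a set \<Rightarrow> ('a \<Rightarrow> nat) \<Rightarrow> ('a set \<Rightarrow> real) \<Rightarrow> bool" where
  "feasible E V \<kappa> p \<longleftrightarrow> (\<forall>e\<in>E. 0 \<le> p e \<and> p e \<le> 1) \<and>
     (\<forall>i\<in>V. (\<Sum>e | e \<in> E \<and> i \<in> e. p e) = real (\<kappa> i))"

lemma finite_degree_class [simp]: "finite E \<Longrightarrow> finite (degree_class E V \<kappa>)"
  by (rule finite_subset[of _ "Pow E"]) (auto simp: degree_class_def)

lemma real_vdeg: "finite E \<Longrightarrow> G \<subseteq> E \<Longrightarrow> real (vdeg (G \<inter> F) i) = (\<Sum>e | e \<in> E \<inter> F \<and> i \<in> e. of_bool (e \<in> G))"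
proof -
  assume "finite E" "G \<subseteq> E"
  have "(\<Sum>e | e \<in> E \<inter> F \<and> i \<in> e. of_bool (e \<in> G)) = (\<Sum>e | e \<in> G \<inter> F \<and> i \<in> e. 1 :: real)"
    using \<open>finite E\<close> \<open>G \<subseteq> E\<close> by (intro sum.mono_neutral_cong_right) auto
  then show ?thesis by (simp add: vdeg_def)
qed

lemma sum_pmf_vdeg:
  assumes "finite E" "set_pmf P \<subseteq> Pow E"
  shows "(\<Sum>G\<in>Pow E. pmf P G * real (vdeg (G \<inter> F) i)) = (\<Sum>e | e \<in> E \<inter> F \<and> i \<in> e. marginal E P e)"
proof -
  have "(\<Sum>G\<in>Pow E. pmf P G * real (vdeg (G \<inter> F) i))
      = (\<Sum>G\<in>Pow E. \<Sum>e | e \<in> E \<inter> F \<and> i \<in> e. pmf P G * of_bool (e \<in> G))"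
    by (intro sum.cong refl) (simp add: real_vdeg[OF assms(1)] sum_distrib_left)
  also have "\<dots> = (\<Sum>e | e \<in> E \<inter> F \<and> i \<in> e. marginal E P e)"
    unfolding marginal_def by (rule sum.swap)
  finally show ?thesis .
qed

lemma degree_class_UN_bij:
  assumes disj: "\<And>c d. c \<in> J \<Longrightarrow> d \<in> J \<Longrightarrow> c \<noteq> d \<Longrightarrow> E c \<inter> E d = {}"
  shows "bij_betw (\<lambda>G. \<lambda>c\<in>J. G \<inter> E c)
    {G. G \<subseteq> (\<Union>c\<in>J. E c) \<and> (\<forall>c\<in>J. G \<inter> E c \<in> D c)} (\<Pi>\<^sub>E c\<in>J. {G \<in> D c. G \<subseteq> E c})"
proof (rule bij_betw_byWitness[where f' = "\<lambda>h. \<Union>c\<in>J. h c"])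
  show "\<forall>G\<in>{G. G \<subseteq> (\<Union>c\<in>J. E c) \<and> (\<forall>c\<in>J. G \<inter> E c \<in> D c)}. (\<Union>c\<in>J. (\<lambda>c\<in>J. G \<inter> E c) c) = G"
    by auto
  have *: "(\<Union>d\<in>J. h d) \<inter> E c = h c" if "h \<in> (\<Pi>\<^sub>E c\<in>J. {G \<in> D c. G \<subseteq> E c})" "c \<in> J" for h c
  proof -
    have "h d \<subseteq> E d" if "d \<in> J" for d using \<open>h \<in> _\<close> that by (auto simp: PiE_def Pi_def)
    then show ?thesis using disj that(2) by fast
  qed
  show "\<forall>h\<in>\<Pi>\<^sub>E c\<in>J. {G \<in> D c. G \<subseteq> E c}. (\<lambda>c\<in>J. (\<Union>d\<in>J. h d) \<inter> E c) = h"
  proof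
    fix h assume h: "h \<in> (\<Pi>\<^sub>E c\<in>J. {G \<in> D c. G \<subseteq> E c})"
    show "(\<lambda>c\<in>J. (\<Union>d\<in>J. h d) \<inter> E c) = h"
      using *[OF h] h by (intro ext) (auto simp: PiE_def extensional_def restrict_def)
  qed
  show "(\<lambda>G. \<lambda>c\<in>J. G \<inter> E c) ` {G. G \<subseteq> (\<Union>c\<in>J. E c) \<and> (\<forall>c\<in>J. G \<inter> E c \<in> D c)}
      \<subseteq> (\<Pi>\<^sub>E c\<in>J. {G \<in> D c. G \<subseteq> E c})"
    by auto
  show "(\<lambda>h. \<Union>c\<in>J. h c) ` (\<Pi>\<^sub>E c\<in>J. {G \<in> D c. G \<subseteq> E c})
      \<subseteq> {G. G \<subseteq> (\<Union>c\<in>J. E c) \<and> (\<forall>c\<in>J. G \<inter> E c \<in> D c)}"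
  proof
    fix G assume "G \<in> (\<lambda>h. \<Union>c\<in>J. h c) ` (\<Pi>\<^sub>E c\<in>J. {G \<in> D c. G \<subseteq> E c})"
    then obtain h where h: "h \<in> (\<Pi>\<^sub>E c\<in>J. {G \<in> D c. G \<subseteq> E c})" "G = (\<Union>c\<in>J. h c)" by blast
    have "h c \<in> D c" "h c \<subseteq> E c" if "c \<in> J" for c using h(1) that by (auto simp: PiE_def Pi_def)
    then show "G \<in> {G. G \<subseteq> (\<Union>c\<in>J. E c) \<and> (\<forall>c\<in>J. G \<inter> E c \<in> D c)}"
      using *[OF h(1)] h(2) by auto
  qed
qed

lemma card_degree_class_UN:
  assumes "finite J" and disj: "\<And>c d. c \<in> J \<Longrightarrow> d \<in> J \<Longrightarrow> c \<noteq> d \<Longrightarrow> E c \<inter> E d = {}"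
  shows "card {G. G \<subseteq> (\<Union>c\<in>J. E c) \<and> (\<forall>c\<in>J. G \<inter> E c \<in> degree_class (E c) (V c) (\<kappa> c))}
    = (\<Prod>c\<in>J. card (degree_class (E c) (V c) (\<kappa> c)))"
proof -
  have "{G \<in> degree_class (E c) (V c) (\<kappa> c). G \<subseteq> E c} = degree_class (E c) (V c) (\<kappa> c)" for c
    by (auto simp: degree_class_def)
  then show ?thesis
    using bij_betw_same_card[OF degree_class_UN_bij[OF disj, where D = "\<lambda>c. degree_class (E c) (V c) (\<kappa> c)"]]
    by (simp add: card_PiE[OF assms(1)])
qed

text \<open>The entropy gap of one block: \<open>p\<close> competes for the canonical entropy,
  the size of the degree class gives the microcanonical one.\<close>

definition entropy_gap :: "'a set set \<Rightarrow> 'a set \<Rightarrow> ('a \<Rightarrow> nat) \<Rightarrow> ('a set \<Rightarrow> real) \<Rightarrow> real" where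
  "entropy_gap E V \<kappa> p = (\<Sum>e\<in>E. binary_entropy (p e)) - ln (card (degree_class E V \<kappa>))"

text \<open>\<open>\<alpha>\<close> sends the index of a constraint to its block and node. The upper
  bound takes for \<open>p\<close> the marginals of the canonical ensemble. For the lower bound,
  arbitrary choices \<open>q c\<close> glue together because the blocks share no links, and
  independent links with these probabilities compete with the maximiser.\<close>

lemma relative_entropy_blocks:
  fixes E :: "'c \<Rightarrow> 'a set set"
  assumes fin: "finite J" "\<And>c. c \<in> J \<Longrightarrow> finite (E c)"
    and disj: "\<And>c d. c \<in> J \<Longrightarrow> d \<in> J \<Longrightarrow> c \<noteq> d \<Longrightarrow> E c \<inter> E d = {}"
    and idx: "\<alpha> ` I = Sigma J V"
    and C: "\<And>G x. G \<subseteq> (\<Union>c\<in>J. E c) \<Longrightarrow> x \<in> I \<Longrightarrow>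
      C G x = real (vdeg (G \<inter> E (fst (\<alpha> x))) (snd (\<alpha> x)))"
    and cs: "\<And>x. x \<in> I \<Longrightarrow> cs x = real (\<kappa> (fst (\<alpha> x)) (snd (\<alpha> x)))"
    and X: "X = Pow (\<Union>c\<in>J. E c)"
    and ne: "\<exists>G\<in>X. \<forall>x\<in>I. C G x = cs x"
  defines "R \<equiv> relative_entropy X (microcanonical X I C cs) (canonical X I C cs)"
  shows "\<exists>p. (\<forall>c\<in>J. feasible (E c) (V c) (\<kappa> c) p) \<and> R \<le> (\<Sum>c\<in>J. entropy_gap (E c) (V c) (\<kappa> c) p)"
    and "(\<And>c. c \<in> J \<Longrightarrow> feasible (E c) (V c) (\<kappa> c) (q c)) \<Longrightarrow>
      (\<Sum>c\<in>J. entropy_gap (E c) (V c) (\<kappa> c) (q c)) \<le> R"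
proof -
  define U where "U = (\<Union>c\<in>J. E c)"
  have finU: "finite U" and X: "X = Pow U" using fin X by (auto simp: U_def)
  then have finX: "finite X" by simp
  have idx1: "fst (\<alpha> x) \<in> J" "snd (\<alpha> x) \<in> V (fst (\<alpha> x))" if "x \<in> I" for x
  proof -
    have "\<alpha> x \<in> Sigma J V" using that by (simp flip: idx)
    then show "fst (\<alpha> x) \<in> J" "snd (\<alpha> x) \<in> V (fst (\<alpha> x))" by auto
  qed
  have idx2: "\<exists>x\<in>I. \<alpha> x = (c, i)" if "c \<in> J" "i \<in> V c" for c i
  proof -
    have "(c, i) \<in> \<alpha> ` I" using that by (simp add: idx)
    then show ?thesis by auto
  qed
  have "{G\<in>X. \<forall>x\<in>I. C G x = cs x}
      = {G. G \<subseteq> (\<Union>c\<in>J. E c) \<and> (\<forall>c\<in>J. G \<inter> E c \<in> degree_class (E c) (V c) (\<kappa> c))}"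
    (is "?A = ?B")
  proof (intro equalityI subsetI)
    fix G assume G: "G \<in> ?A"
    have "vdeg (G \<inter> E c) i = \<kappa> c i" if "c \<in> J" "i \<in> V c" for c i
    proof -
      obtain x where "x \<in> I" "\<alpha> x = (c, i)" using idx2[OF \<open>c \<in> J\<close> \<open>i \<in> V c\<close>] by blast
      then show ?thesis using G C[of G x] cs[of x] by (auto simp: X U_def)
    qed
    then show "G \<in> ?B" using G by (auto simp: X U_def degree_class_def)
  next
    fix G assume G: "G \<in> ?B"
    then have "C G x = cs x" if "x \<in> I" for x
      using C[of G x] cs[of x] idx1[OF that] that by (auto simp: degree_class_def)
    then show "G \<in> ?A" using G by (auto simp: X U_def)
  qed
  then have card: "card {G\<in>X. \<forall>x\<in>I. C G x = cs x} = (\<Prod>c\<in>J. card (degree_class (E c) (V c) (\<kappa> c)))"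
    by (simp add: card_degree_class_UN[OF fin(1) disj])
  moreover have "card {G\<in>X. \<forall>x\<in>I. C G x = cs x} \<noteq> 0"
    using ne finX by auto
  ultimately have pos: "card (degree_class (E c) (V c) (\<kappa> c)) > 0" if "c \<in> J" for c
    using that fin(1) by auto
  have ln_card: "ln (card {G\<in>X. \<forall>x\<in>I. C G x = cs x}) = (\<Sum>c\<in>J. ln (card (degree_class (E c) (V c) (\<kappa> c))))"
    unfolding card of_nat_prod using pos by (intro ln_prod fin) auto
  define P where "P = canonical X I C cs"
  have P: "max_entropy X I C cs P"
    unfolding P_def by (rule relative_entropy_microcanonical_canonical(1)[OF finX ne])
  have R: "R = gibbs_entropy X P - (\<Sum>c\<in>J. ln (card (degree_class (E c) (V c) (\<kappa> c))))"
    unfolding R_def P_def ln_card[symmetric]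
    by (rule relative_entropy_microcanonical_canonical(4)[OF finX ne])
  have sumU: "(\<Sum>e\<in>U. h e) = (\<Sum>c\<in>J. \<Sum>e\<in>E c. h e)" for h :: "'a set \<Rightarrow> real"
    unfolding U_def using fin disj by (intro sum.UNION_disjoint) auto
  have UE: "U \<inter> E c = E c" if "c \<in> J" for c using that by (auto simp: U_def)
  have soft: "soft_constraint X I C cs Q \<longleftrightarrow> set_pmf Q \<subseteq> Pow U \<and>
      (\<forall>c\<in>J. \<forall>i\<in>V c. (\<Sum>e | e \<in> E c \<and> i \<in> e. marginal U Q e) = \<kappa> c i)" for Q
  proof (cases "set_pmf Q \<subseteq> Pow U")
    case True
    have *: "(\<Sum>G\<in>X. pmf Q G * C G x) = (\<Sum>e | e \<in> E (fst (\<alpha> x)) \<and> snd (\<alpha> x) \<in> e. marginal U Q e)"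
      if "x \<in> I" for x
    proof -
      have "(\<Sum>G\<in>X. pmf Q G * C G x)
          = (\<Sum>G\<in>Pow U. pmf Q G * real (vdeg (G \<inter> E (fst (\<alpha> x))) (snd (\<alpha> x))))"
        using C[OF _ that] by (intro sum.cong) (auto simp: X U_def)
      then show ?thesis using UE[OF idx1(1)[OF that]] by (simp add: sum_pmf_vdeg[OF finU True])
    qed
    show ?thesis
    proof
      assume sc: "soft_constraint X I C cs Q"
      have "(\<Sum>e | e \<in> E c \<and> i \<in> e. marginal U Q e) = \<kappa> c i" if "c \<in> J" "i \<in> V c" for c i
      proof -
        obtain x where "x \<in> I" "\<alpha> x = (c, i)" using idx2[OF \<open>c \<in> J\<close> \<open>i \<in> V c\<close>] by blast
        then show ?thesis using *[of x] sc cs[of x] by (simp add: soft_constraint_def)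
      qed
      then show "set_pmf Q \<subseteq> Pow U \<and>
        (\<forall>c\<in>J. \<forall>i\<in>V c. (\<Sum>e | e \<in> E c \<and> i \<in> e. marginal U Q e) = \<kappa> c i)" using True by blast
    next
      assume "set_pmf Q \<subseteq> Pow U \<and>
        (\<forall>c\<in>J. \<forall>i\<in>V c. (\<Sum>e | e \<in> E c \<and> i \<in> e. marginal U Q e) = \<kappa> c i)"
      then show "soft_constraint X I C cs Q"
        using * cs idx1 by (auto simp: soft_constraint_def X)
    qed
  qed (simp add: soft_constraint_def X)
  have scP: "soft_constraint X I C cs P" using P by (simp add: max_entropy_def)
  then have supp: "set_pmf P \<subseteq> Pow U" by (simp add: soft)
  show "\<exists>p. (\<forall>c\<in>J. feasible (E c) (V c) (\<kappa> c) p) \<and> R \<le> (\<Sum>c\<in>J. entropy_gap (E c) (V c) (\<kappa> c) p)"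
  proof (intro exI conjI ballI)
    show "feasible (E c) (V c) (\<kappa> c) (marginal U P)" if "c \<in> J" for c
      using scP that marginal_bounds[OF finU supp] by (simp add: feasible_def soft)
    show "R \<le> (\<Sum>c\<in>J. entropy_gap (E c) (V c) (\<kappa> c) (marginal U P))"
      unfolding R X entropy_gap_def sum_subtractf
      using gibbs_entropy_le_marginals[OF finU supp] by (simp add: sumU)
  qed
  show "(\<Sum>c\<in>J. entropy_gap (E c) (V c) (\<kappa> c) (q c)) \<le> R"
    if q: "\<And>c. c \<in> J \<Longrightarrow> feasible (E c) (V c) (\<kappa> c) (q c)"
  proof -
    define p where "p = (\<lambda>e. q (THE c. c \<in> J \<and> e \<in> E c) e)"
    have p: "p e = q c e" if "c \<in> J" "e \<in> E c" for c e
    proof -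
      have "(THE c. c \<in> J \<and> e \<in> E c) = c"
        using that disj by (intro the_equality) blast+
      then show ?thesis by (simp add: p_def)
    qed
    have "0 \<le> p e \<and> p e \<le> 1" if "e \<in> U" for e
      using that p q by (auto simp: U_def feasible_def)
    then obtain Q where Q: "set_pmf Q \<subseteq> Pow U" "\<forall>e\<in>U. marginal U Q e = p e"
      "gibbs_entropy (Pow U) Q = (\<Sum>e\<in>U. binary_entropy (p e))"
      using exists_product_pmf[OF finU] by blast
    have "(\<Sum>e | e \<in> E c \<and> i \<in> e. marginal U Q e) = \<kappa> c i" if "c \<in> J" "i \<in> V c" for c i
    proof -
      have "(\<Sum>e | e \<in> E c \<and> i \<in> e. marginal U Q e) = (\<Sum>e | e \<in> E c \<and> i \<in> e. q c e)"
        using Q(2) p that(1) by (intro sum.cong) (auto simp: U_def)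
      then show ?thesis using q[OF that(1)] that(2) by (simp add: feasible_def)
    qed
    then have "soft_constraint X I C cs Q" using Q(1) by (simp add: soft)
    then have "gibbs_entropy X Q \<le> gibbs_entropy X P" using P by (simp add: max_entropy_def)
    moreover have "(\<Sum>c\<in>J. \<Sum>e\<in>E c. binary_entropy (q c e)) = (\<Sum>c\<in>J. \<Sum>e\<in>E c. binary_entropy (p e))"
      using p by (intro sum.cong) auto
    ultimately show ?thesis
      unfolding R entropy_gap_def sum_subtractf using Q(3) by (simp add: sumU X)
  qed
qed

section \<open>Counting graphs with given degrees\<close>

text \<open>The degrees left after deletion of the link \<open>e\<close>. The subtraction truncates
  at 0, whence the positivity hypotheses on the ends of \<open>e\<close> in what follows.\<close>

definition reduce :: "('a \<Rightarrow> nat) \<Rightarrow> 'a set \<Rightarrow> 'a \<Rightarrow> nat" where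
  "reduce \<kappa> e i = (if i \<in> e then \<kappa> i - 1 else \<kappa> i)"

lemma vdeg_insert:
  assumes "finite G" "e \<notin> G"
  shows "vdeg (insert e G) i = vdeg G i + of_bool (i \<in> e)"
proof -
  have "{f \<in> insert e G. i \<in> f} = (if i \<in> e then insert e {f \<in> G. i \<in> f} else {f \<in> G. i \<in> f})" by auto
  then show ?thesis using assms by (simp add: vdeg_def)
qed

lemma vdeg_remove:
  assumes "finite G" "e \<in> G"
  shows "vdeg G i = vdeg (G - {e}) i + of_bool (i \<in> e)"
  using vdeg_insert[of "G - {e}" e i] assms by (simp add: insert_absorb)

text \<open>Deleting and inserting \<open>e\<close> are mutually inverse. The inductions on the
  number of links rest on this passage to smaller degrees.\<close>

lemma card_containing:
  assumes E: "finite E" "e \<in> E" "e \<subseteq> V" and pos: "\<And>i. i \<in> e \<Longrightarrow> 0 < \<kappa> i"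
  shows "card {G \<in> degree_class E V \<kappa>. e \<in> G} = card {G \<in> degree_class E V (reduce \<kappa> e). e \<notin> G}"
proof (rule bij_betw_same_card[of "\<lambda>G. G - {e}"], rule bij_betw_byWitness[where f' = "insert e"])
  show "\<forall>G\<in>{G \<in> degree_class E V \<kappa>. e \<in> G}. insert e (G - {e}) = G" by auto
  show "\<forall>G\<in>{G \<in> degree_class E V (reduce \<kappa> e). e \<notin> G}. insert e G - {e} = G" by auto
  show "(\<lambda>G. G - {e}) ` {G \<in> degree_class E V \<kappa>. e \<in> G} \<subseteq> {G \<in> degree_class E V (reduce \<kappa> e). e \<notin> G}"
  proof (rule image_subsetI)
    fix G assume G: "G \<in> {G \<in> degree_class E V \<kappa>. e \<in> G}"
    then have "finite G" using E by (auto simp: degree_class_def intro: finite_subset)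
    have "vdeg (G - {e}) i = reduce \<kappa> e i" if "i \<in> V" for i
      using vdeg_remove[OF \<open>finite G\<close>, of e i] G that by (auto simp: degree_class_def reduce_def)
    then show "G - {e} \<in> {G \<in> degree_class E V (reduce \<kappa> e). e \<notin> G}"
      using G by (auto simp: degree_class_def)
  qed
  show "insert e ` {G \<in> degree_class E V (reduce \<kappa> e). e \<notin> G} \<subseteq> {G \<in> degree_class E V \<kappa>. e \<in> G}"
  proof (rule image_subsetI)
    fix G assume G: "G \<in> {G \<in> degree_class E V (reduce \<kappa> e). e \<notin> G}"
    then have "finite G" using E by (auto simp: degree_class_def intro: finite_subset)
    have "vdeg (insert e G) i = \<kappa> i" if "i \<in> V" for i
      using vdeg_insert[OF \<open>finite G\<close>, of e i] G that pos[of i] by (auto simp: degree_class_def reduce_def)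
    then show "insert e G \<in> {G \<in> degree_class E V \<kappa>. e \<in> G}"
      using G E by (auto simp: degree_class_def)
  qed
qed

lemma vdeg_pos: "finite G \<Longrightarrow> e \<in> G \<Longrightarrow> i \<in> e \<Longrightarrow> 0 < vdeg G i"
  by (auto simp: vdeg_def card_gt_0_iff)

definition is_link_set :: "'a set \<Rightarrow> 'a set set \<Rightarrow> bool" where
  "is_link_set V E \<longleftrightarrow> finite V \<and> finite E \<and> (\<forall>e\<in>E. card e = 2 \<and> e \<subseteq> V)"

lemma is_link_setD:
  assumes "is_link_set V E"
  shows "finite V" "finite E" "\<And>e. e \<in> E \<Longrightarrow> card e = 2" "\<And>e. e \<in> E \<Longrightarrow> e \<subseteq> V"
    "\<And>e. e \<in> E \<Longrightarrow> finite e"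
  using assms by (auto simp: is_link_set_def intro: finite_subset)

lemma is_link_set_mono: "is_link_set V E \<Longrightarrow> F \<subseteq> E \<Longrightarrow> is_link_set V F"
  by (auto simp: is_link_set_def intro: finite_subset)

lemma degree_classD:
  assumes "G \<in> degree_class E V \<kappa>"
  shows "G \<subseteq> E" "\<And>i. i \<in> V \<Longrightarrow> vdeg G i = \<kappa> i"
  using assms by (auto simp: degree_class_def)

lemma sum_links_swap:
  fixes f :: "'a set \<Rightarrow> 'a \<Rightarrow> 'b :: comm_semiring_1"
  assumes "is_link_set V E"
  shows "(\<Sum>e\<in>E. \<Sum>i\<in>e. f e i) = (\<Sum>i\<in>V. \<Sum>e | e \<in> E \<and> i \<in> e. f e i)"
proof -
  note E = is_link_setD[OF assms]
  have "(\<Sum>e\<in>E. \<Sum>i\<in>e. f e i) = (\<Sum>e\<in>E. \<Sum>i | i \<in> V \<and> i \<in> e. f e i)"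
    using E(4) by (intro sum.cong refl) auto
  also have "\<dots> = (\<Sum>i\<in>V. \<Sum>e | e \<in> E \<and> i \<in> e. f e i)"
    by (rule sum.swap_restrict) (use E in auto)
  finally show ?thesis .
qed

lemma handshake:
  assumes "is_link_set V E"
  shows "(\<Sum>i\<in>V. vdeg E i) = 2 * card E"
proof -
  have "(\<Sum>i\<in>V. vdeg E i) = (\<Sum>e\<in>E. \<Sum>i\<in>e. 1)"
    unfolding sum_links_swap[OF assms] by (simp add: vdeg_def)
  also have "\<dots> = (\<Sum>e\<in>E. 2)"
    using is_link_setD[OF assms] by (intro sum.cong) auto
  finally show ?thesis by simp
qed

lemma degree_class_card:
  assumes "is_link_set V E" "G \<in> degree_class E V \<kappa>"
  shows "(\<Sum>i\<in>V. \<kappa> i) = 2 * card G"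
  using handshake[OF is_link_set_mono[OF assms(1)], of G] degree_classD[OF assms(2)] by simp

lemma link_cases:
  assumes "card e = 2"
  obtains i j where "e = {i, j}" "i \<noteq> j"
  using assms by (meson card_2_iff)

lemma sum_reduce:
  assumes "finite V" "e \<subseteq> V" "card e = 2" "\<And>i. i \<in> e \<Longrightarrow> 0 < \<kappa> i"
  shows "(\<Sum>i\<in>V. \<kappa> i) = (\<Sum>i\<in>V. reduce \<kappa> e i) + 2"
proof -
  have "(\<Sum>i\<in>V. \<kappa> i) = (\<Sum>i\<in>V. reduce \<kappa> e i + of_bool (i \<in> e))"
    using assms(4) by (intro sum.cong) (auto simp: reduce_def)
  also have "\<dots> = (\<Sum>i\<in>V. reduce \<kappa> e i) + card (V \<inter> e)"
    using assms(1) by (simp add: sum.distrib sum.If_cases of_bool_def)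
  also have "V \<inter> e = e" using assms(2) by auto
  finally show ?thesis using assms(3) by simp
qed

lemma prod_fact_reduce:
  assumes "finite V" "e \<subseteq> V" "\<And>i. i \<in> e \<Longrightarrow> 0 < \<kappa> i"
  shows "(\<Prod>i\<in>V. fact (\<kappa> i) :: real) = (\<Prod>i\<in>V. fact (reduce \<kappa> e i)) * (\<Prod>i\<in>e. real (\<kappa> i))"
proof -
  have "(\<Prod>i\<in>V. fact (\<kappa> i) :: real) = (\<Prod>i\<in>V. fact (reduce \<kappa> e i) * (if i \<in> e then real (\<kappa> i) else 1))"
  proof (rule prod.cong[OF refl])
    fix i assume "i \<in> V"
    show "fact (\<kappa> i) = fact (reduce \<kappa> e i) * (if i \<in> e then real (\<kappa> i) else 1)"
      using assms(3)[of i] by (cases "\<kappa> i") (auto simp: reduce_def)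
  qed
  also have "\<dots> = (\<Prod>i\<in>V. fact (reduce \<kappa> e i)) * (\<Prod>i\<in>V \<inter> e. real (\<kappa> i))"
    by (simp add: prod.distrib prod.inter_restrict[OF assms(1)])
  also have "V \<inter> e = e" using assms(2) by auto
  finally show ?thesis .
qed

text \<open>Counting pairs of a graph and one of its links; the lower-order factor in \<open>r\<close> accounts for the loops excluded on a single layer.\<close>

lemma card_degree_class_le:
  fixes r :: "nat \<Rightarrow> real"
  assumes E: "is_link_set V E" and r0: "\<And>M. 0 \<le> r M"
    and r: "\<And>G \<kappa>. G \<in> degree_class E V \<kappa> \<Longrightarrow> G \<noteq> {} \<Longrightarrow>
      (\<Sum>e\<in>E. \<Prod>i\<in>e. real (\<kappa> i)) \<le> card G * r (card G)"
  shows "G0 \<in> degree_class E V \<kappa> \<Longrightarrow>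
    card (degree_class E V \<kappa>) \<le> (\<Prod>t=1..card G0. r t) / (\<Prod>i\<in>V. fact (\<kappa> i))"
proof (induction "card G0" arbitrary: G0 \<kappa>)
  case 0
  note E' = is_link_setD[OF E]
  have "G = {}" if "G \<in> degree_class E V \<kappa>" for G
  proof -
    have "card G = 0" using degree_class_card[OF E that] degree_class_card[OF E 0(2)] 0(1) by simp
    then show ?thesis using degree_classD(1)[OF that] E'(2) by (meson card_eq_0_iff finite_subset)
  qed
  then have "card (degree_class E V \<kappa>) \<le> card {{} :: 'a set set}"
    by (intro card_mono) auto
  moreover have "\<kappa> i = 0" if "i \<in> V" for i
  proof -
    have "(\<Sum>i\<in>V. \<kappa> i) = 0" using degree_class_card[OF E 0(2)] 0(1) by simp
    then show ?thesis using that E'(1) by simp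
  qed
  ultimately show ?case by (simp flip: 0(1))
next
  case (Suc M)
  note E' = is_link_setD[OF E]
  define D where "D = degree_class E V \<kappa>"
  have finD: "finite D" using E' by (simp add: D_def)
  have cardG: "card G = Suc M" "finite G" if "G \<in> D" for G
    using degree_class_card[OF E, of G \<kappa>] degree_class_card[OF E Suc(3)] Suc(2) that
      degree_classD(1)[of G E V \<kappa>] E'(2) by (auto simp: D_def intro: finite_subset)
  have "real (Suc M) * card D = (\<Sum>G\<in>D. card G)" using cardG by (simp add: algebra_simps)
  also have "\<dots> = (\<Sum>G\<in>D. \<Sum>e | e \<in> E \<and> e \<in> G. 1 :: real)"
  proof (unfold of_nat_sum, rule sum.cong[OF refl])
    fix G assume "G \<in> D"
    then have "{e. e \<in> E \<and> e \<in> G} = G" by (auto simp: D_def degree_class_def)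
    then show "real (card G) = (\<Sum>e | e \<in> E \<and> e \<in> G. 1)" by simp
  qed
  also have "\<dots> = (\<Sum>e\<in>E. real (card {G \<in> D. e \<in> G}))"
    using finD E' by (subst sum.swap_restrict) auto
  \<comment> \<open>The graphs through \<open>e\<close> are at most as many as those with reduced
    degrees, and the reduction costs exactly the factors \<open>\<kappa> i\<close> of the two ends
    in the product of factorials.\<close>
  also have "\<dots> \<le> (\<Sum>e\<in>E. (\<Prod>t=1..M. r t) / (\<Prod>i\<in>V. fact (\<kappa> i)) * (\<Prod>i\<in>e. real (\<kappa> i)))"
  proof (rule sum_mono)
    fix e assume e: "e \<in> E"
    show "card {G \<in> D. e \<in> G} \<le> (\<Prod>t=1..M. r t) / (\<Prod>i\<in>V. fact (\<kappa> i)) * (\<Prod>i\<in>e. real (\<kappa> i))"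
    proof (cases "{G \<in> D. e \<in> G} = {}")
      case True
      show ?thesis unfolding True by (simp add: prod_nonneg r0)
    next
      case False
      then obtain G where G: "G \<in> D" "e \<in> G" by auto
      have pos: "0 < \<kappa> i" if "i \<in> e" for i
        using vdeg_pos[OF cardG(2)[OF G(1)] G(2) that] degree_classD(2)[of G E V \<kappa> i] G(1) E'(4)[OF e] that
        by (auto simp: D_def)
      have "finite {G \<in> degree_class E V (reduce \<kappa> e). e \<notin> G}" using E' by simp
      define D' where "D' = {G \<in> degree_class E V (reduce \<kappa> e). e \<notin> G}"
      have card: "card {G \<in> D. e \<in> G} = card D'"
        unfolding D_def D'_def by (rule card_containing[OF E'(2) e E'(4)[OF e] pos])
      have "card {G \<in> D. e \<in> G} \<noteq> 0" using False finD by simp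
      then have "D' \<noteq> {}" using card by force
      then obtain G' where G': "G' \<in> degree_class E V (reduce \<kappa> e)" by (auto simp: D'_def)
      have "2 * card G' + 2 = 2 * Suc M"
        using degree_class_card[OF E G'] degree_class_card[OF E Suc(3)] Suc(2)
          sum_reduce[OF E'(1) E'(4)[OF e] E'(3)[OF e] pos] by simp
      then have M: "M = card G'" by simp
      have "card {G \<in> D. e \<in> G} \<le> card (degree_class E V (reduce \<kappa> e))"
        unfolding card D'_def using E' by (intro card_mono) auto
      also have "real \<dots> \<le> (\<Prod>t=1..M. r t) / (\<Prod>i\<in>V. fact (reduce \<kappa> e i))"
        using Suc(1)[OF M G'] by (simp add: M)
      also have "\<dots> = (\<Prod>t=1..M. r t) / (\<Prod>i\<in>V. fact (\<kappa> i)) * (\<Prod>i\<in>e. real (\<kappa> i))"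
      proof -
        have "(\<Prod>i\<in>e. real (\<kappa> i)) \<noteq> 0" using pos E'(5)[OF e] by auto
        then show ?thesis
          using prod_fact_reduce[OF E'(1) E'(4)[OF e] pos] by simp
      qed
      finally show ?thesis by simp
    qed
  qed
  also have "\<dots> = (\<Prod>t=1..M. r t) / (\<Prod>i\<in>V. fact (\<kappa> i)) * (\<Sum>e\<in>E. \<Prod>i\<in>e. real (\<kappa> i))"
    by (simp add: sum_distrib_left)
  also have "\<dots> \<le> (\<Prod>t=1..M. r t) / (\<Prod>i\<in>V. fact (\<kappa> i)) * (Suc M * r (Suc M))"
  proof (rule mult_left_mono)
    have "G0 \<noteq> {}" using Suc(2) by auto
    then show "(\<Sum>e\<in>E. \<Prod>i\<in>e. real (\<kappa> i)) \<le> Suc M * r (Suc M)"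
      using r[OF Suc(3)] by (simp flip: Suc(2))
  qed (simp add: prod_nonneg r0)
  also have "\<dots> = real (Suc M) * ((\<Prod>t=1..Suc M. r t) / (\<Prod>i\<in>V. fact (\<kappa> i)))" by simp
  finally show ?case unfolding D_def Suc(2)[symmetric] by (rule mult_left_le_imp_le) simp
qed

section \<open>Neighbours and switchings\<close>

definition nbrs :: "'a set set \<Rightarrow> 'a \<Rightarrow> 'a set" where
  "nbrs G i = {j. {i, j} \<in> G}"

lemma nbrs_iff: "j \<in> nbrs G i \<longleftrightarrow> {i, j} \<in> G" by (simp add: nbrs_def)

lemma bij_betw_nbrs:
  assumes "\<And>e. e \<in> G \<Longrightarrow> card e = 2"
  shows "bij_betw (\<lambda>j. {i, j}) (nbrs G i) {e \<in> G. i \<in> e}"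
  unfolding bij_betw_def
proof
  show "inj_on (\<lambda>j. {i, j}) (nbrs G i)"
    by (auto simp: inj_on_def doubleton_eq_iff)
  show "(\<lambda>j. {i, j}) ` nbrs G i = {e \<in> G. i \<in> e}"
  proof (intro equalityI subsetI)
    fix e assume e: "e \<in> {e \<in> G. i \<in> e}"
    then obtain a b where ab: "e = {a, b}" "a \<noteq> b" using assms[of e] by (auto elim: link_cases)
    then have "e = {i, a} \<or> e = {i, b}" using e by auto
    then show "e \<in> (\<lambda>j. {i, j}) ` nbrs G i" using e by (auto simp: nbrs_def)
  qed (auto simp: nbrs_def)
qed

lemma card_nbrs:
  assumes "\<And>e. e \<in> G \<Longrightarrow> card e = 2"
  shows "card (nbrs G i) = vdeg G i"
  unfolding vdeg_def by (rule bij_betw_same_card[OF bij_betw_nbrs[OF assms]])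

lemma sum_incident:
  assumes "\<And>e. e \<in> G \<Longrightarrow> card e = 2"
  shows "(\<Sum>e | e \<in> G \<and> i \<in> e. f e) = (\<Sum>j\<in>nbrs G i. f {i, j})"
  by (rule sum.reindex_bij_betw[OF bij_betw_nbrs[where i = i, OF assms], symmetric])

lemma nbrs_subset:
  assumes "is_link_set V E" "G \<subseteq> E"
  shows "nbrs G i \<subseteq> V"
  using is_link_setD(4)[OF assms(1)] assms(2) by (auto simp: nbrs_def)

text \<open>Replacing the links \<open>ij, uv\<close> by \<open>iu, jv\<close>.\<close>

lemma switching:
  assumes E: "is_link_set V E" and ij: "{i, j} \<in> E" "i \<noteq> j" "i \<in> V" "j \<in> V"
    and Q: "\<And>G. G \<in> degree_class E V \<kappa> \<Longrightarrow> {i, j} \<in> G \<Longrightarrow> c \<le> card (Q G)"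
    and sub: "\<And>G u v. (u, v) \<in> Q G \<Longrightarrow> {u, v} \<in> G \<and> {u, v} \<inter> {i, j} = {} \<and>
      {i, u} \<in> E - G \<and> {j, v} \<in> E - G"
  shows "card {G \<in> degree_class E V \<kappa>. {i, j} \<in> G} * c
    \<le> \<kappa> i * \<kappa> j * card {G \<in> degree_class E V \<kappa>. {i, j} \<notin> G}"
proof -
  note E' = is_link_setD[OF E]
  define S1 where "S1 = {G \<in> degree_class E V \<kappa>. {i, j} \<in> G}"
  define S0 where "S0 = {G \<in> degree_class E V \<kappa>. {i, j} \<notin> G}"
  \<comment> \<open>Keeping \<open>u\<close> and \<open>v\<close> makes the switching invertible. In
    the image they are neighbours of \<open>i\<close> and \<open>j\<close>, which leaves at most
    \<open>\<kappa> i * \<kappa> j\<close> choices for each new graph.\<close>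
  define \<Phi> where "\<Phi> = (\<lambda>(G, u, v). (insert {i, u} (insert {j, v} (G - {{i, j}, {u, v}})), u, v))"
  define \<Psi> where "\<Psi> = (\<lambda>(G, u, v). (insert {i, j} (insert {u, v} (G - {{i, u}, {j, v}})), u, v))"
  have fin: "finite S1" "finite S0" using E' by (auto simp: S1_def S0_def)
  have finQ: "finite (Q G)" if "G \<in> S1" for G
  proof (rule finite_subset)
    show "Q G \<subseteq> V \<times> V"
    proof
      fix x assume "x \<in> Q G"
      obtain u v where x: "x = (u, v)" by fastforce
      then have "{u, v} \<in> E" using sub[of u v G] \<open>x \<in> Q G\<close> that by (auto simp: S1_def degree_class_def)
      then show "x \<in> V \<times> V" using E'(4) x by auto
    qed
  qed (use E' in simp)
  have Phi_mem: "\<Phi> (G, u, v) \<in> Sigma S0 (\<lambda>G. nbrs G i \<times> nbrs G j)" (is ?A)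
    and Psi_Phi: "\<Psi> (\<Phi> (G, u, v)) = (G, u, v)" (is ?B)
    if "G \<in> S1" "(u, v) \<in> Q G" for G u v
  proof -
    note s = sub[OF that(2)]
    have G: "G \<subseteq> E" "\<And>x. x \<in> V \<Longrightarrow> vdeg G x = \<kappa> x" "{i, j} \<in> G"
      using that(1) by (auto simp: S1_def degree_class_def)
    have finG: "finite G" using G(1) E'(2) by (rule finite_subset)
    have uv: "u \<noteq> v" using s G(1) E'(3)[of "{u, v}"] by auto
    define H where "H = G - {{i, j}} - {{u, v}}"
    have ne: "{i, j} \<noteq> {u, v}" using s by auto
    define G' where "G' = insert {i, u} (insert {j, v} H)"
    have Phi: "\<Phi> (G, u, v) = (G', u, v)" by (auto simp: \<Phi>_def G'_def H_def)
    have finH: "finite H" using finG by (simp add: H_def)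
    have notin: "{j, v} \<notin> H" "{i, u} \<notin> insert {j, v} H"
      using s ij by (auto simp: H_def doubleton_eq_iff)
    have "vdeg G' x = \<kappa> x" if "x \<in> V" for x
    proof -
      have "vdeg G' x = vdeg H x + of_bool (x \<in> {j, v}) + of_bool (x \<in> {i, u})"
        unfolding G'_def using vdeg_insert[OF finH notin(1), of x] vdeg_insert[OF _ notin(2), of x] finH
        by simp
      moreover have "vdeg G x = vdeg H x + of_bool (x \<in> {u, v}) + of_bool (x \<in> {i, j})"
        unfolding H_def using vdeg_remove[OF finG G(3), of x] vdeg_remove[of "G - {{i, j}}" "{u, v}" x] s ne finG
        by simp
      moreover have "i \<noteq> u" "j \<noteq> u" "i \<noteq> v" "j \<noteq> v" using s by auto
      ultimately show ?thesis using G(2)[OF that] uv ij(2)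
        by (cases "x = i"; cases "x = j"; cases "x = u"; cases "x = v"; simp)
    qed
    moreover have "G' \<subseteq> E" using G(1) s by (auto simp: G'_def H_def)
    moreover have "{i, j} \<notin> G'" using s ij(2) by (auto simp: G'_def H_def doubleton_eq_iff)
    ultimately have "G' \<in> S0" by (auto simp: S0_def degree_class_def)
    then show ?A unfolding Phi by (auto simp: nbrs_def G'_def)
    have "G' - {{i, u}, {j, v}} = H" using s by (auto simp: G'_def H_def)
    then show ?B unfolding Phi using G(3) s by (auto simp: \<Psi>_def H_def)
  qed
  have "card S1 * c = (\<Sum>G\<in>S1. c)" by simp
  also have "\<dots> \<le> (\<Sum>G\<in>S1. card (Q G))" using Q by (intro sum_mono) (auto simp: S1_def)
  also have "\<dots> = card (Sigma S1 Q)" using fin finQ by (simp add: card_SigmaI)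
  also have "\<dots> \<le> card (Sigma S0 (\<lambda>G. nbrs G i \<times> nbrs G j))"
  proof (rule card_inj_on_le[of \<Phi>])
    show "inj_on \<Phi> (Sigma S1 Q)"
      by (rule inj_on_inverseI[of _ \<Psi>]) (use Psi_Phi in auto)
    show "\<Phi> ` Sigma S1 Q \<subseteq> Sigma S0 (\<lambda>G. nbrs G i \<times> nbrs G j)"
    proof
      fix x assume "x \<in> \<Phi> ` Sigma S1 Q"
      then obtain G u v where "G \<in> S1" "(u, v) \<in> Q G" "x = \<Phi> (G, u, v)" by auto
      then show "x \<in> Sigma S0 (\<lambda>G. nbrs G i \<times> nbrs G j)" using Phi_mem by blast
    qed
    show "finite (Sigma S0 (\<lambda>G. nbrs G i \<times> nbrs G j))"
    proof (intro finite_SigmaI fin finite_cartesian_product)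
      fix G assume "G \<in> S0"
      then show "finite (nbrs G i)" "finite (nbrs G j)"
        using nbrs_subset[OF E, of G] E'(1) by (auto simp: S0_def degree_class_def intro: finite_subset)
    qed
  qed
  also have "\<dots> = (\<Sum>G\<in>S0. \<kappa> i * \<kappa> j)"
  proof (subst card_SigmaI)
    show "\<forall>G\<in>S0. finite (nbrs G i \<times> nbrs G j)"
    proof
      fix G assume "G \<in> S0"
      then show "finite (nbrs G i \<times> nbrs G j)"
        using nbrs_subset[OF E, of G] E'(1)
        by (auto simp: S0_def degree_class_def intro!: finite_cartesian_product intro: finite_subset)
    qed
    show "(\<Sum>G\<in>S0. card (nbrs G i \<times> nbrs G j)) = (\<Sum>G\<in>S0. \<kappa> i * \<kappa> j)"
    proof (rule sum.cong[OF refl])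
      fix G assume "G \<in> S0"
      then have G: "G \<subseteq> E" "vdeg G i = \<kappa> i" "vdeg G j = \<kappa> j"
        using ij by (auto simp: S0_def degree_class_def)
      then have "card e = 2" if "e \<in> G" for e using E'(3) that by auto
      then show "card (nbrs G i \<times> nbrs G j) = \<kappa> i * \<kappa> j"
        using G by (simp add: card_cartesian_product card_nbrs)
    qed
  qed (use fin in simp)
  finally show ?thesis by (simp add: S1_def S0_def mult.commute)
qed

text \<open>The links \<open>uv\<close> to be switched with \<open>ij\<close> are read as ordered
  pairs with \<open>u\<close> in \<open>U\<close> and counted by the degrees of \<open>U\<close>.
  The bounds \<open>a\<close> and \<open>b\<close> discard pairs where \<open>u\<close> cannot
  become a neighbour of \<open>i\<close>, or \<open>v\<close> of \<open>j\<close>: equal nodes,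
  links already present, pairs not allowed. If \<open>U\<close> is one side of a bipartition each
  link counts once; if it is a whole layer, both orientations count.\<close>

lemma switching_count:
  fixes a b :: real
  assumes E: "is_link_set V E" and ij: "{i, j} \<in> E" "i \<noteq> j"
    and U: "U \<subseteq> V" "\<And>u. u \<in> U \<Longrightarrow> nbrs E u \<subseteq> W" and W: "W \<subseteq> V"
    and a: "\<And>G. G \<in> degree_class E V \<kappa> \<Longrightarrow>
      real (\<Sum>u | u \<in> U \<and> (u = i \<or> {i, u} \<in> G \<or> {i, u} \<notin> E). \<kappa> u) \<le> a"
    and b: "\<And>G. G \<in> degree_class E V \<kappa> \<Longrightarrow>
      real (\<Sum>v | v \<in> W \<and> (v = j \<or> {j, v} \<in> G \<or> {j, v} \<notin> E). \<kappa> v) \<le> b"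
  shows "real (card {G \<in> degree_class E V \<kappa>. {i, j} \<in> G}) * (real (\<Sum>u\<in>U. \<kappa> u) - a - b)
    \<le> real (\<kappa> i * \<kappa> j) * card {G \<in> degree_class E V \<kappa>. {i, j} \<notin> G}"
proof -
  note E' = is_link_setD[OF E]
  have ijV: "i \<in> V" "j \<in> V" using E'(4)[OF ij(1)] by auto
  define bi where "bi = (\<lambda>G. {u. u \<in> U \<and> (u = i \<or> {i, u} \<in> G \<or> {i, u} \<notin> E)})"
  define bj where "bj = (\<lambda>G. {v. v \<in> W \<and> (v = j \<or> {j, v} \<in> G \<or> {j, v} \<notin> E)})"
  define T where "T = (\<lambda>G. Sigma U (nbrs G))"
  define Q where "Q = (\<lambda>G. T G - Sigma (bi G) (nbrs G) - prod.swap ` Sigma (bj G) (nbrs G))"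
  define c where "c = nat \<lceil>real (\<Sum>u\<in>U. \<kappa> u) - a - b\<rceil>"
  have "card {G \<in> degree_class E V \<kappa>. {i, j} \<in> G} * c
    \<le> \<kappa> i * \<kappa> j * card {G \<in> degree_class E V \<kappa>. {i, j} \<notin> G}"
  \<comment> \<open>The side conditions on the pairs are required for every \<open>G\<close>, so the
    set is made empty for irrelevant ones.\<close>
  proof (rule switching[where Q = "\<lambda>G. if {i, j} \<in> G \<and> G \<subseteq> E then Q G else {}", OF E ij ijV])
    fix G assume G: "G \<in> degree_class E V \<kappa>" "{i, j} \<in> G"
    note G' = degree_classD[OF G(1)]
    have card2: "card e = 2" if "e \<in> G" for e using that G'(1) E'(3) by auto
    have finU: "finite U" "finite W" using U W E'(1) by (auto intro: finite_subset)
    have finn: "finite (nbrs G u)" for u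
      using nbrs_subset[OF E G'(1)] E'(1) by (rule finite_subset)
    have sum: "card (Sigma S (nbrs G)) = (\<Sum>u\<in>S. \<kappa> u)" if "S \<subseteq> V" for S
    proof -
      have "card (Sigma S (nbrs G)) = (\<Sum>u\<in>S. card (nbrs G u))"
        using that E'(1) finn by (intro card_SigmaI) (auto intro: finite_subset)
      also have "\<dots> = (\<Sum>u\<in>S. \<kappa> u)"
        using that G'(2) by (intro sum.cong) (auto simp: card_nbrs[OF card2])
      finally show ?thesis .
    qed
    have sub: "bi G \<subseteq> V" "bj G \<subseteq> V" using U W by (auto simp: bi_def bj_def)
    have "card (T G) \<le> card (Q G) + card (Sigma (bi G) (nbrs G)) + card (prod.swap ` Sigma (bj G) (nbrs G))"
    proof -
      have f: "finite (Sigma (bi G) (nbrs G))" "finite (Sigma (bj G) (nbrs G))" "finite (T G)"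
        using finU finn sub E'(1) by (auto simp: T_def intro!: finite_SigmaI intro: finite_subset)
      have "card (T G) \<le> card (Q G \<union> Sigma (bi G) (nbrs G) \<union> prod.swap ` Sigma (bj G) (nbrs G))"
        using f by (intro card_mono) (auto simp: Q_def)
      then show ?thesis using card_Un_le[of "Q G \<union> Sigma (bi G) (nbrs G)" "prod.swap ` Sigma (bj G) (nbrs G)"]
          card_Un_le[of "Q G" "Sigma (bi G) (nbrs G)"] by linarith
    qed
    moreover have "card (prod.swap ` Sigma (bj G) (nbrs G)) = card (Sigma (bj G) (nbrs G))"
      by (intro card_image) (auto simp: inj_on_def)
    ultimately have "real (\<Sum>u\<in>U. \<kappa> u) \<le> card (Q G) + real (\<Sum>u\<in>bi G. \<kappa> u) + real (\<Sum>u\<in>bj G. \<kappa> u)"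
      unfolding T_def by (simp add: sum[OF sub(1)] sum[OF sub(2)] sum[OF U(1)] flip: of_nat_sum of_nat_add)
    then have "real (\<Sum>u\<in>U. \<kappa> u) - a - b \<le> card (Q G)"
      using a[OF G(1)] b[OF G(1)] unfolding bi_def bj_def by linarith
    then show "c \<le> card (if {i, j} \<in> G \<and> G \<subseteq> E then Q G else {})"
      using G(2) G'(1) unfolding c_def by (simp add: nat_le_iff ceiling_le_iff)
  next
    fix G u v assume "(u, v) \<in> (if {i, j} \<in> G \<and> G \<subseteq> E then Q G else {})"
    then have G: "{i, j} \<in> G" "G \<subseteq> E" "(u, v) \<in> Q G" by (auto split: if_splits)
    then have uv: "{u, v} \<in> G" "u \<in> U" "u \<notin> bi G" "v \<notin> bj G"
      by (auto simp: Q_def T_def nbrs_def insert_commute)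
    have "v \<in> W" using U(2)[OF uv(2)] uv(1) G(2) by (auto simp: nbrs_def)
    then have *: "u \<noteq> i" "{i, u} \<notin> G" "{i, u} \<in> E" "v \<noteq> j" "{j, v} \<notin> G" "{j, v} \<in> E"
      using uv by (auto simp: bi_def bj_def)
    \<comment> \<open>\<open>{i, j}\<close> lies in \<open>G\<close> whereas \<open>{i, u}\<close>
      and \<open>{j, v}\<close> do not, so these coincidences are already excluded.\<close>
    then have "u \<noteq> j" "v \<noteq> i" using G(1) by (auto simp: insert_commute)
    then show "{u, v} \<in> G \<and> {u, v} \<inter> {i, j} = {} \<and> {i, u} \<in> E - G \<and> {j, v} \<in> E - G"
      using * uv(1) by auto
  qed
  then have "real (card {G \<in> degree_class E V \<kappa>. {i, j} \<in> G}) * c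
    \<le> real (\<kappa> i * \<kappa> j) * card {G \<in> degree_class E V \<kappa>. {i, j} \<notin> G}"
    by (simp flip: of_nat_mult)
  moreover have "real (\<Sum>u\<in>U. \<kappa> u) - a - b \<le> c" unfolding c_def by linarith
  ultimately show ?thesis
    by (meson mult_left_mono of_nat_0_le_iff order_trans)
qed

text \<open>\<open>Z\<close> counts the graphs with degrees \<open>\<kappa>\<close> through
  \<open>ij\<close>, equivalently those with reduced degrees avoiding \<open>ij\<close>. Switching
  among degrees \<open>\<kappa>\<close> bounds \<open>Z * c\<close> by \<open>w\<close> times the
  whole class; switching among the reduced degrees shows that the graphs containing
  \<open>ij\<close> there number at most \<open>Z * w / c'\<close>. The bounds \<open>a\<close>,
  \<open>b\<close> are assumed for all degrees below \<open>\<kappa>\<close> so as to serve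
  both.\<close>

lemma switching_ratio:
  fixes a b c c' w :: real
  assumes E: "is_link_set V E" and ij: "{i, j} \<in> E" "i \<noteq> j"
    and U: "U \<subseteq> V" "\<And>u. u \<in> U \<Longrightarrow> nbrs E u \<subseteq> W" and W: "W \<subseteq> V"
    and pos: "0 < \<kappa> i" "0 < \<kappa> j"
    and a: "\<And>G \<kappa>'. G \<in> degree_class E V \<kappa>' \<Longrightarrow> (\<And>x. \<kappa>' x \<le> \<kappa> x) \<Longrightarrow>
      real (\<Sum>u | u \<in> U \<and> (u = i \<or> {i, u} \<in> G \<or> {i, u} \<notin> E). \<kappa>' u) \<le> a"
    and b: "\<And>G \<kappa>'. G \<in> degree_class E V \<kappa>' \<Longrightarrow> (\<And>x. \<kappa>' x \<le> \<kappa> x) \<Longrightarrow>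
      real (\<Sum>v | v \<in> W \<and> (v = j \<or> {j, v} \<in> G \<or> {j, v} \<notin> E). \<kappa>' v) \<le> b"
    and c: "c = real (\<Sum>u\<in>U. \<kappa> u) - a - b" "0 < c"
    and c': "c' \<le> real (\<Sum>u\<in>U. reduce \<kappa> {i, j} u) - a - b" "0 < c'"
    and w: "w = real (\<kappa> i * \<kappa> j)"
  shows "card (degree_class E V (reduce \<kappa> {i, j})) * c \<le> card (degree_class E V \<kappa>) * w * (1 + w / c')"
proof -
  note E' = is_link_setD[OF E]
  define \<kappa>' where "\<kappa>' = reduce \<kappa> {i, j}"
  define Z where "Z = card {G \<in> degree_class E V \<kappa>'. {i, j} \<notin> G}"
  define S1 where "S1 = card {G \<in> degree_class E V \<kappa>'. {i, j} \<in> G}"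
  have le: "\<kappa>' x \<le> \<kappa> x" for x by (simp add: \<kappa>'_def reduce_def)
  have Z: "card {G \<in> degree_class E V \<kappa>. {i, j} \<in> G} = Z"
    unfolding Z_def \<kappa>'_def by (rule card_containing[OF E'(2) ij(1) E'(4)[OF ij(1)]]) (use pos in auto)
  have count: "real (card {G \<in> degree_class E V \<kappa>'. {i, j} \<in> G}) * (real (\<Sum>u\<in>U. \<kappa>' u) - a - b)
      \<le> real (\<kappa>' i * \<kappa>' j) * card {G \<in> degree_class E V \<kappa>'. {i, j} \<notin> G}"
    if "\<And>x. \<kappa>' x \<le> \<kappa> x" for \<kappa>'
    by (rule switching_count[OF E ij U W]) (use a b that in blast)+
  have "Z * c \<le> w * card {G \<in> degree_class E V \<kappa>. {i, j} \<notin> G}"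
    using count[of \<kappa>, OF order_refl] by (simp only: Z c(1) w)
  also have "\<dots> \<le> w * card (degree_class E V \<kappa>)"
    using E' by (intro mult_left_mono of_nat_mono card_mono) (auto simp: w)
  finally have 1: "Z * c \<le> w * card (degree_class E V \<kappa>)" .
  have "real S1 * c' \<le> S1 * (real (\<Sum>u\<in>U. \<kappa>' u) - a - b)"
    using c' by (intro mult_left_mono) (auto simp: \<kappa>'_def)
  also have "\<dots> \<le> real (\<kappa>' i * \<kappa>' j) * Z"
    using count[OF le] by (simp only: S1_def Z_def)
  also have "\<dots> \<le> w * Z"
    unfolding w by (intro mult_right_mono of_nat_mono mult_le_mono le) auto
  finally have "S1 \<le> w * Z / c'" using c'(2) by (simp add: field_simps)
  moreover have "card (degree_class E V \<kappa>') = Z + S1"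
  proof -
    have "degree_class E V \<kappa>' = {G \<in> degree_class E V \<kappa>'. {i, j} \<notin> G} \<union> {G \<in> degree_class E V \<kappa>'. {i, j} \<in> G}"
      by auto
    then show ?thesis unfolding Z_def S1_def using E'(2)
      by (subst card_Un_disjoint[symmetric]) auto
  qed
  ultimately have "card (degree_class E V \<kappa>') \<le> Z * (1 + w / c')"
    by (simp add: algebra_simps)
  then have "card (degree_class E V \<kappa>') * c \<le> Z * (1 + w / c') * c"
    using c(2) by (intro mult_right_mono) auto
  also have "\<dots> = (Z * c) * (1 + w / c')" by (simp add: algebra_simps)
  also have "\<dots> \<le> (w * card (degree_class E V \<kappa>)) * (1 + w / c')"
    using 1 c' by (intro mult_right_mono) (auto simp: w)
  finally show ?thesis by (simp add: \<kappa>'_def algebra_simps)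
qed

text \<open>On this range \<open>1 / (1 - 2 * y) \<le> exp (4 * y)\<close> and
  \<open>1 + 2 * y \<le> exp (2 * y)\<close>; the exponent 8 leaves some room.\<close>

lemma exp_ratio_bound:
  fixes y :: real
  assumes "0 \<le> y" "y \<le> 1 / 8"
  shows "exp (- (8 * y)) * (1 + 2 * y) \<le> 1 - 2 * y"
proof -
  have "1 / (1 - 2 * y) = 1 + 2 * y / (1 - 2 * y)" using assms by (simp add: field_simps)
  also have "\<dots> \<le> 1 + 4 * y" using assms mult_mono[of y "1/8" y y] by (simp add: field_simps)
  also have "\<dots> \<le> exp (4 * y)" by (rule exp_ge_add_one_self)
  finally have "1 \<le> exp (4 * y) * (1 - 2 * y)" using assms by (simp add: field_simps)
  moreover have "1 + 2 * y \<le> exp (2 * y)" by (rule exp_ge_add_one_self)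
  ultimately have "exp (- (8 * y)) * (1 + 2 * y) * 1
      \<le> exp (- (8 * y)) * exp (2 * y) * (exp (4 * y) * (1 - 2 * y))"
    using assms by (intro mult_mono) auto
  also have "\<dots> = exp (- (2 * y)) * (1 - 2 * y)" by (simp flip: exp_add mult.assoc)
  also have "\<dots> \<le> 1 * (1 - 2 * y)" using assms by (intro mult_right_mono) auto
  finally show ?thesis by simp
qed

text \<open>One notion for both kinds of blocks: two disjoint layers, or a single layer when
  \<open>A = B\<close>, where \<open>i \<noteq> j\<close> rules out loops.\<close>

definition links :: "'a set \<Rightarrow> 'a set \<Rightarrow> 'a set set" where
  "links A B = {{i, j} | i j. i \<in> A \<and> j \<in> B \<and> i \<noteq> j}"

lemma is_link_set_links:
  assumes "finite A" "finite B"
  shows "is_link_set (A \<union> B) (links A B)"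
proof -
  have "links A B \<subseteq> Pow (A \<union> B)" by (auto simp: links_def)
  then show ?thesis using assms by (auto simp: is_link_set_def links_def intro: finite_subset)
qed

lemma linksI: "i \<in> A \<Longrightarrow> j \<in> B \<Longrightarrow> i \<noteq> j \<Longrightarrow> {i, j} \<in> links A B"
  by (auto simp: links_def)

lemma linksE:
  assumes "e \<in> links A B"
  obtains i j where "e = {i, j}" "i \<in> A" "j \<in> B" "i \<noteq> j"
  using assms by (auto simp: links_def)

lemma links_commute: "links A B = links B A"
proof -
  have "links A B \<subseteq> links B A" for A B :: "'a set"
  proof
    fix e assume "e \<in> links A B"
    then obtain i j where "e = {j, i}" "i \<in> A" "j \<in> B" "i \<noteq> j"
      by (auto elim!: linksE simp: insert_commute)
    then show "e \<in> links B A" by (auto intro: linksI)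
  qed
  then show ?thesis by blast
qed

lemma mem_links_iff: "{i, j} \<in> links A B \<longleftrightarrow> i \<noteq> j \<and> (i \<in> A \<and> j \<in> B \<or> j \<in> A \<and> i \<in> B)"
proof
  assume "{i, j} \<in> links A B"
  then obtain a b where "{i, j} = {a, b}" "a \<in> A" "b \<in> B" "a \<noteq> b" by (rule linksE)
  then show "i \<noteq> j \<and> (i \<in> A \<and> j \<in> B \<or> j \<in> A \<and> i \<in> B)" by (auto simp: doubleton_eq_iff)
next
  assume "i \<noteq> j \<and> (i \<in> A \<and> j \<in> B \<or> j \<in> A \<and> i \<in> B)"
  then show "{i, j} \<in> links A B"
    using linksI[of i A j B] linksI[of j A i B] by (auto simp: insert_commute)
qed

lemma nbrs_links_left: "A \<inter> B = {} \<Longrightarrow> i \<in> A \<Longrightarrow> nbrs (links A B) i = B"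
  unfolding nbrs_def mem_links_iff by blast

lemma nbrs_links_right: "A \<inter> B = {} \<Longrightarrow> j \<in> B \<Longrightarrow> nbrs (links A B) j = A"
  unfolding nbrs_def mem_links_iff by blast

lemma nbrs_links_self: "i \<in> A \<Longrightarrow> nbrs (links A A) i = A - {i}"
  unfolding nbrs_def mem_links_iff by blast

lemma sum_links_bip:
  assumes "A \<inter> B = {}"
  shows "(\<Sum>e\<in>links A B. f e) = (\<Sum>i\<in>A. \<Sum>j\<in>B. f {i, j})"
proof -
  have "bij_betw (\<lambda>(i, j). {i, j}) (A \<times> B) (links A B)"
    unfolding bij_betw_def
  proof
    show "inj_on (\<lambda>(i, j). {i, j}) (A \<times> B)"
      using assms by (auto simp: inj_on_def doubleton_eq_iff)
    show "(\<lambda>(i, j). {i, j}) ` (A \<times> B) = links A B"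
      using assms by (auto intro!: linksI) (auto simp: links_def)
  qed
  from sum.reindex_bij_betw[OF this, of f] show ?thesis
    by (simp add: sum.cartesian_product split_beta)
qed

lemma sum_links_self:
  fixes f :: "'a set \<Rightarrow> real"
  assumes "finite A"
  shows "2 * (\<Sum>e\<in>links A A. f e) = (\<Sum>i\<in>A. \<Sum>j\<in>A - {i}. f {i, j})"
proof -
  have E: "is_link_set A (links A A)" using is_link_set_links[OF assms assms] by simp
  note E' = is_link_setD[OF E]
  have "2 * (\<Sum>e\<in>links A A. f e) = (\<Sum>e\<in>links A A. \<Sum>i\<in>e. f e)"
    using E'(3) by (simp add: sum_distrib_left)
  also have "\<dots> = (\<Sum>i\<in>A. \<Sum>e | e \<in> links A A \<and> i \<in> e. f e)"
    by (rule sum_links_swap[OF E])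
  also have "\<dots> = (\<Sum>i\<in>A. \<Sum>j\<in>A - {i}. f {i, j})"
    by (intro sum.cong refl) (simp add: sum_incident[OF E'(3)] nbrs_links_self)
  finally show ?thesis .
qed

lemma sum_vdeg_bip:
  assumes "finite A" "finite B" "A \<inter> B = {}" "G \<subseteq> links A B"
  shows "(\<Sum>i\<in>A. vdeg G i) = card G" "(\<Sum>j\<in>B. vdeg G j) = card G"
proof -
  have fin: "finite G" using is_link_setD(2)[OF is_link_set_links[OF assms(1,2)]] assms(4)
    by (rule rev_finite_subset)
  have "(\<Sum>i\<in>A. vdeg G i) = (\<Sum>e\<in>G. \<Sum>i | i \<in> A \<and> i \<in> e. 1)"
    unfolding vdeg_def using fin assms(1) by (subst sum.swap_restrict) auto
  also have "\<dots> = (\<Sum>e\<in>G. 1)"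
  proof (rule sum.cong[OF refl])
    fix e assume "e \<in> G"
    then obtain i j where "e = {i, j}" "i \<in> A" "j \<in> B" using assms(4) by (auto simp: links_def)
    then have "{i. i \<in> A \<and> i \<in> e} = {i}" using assms(3) by auto
    then show "(\<Sum>i | i \<in> A \<and> i \<in> e. 1) = (1::nat)" by simp
  qed
  finally show "(\<Sum>i\<in>A. vdeg G i) = card G" by simp
  have "(\<Sum>i\<in>B. vdeg G i) = (\<Sum>e\<in>G. \<Sum>i | i \<in> B \<and> i \<in> e. 1)"
    unfolding vdeg_def using fin assms(2) by (subst sum.swap_restrict) auto
  also have "\<dots> = (\<Sum>e\<in>G. 1)"
  proof (rule sum.cong[OF refl])
    fix e assume "e \<in> G"
    then obtain i j where "e = {i, j}" "i \<in> A" "j \<in> B" using assms(4) by (auto simp: links_def)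
    then have "{i. i \<in> B \<and> i \<in> e} = {j}" using assms(3) by auto
    then show "(\<Sum>i | i \<in> B \<and> i \<in> e. 1) = (1::nat)" by simp
  qed
  finally show "(\<Sum>j\<in>B. vdeg G j) = card G" by simp
qed

lemma degree_class_bip_sums:
  assumes "finite A" "finite B" "A \<inter> B = {}" "G \<in> degree_class (links A B) (A \<union> B) \<kappa>"
  shows "(\<Sum>i\<in>A. \<kappa> i) = card G" "(\<Sum>j\<in>B. \<kappa> j) = card G"
  using sum_vdeg_bip[OF assms(1-3) degree_classD(1)[OF assms(4)]] degree_classD(2)[OF assms(4)] by simp_all

text \<open>The count of the configuration model, in which parallel links are allowed.\<close>

definition config_bip :: "'a set \<Rightarrow> 'a set \<Rightarrow> ('a \<Rightarrow> nat) \<Rightarrow> real" where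
  "config_bip A B \<kappa> = fact (\<Sum>i\<in>A. \<kappa> i) / (\<Prod>i\<in>A \<union> B. fact (\<kappa> i))"

lemma config_bip_pos: "0 < config_bip A B \<kappa>"
  by (simp add: config_bip_def prod_pos)

text \<open>The third identity is the exact counterpart of the switching estimate: deleting
  \<open>ij\<close> multiplies the configuration count by
  \<open>\<kappa> i * \<kappa> j / L\<close>, with \<open>L\<close> the number of links. Only
  deviations from this factor remain to be controlled.\<close>

lemma config_bip_reduce:
  assumes "finite A" "finite B" "A \<inter> B = {}" "i \<in> A" "j \<in> B" "0 < \<kappa> i" "0 < \<kappa> j"
  shows "(\<Sum>x\<in>A. \<kappa> x) = Suc (\<Sum>x\<in>A. reduce \<kappa> {i, j} x)"
    and "(\<Sum>x\<in>B. \<kappa> x) = Suc (\<Sum>x\<in>B. reduce \<kappa> {i, j} x)"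
    and "config_bip A B \<kappa> * (\<kappa> i * \<kappa> j) = config_bip A B (reduce \<kappa> {i, j}) * (\<Sum>x\<in>A. \<kappa> x)"
proof -
  have ne: "i \<noteq> j" "i \<notin> B" "j \<notin> A" using assms by auto
  have "(\<Sum>x\<in>A - {i}. \<kappa> x) = (\<Sum>x\<in>A - {i}. reduce \<kappa> {i, j} x)"
    using ne by (intro sum.cong) (auto simp: reduce_def)
  then show s: "(\<Sum>x\<in>A. \<kappa> x) = Suc (\<Sum>x\<in>A. reduce \<kappa> {i, j} x)"
    using assms sum.remove[OF assms(1,4), of \<kappa>] sum.remove[OF assms(1,4), of "reduce \<kappa> {i, j}"]
    by (simp add: reduce_def)
  have "(\<Sum>x\<in>B - {j}. \<kappa> x) = (\<Sum>x\<in>B - {j}. reduce \<kappa> {i, j} x)"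
    using ne by (intro sum.cong) (auto simp: reduce_def)
  then show "(\<Sum>x\<in>B. \<kappa> x) = Suc (\<Sum>x\<in>B. reduce \<kappa> {i, j} x)"
    using assms sum.remove[OF assms(2,5), of \<kappa>] sum.remove[OF assms(2,5), of "reduce \<kappa> {i, j}"]
    by (simp add: reduce_def)
  have "(\<Prod>x\<in>A \<union> B. fact (\<kappa> x) :: real) = (\<Prod>x\<in>A \<union> B. fact (reduce \<kappa> {i, j} x)) * (\<Prod>x\<in>{i, j}. real (\<kappa> x))"
    by (rule prod_fact_reduce) (use assms in auto)
  moreover have "(\<Prod>x\<in>A \<union> B. fact (reduce \<kappa> {i, j} x) :: real) > 0" by (simp add: prod_pos)
  ultimately show "config_bip A B \<kappa> * (\<kappa> i * \<kappa> j) = config_bip A B (reduce \<kappa> {i, j}) * (\<Sum>x\<in>A. \<kappa> x)"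
    unfolding config_bip_def s using ne(1) assms(6,7) by (simp add: field_simps)
qed

text \<open>With left degrees at most 1 no parallel links arise, so the configuration model makes no
  error. Fix a left node of degree 1 and sum over its only neighbour \<open>j\<close>: the
  contributions are proportional to \<open>\<kappa> j\<close>, and these degrees sum to the number
  of links.\<close>

lemma card_bip_ge_config_left_one:
  assumes AB: "finite A" "finite B" "A \<inter> B = {}"
  shows "(\<Sum>i\<in>A. \<kappa> i) = (\<Sum>j\<in>B. \<kappa> j) \<Longrightarrow> (\<And>i. i \<in> A \<Longrightarrow> \<kappa> i \<le> 1) \<Longrightarrow>
    config_bip A B \<kappa> \<le> card (degree_class (links A B) (A \<union> B) \<kappa>)"
proof (induction "\<Sum>i\<in>A. \<kappa> i" arbitrary: \<kappa>)
  case 0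
  then have "\<kappa> i = 0" if "i \<in> A \<union> B" for i using that AB by auto
  then have "{} \<in> degree_class (links A B) (A \<union> B) \<kappa>" "config_bip A B \<kappa> = 1"
    by (auto simp: degree_class_def vdeg_def config_bip_def)
  moreover have "finite (degree_class (links A B) (A \<union> B) \<kappa>)"
    using is_link_setD(2)[OF is_link_set_links[OF AB(1,2)]] by simp
  ultimately show ?case by (auto simp: Suc_le_eq card_gt_0_iff)
next
  case (Suc M)
  note E = is_link_set_links[OF AB(1,2)]
  note E' = is_link_setD[OF E]
  define D where "D = degree_class (links A B) (A \<union> B)"
  have "\<exists>i\<in>A. \<kappa> i \<noteq> 0"
    using Suc(2) by (metis nat.simps(3) sum.neutral)
  then obtain i where i: "i \<in> A" "\<kappa> i = 1" using Suc(4) by (metis le_antisym less_one not_less)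
  have fin: "finite (D \<kappa>')" for \<kappa>' using E' by (simp add: D_def)
  have e: "{i, j} \<in> links A B" if "j \<in> B" for j using that i AB(3) by (intro linksI) auto
  have ge: "config_bip A B \<kappa> / real (\<Sum>x\<in>A. \<kappa> x) * \<kappa> j \<le> card {G \<in> D \<kappa>. {i, j} \<in> G}" if "j \<in> B" for j
  proof (cases "\<kappa> j = 0")
    case False
    \<comment> \<open>Node \<open>i\<close> has degree 0 after the reduction.\<close>
    have "{G \<in> D (reduce \<kappa> {i, j}). {i, j} \<notin> G} = D (reduce \<kappa> {i, j})"
    proof -
      have "{i, j} \<notin> G" if "G \<in> D (reduce \<kappa> {i, j})" for G
      proof
        assume "{i, j} \<in> G"
        moreover have "finite G" using that E'(2) by (auto simp: D_def degree_class_def intro: finite_subset)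
        ultimately have "0 < vdeg G i" using vdeg_pos by fastforce
        then show False using that i by (auto simp: D_def degree_class_def reduce_def)
      qed
      then show ?thesis by auto
    qed
    moreover have "card {G \<in> D \<kappa>. {i, j} \<in> G} = card {G \<in> D (reduce \<kappa> {i, j}). {i, j} \<notin> G}"
      unfolding D_def
      by (rule card_containing[OF E'(2) e[OF that] E'(4)[OF e[OF that]]]) (use i False in auto)
    ultimately have card: "card {G \<in> D \<kappa>. {i, j} \<in> G} = card (D (reduce \<kappa> {i, j}))"
      by simp
    note red = config_bip_reduce[OF AB i(1) that, of \<kappa>]
    have "config_bip A B (reduce \<kappa> {i, j}) \<le> card (D (reduce \<kappa> {i, j}))"
      unfolding D_def
    proof (rule Suc(1))
      show "M = (\<Sum>x\<in>A. reduce \<kappa> {i, j} x)" using red(1) Suc(2) i False by simp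
      show "(\<Sum>x\<in>A. reduce \<kappa> {i, j} x) = (\<Sum>x\<in>B. reduce \<kappa> {i, j} x)"
        using red(1,2) Suc(3) i False by simp
      show "reduce \<kappa> {i, j} x \<le> 1" if "x \<in> A" for x
        using Suc(4)[OF that] by (simp add: reduce_def)
    qed
    moreover have "config_bip A B \<kappa> / real (\<Sum>x\<in>A. \<kappa> x) * \<kappa> j = config_bip A B (reduce \<kappa> {i, j})"
    proof -
      have "real (\<Sum>x\<in>A. \<kappa> x) \<noteq> 0" unfolding Suc(2)[symmetric] by simp
      then show ?thesis using red(3) i False by (simp add: field_simps del: of_nat_sum)
    qed
    ultimately show ?thesis by (simp add: card)
  qed simp
  have M0: "real (\<Sum>x\<in>A. \<kappa> x) \<noteq> 0" unfolding Suc(2)[symmetric] by simp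
  then have "config_bip A B \<kappa> = config_bip A B \<kappa> / real (\<Sum>x\<in>A. \<kappa> x) * real (\<Sum>j\<in>B. \<kappa> j)"
    unfolding Suc(3)[symmetric] by (simp del: of_nat_sum)
  also have "\<dots> = (\<Sum>j\<in>B. config_bip A B \<kappa> / real (\<Sum>x\<in>A. \<kappa> x) * \<kappa> j)"
    unfolding of_nat_sum[of _ B] by (rule sum_distrib_left)
  also have "\<dots> \<le> (\<Sum>j\<in>B. real (card {G \<in> D \<kappa>. {i, j} \<in> G}))"
    by (intro sum_mono ge)
  also have "\<dots> = real (\<Sum>j\<in>B. card {G \<in> D \<kappa>. {i, j} \<in> G})" by simp
  also have "(\<Sum>j\<in>B. card {G \<in> D \<kappa>. {i, j} \<in> G}) = (\<Sum>j\<in>B. \<Sum>G | G \<in> D \<kappa> \<and> {i, j} \<in> G. 1)"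
    by simp
  also have "\<dots> = (\<Sum>G\<in>D \<kappa>. \<Sum>j | j \<in> B \<and> {i, j} \<in> G. 1)"
    by (rule sum.swap_restrict) (use fin AB in auto)
  also have "\<dots> = (\<Sum>G\<in>D \<kappa>. card {j \<in> B. {i, j} \<in> G})" by simp
  also have "\<dots> = (\<Sum>G\<in>D \<kappa>. 1)"
  proof (rule sum.cong[OF refl])
    fix G assume G: "G \<in> D \<kappa>"
    then have GE: "G \<subseteq> links A B" by (auto simp: D_def degree_class_def)
    have "{j \<in> B. {i, j} \<in> G} = nbrs G i"
    proof -
      have "j \<in> B" if "{i, j} \<in> G" for j
        using nbrs_links_left[OF AB(3) i(1)] GE that nbrs_iff[of j "links A B" i] by blast
      then show ?thesis by (auto simp: nbrs_def)
    qed
    moreover have "card (nbrs G i) = vdeg G i" using GE E'(3) by (intro card_nbrs) auto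
    ultimately show "card {j \<in> B. {i, j} \<in> G} = 1"
      using G i by (auto simp: D_def degree_class_def)
  qed
  finally show ?case by (simp add: D_def)
qed

section \<open>Lower bounds for two constrained layers\<close>

text \<open>Converts the switching estimate into one for the quotient with the configuration count.
  \<open>N\<close> and \<open>N'\<close> stand for the counts before and after removal of a link,
  \<open>L\<close> for the total weight of the pairs, \<open>y\<close> for the share excluded at
  either end.\<close>

lemma ratio_exp_bound:
  fixes c c' w L y N N' :: real
  assumes "0 < L" "0 \<le> y" "y \<le> 1 / 8" "0 \<le> N" "0 \<le> N'"
    and "N' * c \<le> N * w * (1 + w / c')" "L * (1 - 2 * y) \<le> c" "L / 2 \<le> c'" "0 \<le> w" "w \<le> y * L"
  shows "N' * L * exp (- (8 * y)) \<le> N * w"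
proof -
  have "w / c' \<le> (y * L) / (L / 2)" using assms by (intro frac_le) auto
  then have wc: "w / c' \<le> 2 * y" using assms(1) by simp
  have "N' * L * exp (- (8 * y)) * (1 + 2 * y) = N' * L * (exp (- (8 * y)) * (1 + 2 * y))" by simp
  also have "\<dots> \<le> N' * L * (1 - 2 * y)"
    using assms exp_ratio_bound[of y] by (intro mult_left_mono) auto
  also have "\<dots> \<le> N' * c" using assms mult_left_mono[OF assms(7,5)] by (simp add: mult.assoc)
  also have "\<dots> \<le> N * w * (1 + w / c')" by fact
  also have "\<dots> \<le> N * w * (1 + 2 * y)" using assms wc by (intro mult_left_mono) auto
  finally show ?thesis using assms by simp
qed

lemma sum_nbrs_le:
  fixes \<kappa> :: "'a \<Rightarrow> nat"
  assumes E: "is_link_set V E" and G: "G \<in> degree_class E V \<kappa>" and i: "i \<in> V"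
    and S: "S \<subseteq> nbrs G i" and m: "\<And>u. u \<in> S \<Longrightarrow> \<kappa> u \<le> m"
  shows "(\<Sum>u\<in>S. \<kappa> u) \<le> \<kappa> i * m"
proof -
  note E' = is_link_setD[OF E] and G' = degree_classD[OF G]
  have fin: "finite (nbrs G i)" using nbrs_subset[OF E G'(1)] E'(1) by (rule finite_subset)
  have "(\<Sum>u\<in>S. \<kappa> u) \<le> card S * m" using sum_bounded_above[of S \<kappa> m] m by simp
  also have "\<dots> \<le> card (nbrs G i) * m" using card_mono[OF fin S] by simp
  also have "card (nbrs G i) = \<kappa> i" using G' E'(3) i by (subst card_nbrs) auto
  finally show ?thesis .
qed

lemma exists_nbr:
  assumes E: "is_link_set V E" and G: "G \<in> degree_class E V \<kappa>" and i: "i \<in> V" "0 < \<kappa> i"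
  shows "\<exists>j. {i, j} \<in> G"
proof -
  note E' = is_link_setD[OF E] and G' = degree_classD[OF G]
  have "card (nbrs G i) = \<kappa> i" using G' E'(3) i by (subst card_nbrs) auto
  then have "nbrs G i \<noteq> {}" using i by auto
  then show ?thesis by (auto simp: nbrs_def)
qed

text \<open>The removed link is taken from an actual graph, so the reduced degrees are realised
  again; the inductions carry this along.\<close>

lemma degree_class_remove:
  assumes E: "is_link_set V E" and G: "G \<in> degree_class E V \<kappa>" "e \<in> G"
  shows "G - {e} \<in> degree_class E V (reduce \<kappa> e)" "\<And>i. i \<in> e \<Longrightarrow> 0 < \<kappa> i" "e \<in> E" "card e = 2" "e \<subseteq> V"
proof -
  note E' = is_link_setD[OF E] and G' = degree_classD[OF G(1)]
  have fin: "finite G" using G'(1) E'(2) by (rule finite_subset)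
  show e: "e \<in> E" "card e = 2" "e \<subseteq> V" using G'(1) G(2) E'(3,4) by auto
  have "vdeg (G - {e}) i = reduce \<kappa> e i" if "i \<in> V" for i
    using vdeg_remove[OF fin G(2), of i] G'(2)[OF that] by (auto simp: reduce_def)
  then show "G - {e} \<in> degree_class E V (reduce \<kappa> e)" using G'(1) by (auto simp: degree_class_def)
  show "0 < \<kappa> i" if "i \<in> e" for i
    using vdeg_pos[OF fin G(2) that] G'(2)[of i] e(3) that by auto
qed

lemma reduce_le: "reduce \<kappa> e x \<le> \<kappa> x" by (simp add: reduce_def)

definition bip_class :: "'a set \<Rightarrow> 'a set \<Rightarrow> ('a \<Rightarrow> nat) \<Rightarrow> 'a set set set" where
  "bip_class A B \<kappa> = degree_class (links A B) (A \<union> B) \<kappa>"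

definition bip_ratio :: "'a set \<Rightarrow> 'a set \<Rightarrow> ('a \<Rightarrow> nat) \<Rightarrow> real" where
  "bip_ratio A B \<kappa> = card (bip_class A B \<kappa>) / config_bip A B \<kappa>"

text \<open>At \<open>i\<close> the excluded pairs come from at most \<open>d\<close> neighbours of
  degree at most \<open>m\<close>, at \<open>j\<close> from at most \<open>m\<close> neighbours of
  degree at most \<open>d\<close>. Both weigh at most \<open>d * m\<close>, a share
  \<open>y = d * m / L\<close> of the total. This is where maximality of the degree of
  \<open>i\<close> enters.\<close>

lemma bip_ratio_step:
  fixes d m :: nat
  assumes AB: "finite A" "finite B" "A \<inter> B = {}" and G0: "bip_class A B \<kappa> \<noteq> {}"
    and d: "\<And>x. x \<in> A \<Longrightarrow> \<kappa> x \<le> d" and m: "\<And>x. x \<in> B \<Longrightarrow> \<kappa> x \<le> m"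
    and i: "i \<in> A" "\<kappa> i = d" "0 < d" and M: "8 * (d * m) \<le> (\<Sum>x\<in>A. \<kappa> x)"
  shows "\<exists>j\<in>B. bip_class A B (reduce \<kappa> {i, j}) \<noteq> {} \<and>
    bip_ratio A B (reduce \<kappa> {i, j}) * exp (- (real (8 * (d * m)) / real (\<Sum>x\<in>A. \<kappa> x))) \<le> bip_ratio A B \<kappa>"
proof -
  note E = is_link_set_links[OF AB(1,2)]
  obtain G where G: "G \<in> degree_class (links A B) (A \<union> B) \<kappa>" using G0 by (auto simp: bip_class_def)
  obtain j where ijG: "{i, j} \<in> G" using exists_nbr[OF E G, of i] i by auto
  note rem = degree_class_remove[OF E G ijG]
  have ij: "{i, j} \<in> links A B" "i \<noteq> j" "j \<in> B" using rem(3) i AB(3) by (auto simp: mem_links_iff)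
  have pos: "0 < \<kappa> i" "0 < \<kappa> j" using rem(2) by auto
  have jm: "\<kappa> j \<le> m" "0 < m" using m[OF ij(3)] pos by auto
  define L where "L = real (\<Sum>x\<in>A. \<kappa> x)"
  define y where "y = real (d * m) / L"
  define w where "w = real (\<kappa> i * \<kappa> j)"
  have L: "8 * (d * m) \<le> L" "0 < L"
  proof -
    have "1 \<le> d * m" using i jm by (simp add: Suc_le_eq)
    moreover show "8 * (d * m) \<le> L" using M unfolding L_def by (simp only: of_nat_le_iff)
    ultimately show "0 < L" by linarith
  qed
  have yL: "y * L = d * m" using L by (simp add: y_def)
  have y: "0 \<le> y" "y \<le> 1 / 8" using L by (auto simp: y_def field_simps)
  have dm1: "1 \<le> real (d * m)" using i jm by (simp add: Suc_le_eq flip: of_nat_mult)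
  note red = config_bip_reduce[OF AB i(1) ij(3) pos]
  have LB: "L = real (\<Sum>x\<in>B. \<kappa> x)" "L - 1 = real (\<Sum>x\<in>B. reduce \<kappa> {i, j} x)"
  proof -
    show LB: "L = real (\<Sum>x\<in>B. \<kappa> x)" using degree_class_bip_sums[OF AB G] by (simp only: L_def)
    show "L - 1 = real (\<Sum>x\<in>B. reduce \<kappa> {i, j} x)" unfolding LB red(2) by simp
  qed
  have "real (card (degree_class (links A B) (A \<union> B) (reduce \<kappa> {i, j}))) * (L * (1 - 2 * y))
      \<le> card (degree_class (links A B) (A \<union> B) \<kappa>) * w * (1 + w / (L / 2))"
  \<comment> \<open>As \<open>i\<close> lies in \<open>A\<close>, its new neighbour \<open>u\<close>
    ranges over \<open>B\<close>.\<close>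
  proof (rule switching_ratio[OF E ij(1,2), where U = B and W = A and a = "d * m" and b = "d * m"])
    show "nbrs (links A B) u \<subseteq> A" if "u \<in> B" for u using nbrs_links_right[OF AB(3) that] by simp
    fix H \<kappa>' assume H: "H \<in> degree_class (links A B) (A \<union> B) \<kappa>'" "\<And>x. \<kappa>' x \<le> \<kappa> x"
    have le: "\<kappa>' x \<le> m" if "x \<in> B" for x using m[OF that] H(2)[of x] by simp
    have le': "\<kappa>' x \<le> d" if "x \<in> A" for x using d[OF that] H(2)[of x] by simp
    have "(\<Sum>u | u \<in> B \<and> (u = i \<or> {i, u} \<in> H \<or> {i, u} \<notin> links A B). \<kappa>' u) \<le> \<kappa>' i * m"
      by (rule sum_nbrs_le[OF E H(1)])
        (use i AB(3) le in \<open>auto simp: nbrs_def mem_links_iff\<close>)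
    also have "\<dots> \<le> d * m" using H(2)[of i] i by simp
    finally show "real (\<Sum>u | u \<in> B \<and> (u = i \<or> {i, u} \<in> H \<or> {i, u} \<notin> links A B). \<kappa>' u) \<le> d * m"
      by (simp only: of_nat_le_iff)
    have "(\<Sum>v | v \<in> A \<and> (v = j \<or> {j, v} \<in> H \<or> {j, v} \<notin> links A B). \<kappa>' v) \<le> \<kappa>' j * d"
      by (rule sum_nbrs_le[OF E H(1)])
        (use ij AB(3) le' in \<open>auto simp: nbrs_def mem_links_iff\<close>)
    also have "\<dots> \<le> d * m" using H(2)[of j] jm by simp
    finally show "real (\<Sum>v | v \<in> A \<and> (v = j \<or> {j, v} \<in> H \<or> {j, v} \<notin> links A B). \<kappa>' v) \<le> d * m"
      by (simp only: of_nat_le_iff)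
  next
    show "L * (1 - 2 * y) = real (\<Sum>x\<in>B. \<kappa> x) - real (d * m) - real (d * m)"
      using yL by (simp add: LB(1)[symmetric] algebra_simps del: of_nat_sum)
    show "L / 2 \<le> real (\<Sum>x\<in>B. reduce \<kappa> {i, j} x) - real (d * m) - real (d * m)"
      unfolding LB(2)[symmetric] using L dm1 by linarith
  qed (use pos L y AB w_def in auto)
  then have "real (card (degree_class (links A B) (A \<union> B) (reduce \<kappa> {i, j}))) * L * exp (- (8 * y))
      \<le> card (degree_class (links A B) (A \<union> B) \<kappa>) * w"
    by (rule ratio_exp_bound[rotated 5]) (use L y yL i jm w_def in \<open>auto intro!: mult_mono\<close>)
  moreover have "config_bip A B \<kappa> * w = config_bip A B (reduce \<kappa> {i, j}) * L"
    using red(3) by (simp add: w_def L_def)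
  ultimately have "bip_ratio A B (reduce \<kappa> {i, j}) * exp (- (8 * y)) \<le> bip_ratio A B \<kappa>"
    using config_bip_pos[of A B \<kappa>] config_bip_pos[of A B "reduce \<kappa> {i, j}"] L(2)
    by (simp add: bip_ratio_def bip_class_def field_simps)
      (smt (verit, ccfv_SIG) mult.assoc mult.commute mult_le_cancel_left_pos mult_left_mono)
  moreover have "bip_class A B (reduce \<kappa> {i, j}) \<noteq> {}" using rem(1) by (auto simp: bip_class_def)
  ultimately show ?thesis using ij(3) by (auto simp: y_def L_def)
qed

text \<open>One link is removed at each left node of degree \<open>d\<close>, which truncates the
  left degrees at \<open>d - 1\<close>. The right degrees then depend on the links chosen, so
  \<open>hyp\<close> prescribes the left ones only. The number of links never falls below the sum of
  \<open>\<tau>\<close>, and every step is charged with that sum.\<close>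

lemma bip_ratio_level:
  fixes d m :: nat and \<tau> :: "'a \<Rightarrow> nat" and x :: real
  assumes AB: "finite A" "finite B" "A \<inter> B = {}" and d: "2 \<le> d" and m: "0 < m"
    and \<tau>: "16 * m * (d - 1) \<le> (\<Sum>i\<in>A. \<tau> i)"
    and hyp: "\<And>\<kappa>. bip_class A B \<kappa> \<noteq> {} \<Longrightarrow> (\<And>i. i \<in> A \<Longrightarrow> \<kappa> i = \<tau> i) \<Longrightarrow> (\<And>j. j \<in> B \<Longrightarrow> \<kappa> j \<le> m)
      \<Longrightarrow> x \<le> bip_ratio A B \<kappa>" and x: "0 \<le> x"
  shows "bip_class A B \<kappa> \<noteq> {} \<Longrightarrow> (\<And>i. i \<in> A \<Longrightarrow> \<kappa> i \<le> d) \<Longrightarrow> (\<And>i. i \<in> A \<Longrightarrow> \<tau> i = min (\<kappa> i) (d - 1)) \<Longrightarrow>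
    (\<And>j. j \<in> B \<Longrightarrow> \<kappa> j \<le> m) \<Longrightarrow>
    x * exp (- (real (8 * (d * m)) / real (\<Sum>i\<in>A. \<tau> i) * card {i \<in> A. \<kappa> i = d})) \<le> bip_ratio A B \<kappa>"
proof (induction "card {i \<in> A. \<kappa> i = d}" arbitrary: \<kappa>)
  case 0
  then have "\<kappa> i \<noteq> d" if "i \<in> A" for i using that AB(1) by auto
  then have "\<kappa> i = \<tau> i" if "i \<in> A" for i using 0(3)[OF that] 0(4)[OF that] that d
    by (metis Suc_diff_1 Suc_leI le_neq_implies_less less_Suc_eq_le min.absorb1 pos2 order_less_le_trans)
  then show ?case using hyp[OF 0(2) _ 0(5)] by (simp flip: 0(1))
next
  case (Suc N)
  define S where "S = (\<Sum>i\<in>A. \<tau> i)"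
  have "{i \<in> A. \<kappa> i = d} \<noteq> {}" using Suc(2) by (metis card.empty nat.simps(3))
  then obtain i where i: "i \<in> A" "\<kappa> i = d" by auto
  have SM: "S \<le> (\<Sum>i\<in>A. \<kappa> i)" unfolding S_def using Suc(5) by (intro sum_mono) simp
  have "d \<le> 2 * (d - 1)" using d by simp
  then have "8 * (d * m) \<le> 8 * (2 * (d - 1) * m)" by simp
  also have "\<dots> = 16 * m * (d - 1)" by simp
  also have "\<dots> \<le> S" unfolding S_def by (rule \<tau>)
  finally have dm: "8 * (d * m) \<le> S" .
  have "0 < d * m" using d m by simp
  then have S0: "0 < S" using dm by linarith
  have step: "\<exists>j\<in>B. bip_class A B (reduce \<kappa> {i, j}) \<noteq> {} \<and>
      bip_ratio A B (reduce \<kappa> {i, j}) * exp (- (real (8 * (d * m)) / real (\<Sum>x\<in>A. \<kappa> x))) \<le> bip_ratio A B \<kappa>"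
    by (rule bip_ratio_step[OF AB Suc(3) Suc(4) Suc(6) i]) (use d dm SM in auto)
  then obtain j where j: "j \<in> B" "bip_class A B (reduce \<kappa> {i, j}) \<noteq> {}"
    "bip_ratio A B (reduce \<kappa> {i, j}) * exp (- (real (8 * (d * m)) / real (\<Sum>x\<in>A. \<kappa> x))) \<le> bip_ratio A B \<kappa>" by blast
  have jA: "j \<notin> A" using j AB by auto
  have "{k \<in> A. reduce \<kappa> {i, j} k = d} = {k \<in> A. \<kappa> k = d} - {i}"
    using jA i d by (auto simp: reduce_def)
  then have N: "N = card {k \<in> A. reduce \<kappa> {i, j} k = d}" using Suc(2) i AB(1) by simp
  have IH: "x * exp (- (real (8 * (d * m)) / real (\<Sum>i\<in>A. \<tau> i) * card {k \<in> A. reduce \<kappa> {i, j} k = d}))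
      \<le> bip_ratio A B (reduce \<kappa> {i, j})"
  proof (rule Suc(1)[OF N j(2)])
    show "reduce \<kappa> {i, j} k \<le> d" if "k \<in> A" for k using Suc(4)[OF that] reduce_le[of \<kappa> "{i, j}" k] by simp
    show "reduce \<kappa> {i, j} k \<le> m" if "k \<in> B" for k using Suc(6)[OF that] reduce_le[of \<kappa> "{i, j}" k] by simp
    show "\<tau> k = min (reduce \<kappa> {i, j} k) (d - 1)" if "k \<in> A" for k
      using Suc(5)[OF that] that jA i by (auto simp: reduce_def)
  qed
  define p where "p = real (8 * (d * m)) / real S"
  define q where "q = real (8 * (d * m)) / real (\<Sum>x\<in>A. \<kappa> x)"
  have "q \<le> p" unfolding p_def q_def
    using S0 SM by (intro divide_left_mono mult_pos_pos) (auto simp flip: of_nat_sum)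
  then have "exp (- (p * Suc N)) \<le> exp (- (p * N)) * exp (- q)"
    by (simp add: algebra_simps flip: exp_add)
  then have "x * exp (- (p * Suc N)) \<le> x * exp (- (p * N)) * exp (- q)"
    using x by (simp add: mult.assoc mult_left_mono)
  also have "\<dots> \<le> bip_ratio A B (reduce \<kappa> {i, j}) * exp (- q)"
    using IH by (intro mult_right_mono) (auto simp: S_def N p_def)
  also have "\<dots> \<le> bip_ratio A B \<kappa>" unfolding q_def by (rule j(3))
  finally show ?case unfolding p_def S_def Suc(2) .
qed

text \<open>Each level costs \<open>16 * m\<close>: the \<open>N\<close> nodes of degree
  \<open>c + 1\<close> contribute \<open>c\<close> each to the truncated sum \<open>S\<close>, so
  \<open>N * c \<le> S\<close>, and the loss \<open>8 * (c + 1) * m * N / S\<close> is at most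
  \<open>16 * m\<close>. Left degrees at most 1 form the exact base.\<close>

lemma bip_ratio_ge_levels:
  fixes d m :: nat
  assumes AB: "finite A" "finite B" "A \<inter> B = {}" and m: "0 < m"
  shows "bip_class A B \<kappa> \<noteq> {} \<Longrightarrow> (\<And>i. i \<in> A \<Longrightarrow> \<kappa> i \<le> Suc d) \<Longrightarrow> (\<And>j. j \<in> B \<Longrightarrow> \<kappa> j \<le> m) \<Longrightarrow>
    (\<And>c. 1 \<le> c \<Longrightarrow> c \<le> d \<Longrightarrow> 16 * m * c \<le> (\<Sum>i\<in>A. min (\<kappa> i) c)) \<Longrightarrow>
    exp (- (16 * real m * d)) \<le> bip_ratio A B \<kappa>"
proof (induction d arbitrary: \<kappa>)
  case 0
  obtain G where G: "G \<in> degree_class (links A B) (A \<union> B) \<kappa>" using 0(1) by (auto simp: bip_class_def)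
  have "config_bip A B \<kappa> \<le> card (degree_class (links A B) (A \<union> B) \<kappa>)"
    by (rule card_bip_ge_config_left_one[OF AB]) (use degree_class_bip_sums[OF AB G] 0(2) in auto)
  then show ?case using config_bip_pos[of A B \<kappa>] by (simp add: bip_ratio_def bip_class_def)
next
  case (Suc d)
  define \<tau> where "\<tau> = (\<lambda>i. min (\<kappa> i) (Suc d))"
  define S where "S = real (\<Sum>i\<in>A. \<tau> i)"
  define N where "N = card {i \<in> A. \<kappa> i = Suc (Suc d)}"
  have S: "16 * m * Suc d \<le> (\<Sum>i\<in>A. \<tau> i)" using Suc(5)[of "Suc d"] by (simp add: \<tau>_def)
  have *: "exp (- (16 * real m * d)) * exp (- (real (8 * (Suc (Suc d) * m)) / real (\<Sum>i\<in>A. \<tau> i) * card {i \<in> A. \<kappa> i = Suc (Suc d)}))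
      \<le> bip_ratio A B \<kappa>"
  proof (rule bip_ratio_level[OF AB _ m])
    show "16 * m * (Suc (Suc d) - 1) \<le> (\<Sum>i\<in>A. \<tau> i)" using S by simp
    fix \<kappa>0 :: "'a \<Rightarrow> nat"
    assume k0: "bip_class A B \<kappa>0 \<noteq> {}" "\<And>i. i \<in> A \<Longrightarrow> \<kappa>0 i = \<tau> i" "\<And>j. j \<in> B \<Longrightarrow> \<kappa>0 j \<le> m"
    show "exp (- (16 * real m * d)) \<le> bip_ratio A B \<kappa>0"
    proof (rule Suc(1)[OF k0(1) _ k0(3)])
      show "\<kappa>0 i \<le> Suc d" if "i \<in> A" for i using k0(2)[OF that] by (simp add: \<tau>_def)
      fix c assume c: "1 \<le> c" "c \<le> d"
      have "(\<Sum>i\<in>A. min (\<kappa>0 i) c) = (\<Sum>i\<in>A. min (\<kappa> i) c)"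
        using k0(2) c by (intro sum.cong) (auto simp: \<tau>_def)
      then show "16 * m * c \<le> (\<Sum>i\<in>A. min (\<kappa>0 i) c)" using Suc(5)[of c] c by simp
    qed
  qed (use Suc in \<open>auto simp: \<tau>_def\<close>)
  have "N * Suc d = (\<Sum>i | i \<in> A \<and> \<kappa> i = Suc (Suc d). \<tau> i)" by (simp add: N_def \<tau>_def)
  also have "\<dots> \<le> (\<Sum>i\<in>A. \<tau> i)" using AB(1) by (intro sum_mono2) auto
  finally have NS: "real N * (1 + d) \<le> S" unfolding S_def by (simp flip: of_nat_sum of_nat_mult of_nat_Suc)
  have "0 < 16 * m * Suc d" using m by simp
  then have "0 < S" unfolding S_def of_nat_0_less_iff using S by (rule order.strict_trans2)
  have "8 * (Suc (Suc d) * m) * N \<le> 16 * m * (N * (1 + d))" by (simp add: algebra_simps)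
  then have "real (8 * (Suc (Suc d) * m) * N) \<le> real (16 * m * (N * (1 + d)))" by (simp only: of_nat_le_iff)
  also have "\<dots> = 16 * real m * (real N * (1 + d))" by (simp add: algebra_simps)
  also have "\<dots> \<le> 16 * real m * S" by (intro mult_left_mono NS) simp
  finally have "real (8 * (Suc (Suc d) * m)) / S * N \<le> 16 * real m" using \<open>0 < S\<close> by (simp add: field_simps)
  then have "exp (- (16 * real m * Suc d)) \<le> exp (- (16 * real m * d)) * exp (- (real (8 * (Suc (Suc d) * m)) / S * N))"
    by (simp add: algebra_simps flip: exp_add)
  also have "\<dots> \<le> bip_ratio A B \<kappa>" using * by (simp add: S_def N_def)
  finally show ?case .
qed

text \<open>Enough links in total mean enough links on all levels:
  \<open>c * \<kappa> i \<le> min (\<kappa> i) c * m\<close>, so truncation at \<open>c\<close>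
  keeps at least the share \<open>c / m\<close> of the total degree.\<close>

lemma card_bip_ge_config:
  fixes m m' :: nat
  assumes AB: "finite A" "finite B" "A \<inter> B = {}" and G: "G \<in> degree_class (links A B) (A \<union> B) \<kappa>"
    and m: "\<And>i. i \<in> A \<Longrightarrow> \<kappa> i \<le> m" "\<And>j. j \<in> B \<Longrightarrow> \<kappa> j \<le> m'" and M: "16 * (m * m') \<le> card G"
  shows "config_bip A B \<kappa> * exp (- (16 * real (m * m'))) \<le> card (degree_class (links A B) (A \<union> B) \<kappa>)"
proof -
  note sums = degree_class_bip_sums[OF AB G]
  consider "m \<le> 1" | "m' = 0" | "1 < m" "0 < m'" by linarith
  then have "exp (- (16 * real (m * m'))) \<le> bip_ratio A B \<kappa>"
  proof cases
    case 1
    have "config_bip A B \<kappa> \<le> card (degree_class (links A B) (A \<union> B) \<kappa>)"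
      by (rule card_bip_ge_config_left_one[OF AB]) (use sums 1 m in \<open>auto intro: order_trans\<close>)
    then have "1 \<le> bip_ratio A B \<kappa>"
      using config_bip_pos[of A B \<kappa>] by (simp add: bip_ratio_def bip_class_def)
    then show ?thesis by (smt (verit) exp_le_one_iff of_nat_0_le_iff)
  next
    case 2
    then have "(\<Sum>i\<in>A. \<kappa> i) = 0" using sums m by simp
    then have "config_bip A B \<kappa> \<le> card (degree_class (links A B) (A \<union> B) \<kappa>)"
      by (intro card_bip_ge_config_left_one[OF AB]) (use sums AB in auto)
    then have "1 \<le> bip_ratio A B \<kappa>"
      using config_bip_pos[of A B \<kappa>] by (simp add: bip_ratio_def bip_class_def)
    then show ?thesis by (smt (verit) exp_le_one_iff of_nat_0_le_iff)
  next
    case 3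
    have "exp (- (16 * real m' * (m - 1))) \<le> bip_ratio A B \<kappa>"
    proof (rule bip_ratio_ge_levels[OF AB 3(2)])
      show "bip_class A B \<kappa> \<noteq> {}" using G by (auto simp: bip_class_def)
      show "\<kappa> i \<le> Suc (m - 1)" if "i \<in> A" for i using m(1)[OF that] by simp
      show "\<kappa> j \<le> m'" if "j \<in> B" for j using m(2)[OF that] .
      fix c assume c: "1 \<le> c" "c \<le> m - 1"
      have "16 * m' * c * m = c * (16 * (m * m'))" by simp
      also have "\<dots> \<le> c * (\<Sum>i\<in>A. \<kappa> i)" using M sums by simp
      also have "\<dots> = (\<Sum>i\<in>A. c * \<kappa> i)" by (simp add: sum_distrib_left)
      also have "\<dots> \<le> (\<Sum>i\<in>A. min (\<kappa> i) c * m)"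
      proof (rule sum_mono)
        fix i assume "i \<in> A"
        have "c * \<kappa> i \<le> c * m" "c * \<kappa> i \<le> \<kappa> i * m"
          using m(1)[OF \<open>i \<in> A\<close>] c by (auto simp: mult.commute intro!: mult_le_mono)
        then show "c * \<kappa> i \<le> min (\<kappa> i) c * m" by (simp add: min_def)
      qed
      also have "\<dots> = (\<Sum>i\<in>A. min (\<kappa> i) c) * m" by (simp add: sum_distrib_right)
      finally show "16 * m' * c \<le> (\<Sum>i\<in>A. min (\<kappa> i) c)" using 3 by simp
    qed
    moreover have "exp (- (16 * real (m * m'))) \<le> exp (- (16 * real m' * (m - 1)))"
      using 3 by (simp add: algebra_simps)
    ultimately show ?thesis by linarith
  qed
  then show ?thesis
    using config_bip_pos[of A B \<kappa>] by (simp add: bip_ratio_def bip_class_def field_simps)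
qed

section \<open>Lower bounds within one layer\<close>

text \<open>The integral of \<open>ln (32 * n / t)\<close> over \<open>0 < t \<le> x\<close>: the
  accumulated loss if each half-link costs this logarithm at the current total degree
  \<open>t\<close>.\<close>

definition sparse_loss :: "real \<Rightarrow> real \<Rightarrow> real" where
  "sparse_loss n x = x * (ln (32 * n / x) + 1)"

lemma sparse_loss_0 [simp]: "sparse_loss n 0 = 0" by (simp add: sparse_loss_def)

text \<open>The integrand decreases, so its value at the right end bounds the increment of the
  integral from below.\<close>

lemma sparse_loss_step:
  assumes "0 \<le> x" "0 < h" "0 < n"
  shows "sparse_loss n x + h * ln (32 * n / (x + h)) \<le> sparse_loss n (x + h)"
proof (cases "x = 0")
  case True
  then show ?thesis using assms by (simp add: sparse_loss_def algebra_simps)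
next
  case False
  then have x: "0 < x" using assms by simp
  have "x * ln ((x + h) / x) \<le> x * ((x + h) / x - 1)"
    using x assms by (intro mult_left_mono ln_le_minus_one) auto
  also have "\<dots> = h" using x by (simp add: field_simps)
  finally have "x * (ln (x + h) - ln x) \<le> h" using x assms by (simp add: ln_div)
  then show ?thesis using x assms by (simp add: sparse_loss_def ln_div ln_mult algebra_simps)
qed

lemma sum_indicator_ge_card:
  assumes "is_link_set V G" "U \<subseteq> V" "\<And>e. e \<in> G \<Longrightarrow> e \<inter> U \<noteq> {}"
  shows "card G \<le> (\<Sum>u\<in>U. vdeg G u)"
proof -
  note G = is_link_setD[OF assms(1)]
  have finU: "finite U" using assms(2) G(1) by (rule finite_subset)
  have "card G = (\<Sum>e\<in>G. 1)" by simp
  also have "\<dots> \<le> (\<Sum>e\<in>G. card {u. u \<in> U \<and> u \<in> e})"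
  proof (rule sum_mono)
    fix e assume "e \<in> G"
    then have "{u. u \<in> U \<and> u \<in> e} \<noteq> {}" using assms(3) by blast
    then show "1 \<le> card {u. u \<in> U \<and> u \<in> e}" using finU by (simp add: Suc_le_eq card_gt_0_iff)
  qed
  also have "\<dots> = (\<Sum>u\<in>U. vdeg G u)"
    unfolding vdeg_def using finU G(2)
    by (simp only: card_eq_sum) (subst sum.swap_restrict, auto)
  finally show ?thesis .
qed

text \<open>The degree counts the forced links as well: \<open>D i\<close> bounds the remaining degree of \<open>i\<close> plus the number of pairs at \<open>i\<close>
  that may no longer be used. While the low-degree nodes carry enough links, a switching gains the
  factor \<open>n / (D i * D j)\<close> for a link \<open>ij\<close> up to a loss covered by \<open>sparse_loss\<close>; otherwise both ends have
  degree comparable to \<open>sqrt n\<close>, and the link is simply frozen.\<close>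

lemma ln_card_degree_class_ge:
  fixes D :: "'a \<Rightarrow> nat" and \<Delta> :: real
  assumes \<Delta>: "1 \<le> \<Delta>" and D: "\<And>i. i \<in> V \<Longrightarrow> D i \<le> \<Delta>"
  shows "is_link_set V E \<Longrightarrow> G0 \<in> degree_class E V \<kappa> \<Longrightarrow>
    (\<And>i. i \<in> V \<Longrightarrow> \<kappa> i + card {u \<in> V. u \<noteq> i \<and> {i, u} \<notin> E} \<le> D i) \<Longrightarrow>
    2 * card G0 \<le> \<Delta>\<^sup>2 \<Longrightarrow>
    (\<Sum>i\<in>V. \<kappa> i * ln (\<Delta> / D i)) - sparse_loss (\<Delta>\<^sup>2) (2 * card G0) \<le> ln (card (degree_class E V \<kappa>))"
proof (induction "card G0" arbitrary: E G0 \<kappa>)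
  case 0
  have "(\<Sum>i\<in>V. \<kappa> i) = 0" using degree_class_card[OF 0(2,3)] 0(1) by simp
  then have "\<kappa> i = 0" if "i \<in> V" for i using that is_link_setD(1)[OF 0(2)] by simp
  moreover have "1 \<le> card (degree_class E V \<kappa>)"
    using 0(3) is_link_setD(2)[OF 0(2)] by (auto simp: Suc_le_eq card_gt_0_iff)
  ultimately show ?case by (simp flip: 0(1))
next
  case (Suc M)
  note E = Suc(3) and G0 = Suc(4) and DE = Suc(5)
  note E' = is_link_setD[OF E]
  have G0E: "G0 \<subseteq> E" using degree_classD(1)[OF G0] .
  have finG0: "finite G0" using G0E E'(2) by (rule finite_subset)
  have linkG0: "is_link_set V G0" using is_link_set_mono[OF E G0E] .
  \<comment> \<open>The chosen link maximises the smaller \<open>D\<close> of its ends. Every link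
    of \<open>G0\<close> then has an end with \<open>D\<close> at most \<open>t\<close>, so the
    nodes in \<open>U\<close> carry at least half of the total degree.\<close>
  define \<mu> where "\<mu> = (\<lambda>e. Min (D ` e))"
  have "G0 \<noteq> {}" using Suc(2) by auto
  then have "Max (\<mu> ` G0) \<in> \<mu> ` G0" using finG0 by (intro Max_in) auto
  then obtain e where e: "e \<in> G0" "\<mu> e = Max (\<mu> ` G0)" by auto
  have emax: "\<mu> f \<le> \<mu> e" if "f \<in> G0" for f using that finG0 by (simp add: e(2))
  note rem = degree_class_remove[OF E G0 e(1)]
  obtain a b where "e = {a, b}" "a \<noteq> b" using link_cases[OF rem(4)] .
  then obtain i j where ij: "e = {i, j}" "i \<noteq> j" "D j \<le> D i"
    by (metis insert_commute linear)
  define t where "t = D j"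
  have \<mu>e: "\<mu> e = t" using ij by (simp add: \<mu>_def t_def)
  have ijV: "i \<in> V" "j \<in> V" using rem(5) ij by auto
  have pos: "0 < \<kappa> i" "0 < \<kappa> j" using rem(2) ij by auto
  have kD: "\<kappa> x \<le> D x" if "x \<in> V" for x using DE[OF that] by simp
  have t1: "1 \<le> real t" using kD[OF ijV(2)] pos(2) by (simp add: t_def)
  have tD: "real t \<le> real (D i)" "real (D i) \<le> \<Delta>" using ij D[OF ijV(1)] by (auto simp: t_def)
  define U where "U = {u \<in> V. D u \<le> t}"
  have UV: "U \<subseteq> V" by (auto simp: U_def)
  define L where "L = real (2 * card G0)"
  define LU where "LU = real (\<Sum>u\<in>U. \<kappa> u)"
  have "card G0 \<le> (\<Sum>u\<in>U. vdeg G0 u)"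
  proof (rule sum_indicator_ge_card[OF linkG0 UV])
    fix f assume f: "f \<in> G0"
    have fin: "finite f" "f \<noteq> {}" "f \<subseteq> V" using is_link_setD(3-5)[OF linkG0 f] by auto
    then have "Min (D ` f) \<in> D ` f" by (intro Min_in) auto
    then obtain u where u: "u \<in> f" "D u = \<mu> f" by (auto simp: \<mu>_def)
    then have "D u \<le> t" using emax[OF f] \<mu>e by simp
    then show "f \<inter> U \<noteq> {}" using u fin by (auto simp: U_def)
  qed
  also have "\<dots> = (\<Sum>u\<in>U. \<kappa> u)" using degree_classD(2)[OF G0] UV by (intro sum.cong) auto
  finally have "card G0 \<le> (\<Sum>u\<in>U. \<kappa> u)" .
  then have LU: "L \<le> 2 * LU" unfolding L_def LU_def by (simp del: of_nat_sum)
  have L2: "2 \<le> L" "L \<le> \<Delta>\<^sup>2" using Suc(2) Suc(6) by (auto simp: L_def)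
  define n where "n = \<Delta>\<^sup>2"
  have n: "0 < n" "L \<le> n" using \<Delta> L2 by (auto simp: n_def)
  define g where "g = (\<lambda>x. ln (\<Delta> / real (D x)))"
  have Dpos: "0 < D i" "0 < D j" using kD[OF ijV(1)] kD[OF ijV(2)] pos by auto
  have card': "M = card (G0 - {e})" using Suc(2) e(1) finG0 by simp
  have sum_g: "(\<Sum>x\<in>V. \<kappa> x * g x) = (\<Sum>x\<in>V. reduce \<kappa> e x * g x) + g i + g j"
  proof -
    have "(\<Sum>x\<in>V. \<kappa> x * g x) = (\<Sum>x\<in>V. reduce \<kappa> e x * g x + (if x \<in> e then g x else 0))"
    proof (rule sum.cong[OF refl])
      fix x
      show "\<kappa> x * g x = reduce \<kappa> e x * g x + (if x \<in> e then g x else 0)"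
        using rem(2)[of x] by (cases "\<kappa> x") (auto simp: reduce_def algebra_simps)
    qed
    also have "\<dots> = (\<Sum>x\<in>V. reduce \<kappa> e x * g x) + (\<Sum>x\<in>V \<inter> e. g x)"
      using E'(1) by (simp add: sum.distrib sum.inter_restrict)
    also have "V \<inter> e = e" using rem(5) by auto
    finally show ?thesis using ij by simp
  qed
  have loss: "sparse_loss n (L - 2) + 2 * ln (32 * n / L) \<le> sparse_loss n L"
    using sparse_loss_step[of "L - 2" 2 n] L2 n by simp
  have L': "real (2 * card (G0 - {e})) = L - 2" using Suc(2) by (simp add: L_def flip: card')
  \<comment> \<open>\<open>z\<close> is the logarithmic gain of the step. It may fall short of
    \<open>g i + g j\<close> by \<open>2 * ln (32 * n / L)\<close>, the loss budgeted for two
    half-links.\<close>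
  have main: "ln (card (degree_class E V \<kappa>)) \<ge> (\<Sum>x\<in>V. reduce \<kappa> e x * g x) - sparse_loss n (L - 2) + z
      \<Longrightarrow> g i + g j \<le> z + 2 * ln (32 * n / L) \<Longrightarrow> ?case" for z
    using loss unfolding sum_g[unfolded g_def] L_def[symmetric] n_def[symmetric] by (simp add: g_def)
  have gij: "g i + g j = ln (n / (D i * D j))"
    using \<Delta> Dpos by (simp add: g_def n_def ln_div ln_mult ln_realpow)
  show ?case
  \<comment> \<open>The excluded pairs weigh at most \<open>4 * \<Delta> * t\<close>, so with the
    factor 16 three quarters of \<open>LU\<close> remain. Otherwise
    \<open>L \<le> 2 * LU < 32 * \<Delta> * t\<close>, which is where the 32 in
    \<open>sparse_loss\<close> comes from.\<close>
  proof (cases "16 * \<Delta> * t \<le> LU")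
    case True
    have count: "card {u \<in> V. u = k \<or> {k, u} \<in> H \<or> {k, u} \<notin> E} \<le> 1 + D k"
      if "H \<in> degree_class E V \<kappa>'" "\<And>x. \<kappa>' x \<le> \<kappa> x" "k \<in> V" for H \<kappa>' k
    proof -
      have "{u \<in> V. u = k \<or> {k, u} \<in> H \<or> {k, u} \<notin> E}
          \<subseteq> {k} \<union> nbrs H k \<union> {u \<in> V. u \<noteq> k \<and> {k, u} \<notin> E}" by (auto simp: nbrs_def)
      moreover have fin: "finite (nbrs H k)"
        using nbrs_subset[OF E degree_classD(1)[OF that(1)]] E'(1) by (rule finite_subset)
      ultimately have "card {u \<in> V. u = k \<or> {k, u} \<in> H \<or> {k, u} \<notin> E}
          \<le> card ({k} \<union> nbrs H k \<union> {u \<in> V. u \<noteq> k \<and> {k, u} \<notin> E})"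
        using E'(1) by (intro card_mono) auto
      also have "\<dots> \<le> card {k} + card (nbrs H k) + card {u \<in> V. u \<noteq> k \<and> {k, u} \<notin> E}"
        by (meson add_mono_thms_linordered_semiring(3) card_Un_le order_trans)
      also have "card (nbrs H k) = \<kappa>' k"
        using degree_classD[OF that(1)] E'(3) that(3) by (subst card_nbrs) auto
      finally show ?thesis using DE[OF that(3)] that(2)[of k] by simp
    qed
    have "\<kappa> i * \<kappa> j \<le> D i * D j" using kD[OF ijV(1)] kD[OF ijV(2)] by (rule mult_le_mono)
    then have w: "real (\<kappa> i * \<kappa> j) \<le> D i * D j" "real (D i * D j) \<le> \<Delta> * t"
      using tD by (auto simp: t_def intro: mult_right_mono simp flip: of_nat_mult) (simp add: mult_right_mono)
    have \<Delta>t: "t \<le> \<Delta> * t" "\<Delta> \<le> \<Delta> * t" "1 \<le> \<Delta> * t" "D i * t \<le> \<Delta> * t"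
      using \<Delta> t1 tD mult_mono[of 1 \<Delta> 1 "real t"] by (auto intro!: mult_right_mono)
    have sumbound: "real (\<Sum>u | u \<in> S \<and> (u = k \<or> {k, u} \<in> H \<or> {k, u} \<notin> E). \<kappa>' u) \<le> (1 + real (D k)) * m"
      if H: "H \<in> degree_class E V \<kappa>'" "\<And>x. \<kappa>' x \<le> \<kappa> x" "k \<in> V" and S: "S \<subseteq> V" "\<And>u. u \<in> S \<Longrightarrow> D u \<le> m"
        and m0: "0 \<le> m"
      for S k H \<kappa>' and m :: real
    proof -
      have km: "real (\<kappa>' u) \<le> m" if "u \<in> S" for u
        using H(2)[of u] kD[of u] S(1) S(2)[OF that] that by (meson in_mono of_nat_mono order_trans)
      have "real (\<Sum>u | u \<in> S \<and> (u = k \<or> {k, u} \<in> H \<or> {k, u} \<notin> E). \<kappa>' u)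
        \<le> card {u. u \<in> S \<and> (u = k \<or> {k, u} \<in> H \<or> {k, u} \<notin> E)} * m"
        unfolding of_nat_sum using km by (intro sum_bounded_above) auto
      also have "\<dots> \<le> card {u \<in> V. u = k \<or> {k, u} \<in> H \<or> {k, u} \<notin> E} * m"
        using S E'(1) m0 by (intro mult_right_mono of_nat_mono card_mono) auto
      also have "\<dots> \<le> real (1 + D k) * m"
        using count[OF H] m0 by (intro mult_right_mono of_nat_mono) auto
      finally show ?thesis by simp
    qed
    \<comment> \<open>The new neighbour of \<open>i\<close> lies in \<open>U\<close> and has degree
      at most \<open>t\<close>; for that of \<open>j\<close> only \<open>\<Delta>\<close> is
      available. This balances, as \<open>D i \<le> \<Delta>\<close> and
      \<open>D j = t\<close>.\<close>
    define p where "p = (1 + real (D i)) * t"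
    define q where "q = (1 + real (D j)) * \<Delta>"
    have pq: "p + q \<le> 4 * (\<Delta> * t)"
      using \<Delta>t by (simp add: p_def q_def t_def[symmetric] algebra_simps)
    have LU0: "0 < LU" using True \<Delta>t(3) by linarith
    have "(\<Sum>u\<in>U. \<kappa> u) \<le> (\<Sum>u\<in>U. reduce \<kappa> {i, j} u + of_bool (u \<in> {i, j}))"
      by (intro sum_mono) (auto simp: reduce_def)
    also have "\<dots> = (\<Sum>u\<in>U. reduce \<kappa> {i, j} u) + card (U \<inter> {i, j})"
      using sum.inter_restrict[OF finite_subset[OF UV E'(1)], of "\<lambda>_. 1::nat" "{i, j}"]
      by (simp add: sum.distrib of_bool_def)
    also have "card (U \<inter> {i, j}) \<le> card {i, j}" by (intro card_mono) auto
    also have "card {i, j} = 2" using ij by simp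
    finally have "real (\<Sum>u\<in>U. \<kappa> u) \<le> real ((\<Sum>u\<in>U. reduce \<kappa> {i, j} u) + 2)"
      by (simp only: of_nat_le_iff)
    then have red: "LU \<le> real (\<Sum>u\<in>U. reduce \<kappa> {i, j} u) + 2"
      unfolding LU_def by (simp del: of_nat_sum)
    have "card (degree_class E V (reduce \<kappa> {i, j})) * (LU - p - q)
      \<le> card (degree_class E V \<kappa>) * real (\<kappa> i * \<kappa> j) * (1 + real (\<kappa> i * \<kappa> j) / (LU / 2))"
    proof (rule switching_ratio[OF E _ ij(2), where U = U and W = V and a = p and b = q])
      show "{i, j} \<in> E" using rem(3) ij(1) by simp
      show "nbrs E u \<subseteq> V" if "u \<in> U" for u by (rule nbrs_subset[OF E order_refl])
      show "real (\<Sum>u | u \<in> U \<and> (u = i \<or> {i, u} \<in> H \<or> {i, u} \<notin> E). \<kappa>' u) \<le> p"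
        if "H \<in> degree_class E V \<kappa>'" "\<And>x. \<kappa>' x \<le> \<kappa> x" for H \<kappa>'
        unfolding p_def by (rule sumbound[OF that ijV(1) UV]) (auto simp: U_def)
      show "real (\<Sum>u | u \<in> V \<and> (u = j \<or> {j, u} \<in> H \<or> {j, u} \<notin> E). \<kappa>' u) \<le> q"
        if "H \<in> degree_class E V \<kappa>'" "\<And>x. \<kappa>' x \<le> \<kappa> x" for H \<kappa>'
        unfolding q_def by (rule sumbound[OF that ijV(2) order_refl]) (use D \<Delta> in auto)
      show "LU / 2 \<le> real (\<Sum>u\<in>U. reduce \<kappa> {i, j} u) - p - q"
        using red True pq \<Delta>t(3) by linarith
      show "0 < LU - p - q" using True pq \<Delta>t(3) by linarith
    qed (use UV pos LU0 LU_def in auto)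
    moreover have "card (degree_class E V (reduce \<kappa> {i, j})) * (3 / 4 * LU)
        \<le> card (degree_class E V (reduce \<kappa> {i, j})) * (LU - p - q)"
      using True pq by (intro mult_left_mono) auto
    moreover have "real (\<kappa> i * \<kappa> j) / (LU / 2) \<le> 1 / 8" using w True LU0 by (simp add: field_simps)
    then have "card (degree_class E V \<kappa>) * real (\<kappa> i * \<kappa> j) * (1 + real (\<kappa> i * \<kappa> j) / (LU / 2))
      \<le> card (degree_class E V \<kappa>) * real (D i * D j) * (1 + 1 / 8)"
      using w LU0 by (intro mult_mono) auto
    ultimately have "card (degree_class E V (reduce \<kappa> e)) * (3 / 4 * LU)
        \<le> card (degree_class E V \<kappa>) * real (D i * D j) * (1 + 1 / 8)"
      unfolding ij(1) by (meson order_trans)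
    then have "card (degree_class E V (reduce \<kappa> e)) * (2 / 3 * LU) \<le> card (degree_class E V \<kappa>) * real (D i * D j)"
      by (simp add: algebra_simps)
    moreover have "card (degree_class E V (reduce \<kappa> e)) * (L / 3) \<le> card (degree_class E V (reduce \<kappa> e)) * (2 / 3 * LU)"
      using LU by (intro mult_left_mono) auto
    ultimately have N: "card (degree_class E V (reduce \<kappa> e)) * (L / (3 * real (D i * D j))) \<le> card (degree_class E V \<kappa>)"
      using Dpos by (simp add: field_simps)
    have N1: "0 < card (degree_class E V (reduce \<kappa> e))" "0 < card (degree_class E V \<kappa>)"
      using rem(1) G0 E'(2) by (auto simp: card_gt_0_iff)
    have "(\<Sum>x\<in>V. reduce \<kappa> e x * g x) - sparse_loss n (L - 2) \<le> ln (card (degree_class E V (reduce \<kappa> e)))"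
      unfolding g_def n_def L'[symmetric]
    proof (rule Suc(1)[OF card' E rem(1)])
      show "reduce \<kappa> e x + card {u \<in> V. u \<noteq> x \<and> {x, u} \<notin> E} \<le> D x" if "x \<in> V" for x
        using DE[OF that] reduce_le[of \<kappa> e x] by simp
      show "real (2 * card (G0 - {e})) \<le> \<Delta>\<^sup>2" unfolding L' using L2 by simp
    qed
    moreover have "ln (card (degree_class E V (reduce \<kappa> e))) + ln (L / (3 * real (D i * D j)))
        \<le> ln (card (degree_class E V \<kappa>))"
      using N N1 L2 Dpos by (subst ln_mult_pos[symmetric]) auto
    ultimately show ?thesis
    proof (intro main)
      have "ln (n / real (D i * D j)) = ln (L / (3 * real (D i * D j))) + ln (3 * n / L)"
        using n L2 Dpos by (subst ln_mult_pos[symmetric]) auto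
      moreover have "ln (3 * n / L) \<le> ln (32 * n / L)" "0 \<le> ln (32 * n / L)"
        using n L2 by (auto simp: field_simps)
      ultimately show "g i + g j \<le> ln (L / (3 * real (D i * D j))) + 2 * ln (32 * n / L)"
        unfolding gij by simp
    qed simp
  next
    case False
    \<comment> \<open>The link \<open>e\<close> is frozen: it belongs to all graphs counted from
      here on, and its pair is no longer available. The bounds \<open>D\<close> survive, since at
      each end the remaining degree drops by 1 while the number of forbidden pairs rises by
      1.\<close>
    define F where "F = E - {e}"
    have F: "is_link_set V F" using is_link_set_mono[OF E] by (auto simp: F_def)
    have "ln (card (degree_class F V (reduce \<kappa> e))) \<le> ln (card (degree_class E V \<kappa>))"
    proof -
      have "degree_class F V (reduce \<kappa> e) = {G \<in> degree_class E V (reduce \<kappa> e). e \<notin> G}"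
        by (auto simp: degree_class_def F_def)
      then have "card (degree_class F V (reduce \<kappa> e)) = card {G \<in> degree_class E V \<kappa>. e \<in> G}"
        using card_containing[OF E'(2) rem(3) rem(5), of \<kappa>] rem(2) by simp
      also have "\<dots> \<le> card (degree_class E V \<kappa>)" using E'(2) by (intro card_mono) auto
      finally have "card (degree_class F V (reduce \<kappa> e)) \<le> card (degree_class E V \<kappa>)" .
      moreover have "0 < card (degree_class F V (reduce \<kappa> e))"
        using rem(1) G0E is_link_setD(2)[OF F] by (auto simp: card_gt_0_iff degree_class_def F_def)
      ultimately show ?thesis by simp
    qed
    moreover have "(\<Sum>x\<in>V. reduce \<kappa> e x * g x) - sparse_loss n (L - 2) \<le> ln (card (degree_class F V (reduce \<kappa> e)))"
      unfolding g_def n_def L'[symmetric]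
    proof (rule Suc(1)[OF card' F])
      show "G0 - {e} \<in> degree_class F V (reduce \<kappa> e)"
        using rem(1) G0E by (auto simp: degree_class_def F_def)
      show "reduce \<kappa> e x + card {u \<in> V. u \<noteq> x \<and> {x, u} \<notin> F} \<le> D x" if "x \<in> V" for x
      proof (cases "x \<in> e")
        case True
        then obtain y where y: "e = {x, y}" using ij(1) by auto
        have "{u \<in> V. u \<noteq> x \<and> {x, u} \<notin> F} \<subseteq> insert y {u \<in> V. u \<noteq> x \<and> {x, u} \<notin> E}"
          by (auto simp: F_def y doubleton_eq_iff)
        then have "card {u \<in> V. u \<noteq> x \<and> {x, u} \<notin> F} \<le> card (insert y {u \<in> V. u \<noteq> x \<and> {x, u} \<notin> E})"
          using E'(1) by (intro card_mono) auto
        also have "\<dots> \<le> Suc (card {u \<in> V. u \<noteq> x \<and> {x, u} \<notin> E})" by (rule card_insert_le_m1) auto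
        finally show ?thesis using DE[OF that] rem(2)[OF True] True by (simp add: reduce_def)
      next
        case False
        then have "{u \<in> V. u \<noteq> x \<and> {x, u} \<notin> F} = {u \<in> V. u \<noteq> x \<and> {x, u} \<notin> E}"
          by (auto simp: F_def)
        then show ?thesis using DE[OF that] False by (simp add: reduce_def)
      qed
      show "real (2 * card (G0 - {e})) \<le> \<Delta>\<^sup>2" unfolding L' using L2 by simp
    qed
    ultimately show ?thesis
    proof (intro main[of 0])
      \<comment> \<open>Freezing gains nothing, but both ends have \<open>D\<close> at least
        \<open>t\<close>, so each of \<open>g i\<close>, \<open>g j\<close> is within the budget for
        one half-link.\<close>
      have "\<Delta> / t \<le> 32 * n / L"
      proof -
        have "L * \<Delta> \<le> (32 * \<Delta> * t) * \<Delta>" using False LU \<Delta> by (intro mult_right_mono) auto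
        then show ?thesis using t1 L2 by (simp add: field_simps n_def power2_eq_square)
      qed
      moreover have "\<Delta> / D i \<le> \<Delta> / t" "\<Delta> / D j = \<Delta> / t" using tD t1 \<Delta> by (auto simp: t_def intro!: divide_left_mono)
      ultimately have "g i \<le> ln (32 * n / L)" "g j \<le> ln (32 * n / L)"
        unfolding g_def using Dpos \<Delta> n L2 by auto
      then show "g i + g j \<le> 0 + 2 * ln (32 * n / L)" by simp
    qed simp
  qed
qed

text \<open>For an even total degree \<open>L\<close> the numerator is the double factorial of
  \<open>L - 1\<close>, the number of perfect matchings of the half-links.\<close>

definition config_self :: "'a set \<Rightarrow> ('a \<Rightarrow> nat) \<Rightarrow> real" where
  "config_self A \<kappa> = (\<Prod>t=1..(\<Sum>i\<in>A. \<kappa> i) div 2. 2 * real t - 1) / (\<Prod>i\<in>A. fact (\<kappa> i))"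

lemma config_self_pos: "0 < config_self A \<kappa>"
  by (auto simp: config_self_def intro!: divide_pos_pos prod_pos)

lemma config_self_reduce:
  assumes "finite A" "i \<in> A" "j \<in> A" "i \<noteq> j" "0 < \<kappa> i" "0 < \<kappa> j" "even (\<Sum>x\<in>A. \<kappa> x)"
  shows "(\<Sum>x\<in>A. \<kappa> x) = (\<Sum>x\<in>A. reduce \<kappa> {i, j} x) + 2"
    and "config_self A \<kappa> * real (\<kappa> i * \<kappa> j) = config_self A (reduce \<kappa> {i, j}) * (real (\<Sum>x\<in>A. \<kappa> x) - 1)"
proof -
  show s: "(\<Sum>x\<in>A. \<kappa> x) = (\<Sum>x\<in>A. reduce \<kappa> {i, j} x) + 2"
    by (rule sum_reduce) (use assms in auto)
  define S where "S = (\<Sum>x\<in>A. reduce \<kappa> {i, j} x)"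
  have "even S" using assms(7) s by (simp add: S_def)
  then obtain k where k: "S = 2 * k" by auto
  have "(\<Prod>x\<in>A. fact (\<kappa> x) :: real) = (\<Prod>x\<in>A. fact (reduce \<kappa> {i, j} x)) * (\<Prod>x\<in>{i, j}. real (\<kappa> x))"
    by (rule prod_fact_reduce) (use assms in auto)
  moreover have "(\<Prod>x\<in>A. fact (reduce \<kappa> {i, j} x) :: real) > 0" by (simp add: prod_pos)
  moreover have "(S + 2) div 2 = Suc k" "S div 2 = k" using k by auto
  ultimately show "config_self A \<kappa> * real (\<kappa> i * \<kappa> j) = config_self A (reduce \<kappa> {i, j}) * (real (\<Sum>x\<in>A. \<kappa> x) - 1)"
    unfolding config_self_def s S_def[symmetric] using assms(4-6) k by (simp add: field_simps)
qed

definition self_class :: "'a set \<Rightarrow> ('a \<Rightarrow> nat) \<Rightarrow> 'a set set set" where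
  "self_class A \<kappa> = degree_class (links A A) A \<kappa>"

definition self_ratio :: "'a set \<Rightarrow> ('a \<Rightarrow> nat) \<Rightarrow> real" where
  "self_ratio A \<kappa> = card (self_class A \<kappa>) / config_self A \<kappa>"

text \<open>As for two layers, except that \<open>i\<close> itself is now among the excluded nodes,
  whence the weight \<open>d * (d + 1)\<close>. The configuration count changes with the factor
  \<open>L - 1\<close> in place of \<open>L\<close>, which only helps.\<close>

lemma self_ratio_step:
  fixes d :: nat
  assumes A: "finite A" and G0: "self_class A \<kappa> \<noteq> {}"
    and d: "\<And>x. x \<in> A \<Longrightarrow> \<kappa> x \<le> d" and i: "i \<in> A" "\<kappa> i = d" "0 < d"
    and M: "8 * (d * (d + 1)) \<le> (\<Sum>x\<in>A. \<kappa> x)"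
  shows "\<exists>j\<in>A. j \<noteq> i \<and> self_class A (reduce \<kappa> {i, j}) \<noteq> {} \<and>
    (\<Sum>x\<in>A. \<kappa> x) = (\<Sum>x\<in>A. reduce \<kappa> {i, j} x) + 2 \<and>
    self_ratio A (reduce \<kappa> {i, j}) * exp (- (real (8 * (d * (d + 1))) / real (\<Sum>x\<in>A. \<kappa> x))) \<le> self_ratio A \<kappa>"
proof -
  have E: "is_link_set A (links A A)" using is_link_set_links[OF A A] by simp
  obtain G where G: "G \<in> degree_class (links A A) A \<kappa>" using G0 by (auto simp: self_class_def)
  obtain j where ijG: "{i, j} \<in> G" using exists_nbr[OF E G, of i] i by auto
  note rem = degree_class_remove[OF E G ijG]
  have ij: "{i, j} \<in> links A A" "i \<noteq> j" "j \<in> A" using rem(3) by (auto simp: mem_links_iff)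
  have pos: "0 < \<kappa> i" "0 < \<kappa> j" using rem(2) by auto
  define s where "s = (\<Sum>x\<in>A. \<kappa> x)"
  define L where "L = real s"
  define m where "m = d * (d + 1)"
  define y where "y = real m / L"
  define w where "w = real (\<kappa> i * \<kappa> j)"
  have "even s" using degree_class_card[OF E G] by (simp add: s_def)
  then have red: "s = (\<Sum>x\<in>A. reduce \<kappa> {i, j} x) + 2"
    "config_self A \<kappa> * w = config_self A (reduce \<kappa> {i, j}) * (L - 1)"
    using config_self_reduce[OF A i(1) ij(3,2) pos] by (simp_all add: s_def w_def L_def)
  have "1 * (1 + 1) \<le> d * (d + 1)" using i by (intro mult_le_mono) auto
  then have "2 \<le> m" by (simp add: m_def)
  then have m2: "2 \<le> real m" by simp
  have L: "8 * real m \<le> L" "0 < L"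
  proof -
    have "8 * m \<le> s" using M by (simp add: m_def s_def)
    then have "real (8 * m) \<le> L" unfolding L_def by (simp only: of_nat_le_iff)
    then show "8 * real m \<le> L" by simp
    then show "0 < L" using m2 by linarith
  qed
  have yL: "y * L = m" using L by (simp add: y_def)
  have y: "0 \<le> y" "y \<le> 1 / 8" using L by (auto simp: y_def field_simps)
  have bound: "real (\<Sum>u | u \<in> A \<and> (u = k \<or> {k, u} \<in> H \<or> {k, u} \<notin> links A A). \<kappa>' u) \<le> real m"
    if H: "H \<in> degree_class (links A A) A \<kappa>'" "\<And>x. \<kappa>' x \<le> \<kappa> x" and k: "k \<in> A" for k H \<kappa>'
  proof -
    have le: "\<kappa>' x \<le> d" if "x \<in> A" for x using d[OF that] H(2)[of x] by simp
    have nb: "nbrs H k \<subseteq> A" using nbrs_subset[OF E degree_classD(1)[OF H(1)]] .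
    have fin: "finite (nbrs H k)" using nb A by (rule finite_subset)
    have sub: "{u. u \<in> A \<and> (u = k \<or> {k, u} \<in> H \<or> {k, u} \<notin> links A A)} \<subseteq> insert k (nbrs H k)"
      using k by (auto simp: nbrs_def mem_links_iff)
    have "(\<Sum>u | u \<in> A \<and> (u = k \<or> {k, u} \<in> H \<or> {k, u} \<notin> links A A). \<kappa>' u) \<le> (\<Sum>u\<in>insert k (nbrs H k). \<kappa>' u)"
      using sub fin by (intro sum_mono2) auto
    also have "\<dots> \<le> \<kappa>' k + (\<Sum>u\<in>nbrs H k. \<kappa>' u)"
      using fin by (cases "k \<in> nbrs H k") (auto simp: insert_absorb)
    also have "(\<Sum>u\<in>nbrs H k. \<kappa>' u) \<le> \<kappa>' k * d"
      by (rule sum_nbrs_le[OF E H(1) k order_refl]) (use le nb in auto)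
    also have "\<kappa>' k + \<kappa>' k * d = \<kappa>' k * (d + 1)" by simp
    also have "\<dots> \<le> m" unfolding m_def using le[OF k] by (intro mult_le_mono) auto
    finally show ?thesis by (simp only: of_nat_le_iff)
  qed
  have "real (card (degree_class (links A A) A (reduce \<kappa> {i, j}))) * (L * (1 - 2 * y))
      \<le> card (degree_class (links A A) A \<kappa>) * w * (1 + w / (L / 2))"
  proof (rule switching_ratio[OF E ij(1,2), where U = A and W = A and a = m and b = m])
    show "nbrs (links A A) u \<subseteq> A" if "u \<in> A" for u using nbrs_subset[OF E order_refl] .
    show "L * (1 - 2 * y) = real (\<Sum>x\<in>A. \<kappa> x) - real m - real m"
      using yL unfolding s_def[symmetric] L_def[symmetric] by (simp add: algebra_simps)
    have "real (\<Sum>x\<in>A. reduce \<kappa> {i, j} x) = L - 2" unfolding L_def red(1) by simp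
    then show "L / 2 \<le> real (\<Sum>x\<in>A. reduce \<kappa> {i, j} x) - real m - real m"
      using L m2 by linarith
  qed (use pos L y bound i ij w_def in auto)
  moreover have "w \<le> y * L" 
  proof -
    have "\<kappa> i * \<kappa> j \<le> d * (d + 1)" using d[OF ij(3)] i by (intro mult_le_mono) auto
    then show ?thesis unfolding yL w_def m_def by (simp only: of_nat_le_iff)
  qed
  ultimately have N: "real (card (degree_class (links A A) A (reduce \<kappa> {i, j}))) * L * exp (- (8 * y))
      \<le> card (degree_class (links A A) A \<kappa>) * w"
    by (intro ratio_exp_bound[where c = "L * (1 - 2 * y)" and c' = "L / 2"]) (use L y w_def in auto)
  have "1 < L" using L m2 by linarith
  have "real (card (degree_class (links A A) A (reduce \<kappa> {i, j}))) * (L - 1) * exp (- (8 * y))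
      \<le> real (card (degree_class (links A A) A (reduce \<kappa> {i, j}))) * L * exp (- (8 * y))"
    by (intro mult_right_mono mult_left_mono) auto
  from order_trans[OF this N]
  have N: "real (card (degree_class (links A A) A (reduce \<kappa> {i, j}))) * exp (- (8 * y)) * (L - 1)
      \<le> card (degree_class (links A A) A \<kappa>) * w" by (simp only: mult_ac)
  have "self_ratio A (reduce \<kappa> {i, j}) * exp (- (8 * y))
      = real (card (degree_class (links A A) A (reduce \<kappa> {i, j}))) * exp (- (8 * y)) * (L - 1)
        / (config_self A (reduce \<kappa> {i, j}) * (L - 1))"
    using \<open>1 < L\<close> by (simp add: self_ratio_def self_class_def)
  also have "\<dots> \<le> card (degree_class (links A A) A \<kappa>) * w / (config_self A (reduce \<kappa> {i, j}) * (L - 1))"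
    using N \<open>1 < L\<close> config_self_pos[of A "reduce \<kappa> {i, j}"] by (intro divide_right_mono) auto
  also have "\<dots> = self_ratio A \<kappa>"
    unfolding red(2)[symmetric] using pos by (simp add: self_ratio_def self_class_def w_def)
  finally have "self_ratio A (reduce \<kappa> {i, j}) * exp (- (8 * y)) \<le> self_ratio A \<kappa>" .
  moreover have "self_class A (reduce \<kappa> {i, j}) \<noteq> {}" using rem(1) by (auto simp: self_class_def)
  moreover have "8 * y = real (8 * (d * (d + 1))) / real (\<Sum>x\<in>A. \<kappa> x)"
    unfolding y_def L_def m_def s_def by simp
  ultimately show ?thesis
  proof (intro bexI[of _ j] conjI)
    show "(\<Sum>x\<in>A. \<kappa> x) = (\<Sum>x\<in>A. reduce \<kappa> {i, j} x) + 2" by (rule red(1)[unfolded s_def])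
    show "j \<noteq> i" using ij(2) by simp
    show "j \<in> A" by fact
  qed (simp_all only: simp_thms)
qed

text \<open>Links are removed at a node of maximal degree \<open>d\<close>, of which there are \<open>N\<close>, out of a total degree \<open>L\<close>.
  A step costs \<open>16 d\<^sup>2 / L\<close>. For \<open>d \<ge> 4\<close> the first term pays for it, as \<open>d * N \<le> L\<close>; for smaller \<open>d\<close> the logarithm does.\<close>

definition level_potential :: "real \<Rightarrow> real \<Rightarrow> real \<Rightarrow> real" where
  "level_potential d N L = 32 * d\<^sup>2 * N / L + 32 * d\<^sup>2 + 360 * ln L"

text \<open>Passing from \<open>N / L\<close> to \<open>N' / (L - 2)\<close> releases at least
  \<open>(L - 2 * N) / (L * (L - 2))\<close>. For \<open>d \<ge> 4\<close> this is at least
  \<open>1 / (2 * L)\<close>, and 32 times one half is the 16 required. For \<open>d \<le> 3\<close>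
  it can be as low as \<open>- 2 / L\<close>; as \<open>d\<^sup>2 \<le> 9\<close>, at most
  \<open>(576 + 144) / L\<close> is missing, and
  \<open>360 * (ln L - ln (L - 2)) \<ge> 720 / L\<close>.\<close>

lemma level_potential_step:
  fixes d N N' :: nat and L :: real
  assumes "0 < d" "N' < N" "real d * N \<le> L" "16 \<le> L"
  shows "level_potential d N' (L - 2) + 16 * (real d)\<^sup>2 / L \<le> level_potential d N L"
proof -
  have ln: "2 / L \<le> ln L - ln (L - 2)"
  proof -
    have "ln ((L - 2) / L) \<le> (L - 2) / L - 1" using assms by (intro ln_le_minus_one) auto
    moreover have "ln ((L - 2) / L) = ln (L - 2) - ln L" using assms ln_div[of "L - 2" L] by auto
    moreover have "(L - 2) / L - 1 = - (2 / L)" using assms by (simp add: field_simps)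
    ultimately show ?thesis by linarith
  qed
  have "real N' \<le> real N - 1" using assms(2) by linarith
  then have "real N' / (L - 2) \<le> (real N - 1) / (L - 2)" using assms by (intro divide_right_mono) auto
  moreover have "real N / L - (real N - 1) / (L - 2) = (L - 2 * N) / (L * (L - 2))"
    using assms by (simp add: field_simps)
  ultimately have diff: "(L - 2 * N) / (L * (L - 2)) \<le> N / L - N' / (L - 2)" by linarith
  have "16 / L * (real d)\<^sup>2 \<le> 32 * (real d)\<^sup>2 * (N / L - N' / (L - 2)) + 360 * (ln L - ln (L - 2))"
  proof (cases "4 \<le> d")
    case True
    have "4 * real N \<le> real d * N" using True by (intro mult_right_mono) auto
    then have "L / 2 \<le> L - 2 * N" using assms(3) by linarith
    then have "(L / 2) / (L * L) \<le> (L - 2 * N) / (L * (L - 2))"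
      using assms(4) by (intro frac_le mult_left_mono mult_pos_pos) auto
    then have "1 / (2 * L) \<le> (L - 2 * N) / (L * (L - 2))" using assms(4) by simp
    then have "1 / (2 * L) \<le> N / L - N' / (L - 2)" using diff by linarith
    then have "32 * (real d)\<^sup>2 * (1 / (2 * L)) \<le> 32 * (real d)\<^sup>2 * (N / L - N' / (L - 2))"
      by (intro mult_left_mono) auto
    moreover have "0 \<le> 360 * (ln L - ln (L - 2))" using assms(4) by simp
    ultimately show ?thesis by simp
  next
    case False
    have d9: "(real d)\<^sup>2 \<le> 9"
    proof -
      have "(real d)\<^sup>2 \<le> 3\<^sup>2" using False by (intro power_mono) auto
      then show ?thesis by simp
    qed
    have "1 * real N \<le> real d * N" using assms(1) by (intro mult_right_mono) auto
    then have "- L \<le> L - 2 * N" using assms(3) by linarith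
    then have "- L / (L * (L - 2)) \<le> (L - 2 * N) / (L * (L - 2))"
      using assms(4) by (intro divide_right_mono) auto
    moreover have "- L / (L * (L - 2)) = - (1 / (L - 2))" using assms(4) by simp
    moreover have "1 / (L - 2) \<le> 2 / L" using assms(4) by (simp add: field_simps)
    ultimately have "- (2 / L) \<le> (L - 2 * N) / (L * (L - 2))" by linarith
    then have "- (2 / L) \<le> N / L - N' / (L - 2)" using diff by linarith
    then have "32 * (real d)\<^sup>2 * (- (2 / L)) \<le> 32 * (real d)\<^sup>2 * (N / L - N' / (L - 2))"
      by (intro mult_left_mono) auto
    moreover have "- 64 * ((real d)\<^sup>2 * (1 / L)) = 32 * (real d)\<^sup>2 * (- (2 / L))" by simp
    ultimately have h1: "- 64 * ((real d)\<^sup>2 * (1 / L)) \<le> 32 * (real d)\<^sup>2 * (N / L - N' / (L - 2))"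
      by (simp only:)
    have h2: "(real d)\<^sup>2 * (1 / L) \<le> 9 * (1 / L)"
      using d9 assms(4) by (intro mult_right_mono) auto
    have h3: "2 * (1 / L) \<le> ln L - ln (L - 2)" using ln by simp
    have "16 * q \<le> T + 360 * Z" if "- 64 * q \<le> T" "q \<le> 9 * r" "2 * r \<le> Z" for q r T Z :: real
      using that by linarith
    from this[OF h1 h2 h3] show ?thesis by simp
  qed
  then show ?thesis by (simp add: level_potential_def algebra_simps)
qed

text \<open>On the lower level the first term reappears with a value of at most
  \<open>32 * (d - 1)\<close>. The drop of the second term pays for it, as
  \<open>(d - 1) + (d - 1)\<^sup>2 \<le> d\<^sup>2\<close>.\<close>

lemma level_potential_down:
  assumes "1 \<le> d" "(d - 1) * N \<le> L" "0 < L"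
  shows "level_potential (d - 1) N L \<le> level_potential d 0 L"
proof -
  have "(d - 1)\<^sup>2 * N / L = (d - 1) * ((d - 1) * N / L)" by (simp add: power2_eq_square)
  also have "\<dots> \<le> (d - 1) * 1" using assms by (intro mult_left_mono) auto
  finally have "(d - 1)\<^sup>2 * N / L + (d - 1)\<^sup>2 \<le> d * (d - 1)" by (simp add: power2_eq_square algebra_simps)
  also have "\<dots> \<le> d\<^sup>2" using assms by (simp add: power2_eq_square algebra_simps)
  finally show ?thesis by (simp add: level_potential_def)
qed

text \<open>Induction on total degree plus level: a link at a node of degree \<open>d\<close> is
  removed, or no such node is left and \<open>d\<close> drops. It stops once the total degree is at
  most \<open>8 * d * (d + 1)\<close>, where the switching error is no longer small;
  \<open>\<Phi>\<close> is the loss from there on.\<close>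

lemma self_ratio_ge_levels:
  fixes m :: nat and \<Phi> :: real
  assumes A: "finite A"
    and base: "\<And>\<kappa>. self_class A \<kappa> \<noteq> {} \<Longrightarrow> (\<And>x. x \<in> A \<Longrightarrow> \<kappa> x \<le> m) \<Longrightarrow> (\<Sum>x\<in>A. \<kappa> x) \<le> 8 * (m * (m + 1))
      \<Longrightarrow> exp (- \<Phi>) \<le> self_ratio A \<kappa>"
  shows "self_class A \<kappa> \<noteq> {} \<Longrightarrow> (\<And>x. x \<in> A \<Longrightarrow> \<kappa> x \<le> d) \<Longrightarrow> d \<le> m \<Longrightarrow> 0 < (\<Sum>x\<in>A. \<kappa> x) \<Longrightarrow>
    exp (- \<Phi> - level_potential d (card {x \<in> A. \<kappa> x = d}) (real (\<Sum>x\<in>A. \<kappa> x))) \<le> self_ratio A \<kappa>"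
proof (induction "(\<Sum>x\<in>A. \<kappa> x) + d" arbitrary: \<kappa> d rule: less_induct)
  case less
  define s where "s = (\<Sum>x\<in>A. \<kappa> x)"
  define N where "N = card {x \<in> A. \<kappa> x = d}"
  define L where "L = real s"
  have dN: "c * card {x \<in> A. \<kappa> x = c} \<le> s" for c
  proof -
    have "c * card {x \<in> A. \<kappa> x = c} = (\<Sum>x | x \<in> A \<and> \<kappa> x = c. \<kappa> x)" by simp
    also have "\<dots> \<le> s" unfolding s_def using A by (intro sum_mono2) auto
    finally show ?thesis .
  qed
  have s0: "0 < s" using less(5) by (simp add: s_def)
  then have pot0: "0 \<le> level_potential d N L" by (simp add: level_potential_def L_def Suc_le_eq)
  have d0: "0 < d"
  proof (rule ccontr)
    assume "\<not> 0 < d"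
    then have "\<kappa> x = 0" if "x \<in> A" for x using less(3)[OF that] by simp
    then show False using s0 by (simp add: s_def)
  qed
  consider "s \<le> 8 * (d * (d + 1))" | "8 * (d * (d + 1)) < s" "N = 0" | "8 * (d * (d + 1)) < s" "N \<noteq> 0" by linarith
  then show ?case
  proof cases
    case 1
    have "8 * (d * (d + 1)) \<le> 8 * (m * (m + 1))" using less(4) by (intro mult_le_mono) auto
    then have "exp (- \<Phi>) \<le> self_ratio A \<kappa>"
      using 1 less(3,4) by (intro base less(2)) (auto simp: s_def intro: order_trans)
    moreover have "exp (- \<Phi> - level_potential d N L) \<le> exp (- \<Phi>)" using pot0 by simp
    ultimately show ?thesis unfolding N_def L_def s_def by (rule order_trans[rotated])
  next
    case 2
    have "\<kappa> x \<le> d - 1" if "x \<in> A" for x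
    proof -
      have "\<kappa> x \<noteq> d" using 2(2) that A by (auto simp: N_def)
      then show ?thesis using less(3)[OF that] by simp
    qed
    then have "exp (- \<Phi> - level_potential (d - 1) (card {x \<in> A. \<kappa> x = d - 1}) L) \<le> self_ratio A \<kappa>"
      using less(1)[of \<kappa> "d - 1"] less(2-5) d0 by (simp add: L_def s_def)
    moreover have "level_potential (real d - 1) (card {x \<in> A. \<kappa> x = d - 1}) L \<le> level_potential d 0 L"
    proof (rule level_potential_down)
      have "real ((d - 1) * card {x \<in> A. \<kappa> x = d - 1}) \<le> L" unfolding L_def of_nat_le_iff by (rule dN)
      then show "(real d - 1) * card {x \<in> A. \<kappa> x = d - 1} \<le> L" using d0 by (simp add: of_nat_diff)
    qed (use d0 s0 in \<open>auto simp: L_def\<close>)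
    then have "exp (- \<Phi> - level_potential d N L) \<le> exp (- \<Phi> - level_potential (d - 1) (card {x \<in> A. \<kappa> x = d - 1}) L)"
      using d0 2 by (simp add: of_nat_diff)
    ultimately show ?thesis unfolding N_def L_def s_def by linarith
  next
    case 3
    then obtain i where i: "i \<in> A" "\<kappa> i = d" by (auto simp: N_def card_eq_0_iff)
    obtain j where j: "j \<in> A" "j \<noteq> i" "self_class A (reduce \<kappa> {i, j}) \<noteq> {}"
      "s = (\<Sum>x\<in>A. reduce \<kappa> {i, j} x) + 2"
      "self_ratio A (reduce \<kappa> {i, j}) * exp (- (real (8 * (d * (d + 1))) / L)) \<le> self_ratio A \<kappa>"
    proof -
      have "\<exists>j\<in>A. j \<noteq> i \<and> self_class A (reduce \<kappa> {i, j}) \<noteq> {} \<and>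
          s = (\<Sum>x\<in>A. reduce \<kappa> {i, j} x) + 2 \<and>
          self_ratio A (reduce \<kappa> {i, j}) * exp (- (real (8 * (d * (d + 1))) / L)) \<le> self_ratio A \<kappa>"
        unfolding L_def s_def
        by (rule self_ratio_step[OF A less(2) less(3) i d0]) (use 3(1) in \<open>auto simp: s_def\<close>)
      then show ?thesis using that by blast
    qed
    define \<kappa>' where "\<kappa>' = reduce \<kappa> {i, j}"
    define N' where "N' = card {x \<in> A. \<kappa>' x = d}"
    have "1 * (1 + 1) \<le> d * (d + 1)" using d0 by (intro mult_le_mono) auto
    then have s16: "16 < s" using 3(1) by simp
    have "{x \<in> A. \<kappa>' x = d} \<subset> {x \<in> A. \<kappa> x = d}"
    proof
      show "{x \<in> A. \<kappa>' x = d} \<subseteq> {x \<in> A. \<kappa> x = d}"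
        using less(3) reduce_le[of \<kappa> "{i, j}"] by (auto simp: \<kappa>'_def intro: antisym)
      show "{x \<in> A. \<kappa>' x = d} \<noteq> {x \<in> A. \<kappa> x = d}"
        using i d0 by (auto simp: \<kappa>'_def reduce_def)
    qed
    then have N': "N' < N" unfolding N_def N'_def using A by (intro psubset_card_mono) auto
    have IH: "exp (- \<Phi> - level_potential d N' (real (\<Sum>x\<in>A. \<kappa>' x))) \<le> self_ratio A \<kappa>'"
      unfolding N'_def
    proof (rule less(1))
      show "(\<Sum>x\<in>A. \<kappa>' x) + d < (\<Sum>x\<in>A. \<kappa> x) + d" using j(4) by (simp add: s_def \<kappa>'_def)
      show "self_class A \<kappa>' \<noteq> {}" using j(3) by (simp add: \<kappa>'_def)
      show "\<kappa>' x \<le> d" if "x \<in> A" for x using less(3)[OF that] reduce_le[of \<kappa> "{i, j}" x] by (simp add: \<kappa>'_def)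
      show "d \<le> m" by fact
      show "0 < (\<Sum>x\<in>A. \<kappa>' x)" using j(4) s16 by (simp add: \<kappa>'_def)
    qed
    have L': "real (\<Sum>x\<in>A. \<kappa>' x) = L - 2" unfolding L_def j(4) \<kappa>'_def by simp
    have "real (8 * (d * (d + 1))) \<le> 16 * (real d)\<^sup>2"
    proof -
      have "8 * (d * (d + 1)) \<le> 16 * (d * d)" using d0 by (simp add: Suc_le_eq)
      then have "real (8 * (d * (d + 1))) \<le> real (16 * (d * d))" by (simp only: of_nat_le_iff)
      then show ?thesis by (simp add: power2_eq_square)
    qed
    then have "real (8 * (d * (d + 1))) / L \<le> 16 * (real d)\<^sup>2 / L"
      using s0 by (intro divide_right_mono) (auto simp: L_def)
    moreover have "level_potential d N' (L - 2) + 16 * (real d)\<^sup>2 / L \<le> level_potential d N L"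
    proof (rule level_potential_step[OF d0 N'])
      have "real (d * N) \<le> L" unfolding L_def N_def of_nat_le_iff by (rule dN)
      then show "real d * real N \<le> L" by simp
    qed (use s16 in \<open>simp add: L_def\<close>)
    ultimately have "exp (- \<Phi> - level_potential d N L)
        \<le> exp (- \<Phi> - level_potential d N' (L - 2)) * exp (- (real (8 * (d * (d + 1))) / L))"
      by (simp flip: exp_add)
    also have "\<dots> \<le> self_ratio A \<kappa>' * exp (- (real (8 * (d * (d + 1))) / L))"
      using IH L' by (intro mult_right_mono) auto
    also have "\<dots> \<le> self_ratio A \<kappa>" unfolding \<kappa>'_def by (rule j(5))
    finally show ?thesis by (simp add: N_def L_def s_def)
  qed
qed

section \<open>Growth of the function \<open>g\<close>\<close>

lemma g_eq: "g k = ln (fact k) - k * ln k + k"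
proof (cases "k = 0")
  case False
  then show ?thesis by (simp add: g_def ln_div ln_mult ln_realpow)
qed (simp add: g_def)

lemma g_0 [simp]: "g 0 = 0" by (simp add: g_eq)

text \<open>For positive \<open>k\<close> the increment is \<open>1 - k * ln (1 + 1 / k)\<close>,
  and the logarithm lies between \<open>1 / (k + 1)\<close> and \<open>1 / k\<close>. Monotonicity
  and logarithmic growth follow by summation.\<close>

lemma g_Suc: "g k \<le> g (Suc k)" "g (Suc k) \<le> g k + 1 / Suc k"
proof -
  have "g k \<le> g (Suc k) \<and> g (Suc k) \<le> g k + 1 / Suc k"
  proof (cases "k = 0")
    case False
    then have k: "0 < real k" by simp
    have "ln (fact (Suc k) :: real) = ln (Suc k) + ln (fact k)"
      unfolding fact_Suc by (subst ln_mult_pos) auto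
    then have eq: "g (Suc k) = g k + 1 - k * (ln (Suc k) - ln k)"
      unfolding g_eq by (simp add: algebra_simps)
    have "ln (Suc k / k) \<le> Suc k / k - 1" using k by (intro ln_le_minus_one) auto
    then have "k * (ln (Suc k) - ln k) \<le> k * (1 / k)"
      using k by (intro mult_left_mono) (auto simp: ln_div field_simps)
    moreover have "ln (k / Suc k) \<le> k / Suc k - 1" using k by (intro ln_le_minus_one) auto
    then have "k * (1 / Suc k) \<le> k * (ln (Suc k) - ln k)"
      using k by (intro mult_left_mono) (auto simp: ln_div field_simps)
    moreover have "1 - k * (1 / Suc k) = 1 / Suc k" "k * (1 / real k) = 1" using k by (auto simp: field_simps)
    ultimately show ?thesis unfolding eq by linarith
  qed (simp add: g_eq)
  then show "g k \<le> g (Suc k)" "g (Suc k) \<le> g k + 1 / Suc k" by auto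
qed

lemma g_mono: "k \<le> l \<Longrightarrow> g k \<le> g l"
  using lift_Suc_mono_le[of g] g_Suc(1) by blast

lemma g_nonneg: "0 \<le> g k" using g_mono[of 0 k] by simp

lemma g_diff_le: "g (k + l) - g k \<le> l / Suc k"
proof (induction l)
  case (Suc l)
  have "1 / Suc (k + l) \<le> 1 / Suc k" by (intro divide_left_mono) auto
  then show ?case using Suc g_Suc(2)[of "k + l"] by (simp add: add_divide_distrib)
qed simp

lemma g_le_self: "g k \<le> k"
  using g_diff_le[of 0 k] by simp

lemma g_le_ln: "1 \<le> k \<Longrightarrow> g k \<le> 1 + ln k"
proof (induction k rule: dec_induct)
  case (step k)
  have "ln (k / Suc k) \<le> k / Suc k - 1" using step by (intro ln_le_minus_one) auto
  then have "1 / Suc k \<le> ln (Suc k) - ln k" using step by (simp add: ln_div field_simps)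
  then show ?case using step g_Suc(2)[of k] by linarith
qed (simp add: g_eq)

lemma ln_fact_eq: "ln (fact k) = g k + k * ln k - k"
  by (simp add: g_eq)

lemma sparse_loss_mono:
  assumes "0 \<le> x" "x \<le> y" "y \<le> 32 * n" "0 < n"
  shows "sparse_loss n x \<le> sparse_loss n y"
proof (cases "x = y")
  case False
  then have "0 < y" using assms by simp
  then have "1 \<le> 32 * n / y" using assms by (simp add: field_simps)
  then have "0 \<le> (y - x) * ln (32 * n / y)" using assms by simp
  moreover have "sparse_loss n x + (y - x) * ln (32 * n / y) \<le> sparse_loss n y"
    using sparse_loss_step[of x "y - x" n] assms False by simp
  ultimately show ?thesis by linarith
qed simp

text \<open>With \<open>D = \<kappa>\<close> and \<open>\<Delta> = sqrt n\<close> the crude lower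
  bound has leading term \<Sum> \<open>\<kappa> i * ln (sqrt n / \<kappa> i)\<close>. The logarithm
  of the configuration count exceeds it by at most the total degree, because the factors
  \<open>2 * t - 1\<close> are at most \<open>n\<close>. Both errors are o(n) once \<open>m\<close>
  is o(sqrt n).\<close>

lemma self_ratio_ge_sparse:
  fixes n :: real
  assumes A: "finite A" and ne: "self_class A \<kappa> \<noteq> {}" and m: "\<And>x. x \<in> A \<Longrightarrow> \<kappa> x \<le> m"
    and n: "1 \<le> n" "16 * (real m)\<^sup>2 \<le> n" and L: "real (\<Sum>x\<in>A. \<kappa> x) \<le> 16 * (real m)\<^sup>2"
  shows "exp (- (sparse_loss n (16 * (real m)\<^sup>2) + 16 * (real m)\<^sup>2)) \<le> self_ratio A \<kappa>"
proof -
  have E: "is_link_set A (links A A)" using is_link_set_links[OF A A] by simp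
  obtain G where G: "G \<in> degree_class (links A A) A \<kappa>" using ne by (auto simp: self_class_def)
  have S: "(\<Sum>x\<in>A. \<kappa> x) = 2 * card G" by (rule degree_class_card[OF E G])
  define \<Delta> where "\<Delta> = sqrt n"
  have \<Delta>: "1 \<le> \<Delta>" "\<Delta>\<^sup>2 = n" using n by (auto simp: \<Delta>_def)
  have m\<Delta>: "real m \<le> \<Delta>" unfolding \<Delta>_def using n(2) by (intro real_le_rsqrt) (auto intro: order_trans[rotated])
  have low: "(\<Sum>i\<in>A. \<kappa> i * ln (\<Delta> / \<kappa> i)) - sparse_loss (\<Delta>\<^sup>2) (2 * card G) \<le> ln (card (degree_class (links A A) A \<kappa>))"
  proof (rule ln_card_degree_class_ge[OF \<Delta>(1) _ E G])
    show "real (\<kappa> i) \<le> \<Delta>" if "i \<in> A" for i using m[OF that] m\<Delta> by (meson of_nat_mono order_trans)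
    show "\<kappa> i + card {u \<in> A. u \<noteq> i \<and> {i, u} \<notin> links A A} \<le> \<kappa> i" if "i \<in> A" for i
    proof -
      have "{u \<in> A. u \<noteq> i \<and> {i, u} \<notin> links A A} = {}" using that by (auto simp: mem_links_iff)
      then show ?thesis by (simp only: card.empty)
    qed
    show "real (2 * card G) \<le> \<Delta>\<^sup>2" using L n(2) unfolding S \<Delta>(2) by linarith
  qed
  have "ln (config_self A \<kappa>) = ln (\<Prod>t=1..card G. 2 * real t - 1) - ln (\<Prod>i\<in>A. fact (\<kappa> i))"
    unfolding config_self_def S by (subst ln_divide_pos) (auto intro!: prod_pos)
  also have "ln (\<Prod>t=1..card G. 2 * real t - 1) = (\<Sum>t=1..card G. ln (2 * real t - 1))"
    by (rule ln_prod) auto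
  also have "\<dots> \<le> (\<Sum>t=1..card G. ln n)"
  proof (rule sum_mono)
    fix t assume t: "t \<in> {1..card G}"
    then have "2 * real t - 1 \<le> n" using L n(2) unfolding S by auto
    then show "ln (2 * real t - 1) \<le> ln n" using t by simp
  qed
  also have "\<dots> = card G * ln n" by simp
  also have "ln (\<Prod>i\<in>A. fact (\<kappa> i) :: real) = (\<Sum>i\<in>A. ln (fact (\<kappa> i)))" by (rule ln_prod[OF A]) auto
  also have "card G * ln n - (\<Sum>i\<in>A. ln (fact (\<kappa> i)))
      \<le> card G * ln n - (\<Sum>i\<in>A. \<kappa> i * ln (\<kappa> i) - \<kappa> i)"
    using g_nonneg by (intro diff_left_mono sum_mono) (simp add: ln_fact_eq)
  also have "\<dots> = (\<Sum>i\<in>A. \<kappa> i * ln (\<Delta> / \<kappa> i)) + 2 * card G"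
  proof -
    have "ln n = 2 * ln \<Delta>" using \<Delta> by (simp flip: \<Delta>(2) add: ln_realpow)
    then have "card G * ln n = real (\<Sum>i\<in>A. \<kappa> i) * ln \<Delta>" unfolding S by simp
    also have "\<dots> = (\<Sum>i\<in>A. \<kappa> i * ln \<Delta>)" by (simp add: sum_distrib_right)
    also have "\<dots> = (\<Sum>i\<in>A. \<kappa> i * ln (\<Delta> / \<kappa> i) + \<kappa> i * ln (\<kappa> i))"
    proof (rule sum.cong[OF refl])
      fix i show "\<kappa> i * ln \<Delta> = \<kappa> i * ln (\<Delta> / \<kappa> i) + \<kappa> i * ln (\<kappa> i)"
        using \<Delta> by (cases "\<kappa> i = 0") (auto simp: ln_div algebra_simps)
    qed
    finally have "card G * ln n = (\<Sum>i\<in>A. \<kappa> i * ln (\<Delta> / \<kappa> i) + \<kappa> i * ln (\<kappa> i))" .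
    moreover have "2 * real (card G) = (\<Sum>i\<in>A. real (\<kappa> i))" using S by (simp flip: of_nat_sum)
    ultimately show ?thesis by (simp add: sum.distrib sum_subtractf)
  qed
  finally have up: "ln (config_self A \<kappa>) \<le> (\<Sum>i\<in>A. \<kappa> i * ln (\<Delta> / \<kappa> i)) + 2 * card G" by simp
  have pos: "0 < card (self_class A \<kappa>)"
    using ne is_link_setD(2)[OF E] by (simp add: self_class_def card_gt_0_iff)
  have "sparse_loss n (2 * card G) \<le> sparse_loss n (16 * (real m)\<^sup>2)" "2 * real (card G) \<le> 16 * (real m)\<^sup>2"
    using L n unfolding S by (auto intro!: sparse_loss_mono)
  then have "- (sparse_loss n (16 * (real m)\<^sup>2) + 16 * (real m)\<^sup>2) \<le> ln (card (self_class A \<kappa>)) - ln (config_self A \<kappa>)"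
    using low up unfolding \<Delta>(2) self_class_def[symmetric] by simp
  also have "\<dots> = ln (self_ratio A \<kappa>)"
    unfolding self_ratio_def using pos config_self_pos by (subst ln_divide_pos) auto
  finally have "exp (- (sparse_loss n (16 * (real m)\<^sup>2) + 16 * (real m)\<^sup>2)) \<le> exp (ln (self_ratio A \<kappa>))"
    by (simp only: exp_le_cancel_iff)
  also have "\<dots> = self_ratio A \<kappa>"
    using pos config_self_pos[of A \<kappa>] by (intro exp_ln) (simp add: self_ratio_def)
  finally show ?thesis .
qed

text \<open>Since \<open>m * N \<le> L\<close>, the two terms of the initial potential with factor
  32 are at most \<open>64 * m\<^sup>2\<close> together. The other terms are the final value of the
  logarithm and the loss in the sparse regime.\<close>

lemma card_self_ge_config:
  fixes n :: real
  assumes A: "finite A" and G: "G \<in> degree_class (links A A) A \<kappa>" and m: "\<And>x. x \<in> A \<Longrightarrow> \<kappa> x \<le> m" "1 \<le> m"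
    and n: "1 \<le> n" "16 * (real m)\<^sup>2 \<le> n" and L: "0 < card G"
  shows "config_self A \<kappa> * exp (- (64 * (real m)\<^sup>2 + 360 * ln (2 * card G) + sparse_loss n (16 * (real m)\<^sup>2) + 16 * (real m)\<^sup>2))
    \<le> card (degree_class (links A A) A \<kappa>)"
proof -
  have E: "is_link_set A (links A A)" using is_link_set_links[OF A A] by simp
  have S: "(\<Sum>x\<in>A. \<kappa> x) = 2 * card G" by (rule degree_class_card[OF E G])
  define \<Phi> where "\<Phi> = sparse_loss n (16 * (real m)\<^sup>2) + 16 * (real m)\<^sup>2"
  define N where "N = card {x \<in> A. \<kappa> x = m}"
  define L where "L = real (\<Sum>x\<in>A. \<kappa> x)"
  have "exp (- \<Phi> - level_potential m N L) \<le> self_ratio A \<kappa>"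
    unfolding N_def L_def
  proof (rule self_ratio_ge_levels[OF A])
    fix \<kappa>' assume k: "self_class A \<kappa>' \<noteq> {}" "\<And>x. x \<in> A \<Longrightarrow> \<kappa>' x \<le> m" "(\<Sum>x\<in>A. \<kappa>' x) \<le> 8 * (m * (m + 1))"
    have "8 * (m * (m + 1)) \<le> 16 * (m * m)" using m(2) by simp
    then have "(\<Sum>x\<in>A. \<kappa>' x) \<le> 16 * (m * m)" using k(3) by linarith
    then have "real (\<Sum>x\<in>A. \<kappa>' x) \<le> real (16 * (m * m))" by (simp only: of_nat_le_iff)
    then show "exp (- \<Phi>) \<le> self_ratio A \<kappa>'"
      unfolding \<Phi>_def by (intro self_ratio_ge_sparse[OF A k(1,2) n]) (auto simp: power2_eq_square)
  qed (use G m L S in \<open>auto simp: self_class_def\<close>)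
  moreover have "level_potential m N L \<le> 64 * (real m)\<^sup>2 + 360 * ln (2 * card G)"
  proof -
    have "m * N = (\<Sum>x | x \<in> A \<and> \<kappa> x = m. \<kappa> x)" by (simp add: N_def)
    also have "\<dots> \<le> (\<Sum>x\<in>A. \<kappa> x)" using A by (intro sum_mono2) auto
    finally have "real (m * N) \<le> L" unfolding L_def of_nat_le_iff .
    moreover have "0 < L" using L S by (simp add: L_def)
    ultimately have "real m * N / L \<le> 1" by (simp add: divide_le_eq)
    then have "real m * N / L \<le> m" using m(2) by linarith
    then have "real m * (real m * N / L) \<le> real m * m" by (intro mult_left_mono) auto
    moreover have "32 * (real m)\<^sup>2 * N / L = 32 * (real m * (real m * N / L))" by (simp add: power2_eq_square)
    ultimately have "level_potential m N L \<le> 32 * (real m * m) + 32 * (real m)\<^sup>2 + 360 * ln L"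
      unfolding level_potential_def by linarith
    moreover have "L = real (2 * card G)" unfolding L_def S ..
    ultimately show ?thesis by (simp add: power2_eq_square)
  qed
  ultimately have "exp (- (64 * (real m)\<^sup>2 + 360 * ln (2 * card G) + \<Phi>)) \<le> self_ratio A \<kappa>"
    by (smt (verit) exp_le_cancel_iff)
  then show ?thesis
    using config_self_pos[of A \<kappa>] by (simp add: self_ratio_def self_class_def \<Phi>_def field_simps add.assoc)
qed

section \<open>Entropy gaps\<close>

lemma binary_entropy_le_cross:
  assumes "0 \<le> p" "p \<le> 1" "0 \<le> q" "q \<le> 1" "q = 0 \<Longrightarrow> p = 0" "q = 1 \<Longrightarrow> p = 1"
  shows "binary_entropy p \<le> - p * ln q - (1 - p) * ln (1 - q)"
proof (cases "q = 0 \<or> q = 1")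
  case False
  then have "ent p \<le> - p * ln q + q - p" "ent (1 - p) \<le> - (1 - p) * ln (1 - q) + (1 - q) - (1 - p)"
    using assms by (intro ent_le_tangent; auto)+
  then show ?thesis by (simp add: binary_entropy_def algebra_simps)
qed (use assms in \<open>auto simp: binary_entropy_def\<close>)

text \<open>Tangents of \<open>ent\<close> at \<open>q\<close> and at 1. In contrast to the cross
  entropy bound \<open>q\<close> may exceed 1, so \<open>\<kappa> i * \<kappa> j / L\<close> is
  admissible for all degrees.\<close>

lemma binary_entropy_le_poisson:
  assumes "0 \<le> p" "p \<le> 1" "0 \<le> q" "q = 0 \<Longrightarrow> p = 0"
  shows "binary_entropy p \<le> - p * ln q + q"
proof (cases "q = 0")
  case False
  then show ?thesis using ent_le_tangent[of p q] ent_le_tangent[of "1 - p" 1] assms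
    by (simp add: binary_entropy_def)
qed (use assms in \<open>auto simp: binary_entropy_def\<close>)

lemma binary_entropy_ge:
  assumes "0 \<le> p" "p \<le> 1"
  shows "- p * ln p + p - p\<^sup>2 \<le> binary_entropy p"
proof (cases "p = 1")
  case False
  then have "ln (1 - p) \<le> - p" using ln_le_minus_one[of "1 - p"] assms by simp
  then have "(1 - p) * ln (1 - p) \<le> (1 - p) * (- p)" using assms by (intro mult_left_mono) auto
  then show ?thesis by (simp add: binary_entropy_def ent_def power2_eq_square algebra_simps)
qed (simp add: binary_entropy_def)

text \<open>A quantity additive over the ends of a link has a mean fixed by the degrees. Hence the
  cross entropy against a product form takes the same value for all feasible
  \<open>p\<close>.\<close>

lemma feasible_sum:
  fixes a :: "'a \<Rightarrow> real"
  assumes "is_link_set V E" "feasible E V \<kappa> p"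
  shows "(\<Sum>e\<in>E. p e * (\<Sum>i\<in>e. a i)) = (\<Sum>i\<in>V. \<kappa> i * a i)"
proof -
  have "(\<Sum>e\<in>E. p e * (\<Sum>i\<in>e. a i)) = (\<Sum>i\<in>V. \<Sum>e | e \<in> E \<and> i \<in> e. p e * a i)"
    unfolding sum_distrib_left by (rule sum_links_swap[OF assms(1)])
  also have "\<dots> = (\<Sum>i\<in>V. \<kappa> i * a i)"
    using assms(2) by (intro sum.cong refl) (simp add: feasible_def flip: sum_distrib_right)
  finally show ?thesis .
qed

lemma feasible_total:
  assumes "is_link_set V E" "feasible E V \<kappa> p"
  shows "2 * (\<Sum>e\<in>E. p e) = real (\<Sum>i\<in>V. \<kappa> i)"
proof -
  have "(\<Sum>e\<in>E. p e * (\<Sum>i\<in>e. 1)) = (\<Sum>e\<in>E. p e * 2)"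
    using is_link_setD(3)[OF assms(1)] by (intro sum.cong) auto
  then show ?thesis using feasible_sum[OF assms, of "\<lambda>_. 1"] by (simp flip: sum_distrib_right)
qed

lemma feasible_le_degree:
  assumes "is_link_set V E" "feasible E V \<kappa> p" "e \<in> E" "i \<in> e"
  shows "p e \<le> \<kappa> i"
proof -
  note E = is_link_setD[OF assms(1)]
  have "p e \<le> (\<Sum>e | e \<in> E \<and> i \<in> e. p e)"
    using assms E(2) by (intro member_le_sum) (auto simp: feasible_def)
  moreover have "i \<in> V" using assms E(4) by auto
  ultimately show ?thesis using assms(2) by (simp add: feasible_def)
qed

text \<open>The comparison is with \<open>q = \<kappa> i * \<kappa> j / \<Lambda>\<close>, of total
  at most \<open>M\<close>. This \<open>q\<close> does not have to meet the degree constraints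
  itself, which matters within a single layer.\<close>

lemma sum_binary_entropy_le:
  fixes M :: nat and \<Lambda> :: real
  assumes E: "is_link_set V E" and p: "feasible E V \<kappa> p" and M: "(\<Sum>i\<in>V. \<kappa> i) = 2 * M"
    and \<Lambda>: "0 < \<Lambda> \<or> M = 0 \<and> \<Lambda> = 0" and q: "(\<Sum>e\<in>E. \<Prod>i\<in>e. real (\<kappa> i)) \<le> \<Lambda> * M"
  shows "(\<Sum>e\<in>E. binary_entropy (p e)) \<le> - (\<Sum>i\<in>V. \<kappa> i * ln (\<kappa> i)) + M * ln \<Lambda> + M"
proof -
  note E' = is_link_setD[OF E]
  define q where "q = (\<lambda>e. (\<Prod>i\<in>e. real (\<kappa> i)) / \<Lambda>)"
  have p01: "0 \<le> p e" "p e \<le> 1" if "e \<in> E" for e using p that by (auto simp: feasible_def)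
  have p0: "p e = 0" if "e \<in> E" "q e = 0" for e
  proof -
    have "\<exists>i\<in>e. \<kappa> i = 0"
    proof (cases "\<Lambda> = 0")
      case True
      then have "(\<Sum>i\<in>V. \<kappa> i) = 0" using \<Lambda> M by auto
      then have "\<forall>i\<in>e. \<kappa> i = 0" using E'(1) E'(4)[OF that(1)] by auto
      moreover have "e \<noteq> {}" using E'(3)[OF that(1)] by auto
      ultimately show ?thesis by auto
    next
      case False
      then show ?thesis using that E'(5)[OF that(1)] by (auto simp: q_def)
    qed
    then show ?thesis using feasible_le_degree[OF E p that(1)] p01[OF that(1)] by fastforce
  qed
  have "(\<Sum>e\<in>E. binary_entropy (p e)) \<le> (\<Sum>e\<in>E. - p e * ln (q e) + q e)"
  proof (rule sum_mono)
    fix e assume e: "e \<in> E"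
    show "binary_entropy (p e) \<le> - p e * ln (q e) + q e"
      by (rule binary_entropy_le_poisson) (use p01[OF e] p0[OF e] \<Lambda> in \<open>auto simp: q_def intro!: divide_nonneg_nonneg prod_nonneg\<close>)
  qed
  also have "\<dots> = (\<Sum>e\<in>E. - (p e * (\<Sum>i\<in>e. ln (\<kappa> i) )) + p e * ln \<Lambda> + q e)"
  proof (rule sum.cong[OF refl])
    fix e assume e: "e \<in> E"
    show "- p e * ln (q e) + q e = - (p e * (\<Sum>i\<in>e. ln (\<kappa> i) )) + p e * ln \<Lambda> + q e"
    proof (cases "q e = 0")
      case False
      then have pr: "(\<Prod>i\<in>e. real (\<kappa> i)) \<noteq> 0" "\<Lambda> \<noteq> 0" by (auto simp: q_def)
      then have "\<forall>i\<in>e. real (\<kappa> i) \<noteq> 0" using E'(5)[OF e] by (simp add: prod_zero_iff)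
      then have "ln (\<Prod>i\<in>e. real (\<kappa> i)) = (\<Sum>i\<in>e. ln (\<kappa> i))"
        using E'(5)[OF e] by (intro ln_prod) auto
      then have "ln (q e) = (\<Sum>i\<in>e. ln (\<kappa> i)) - ln \<Lambda>"
        unfolding q_def using pr by (simp add: ln_div)
      then show ?thesis by (simp only:) (simp add: algebra_simps)
    qed (use p0[OF e] in simp)
  qed
  also have "\<dots> = - (\<Sum>i\<in>V. \<kappa> i * ln (\<kappa> i)) + (\<Sum>e\<in>E. p e) * ln \<Lambda> + (\<Sum>e\<in>E. q e)"
    using feasible_sum[OF E p, of "\<lambda>i. ln (\<kappa> i)"]
    by (simp add: sum.distrib sum_negf sum_subtractf sum_distrib_right)
  also have "(\<Sum>e\<in>E. p e) = M" using feasible_total[OF E p] unfolding M by simp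
  also have "(\<Sum>e\<in>E. q e) \<le> M"
    using q \<Lambda> by (auto simp: q_def divide_le_eq mult.commute simp flip: sum_divide_distrib)
  finally show ?thesis by simp
qed

text \<open>For feasible probabilities of product form the leading terms are explicit, and the error
  is the sum of the squared probabilities, at most \<open>b * M\<close>.\<close>

lemma sum_binary_entropy_ge:
  fixes M :: nat and x :: "'a \<Rightarrow> real" and b c :: real
  assumes E: "is_link_set V E" and p: "feasible E V \<kappa> p" and M: "(\<Sum>i\<in>V. \<kappa> i) = 2 * M"
    and prod: "\<And>e. e \<in> E \<Longrightarrow> p e = (\<Prod>i\<in>e. x i) * c" and c: "c \<noteq> 0" and b: "\<And>e. e \<in> E \<Longrightarrow> p e \<le> b"
  shows "- (\<Sum>i\<in>V. \<kappa> i * ln (x i)) - M * ln c + M - b * M \<le> (\<Sum>e\<in>E. binary_entropy (p e))"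
proof -
  note E' = is_link_setD[OF E]
  have p01: "0 \<le> p e" "p e \<le> 1" if "e \<in> E" for e using p that by (auto simp: feasible_def)
  have pM: "(\<Sum>e\<in>E. p e) = M" using feasible_total[OF E p] unfolding M by simp
  have "- (\<Sum>i\<in>V. \<kappa> i * ln (x i)) - M * ln c + M - b * M
      = (\<Sum>e\<in>E. - (p e * (\<Sum>i\<in>e. ln (x i))) - p e * ln c + p e - b * p e)"
    using feasible_sum[OF E p, of "\<lambda>i. ln (x i)"]
    by (simp add: sum.distrib sum_negf sum_subtractf pM flip: sum_distrib_right sum_distrib_left)
  also have "\<dots> \<le> (\<Sum>e\<in>E. binary_entropy (p e))"
  proof (rule sum_mono)
    fix e assume e: "e \<in> E"
    have "- (p e * (\<Sum>i\<in>e. ln (x i))) - p e * ln c = - p e * ln (p e)"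
    proof (cases "p e = 0")
      case False
      then have "(\<Prod>i\<in>e. x i) \<noteq> 0" using prod[OF e] by auto
      then have "\<forall>i\<in>e. x i \<noteq> 0" using E'(5)[OF e] by (simp add: prod_zero_iff)
      then have "ln (\<Prod>i\<in>e. x i) = (\<Sum>i\<in>e. ln (x i))" using E'(5)[OF e] by (intro ln_prod) auto
      then have "ln (p e) = (\<Sum>i\<in>e. ln (x i)) + ln c"
        unfolding prod[OF e] using c \<open>(\<Prod>i\<in>e. x i) \<noteq> 0\<close> by (simp add: ln_mult)
      then show ?thesis by (simp add: algebra_simps)
    qed simp
    moreover have "(p e)\<^sup>2 \<le> b * p e"
      unfolding power2_eq_square using b[OF e] p01[OF e] by (intro mult_right_mono) auto
    ultimately show "- (p e * (\<Sum>i\<in>e. ln (x i))) - p e * ln c + p e - b * p e \<le> binary_entropy (p e)"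
      using binary_entropy_ge[OF p01[OF e]] by linarith
  qed
  finally show ?thesis .
qed

text \<open>The marginals of the microcanonical ensemble are feasible, and by subadditivity their
  entropy is at least the logarithm of the class size. This settles unconstrained blocks and
  degenerate cases.\<close>

lemma exists_feasible_gap_nonneg:
  fixes E :: "'a set set"
  assumes E: "finite E" and ne: "degree_class E V \<kappa> \<noteq> {}"
  shows "\<exists>p. feasible E V \<kappa> p \<and> 0 \<le> entropy_gap E V \<kappa> p"
proof -
  define C :: "'a set set \<Rightarrow> 'a \<Rightarrow> real" where "C = (\<lambda>G i. real (vdeg G i))"
  define Q where "Q = microcanonical (Pow E) V C (\<lambda>i. real (\<kappa> i))"
  have D: "{G \<in> Pow E. \<forall>i\<in>V. C G i = real (\<kappa> i)} = degree_class E V \<kappa>"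
    by (auto simp: C_def degree_class_def)
  then have "\<exists>G\<in>Pow E. \<forall>i\<in>V. C G i = real (\<kappa> i)" using ne by blast
  note mic = relative_entropy_microcanonical_canonical(2,3)[OF _ this, folded Q_def, unfolded D]
  have sc: "soft_constraint (Pow E) V C (\<lambda>i. real (\<kappa> i)) Q" using mic(1) E by simp
  then have supp: "set_pmf Q \<subseteq> Pow E" by (simp add: soft_constraint_def)
  have "feasible E V \<kappa> (marginal E Q)"
    unfolding feasible_def
  proof (intro conjI ballI)
    fix i assume "i \<in> V"
    have "(\<Sum>G\<in>Pow E. pmf Q G * real (vdeg (G \<inter> E) i)) = \<kappa> i"
    proof -
      have "(\<Sum>G\<in>Pow E. pmf Q G * real (vdeg (G \<inter> E) i)) = (\<Sum>G\<in>Pow E. pmf Q G * C G i)"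
        by (intro sum.cong refl) (auto simp: C_def Int_absorb2)
      then show ?thesis using sc \<open>i \<in> V\<close> by (simp add: soft_constraint_def)
    qed
    then show "(\<Sum>e | e \<in> E \<and> i \<in> e. marginal E Q e) = real (\<kappa> i)"
      by (simp add: sum_pmf_vdeg[OF E supp])
  qed (use marginal_bounds[OF E supp] in auto)
  moreover have "0 \<le> entropy_gap E V \<kappa> (marginal E Q)"
    using gibbs_entropy_le_marginals[OF E supp] mic(2) E by (simp add: entropy_gap_def)
  ultimately show ?thesis by blast
qed

lemma entropy_gap_free:
  assumes "finite E"
  shows "feasible E {} \<kappa> p \<Longrightarrow> entropy_gap E {} \<kappa> p \<le> 0"
    and "\<exists>p. feasible E {} \<kappa> p \<and> 0 \<le> entropy_gap E {} \<kappa> p"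
proof -
  have "degree_class E {} \<kappa> = Pow E" by (auto simp: degree_class_def)
  then have card: "ln (card (degree_class E {} \<kappa>)) = (\<Sum>e\<in>E. ln 2)"
    using assms by (simp add: card_Pow ln_realpow)
  show "entropy_gap E {} \<kappa> p \<le> 0" if p: "feasible E {} \<kappa> p"
  proof -
    have "binary_entropy (p e) \<le> ln 2" if "e \<in> E" for e
      using binary_entropy_le_cross[of "p e" "1/2"] p that by (simp add: feasible_def ln_div algebra_simps)
    then show ?thesis unfolding entropy_gap_def card by (simp add: sum_mono del: sum_constant)
  qed
  show "\<exists>p. feasible E {} \<kappa> p \<and> 0 \<le> entropy_gap E {} \<kappa> p"
    by (rule exists_feasible_gap_nonneg[OF assms]) (auto simp: degree_class_def)
qed

lemma ln_config_bip:
  assumes "finite A" "finite B" "A \<inter> B = {}" "(\<Sum>i\<in>A. \<kappa> i) = M" "(\<Sum>j\<in>B. \<kappa> j) = M"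
  shows "ln (config_bip A B \<kappa>)
    = g M + M * ln M + M - (\<Sum>i\<in>A \<union> B. g (\<kappa> i)) - (\<Sum>i\<in>A \<union> B. \<kappa> i * ln (\<kappa> i))"
proof -
  have "(\<Sum>i\<in>A \<union> B. \<kappa> i) = 2 * M" using assms by (simp add: sum.union_disjoint)
  then have S: "(\<Sum>i\<in>A \<union> B. real (\<kappa> i)) = 2 * real M" by (metis of_nat_mult of_nat_numeral of_nat_sum)
  have "ln (config_bip A B \<kappa>) = ln (fact M) - ln (\<Prod>i\<in>A \<union> B. fact (\<kappa> i))"
    unfolding config_bip_def assms(4) by (subst ln_divide_pos) (auto intro!: prod_pos)
  also have "ln (\<Prod>i\<in>A \<union> B. fact (\<kappa> i) :: real) = (\<Sum>i\<in>A \<union> B. ln (fact (\<kappa> i)))"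
    using assms by (intro ln_prod) auto
  finally show ?thesis using S by (simp add: ln_fact_eq sum.distrib sum_subtractf)
qed

text \<open>With two disjoint layers \<open>\<kappa> i * \<kappa> j / L\<close> has exactly the
  right mean degrees, as the neighbours of a node form a whole side. The error
  \<open>16 * m * m'\<close> stems from the lower bound on the count, \<open>m * m'\<close> from the
  squared probabilities, and \<open>g L\<close> from the factorial of \<open>L\<close> in the
  configuration count.\<close>

lemma entropy_gap_bip:
  fixes m m' :: nat
  assumes AB: "finite A" "finite B" "A \<inter> B = {}" and G: "G \<in> degree_class (links A B) (A \<union> B) \<kappa>"
    and m: "\<And>i. i \<in> A \<Longrightarrow> \<kappa> i \<le> m" "\<And>j. j \<in> B \<Longrightarrow> \<kappa> j \<le> m'" and M: "16 * (m * m') \<le> card G"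
  shows "feasible (links A B) (A \<union> B) \<kappa> p \<Longrightarrow>
      entropy_gap (links A B) (A \<union> B) \<kappa> p \<le> (\<Sum>i\<in>A \<union> B. g (\<kappa> i)) + 16 * real (m * m')"
    and "\<exists>p. feasible (links A B) (A \<union> B) \<kappa> p \<and>
      (\<Sum>i\<in>A \<union> B. g (\<kappa> i)) - g (card G) - real (m * m') \<le> entropy_gap (links A B) (A \<union> B) \<kappa> p"
proof -
  define N where "N = card G"
  note E = is_link_set_links[OF AB(1,2)]
  note E' = is_link_setD[OF E]
  have sums: "(\<Sum>i\<in>A. \<kappa> i) = N" "(\<Sum>j\<in>B. \<kappa> j) = N"
    using degree_class_bip_sums[OF AB G] by (simp_all add: N_def)
  have tot: "(\<Sum>i\<in>A \<union> B. \<kappa> i) = 2 * N" using degree_class_card[OF E G] by (simp add: N_def)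
  note lnc = ln_config_bip[OF AB sums]
  have pos: "0 < card (degree_class (links A B) (A \<union> B) \<kappa>)" using G E'(2) by (auto simp: card_gt_0_iff)
  have prodsum: "(\<Sum>e\<in>links A B. \<Prod>i\<in>e. real (\<kappa> i)) = real (\<Sum>i\<in>A. \<kappa> i) * real (\<Sum>j\<in>B. \<kappa> j)" for \<kappa> :: "'a \<Rightarrow> nat"
  proof -
    have "(\<Sum>e\<in>links A B. \<Prod>i\<in>e. real (\<kappa> i)) = (\<Sum>i\<in>A. \<Sum>j\<in>B. real (\<kappa> i) * \<kappa> j)"
      unfolding sum_links_bip[OF AB(3)]
    proof (intro sum.cong refl)
      fix i j assume "i \<in> A" "j \<in> B"
      then have "i \<noteq> j" using AB(3) by auto
      then show "(\<Prod>i\<in>{i, j}. real (\<kappa> i)) = real (\<kappa> i) * \<kappa> j" by simp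
    qed
    then show ?thesis by (simp add: sum_product)
  qed
  show "entropy_gap (links A B) (A \<union> B) \<kappa> p \<le> (\<Sum>i\<in>A \<union> B. g (\<kappa> i)) + 16 * real (m * m')"
    if p: "feasible (links A B) (A \<union> B) \<kappa> p"
  proof -
    have "(\<Sum>e\<in>links A B. binary_entropy (p e)) \<le> - (\<Sum>i\<in>A \<union> B. \<kappa> i * ln (\<kappa> i)) + N * ln N + N"
      by (rule sum_binary_entropy_le[OF E p tot]) (use prodsum[of \<kappa>] sums in auto)
    moreover have "ln (config_bip A B \<kappa>) - 16 * real (m * m') \<le> ln (card (degree_class (links A B) (A \<union> B) \<kappa>))"
    proof -
      have "ln (config_bip A B \<kappa> * exp (- (16 * real (m * m')))) \<le> ln (card (degree_class (links A B) (A \<union> B) \<kappa>))"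
        using card_bip_ge_config[OF AB G m M] config_bip_pos[of A B \<kappa>] pos by (subst ln_le_cancel_iff) auto
      then show ?thesis using config_bip_pos[of A B \<kappa>] by (simp add: ln_mult)
    qed
    ultimately show ?thesis unfolding entropy_gap_def lnc using g_nonneg[of N] by linarith
  qed
  have "card (degree_class (links A B) (A \<union> B) \<kappa>) \<le> (\<Prod>t=1..card G. real t) / (\<Prod>i\<in>A \<union> B. fact (\<kappa> i))"
  proof (rule card_degree_class_le[OF E _ _ G])
    fix H \<kappa>' assume "H \<in> degree_class (links A B) (A \<union> B) \<kappa>'"
    then show "(\<Sum>e\<in>links A B. \<Prod>i\<in>e. real (\<kappa>' i)) \<le> real (card H) * real (card H)"
      unfolding prodsum using degree_class_bip_sums[OF AB] by simp
  qed simp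
  also have "\<dots> = config_bip A B \<kappa>"
    unfolding config_bip_def sums N_def[symmetric] by (simp add: fact_prod)
  finally have up: "ln (card (degree_class (links A B) (A \<union> B) \<kappa>)) \<le> ln (config_bip A B \<kappa>)"
    using pos by (subst ln_le_cancel_iff) (auto simp: config_bip_pos)
  show "\<exists>p. feasible (links A B) (A \<union> B) \<kappa> p \<and>
      (\<Sum>i\<in>A \<union> B. g (\<kappa> i)) - g (card G) - real (m * m') \<le> entropy_gap (links A B) (A \<union> B) \<kappa> p"
  proof (cases "N = 0")
    case True
    then have "\<kappa> i = 0" if "i \<in> A \<union> B" for i using tot that AB by simp
    then have "(\<Sum>i\<in>A \<union> B. g (\<kappa> i)) = 0" by (intro sum.neutral) auto
    moreover obtain p where "feasible (links A B) (A \<union> B) \<kappa> p" "0 \<le> entropy_gap (links A B) (A \<union> B) \<kappa> p"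
      using exists_feasible_gap_nonneg[OF E'(2), of "A \<union> B" \<kappa>] G by blast
    moreover have "0 \<le> g (card G)" "0 \<le> real (m * m')" by (auto simp: g_nonneg)
    ultimately have "(\<Sum>i\<in>A \<union> B. g (\<kappa> i)) - g (card G) - real (m * m') \<le> entropy_gap (links A B) (A \<union> B) \<kappa> p"
      by linarith
    then show ?thesis using \<open>feasible (links A B) (A \<union> B) \<kappa> p\<close> by blast
  next
    case False
    define p where "p = (\<lambda>e. (\<Prod>i\<in>e. real (\<kappa> i)) * (1 / N))"
    have pval: "p {i, j} = real (\<kappa> i) * \<kappa> j / N" if "i \<noteq> j" for i j using that by (simp add: p_def)
    have pb: "0 \<le> p e" "p e \<le> real (m * m') / N" if eE: "e \<in> links A B" for e
    proof -
      obtain i j where e: "e = {i, j}" "i \<in> A" "j \<in> B" "i \<noteq> j" using eE by (rule linksE)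
      show "0 \<le> p e" by (auto simp: p_def intro!: divide_nonneg_nonneg prod_nonneg)
      have "\<kappa> i * \<kappa> j \<le> m * m'" using m(1)[OF e(2)] m(2)[OF e(3)] by (rule mult_le_mono)
      then have "real (\<kappa> i * \<kappa> j) / N \<le> real (m * m') / N" by (intro divide_right_mono of_nat_mono) auto
      then show "p e \<le> real (m * m') / N" using pval[OF e(4)] e(1) by simp
    qed
    have mM: "real (m * m') / N \<le> 1"
    proof -
      have "m * m' \<le> N" using M by (simp add: N_def)
      then show ?thesis using False by (simp add: divide_le_eq flip: of_nat_mult)
    qed
    have nb: "(\<Sum>e | e \<in> links A B \<and> i \<in> e. p e) = (\<Sum>j\<in>nbrs (links A B) i. p {i, j})" for i
      by (rule sum_incident[OF E'(3)])
    have feas: "feasible (links A B) (A \<union> B) \<kappa> p"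
      unfolding feasible_def
    proof (intro conjI ballI)
      show "0 \<le> p e" "p e \<le> 1" if "e \<in> links A B" for e using pb[OF that] mM by linarith+
      fix i assume i: "i \<in> A \<union> B"
      consider "i \<in> A" | "i \<in> B" using i by auto
      then show "(\<Sum>e | e \<in> links A B \<and> i \<in> e. p e) = real (\<kappa> i)"
      proof cases
        case 1
        have "(\<Sum>j\<in>B. p {i, j}) = (\<Sum>j\<in>B. real (\<kappa> i) / N * \<kappa> j)"
          using 1 AB(3) by (intro sum.cong refl) (subst pval, auto)
        also have "\<dots> = real (\<kappa> i) / N * real (\<Sum>j\<in>B. \<kappa> j)" by (simp add: sum_distrib_left)
        finally show ?thesis unfolding nb nbrs_links_left[OF AB(3) 1] sums using False by simp
      next
        case 2
        have "(\<Sum>j\<in>A. p {i, j}) = (\<Sum>j\<in>A. real (\<kappa> i) / N * \<kappa> j)"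
          using 2 AB(3) by (intro sum.cong refl) (subst pval, auto)
        also have "\<dots> = real (\<kappa> i) / N * real (\<Sum>j\<in>A. \<kappa> j)" by (simp add: sum_distrib_left)
        finally show ?thesis unfolding nb nbrs_links_right[OF AB(3) 2] sums using False by simp
      qed
    qed
    have "- (\<Sum>i\<in>A \<union> B. \<kappa> i * ln (real (\<kappa> i))) - N * ln (1 / N) + N - real (m * m') / N * N
        \<le> (\<Sum>e\<in>links A B. binary_entropy (p e))"
      by (rule sum_binary_entropy_ge[OF E feas tot]) (use pb False in \<open>auto simp: p_def\<close>)
    then have "- (\<Sum>i\<in>A \<union> B. \<kappa> i * ln (real (\<kappa> i))) + N * ln N + N - real (m * m')
        \<le> (\<Sum>e\<in>links A B. binary_entropy (p e))"
      using False by (simp add: ln_div)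
    then have "(\<Sum>i\<in>A \<union> B. g (\<kappa> i)) - g (card G) - real (m * m') \<le> entropy_gap (links A B) (A \<union> B) \<kappa> p"
      unfolding entropy_gap_def N_def[symmetric] using up lnc by linarith
    then show ?thesis using feas by blast
  qed
qed

text \<open>Within a layer the missing diagonal spoils \<open>\<kappa> i * \<kappa> j / L\<close>.
  Probabilities \<open>x i * x j\<close> have the right means if
  \<open>x i * (X - x i) = \<kappa> i\<close>, where \<open>X\<close> is the sum of the weights. For
  given \<open>X\<close> one takes the smaller root \<open>y X i\<close>, and then seeks a fixed
  point of the map from \<open>X\<close> to the sum of the roots.\<close>

lemma exists_self_weights:
  fixes m :: nat
  assumes A: "finite A" and m: "\<And>i. i \<in> A \<Longrightarrow> \<kappa> i \<le> m"
    and L: "L = real (\<Sum>i\<in>A. \<kappa> i)" "0 < L" "4 * (real m)\<^sup>2 \<le> L"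
  shows "\<exists>X x. sqrt L \<le> X \<and> (\<Sum>i\<in>A. x i) = X \<and>
    (\<forall>i\<in>A. x i * (X - x i) = \<kappa> i \<and> 0 \<le> x i \<and> x i \<le> X / 2 \<and> x i \<le> 2 * \<kappa> i / X)"
proof -
  define y where "y = (\<lambda>X i. (X - sqrt (X\<^sup>2 - 4 * real (\<kappa> i))) / 2)"
  \<comment> \<open>For natural numbers \<open>\<kappa> i \<le> m\<close> implies
    \<open>\<kappa> i \<le> m\<^sup>2\<close>, so \<open>4 * m\<^sup>2 \<le> L\<close> keeps the
    discriminant nonnegative.\<close>
  have disc: "0 \<le> X\<^sup>2 - 4 * real (\<kappa> i)" if "sqrt L \<le> X" "i \<in> A" for X i
  proof -
    have "\<kappa> i \<le> m * m" using m[OF that(2)] by (cases m) auto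
    then have "real (\<kappa> i) \<le> (real m)\<^sup>2" unfolding power2_eq_square by (simp only: of_nat_le_iff flip: of_nat_mult)
    moreover have "L \<le> X\<^sup>2" using that(1) L(2) by (meson less_imp_le real_sqrt_le_iff sqrt_le_D)
    ultimately show ?thesis using L(3) by linarith
  qed
  have props: "y X i * (X - y X i) = \<kappa> i" "0 \<le> y X i" "y X i \<le> X / 2" "y X i \<le> 2 * \<kappa> i / X" "\<kappa> i / X \<le> y X i"
    if X: "sqrt L \<le> X" and i: "i \<in> A" for X i
  proof -
    have X0: "0 < X" using X L(2) by (meson less_le_trans real_sqrt_gt_zero)
    define s where "s = sqrt (X\<^sup>2 - 4 * real (\<kappa> i))"
    have s: "s\<^sup>2 = X\<^sup>2 - 4 * real (\<kappa> i)" "0 \<le> s" using disc[OF X i] by (auto simp: s_def)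
    have "s \<le> sqrt (X\<^sup>2)" unfolding s_def by (intro real_sqrt_le_mono) simp
    then have sX: "s \<le> X" using X0 by simp
    have y: "y X i = (X - s) / 2" by (simp add: y_def s_def)
    show 1: "y X i * (X - y X i) = \<kappa> i" unfolding y using s(1) by (simp add: field_simps power2_eq_square)
    show 2: "0 \<le> y X i" "y X i \<le> X / 2" unfolding y using sX s(2) by auto
    have "y X i * (X / 2) \<le> y X i * (X - y X i)" using 2 by (intro mult_left_mono) auto
    then show "y X i \<le> 2 * \<kappa> i / X" unfolding 1 using X0 by (simp add: field_simps)
    have "y X i * (X - y X i) \<le> y X i * X" using 2 by (intro mult_left_mono) auto
    then show "\<kappa> i / X \<le> y X i" unfolding 1 using X0 by (simp add: field_simps)
  qed
  have sqrtL: "0 < sqrt L" using L(2) by simp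
  \<comment> \<open>The roots lie between \<open>\<kappa> i / X\<close> and
    \<open>2 * \<kappa> i / X\<close>, so their sum is at least \<open>X\<close> at
    \<open>sqrt L\<close> and at most \<open>X\<close> at \<open>sqrt (2 * L)\<close>.\<close>
  have "\<exists>X\<ge>sqrt L. X \<le> sqrt (2 * L) \<and> (\<Sum>i\<in>A. y X i) - X = 0"
  proof (rule IVT2')
    have "(\<Sum>i\<in>A. y (sqrt (2 * L)) i) \<le> (\<Sum>i\<in>A. 2 * \<kappa> i / sqrt (2 * L))"
      using L(2) by (intro sum_mono props(4)) auto
    also have "\<dots> = 2 * L / sqrt (2 * L)" unfolding L(1) by (simp add: sum_distrib_left sum_divide_distrib)
    also have "\<dots> = sqrt (2 * L)" using L(2) by (simp add: real_div_sqrt)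
    finally show "(\<Sum>i\<in>A. y (sqrt (2 * L)) i) - sqrt (2 * L) \<le> 0" by simp
    have "L / sqrt L = (\<Sum>i\<in>A. \<kappa> i / sqrt L)" unfolding L(1) by (simp add: sum_divide_distrib)
    also have "\<dots> \<le> (\<Sum>i\<in>A. y (sqrt L) i)" by (intro sum_mono props(5)) auto
    finally show "0 \<le> (\<Sum>i\<in>A. y (sqrt L) i) - sqrt L" using L(2) by (simp add: real_div_sqrt)
    show "sqrt L \<le> sqrt (2 * L)" using L(2) by simp
    show "continuous_on {sqrt L..sqrt (2 * L)} (\<lambda>X. (\<Sum>i\<in>A. y X i) - X)"
      unfolding y_def by (intro continuous_intros) auto
  qed
  then obtain X where X: "sqrt L \<le> X" "(\<Sum>i\<in>A. y X i) = X" by auto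
  then show ?thesis using props[OF X(1)] by blast
qed

text \<open>The product of the odd numbers up to \<open>2 * M - 1\<close> is
  \<open>fact (2 * M) / (2 ^ M * fact M)\<close>, so the Stirling corrections nearly cancel:
  \<open>g (2 * M) - g M\<close> lies between 0 and 1.\<close>

lemma ln_config_self:
  assumes A: "finite A" and S: "(\<Sum>i\<in>A. \<kappa> i) = 2 * M"
  shows "ln (config_self A \<kappa>) = g (2 * M) - g M + M * ln (real (2 * M)) + M
    - (\<Sum>i\<in>A. g (\<kappa> i)) - (\<Sum>i\<in>A. \<kappa> i * ln (\<kappa> i))"
proof -
  have dfact: "(\<Prod>t=1..M. 2 * real t - 1) * (2 ^ M * fact M) = fact (2 * M)" for M
  proof (induction M)
    case (Suc M)
    have "(\<Prod>t=1..Suc M. 2 * real t - 1) * (2 ^ Suc M * fact (Suc M))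
        = ((\<Prod>t=1..M. 2 * real t - 1) * (2 ^ M * fact M)) * ((2 * real M + 1) * (2 * (real M + 1)))"
      by (simp add: algebra_simps)
    also have "\<dots> = fact (2 * Suc M)" unfolding Suc by (simp add: algebra_simps)
    finally show ?case .
  qed simp
  have pos: "0 < (\<Prod>t=1..M. 2 * real t - 1)" by (intro prod_pos) auto
  have "ln (fact (2 * M)) = ln (\<Prod>t=1..M. 2 * real t - 1) + M * ln 2 + ln (fact M)"
    unfolding dfact[symmetric] using pos by (simp add: ln_mult ln_realpow)
  then have lnp: "ln (\<Prod>t=1..M. 2 * real t - 1) = g (2 * M) - g M + M * ln (real (2 * M)) - M"
    by (cases "M = 0") (auto simp: ln_fact_eq ln_mult algebra_simps)
  have S': "(\<Sum>i\<in>A. real (\<kappa> i)) = 2 * real M" using S by (metis of_nat_mult of_nat_numeral of_nat_sum)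
  have "ln (config_self A \<kappa>) = ln (\<Prod>t=1..M. 2 * real t - 1) - ln (\<Prod>i\<in>A. fact (\<kappa> i))"
    unfolding config_self_def S using pos by (subst ln_divide_pos) (auto intro!: prod_pos)
  also have "ln (\<Prod>i\<in>A. fact (\<kappa> i) :: real) = (\<Sum>i\<in>A. ln (fact (\<kappa> i)))"
    using A by (intro ln_prod) auto
  finally show ?thesis using S' lnp by (simp add: ln_fact_eq sum.distrib sum_subtractf)
qed

text \<open>Twice the sum is the square of the total degree minus the sum of the squared degrees,
  and these dominate the degrees themselves. The result fits the factor \<open>2 * t - 1\<close> of
  the configuration count exactly.\<close>

lemma sum_prod_links_self_le:
  fixes \<kappa> :: "'a \<Rightarrow> nat"
  assumes A: "finite A" and S: "(\<Sum>i\<in>A. \<kappa> i) = 2 * M"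
  shows "(\<Sum>e\<in>links A A. \<Prod>i\<in>e. real (\<kappa> i)) \<le> M * (2 * real M - 1)"
proof -
  have S': "(\<Sum>i\<in>A. real (\<kappa> i)) = 2 * real M" using S by (metis of_nat_mult of_nat_numeral of_nat_sum)
  have "2 * (\<Sum>e\<in>links A A. \<Prod>i\<in>e. real (\<kappa> i)) = (\<Sum>i\<in>A. \<Sum>j\<in>A - {i}. real (\<kappa> i) * \<kappa> j)"
    unfolding sum_links_self[OF A]
  proof (intro sum.cong refl)
    fix i j assume "i \<in> A" "j \<in> A - {i}"
    then have "i \<noteq> j" by auto
    then show "(\<Prod>i\<in>{i, j}. real (\<kappa> i)) = real (\<kappa> i) * \<kappa> j" by simp
  qed
  also have "\<dots> = (\<Sum>i\<in>A. (\<Sum>j\<in>A. real (\<kappa> i) * \<kappa> j) - real (\<kappa> i) * \<kappa> i)"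
    using A by (intro sum.cong refl) (simp add: sum_diff1)
  also have "\<dots> \<le> (\<Sum>i\<in>A. (\<Sum>j\<in>A. real (\<kappa> i) * \<kappa> j) - real (\<kappa> i))"
  proof (intro sum_mono diff_left_mono)
    fix i
    show "real (\<kappa> i) \<le> real (\<kappa> i) * \<kappa> i" by (cases "\<kappa> i") auto
  qed
  also have "\<dots> = 2 * (M * (2 * real M - 1))"
    by (simp add: sum_subtractf S' flip: sum_distrib_left sum_distrib_right) (simp add: algebra_simps)
  finally show ?thesis by simp
qed

text \<open>In the upper bound 80 combines 64 and 16 from the count. In the lower bound
  \<open>2 * m\<^sup>2\<close> stems from the squared probabilities, \<open>4 * m\<close> from
  replacing the weights by \<open>\<kappa> i / sqrt L\<close>, and 1 from
  \<open>g (2 * M) - g M\<close>. If the total degree is below \<open>4 * m\<^sup>2\<close>, so is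
  the sum of the \<open>g (\<kappa> i)\<close>, and a nonnegative gap suffices.\<close>

lemma entropy_gap_self:
  fixes m :: nat and n :: real
  assumes A: "finite A" and G: "G \<in> degree_class (links A A) A \<kappa>" and m: "\<And>i. i \<in> A \<Longrightarrow> \<kappa> i \<le> m" "1 \<le> m"
    and n: "1 \<le> n" "16 * (real m)\<^sup>2 \<le> n"
  shows "feasible (links A A) A \<kappa> p \<Longrightarrow> entropy_gap (links A A) A \<kappa> p
      \<le> (\<Sum>i\<in>A. g (\<kappa> i)) + (80 * (real m)\<^sup>2 + 360 * ln (2 * card G) + sparse_loss n (16 * (real m)\<^sup>2))"
    and "\<exists>p. feasible (links A A) A \<kappa> p \<and>
      (\<Sum>i\<in>A. g (\<kappa> i)) - (1 + 6 * (real m)\<^sup>2) \<le> entropy_gap (links A A) A \<kappa> p"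
proof -
  define M where "M = card G"
  have E: "is_link_set A (links A A)" using is_link_set_links[OF A A] by simp
  note E' = is_link_setD[OF E]
  have S: "(\<Sum>i\<in>A. \<kappa> i) = 2 * M" using degree_class_card[OF E G] by (simp add: M_def)
  note lnc = ln_config_self[OF A S]
  have pos: "0 < card (degree_class (links A A) A \<kappa>)" using G E'(2) by (auto simp: card_gt_0_iff)
  have gM: "0 \<le> g (2 * M) - g M" "g (2 * M) - g M \<le> 1"
  proof -
    show "0 \<le> g (2 * M) - g M" using g_mono[of M "2 * M"] by simp
    have "g (M + M) - g M \<le> M / Suc M" by (rule g_diff_le)
    also have "\<dots> \<le> 1" by simp
    finally show "g (2 * M) - g M \<le> 1" by (simp add: mult_2)
  qed
  show "entropy_gap (links A A) A \<kappa> p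
      \<le> (\<Sum>i\<in>A. g (\<kappa> i)) + (80 * (real m)\<^sup>2 + 360 * ln (2 * card G) + sparse_loss n (16 * (real m)\<^sup>2))"
    if p: "feasible (links A A) A \<kappa> p"
  proof -
    have "(\<Sum>e\<in>links A A. binary_entropy (p e)) \<le> - (\<Sum>i\<in>A. \<kappa> i * ln (\<kappa> i)) + M * ln (real (2 * M)) + M"
    proof (rule sum_binary_entropy_le[OF E p S])
      have "real M * (2 * real M - 1) \<le> real M * (2 * real M)" by (intro mult_left_mono) auto
      then show "(\<Sum>e\<in>links A A. \<Prod>i\<in>e. real (\<kappa> i)) \<le> real (2 * M) * real M"
        using sum_prod_links_self_le[OF A S] by (simp add: mult.commute)
    qed auto
    moreover have "ln (config_self A \<kappa>) - (80 * (real m)\<^sup>2 + 360 * ln (2 * card G) + sparse_loss n (16 * (real m)\<^sup>2))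
      \<le> ln (card (degree_class (links A A) A \<kappa>))"
    proof (cases "M = 0")
      case True
      then have "\<kappa> i = 0" if "i \<in> A" for i using S A that by simp
      then have "config_self A \<kappa> = 1" by (simp add: config_self_def)
      moreover have "0 \<le> sparse_loss n (16 * (real m)\<^sup>2)"
        using sparse_loss_mono[of 0 "16 * (real m)\<^sup>2" n] n by simp
      moreover have "0 \<le> ln (real (card (degree_class (links A A) A \<kappa>)))" using pos by simp
      ultimately show ?thesis using True by (simp add: M_def) (smt (verit) zero_le_power2)
    next
      case False
      define W where "W = 80 * (real m)\<^sup>2 + 360 * ln (2 * card G) + sparse_loss n (16 * (real m)\<^sup>2)"
      have "config_self A \<kappa> * exp (- W) \<le> card (degree_class (links A A) A \<kappa>)"
        using card_self_ge_config[OF A G m n] False by (simp add: W_def M_def algebra_simps)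
      then have "ln (config_self A \<kappa> * exp (- W)) \<le> ln (card (degree_class (links A A) A \<kappa>))"
        using config_self_pos[of A \<kappa>] pos by (subst ln_le_cancel_iff) auto
      then show ?thesis using config_self_pos[of A \<kappa>] by (simp add: ln_mult W_def)
    qed
    ultimately show ?thesis unfolding entropy_gap_def lnc using gM by linarith
  qed
  have "card (degree_class (links A A) A \<kappa>) \<le> (\<Prod>t=1..card G. \<bar>2 * real t - 1\<bar>) / (\<Prod>i\<in>A. fact (\<kappa> i))"
  proof (rule card_degree_class_le[OF E _ _ G])
    fix H \<kappa>' assume H: "H \<in> degree_class (links A A) A \<kappa>'" "H \<noteq> {}"
    have "finite H" using degree_classD(1)[OF H(1)] E'(2) by (rule finite_subset)
    then have "0 < card H" using H(2) by (simp add: card_gt_0_iff)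
    then have "\<bar>2 * real (card H) - 1\<bar> = 2 * real (card H) - 1" by simp
    then show "(\<Sum>e\<in>links A A. \<Prod>i\<in>e. real (\<kappa>' i)) \<le> real (card H) * \<bar>2 * real (card H) - 1\<bar>"
      using sum_prod_links_self_le[OF A degree_class_card[OF E H(1)]] by simp
  qed simp
  also have "(\<Prod>t=1..card G. \<bar>2 * real t - 1\<bar>) = (\<Prod>t=1..card G. 2 * real t - 1)"
    by (intro prod.cong) auto
  also have "\<dots> / (\<Prod>i\<in>A. fact (\<kappa> i)) = config_self A \<kappa>"
    unfolding config_self_def S M_def by simp
  finally have up: "ln (card (degree_class (links A A) A \<kappa>)) \<le> ln (config_self A \<kappa>)"
    using pos by (subst ln_le_cancel_iff) (auto simp: config_self_pos)
  define L where "L = real (\<Sum>i\<in>A. \<kappa> i)"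
  show "\<exists>p. feasible (links A A) A \<kappa> p \<and>
      (\<Sum>i\<in>A. g (\<kappa> i)) - (1 + 6 * (real m)\<^sup>2) \<le> entropy_gap (links A A) A \<kappa> p"
  proof (cases "4 * (real m)\<^sup>2 \<le> L")
    case False
    have "(\<Sum>i\<in>A. g (\<kappa> i)) \<le> L" unfolding L_def of_nat_sum by (intro sum_mono g_le_self)
    moreover obtain p where "feasible (links A A) A \<kappa> p" "0 \<le> entropy_gap (links A A) A \<kappa> p"
      using exists_feasible_gap_nonneg[OF E'(2), of A \<kappa>] G by blast
    moreover have "0 \<le> (real m)\<^sup>2" by simp
    ultimately have "(\<Sum>i\<in>A. g (\<kappa> i)) - (1 + 6 * (real m)\<^sup>2) \<le> entropy_gap (links A A) A \<kappa> p"
      using False by linarith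
    then show ?thesis using \<open>feasible (links A A) A \<kappa> p\<close> by blast
  next
    case True
    have "1 \<le> (real m)\<^sup>2" using m(2) by simp
    then have L0: "0 < L" using True by linarith
    have LM: "L = 2 * M" unfolding L_def S by simp
    have "\<exists>(X :: real) (x :: 'a \<Rightarrow> real). sqrt L \<le> X \<and> (\<Sum>i\<in>A. x i) = X \<and>
      (\<forall>i\<in>A. x i * (X - x i) = \<kappa> i \<and> 0 \<le> x i \<and> x i \<le> X / 2 \<and> x i \<le> 2 * \<kappa> i / X)"
      by (rule exists_self_weights[OF A m(1) L_def L0 True])
    then obtain X :: real and x :: "'a \<Rightarrow> real" where X: "sqrt L \<le> X" "(\<Sum>i\<in>A. x i) = X"
      and x: "\<And>i. i \<in> A \<Longrightarrow> x i * (X - x i) = \<kappa> i" "\<And>i. i \<in> A \<Longrightarrow> 0 \<le> x i"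
        "\<And>i. i \<in> A \<Longrightarrow> x i \<le> X / 2" "\<And>i. i \<in> A \<Longrightarrow> x i \<le> 2 * \<kappa> i / X"
      by blast
    have X0: "0 < X" using X(1) L0 by (meson less_le_trans real_sqrt_gt_zero)
    have X2: "L \<le> X\<^sup>2" using X(1) L0 by (meson less_imp_le real_sqrt_le_iff sqrt_le_D)
    define p where "p = (\<lambda>e. (\<Prod>i\<in>e. x i) * 1)"
    have xm: "x i \<le> 2 * m / X" if "i \<in> A" for i
    proof -
      have "2 * real (\<kappa> i) / X \<le> 2 * m / X" using m(1)[OF that] X0 by (intro divide_right_mono) auto
      then show ?thesis using x(4)[OF that] by linarith
    qed
    have pb: "0 \<le> p e" "p e \<le> 4 * (real m)\<^sup>2 / L" if eE: "e \<in> links A A" for e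
    proof -
      obtain i j where e: "e = {i, j}" "i \<in> A" "j \<in> A" "i \<noteq> j" using eE by (rule linksE)
      have pe: "p e = x i * x j" using e by (simp add: p_def)
      show "0 \<le> p e" unfolding pe using x(2) e by simp
      have "p e \<le> (2 * m / X) * (2 * m / X)"
        unfolding pe using xm[OF e(2)] xm[OF e(3)] x(2)[OF e(2)] x(2)[OF e(3)] by (intro mult_mono) auto
      also have "\<dots> = 4 * (real m)\<^sup>2 / X\<^sup>2" by (simp add: power2_eq_square)
      also have "\<dots> \<le> 4 * (real m)\<^sup>2 / L" using X2 L0 X0 by (intro divide_left_mono) auto
      finally show "p e \<le> 4 * (real m)\<^sup>2 / L" .
    qed
    have b1: "4 * (real m)\<^sup>2 / L \<le> 1" using True L0 by simp
    have feas: "feasible (links A A) A \<kappa> p"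
      unfolding feasible_def
    proof (intro conjI ballI)
      show "0 \<le> p e" "p e \<le> 1" if "e \<in> links A A" for e using pb[OF that] b1 by linarith+
      fix i assume i: "i \<in> A"
      have "(\<Sum>e | e \<in> links A A \<and> i \<in> e. p e) = (\<Sum>j\<in>A - {i}. p {i, j})"
        unfolding nbrs_links_self[OF i, symmetric] by (rule sum_incident[OF E'(3)])
      also have "\<dots> = (\<Sum>j\<in>A - {i}. x i * x j)" by (intro sum.cong) (auto simp: p_def)
      also have "\<dots> = x i * ((\<Sum>j\<in>A. x j) - x i)"
        using A i by (simp add: sum_diff1 flip: sum_distrib_left)
      finally show "(\<Sum>e | e \<in> links A A \<and> i \<in> e. p e) = real (\<kappa> i)" unfolding X(2) x(1)[OF i] .
    qed
    have h1: "- (\<Sum>i\<in>A. \<kappa> i * ln (x i)) - M * ln 1 + M - 4 * (real m)\<^sup>2 / L * M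
        \<le> (\<Sum>e\<in>links A A. binary_entropy (p e))"
      by (rule sum_binary_entropy_ge[OF E feas S]) (use pb in \<open>auto simp: p_def\<close>)
    have "4 * (real m)\<^sup>2 / L * M = 2 * (real m)\<^sup>2" using L0 by (simp add: LM)
    with h1 have "- (\<Sum>i\<in>A. \<kappa> i * ln (x i)) + M - 2 * (real m)\<^sup>2 \<le> (\<Sum>e\<in>links A A. binary_entropy (p e))"
      by (simp only: ln_one mult_zero_right diff_0_right)
    moreover have "- (\<Sum>i\<in>A. \<kappa> i * ln (\<kappa> i)) + M * ln (real (2 * M)) - 4 * m \<le> - (\<Sum>i\<in>A. \<kappa> i * ln (x i))"
    proof -
      have "(\<Sum>i\<in>A. \<kappa> i * ln (x i)) \<le> (\<Sum>i\<in>A. \<kappa> i * ln (\<kappa> i) - \<kappa> i * (ln L / 2 - 4 * m / L))"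
      proof (rule sum_mono)
        fix i assume i: "i \<in> A"
        show "\<kappa> i * ln (x i) \<le> \<kappa> i * ln (\<kappa> i) - \<kappa> i * (ln L / 2 - 4 * m / L)"
        proof (cases "\<kappa> i = 0")
          case False
          then have xi: "0 < x i" using x(1)[OF i] x(2)[OF i] by (cases "x i = 0") auto
          have d: "0 < X - x i" using x(3)[OF i] X0 by linarith
          have y: "x i / X \<le> 1 / 2" "0 \<le> x i / X" "x i / X \<le> 2 * m / L"
          proof -
            show "x i / X \<le> 1 / 2" "0 \<le> x i / X" using x(3)[OF i] xi X0 by (auto simp: field_simps)
            have "x i / X \<le> (2 * m / X) / X" using xm[OF i] X0 by (intro divide_right_mono) auto
            also have "\<dots> = 2 * m / X\<^sup>2" by (simp add: power2_eq_square)
            also have "\<dots> \<le> 2 * m / L" using X2 L0 X0 by (intro divide_left_mono) auto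
            finally show "x i / X \<le> 2 * m / L" .
          qed
          \<comment> \<open>Since \<open>x i = \<kappa> i / (X * (1 - r))\<close>, the error against
            \<open>\<kappa> i / X\<close> in the logarithm is \<open>- ln (1 - r)\<close>, at most
            \<open>2 * r\<close> for \<open>r \<le> 1 / 2\<close>.\<close>
          define r where "r = x i / X"
          have r: "r \<le> 1 / 2" "0 \<le> r" "r \<le> 2 * m / L" using y by (simp_all add: r_def)
          have "ln (1 / (1 - r)) \<le> 1 / (1 - r) - 1" using r by (intro ln_le_minus_one) auto
          also have "\<dots> = r / (1 - r)" using r by (simp add: field_simps)
          also have "\<dots> \<le> r / (1 / 2)" using r by (intro divide_left_mono) auto
          also have "\<dots> \<le> 4 * m / L" using r(3) by simp
          finally have "- ln (1 - r) \<le> 4 * m / L" using r by (simp add: ln_div)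
          moreover have "X - x i = X * (1 - r)" using X0 by (simp add: r_def field_simps)
          then have "ln (X - x i) = ln X + ln (1 - r)"
            using X0 r by (simp add: ln_mult)
          moreover have "ln L / 2 \<le> ln X"
          proof -
            have "ln L \<le> ln (X\<^sup>2)" using X2 L0 X0 by (subst ln_le_cancel_iff) auto
            then show ?thesis using X0 by (simp add: ln_realpow)
          qed
          ultimately have "ln L / 2 - 4 * m / L \<le> ln (X - x i)" by linarith
          moreover have "ln (\<kappa> i) = ln (x i) + ln (X - x i)"
            unfolding x(1)[OF i, symmetric] using xi d by (rule ln_mult_pos)
          ultimately have "ln (x i) \<le> ln (\<kappa> i) - (ln L / 2 - 4 * m / L)" by linarith
          then have "\<kappa> i * ln (x i) \<le> \<kappa> i * (ln (\<kappa> i) - (ln L / 2 - 4 * m / L))" by (intro mult_left_mono) auto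
          then show ?thesis by (simp add: right_diff_distrib)
        qed simp
      qed
      also have "\<dots> = (\<Sum>i\<in>A. \<kappa> i * ln (\<kappa> i)) - L * (ln L / 2 - 4 * m / L)"
        unfolding L_def by (simp add: sum_subtractf sum_distrib_right)
      also have "L * (ln L / 2 - 4 * m / L) = M * ln (real (2 * M)) - 4 * m"
        using L0 by (simp add: LM algebra_simps)
      finally show ?thesis by linarith
    qed
    moreover have "real m \<le> (real m)\<^sup>2" using m(2) by (simp add: power2_eq_square)
    ultimately have "(\<Sum>i\<in>A. g (\<kappa> i)) - (1 + 6 * (real m)\<^sup>2) \<le> entropy_gap (links A A) A \<kappa> p"
      unfolding entropy_gap_def using up[unfolded lnc] gM(2) by linarith
    then show ?thesis using feas by blast
  qed
qed

text \<open>Each constrained node is the centre of a star of \<open>N\<close> possible links, and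
  the stars are independent. The count is a product of binomial coefficients, and by concavity
  constant probabilities \<open>\<kappa> i / N\<close> on each star are best, so both bounds
  coincide.\<close>

lemma entropy_gap_one_sided:
  assumes AB: "finite A" "finite B" "A \<inter> B = {}" and N: "N = card B" "0 < N"
    and G: "G \<in> degree_class (links A B) A \<kappa>"
  shows "feasible (links A B) A \<kappa> p \<Longrightarrow>
      entropy_gap (links A B) A \<kappa> p \<le> (\<Sum>i\<in>A. g (\<kappa> i) - (g N - g (N - \<kappa> i)))"
    and "\<exists>p. feasible (links A B) A \<kappa> p \<and>
      (\<Sum>i\<in>A. g (\<kappa> i) - (g N - g (N - \<kappa> i))) \<le> entropy_gap (links A B) A \<kappa> p"
proof -
  note E = is_link_set_links[OF AB(1,2)]
  note E' = is_link_setD[OF E]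
  have star: "links A B = (\<Union>i\<in>A. links {i} B)" by (auto simp: links_def)
  have disj: "links {i} B \<inter> links {j} B = {}" if "i \<in> A" "j \<in> A" "i \<noteq> j" for i j
    using that AB(3) by (auto simp: links_def doubleton_eq_iff)
  have inc: "{e \<in> links A B. i \<in> e} = links {i} B" if "i \<in> A" for i
    using that AB(3) by (auto simp: links_def)
  have bij: "bij_betw (\<lambda>j. {i, j}) B (links {i} B)" if "i \<in> A" for i
    using that AB(3) by (auto simp: bij_betw_def inj_on_def links_def doubleton_eq_iff)
  have cardE: "card (links {i} B) = N" if "i \<in> A" for i
    using bij_betw_same_card[OF bij[OF that]] by (simp add: N)
  have finE: "finite (links {i} B)" if "i \<in> A" for i using E'(2) star that by (metis UN_upper finite_subset)
  have kN: "\<kappa> i \<le> N" if "i \<in> A" for i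
  proof -
    have "\<kappa> i = card {e \<in> G. i \<in> e}" using degree_classD(2)[OF G that] by (simp add: vdeg_def)
    also have "\<dots> \<le> card (links {i} B)"
      using degree_classD(1)[OF G] inc[OF that] finE[OF that] by (intro card_mono) auto
    finally show ?thesis by (simp add: cardE[OF that])
  qed
  have cardi: "card (degree_class (links {i} B) {i} \<kappa>) = N choose \<kappa> i" if "i \<in> A" for i
  proof -
    have "degree_class (links {i} B) {i} \<kappa> = {H. H \<subseteq> links {i} B \<and> card H = \<kappa> i}"
    proof -
      have "vdeg H i = card H" if "H \<subseteq> links {i} B" for H
      proof -
        have "{e \<in> H. i \<in> e} = H" using that by (auto simp: links_def)
        then show ?thesis by (simp add: vdeg_def)
      qed
      then show ?thesis by (auto simp: degree_class_def)
    qed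
    then show ?thesis using n_subsets[OF finE[OF that]] cardE[OF that] by simp
  qed
  have "degree_class (links A B) A \<kappa>
      = {G. G \<subseteq> (\<Union>i\<in>A. links {i} B) \<and> (\<forall>i\<in>A. G \<inter> links {i} B \<in> degree_class (links {i} B) {i} \<kappa>)}"
  proof -
    have "vdeg (H \<inter> links {i} B) i = vdeg H i" if "H \<subseteq> links A B" "i \<in> A" for H i
    proof -
      have "{e \<in> H \<inter> links {i} B. i \<in> e} = {e \<in> H. i \<in> e}" using that inc[OF that(2)] by auto
      then show ?thesis by (simp add: vdeg_def)
    qed
    then show ?thesis unfolding degree_class_def star[symmetric] by auto
  qed
  then have "card (degree_class (links A B) A \<kappa>) = (\<Prod>i\<in>A. card (degree_class (links {i} B) {i} \<kappa>))"
    using card_degree_class_UN[OF AB(1) disj, where V = "\<lambda>i. {i}" and \<kappa> = "\<lambda>_. \<kappa>"] by simp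
  also have "\<dots> = (\<Prod>i\<in>A. N choose \<kappa> i)" using cardi by simp
  finally have "ln (card (degree_class (links A B) A \<kappa>)) = ln (\<Prod>i\<in>A. real (N choose \<kappa> i))" by simp
  also have "\<dots> = (\<Sum>i\<in>A. ln (real (N choose \<kappa> i)))"
  proof (rule ln_prod[OF AB(1)])
    show "real (N choose \<kappa> i) \<noteq> 0" if "i \<in> A" for i using kN[OF that] by simp
  qed
  finally have lncard: "ln (card (degree_class (links A B) A \<kappa>)) = (\<Sum>i\<in>A. ln (real (N choose \<kappa> i)))" .
  \<comment> \<open>\<open>N\<close> times the binary entropy of \<open>k / N\<close>, the maximal
    entropy of one star.\<close>
  define H where "H = (\<lambda>k. - real k * ln (k / N) - (real N - k) * ln (1 - k / N))"
  have H: "H (\<kappa> i) - ln (real (N choose \<kappa> i)) = g (\<kappa> i) - (g N - g (N - \<kappa> i))" if i: "i \<in> A" for i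
  proof -
    have "real (N choose \<kappa> i) = fact N / (fact (\<kappa> i) * fact (N - \<kappa> i))"
      by (rule binomial_fact[OF kN[OF i]])
    then have "ln (real (N choose \<kappa> i)) = ln (fact N) - ln (fact (\<kappa> i)) - ln (fact (N - \<kappa> i))"
      by (simp add: ln_div ln_mult)
    moreover have "real (\<kappa> i) * ln (\<kappa> i / N) = \<kappa> i * ln (\<kappa> i) - \<kappa> i * ln N"
      using N(2) by (cases "\<kappa> i = 0") (auto simp: ln_div algebra_simps)
    moreover have "(real N - \<kappa> i) * ln (1 - \<kappa> i / N) = (real N - \<kappa> i) * ln (real N - \<kappa> i) - (real N - \<kappa> i) * ln N"
    proof -
      have "1 - \<kappa> i / N = (real N - \<kappa> i) / N" using N(2) by (simp add: field_simps)
      then show ?thesis unfolding \<open>1 - \<kappa> i / N = _\<close>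
        using N(2) by (cases "real N - \<kappa> i = 0") (auto simp: ln_div algebra_simps)
    qed
    moreover have "real (N - \<kappa> i) = real N - \<kappa> i" using kN[OF i] by (simp add: of_nat_diff)
    ultimately show ?thesis unfolding H_def ln_fact_eq by (simp add: algebra_simps)
  qed
  have split: "(\<Sum>e\<in>links A B. h e) = (\<Sum>i\<in>A. \<Sum>e\<in>links {i} B. h e)" for h :: "'a set \<Rightarrow> real"
    unfolding star using AB(1) finE disj by (intro sum.UNION_disjoint) auto
  have rhs: "(\<Sum>i\<in>A. g (\<kappa> i) - (g N - g (N - \<kappa> i))) = (\<Sum>i\<in>A. H (\<kappa> i)) - ln (card (degree_class (links A B) A \<kappa>))"
    unfolding lncard sum_subtractf[symmetric] using H by (intro sum.cong) auto
  have Hsum: "(\<Sum>e\<in>links {i} B. - p e * ln q - (1 - p e) * ln (1 - q)) = H (\<kappa> i)"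
    if p: "(\<Sum>e\<in>links {i} B. p e) = real (\<kappa> i)" and i: "i \<in> A" and q: "q = \<kappa> i / N" for i p q
  proof -
    have "(\<Sum>e\<in>links {i} B. - p e * ln q - (1 - p e) * ln (1 - q))
        = - (\<Sum>e\<in>links {i} B. p e) * ln q - (real (card (links {i} B)) - (\<Sum>e\<in>links {i} B. p e)) * ln (1 - q)"
      by (simp add: sum_subtractf sum_negf flip: sum_distrib_right)
    then show ?thesis by (simp add: p cardE[OF i] H_def q)
  qed
  show "entropy_gap (links A B) A \<kappa> p \<le> (\<Sum>i\<in>A. g (\<kappa> i) - (g N - g (N - \<kappa> i)))"
    if p: "feasible (links A B) A \<kappa> p"
  proof -
    have "(\<Sum>e\<in>links {i} B. binary_entropy (p e)) \<le> H (\<kappa> i)" if i: "i \<in> A" for i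
    proof -
      define q where "q = \<kappa> i / N"
      have q: "0 \<le> q" "q \<le> 1" using kN[OF i] N(2) by (auto simp: q_def)
      have ps: "(\<Sum>e\<in>links {i} B. p e) = real (\<kappa> i)" using p i by (simp add: feasible_def flip: inc[OF i])
      have p01: "0 \<le> p e" "p e \<le> 1" if "e \<in> links {i} B" for e
        using p that i star by (auto simp: feasible_def)
      have "p e = 0" if "q = 0" "e \<in> links {i} B" for e
      proof -
        have "(\<Sum>e\<in>links {i} B. p e) = 0" using ps that(1) N(2) by (simp add: q_def)
        then show ?thesis using sum_nonneg_eq_0_iff[OF finE[OF i]] p01 that(2) by auto
      qed
      moreover have "p e = 1" if "q = 1" "e \<in> links {i} B" for e
      proof -
        have "(\<Sum>e\<in>links {i} B. 1 - p e) = 0"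
          using ps that(1) N(2) cardE[OF i] by (simp add: q_def sum_subtractf)
        then show ?thesis using sum_nonneg_eq_0_iff[OF finE[OF i], of "\<lambda>e. 1 - p e"] p01 that(2) by auto
      qed
      ultimately have "(\<Sum>e\<in>links {i} B. binary_entropy (p e)) \<le> (\<Sum>e\<in>links {i} B. - p e * ln q - (1 - p e) * ln (1 - q))"
        using p01 q by (intro sum_mono binary_entropy_le_cross) auto
      then show ?thesis using Hsum[OF ps i q_def] by simp
    qed
    then show ?thesis unfolding rhs entropy_gap_def split by (simp add: sum_mono)
  qed
  define P where "P = (\<lambda>e. \<kappa> (THE i. i \<in> A \<and> i \<in> e) / real N)"
  have P: "P e = \<kappa> i / N" if "i \<in> A" "e \<in> links {i} B" for i e
  proof -
    have "(THE i. i \<in> A \<and> i \<in> e) = i" using that AB(3) by (intro the_equality) (auto simp: links_def)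
    then show ?thesis by (simp add: P_def)
  qed
  have Ps: "(\<Sum>e\<in>links {i} B. P e) = real (\<kappa> i)" if i: "i \<in> A" for i
    using P[OF i] cardE[OF i] N(2) by simp
  have "feasible (links A B) A \<kappa> P"
    unfolding feasible_def
  proof (intro conjI ballI)
    fix e assume "e \<in> links A B"
    then obtain i where "i \<in> A" "e \<in> links {i} B" using star by auto
    then show "0 \<le> P e" "P e \<le> 1" using P kN N(2) by auto
  next
    show "(\<Sum>e | e \<in> links A B \<and> i \<in> e. P e) = real (\<kappa> i)" if "i \<in> A" for i
      using Ps[OF that] by (simp add: inc[OF that])
  qed
  moreover have "(\<Sum>e\<in>links A B. binary_entropy (P e)) = (\<Sum>i\<in>A. H (\<kappa> i))"
    unfolding split
  proof (rule sum.cong[OF refl])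
    fix i assume i: "i \<in> A"
    have "(\<Sum>e\<in>links {i} B. binary_entropy (P e)) = (\<Sum>e\<in>links {i} B. - P e * ln (\<kappa> i / N) - (1 - P e) * ln (1 - \<kappa> i / N))"
      using P[OF i] by (intro sum.cong) (auto simp: binary_entropy_def ent_def)
    then show "(\<Sum>e\<in>links {i} B. binary_entropy (P e)) = H (\<kappa> i)" using Hsum[OF Ps[OF i] i refl] by simp
  qed
  ultimately show "\<exists>p. feasible (links A B) A \<kappa> p \<and>
      (\<Sum>i\<in>A. g (\<kappa> i) - (g N - g (N - \<kappa> i))) \<le> entropy_gap (links A B) A \<kappa> p"
    unfolding rhs entropy_gap_def by (intro exI[of _ P]) simp
qed

section \<open>Limits\<close>

definition empirical :: "'a set \<Rightarrow> ('a \<Rightarrow> nat) \<Rightarrow> nat \<Rightarrow> real" where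
  "empirical A \<kappa> j = (\<Sum>i\<in>A. of_bool (\<kappa> i = j)) / real (card A)"

lemma empirical_sums:
  assumes "finite A"
  shows "(\<lambda>j. empirical A \<kappa> j * w j) sums ((\<Sum>i\<in>A. w (\<kappa> i)) / card A)"
proof -
  have "(\<lambda>j. empirical A \<kappa> j * w j) sums (\<Sum>j\<in>\<kappa> ` A. empirical A \<kappa> j * w j)"
  proof (rule sums_finite)
    fix j assume j: "j \<notin> \<kappa> ` A"
    then have "(\<Sum>i\<in>A. of_bool (\<kappa> i = j)) = (0::real)" by (intro sum.neutral) auto
    then show "empirical A \<kappa> j * w j = 0" by (simp add: empirical_def)
  qed (use assms in simp)
  also have "(\<Sum>j\<in>\<kappa> ` A. empirical A \<kappa> j * w j)
      = (\<Sum>j\<in>\<kappa> ` A. \<Sum>i\<in>A. of_bool (\<kappa> i = j) * w (\<kappa> i) / card A)"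
  proof (rule sum.cong[OF refl])
    fix j
    have "(\<Sum>i\<in>A. of_bool (\<kappa> i = j) * w (\<kappa> i) / card A) = (\<Sum>i\<in>A. of_bool (\<kappa> i = j) * (w j / card A))"
      by (intro sum.cong) auto
    then show "empirical A \<kappa> j * w j = (\<Sum>i\<in>A. of_bool (\<kappa> i = j) * w (\<kappa> i) / card A)"
      by (simp add: empirical_def sum_distrib_right sum_divide_distrib)
  qed
  also have "\<dots> = (\<Sum>i\<in>A. \<Sum>j\<in>\<kappa> ` A. of_bool (\<kappa> i = j) * w (\<kappa> i) / card A)"
    by (rule sum.swap)
  also have "\<dots> = (\<Sum>i\<in>A. w (\<kappa> i) / card A)"
  proof (rule sum.cong[OF refl])
    fix i assume "i \<in> A"
    have "(\<Sum>j\<in>\<kappa> ` A. of_bool (\<kappa> i = j) * w (\<kappa> i) / card A)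
        = (\<Sum>j\<in>\<kappa> ` A. if j = \<kappa> i then w (\<kappa> i) / card A else 0)"
      by (intro sum.cong) auto
    then show "(\<Sum>j\<in>\<kappa> ` A. of_bool (\<kappa> i = j) * w (\<kappa> i) / card A) = w (\<kappa> i) / card A"
      using assms \<open>i \<in> A\<close> by (simp add: sum.delta)
  qed
  finally show ?thesis by (simp add: sum_divide_distrib)
qed

text \<open>The norm dominates the difference of the means of \<open>g\<close> as well as each
  weighted difference. The mass at 0 is invisible to it, since \<open>g 0 = 0\<close>; for this
  reason the last claim keeps the factor \<open>g j\<close>.\<close>

lemma l1g_norm_close:
  fixes f :: "nat pmf"
  assumes A: "finite A" and d: "l1g_norm (\<lambda>j. empirical A \<kappa> j - pmf f j) \<noteq> top"
  defines "\<delta> \<equiv> enn2real (l1g_norm (\<lambda>j. empirical A \<kappa> j - pmf f j))"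
  shows "summable (\<lambda>j. pmf f j * g j)"
    and "\<bar>(\<Sum>i\<in>A. g (\<kappa> i)) / card A - (\<Sum>j. pmf f j * g j)\<bar> \<le> \<delta>"
    and "\<bar>empirical A \<kappa> j * g j - pmf f j * g j\<bar> \<le> \<delta>"
proof -
  define a where "a = (\<lambda>j. empirical A \<kappa> j * g j)"
  define b where "b = (\<lambda>j. pmf f j * g j)"
  have ab: "\<bar>empirical A \<kappa> j - pmf f j\<bar> * g j = \<bar>a j - b j\<bar>" for j
    by (simp add: a_def b_def g_nonneg abs_mult flip: left_diff_distrib)
  have l1: "l1g_norm (\<lambda>j. empirical A \<kappa> j - pmf f j) = (\<Sum>j. ennreal \<bar>a j - b j\<bar>)"
    by (simp add: l1g_norm_def ab)
  have sumab: "summable (\<lambda>j. \<bar>a j - b j\<bar>)"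
    using d unfolding l1 by (intro summable_suminf_not_top) auto
  then have \<delta>: "\<delta> = (\<Sum>j. \<bar>a j - b j\<bar>)"
    unfolding \<delta>_def l1 by (subst suminf_ennreal2) (use sumab in \<open>auto simp: suminf_nonneg\<close>)
  have suma: "a sums ((\<Sum>i\<in>A. g (\<kappa> i)) / card A)" unfolding a_def by (rule empirical_sums[OF A])
  have a0: "0 \<le> a j" for j by (auto simp: a_def empirical_def g_nonneg intro!: mult_nonneg_nonneg divide_nonneg_nonneg sum_nonneg)
  have "summable (\<lambda>j. a j + \<bar>a j - b j\<bar>)" using suma sumab by (intro summable_add) (auto simp: sums_iff)
  then have sumb: "summable b"
  proof (rule summable_comparison_test')
    fix j :: nat assume "0 \<le> j"
    have "0 \<le> b j" by (simp add: b_def g_nonneg)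
    then show "norm (b j) \<le> a j + \<bar>a j - b j\<bar>" by simp
  qed
  then show "summable (\<lambda>j. pmf f j * g j)" by (simp add: b_def)
  have "(\<Sum>i\<in>A. g (\<kappa> i)) / card A - (\<Sum>j. b j) = (\<Sum>j. a j - b j)"
    using suma sumb by (subst suminf_diff[symmetric]) (auto simp: sums_iff)
  also have "\<bar>\<dots>\<bar> \<le> (\<Sum>j. \<bar>a j - b j\<bar>)" by (rule summable_rabs[OF sumab])
  finally show "\<bar>(\<Sum>i\<in>A. g (\<kappa> i)) / card A - (\<Sum>j. pmf f j * g j)\<bar> \<le> \<delta>" by (simp add: \<delta> b_def)
  have "\<bar>a j - b j\<bar> = (\<Sum>j\<in>{j}. \<bar>a j - b j\<bar>)" by simp
  also have "\<dots> \<le> \<delta>" unfolding \<delta> by (rule sum_le_suminf[OF sumab]) auto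
  finally show "\<bar>empirical A \<kappa> j * g j - pmf f j * g j\<bar> \<le> \<delta>" by (simp add: a_def b_def)
qed

lemma l1g_norm_pmf:
  assumes "summable (\<lambda>j. pmf f j * g j)"
  shows "l1g_norm (pmf f) = ennreal (\<Sum>j. pmf f j * g j)"
  unfolding l1g_norm_def using assms by (subst suminf_ennreal2) (auto simp: g_nonneg)

lemma empirical_g_limit:
  fixes A :: "nat \<Rightarrow> 'a set"
  assumes A: "\<And>\<nu>. finite (A \<nu>)"
    and f: "(\<lambda>\<nu>. l1g_norm (\<lambda>j. empirical (A \<nu>) (\<kappa> \<nu>) j - pmf f j)) \<longlonglongrightarrow> 0"
  shows "summable (\<lambda>j. pmf f j * g j)"
    and "(\<lambda>\<nu>. (\<Sum>i\<in>A \<nu>. g (\<kappa> \<nu> i)) / card (A \<nu>)) \<longlonglongrightarrow> (\<Sum>j. pmf f j * g j)"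
    and "(\<lambda>\<nu>. empirical (A \<nu>) (\<kappa> \<nu>) j * g j) \<longlonglongrightarrow> pmf f j * g j"
proof -
  define d where "d = (\<lambda>\<nu>. l1g_norm (\<lambda>j. empirical (A \<nu>) (\<kappa> \<nu>) j - pmf f j))"
  have "\<forall>\<^sub>F \<nu> in sequentially. d \<nu> < 1"
    using order_tendstoD(2)[OF f, of 1] by (simp add: d_def)
  then have ev: "\<forall>\<^sub>F \<nu> in sequentially. d \<nu> \<noteq> top" by eventually_elim auto
  have lim: "(\<lambda>\<nu>. enn2real (d \<nu>)) \<longlonglongrightarrow> 0"
    using tendsto_enn2real[of d 0] f by (simp add: d_def)
  obtain \<nu>0 where "d \<nu>0 \<noteq> top" using ev by (auto simp: eventually_sequentially)
  then show "summable (\<lambda>j. pmf f j * g j)" using l1g_norm_close(1)[OF A] by (auto simp: d_def)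
  have "(\<lambda>\<nu>. (\<Sum>i\<in>A \<nu>. g (\<kappa> \<nu> i)) / card (A \<nu>) - (\<Sum>j. pmf f j * g j)) \<longlonglongrightarrow> 0"
    by (rule Lim_null_comparison[OF _ lim], rule eventually_mono[OF ev])
      (use l1g_norm_close(2)[OF A] in \<open>auto simp: d_def\<close>)
  then show "(\<lambda>\<nu>. (\<Sum>i\<in>A \<nu>. g (\<kappa> \<nu> i)) / card (A \<nu>)) \<longlonglongrightarrow> (\<Sum>j. pmf f j * g j)"
    by (simp add: LIM_zero_iff)
  have "(\<lambda>\<nu>. empirical (A \<nu>) (\<kappa> \<nu>) j * g j - pmf f j * g j) \<longlonglongrightarrow> 0"
    by (rule Lim_null_comparison[OF _ lim], rule eventually_mono[OF ev])
      (use l1g_norm_close(3)[OF A] in \<open>auto simp: d_def\<close>)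
  then show "(\<lambda>\<nu>. empirical (A \<nu>) (\<kappa> \<nu>) j * g j) \<longlonglongrightarrow> pmf f j * g j"
    by (simp add: LIM_zero_iff)
qed

text \<open>For positive \<open>k\<close> one has \<open>g k \<ge> g 1 = 1\<close>. If
  \<open>2 * k \<le> N\<close>, the drop is at most \<open>k / (N - k + 1) \<le> 1\<close>;
  otherwise it is at most \<open>g (2 * k) \<le> g k + 1\<close>.\<close>

lemma g_drop_le:
  assumes "k \<le> N"
  shows "g N - g (N - k) \<le> 2 * g k"
proof (cases "k = 0")
  case False
  have g1: "1 \<le> g k" using g_mono[of 1 k] False by (simp add: g_eq)
  show ?thesis
  proof (cases "2 * k \<le> N")
    case True
    have "g (N - k + k) - g (N - k) \<le> k / Suc (N - k)" by (rule g_diff_le)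
    also have "\<dots> \<le> 1" using True by (simp add: divide_le_eq)
    finally show ?thesis using g1 assms by simp
  next
    case False
    have "g (k + k) - g k \<le> k / Suc k" by (rule g_diff_le)
    also have "\<dots> \<le> 1" by simp
    finally have "g (k + k) \<le> 2 * g k" using g1 by simp
    moreover have "g N \<le> g (k + k)" using False by (intro g_mono) simp
    ultimately show ?thesis using g_nonneg[of "N - k"] by linarith
  qed
qed simp

lemma g_drop_le_small:
  assumes "k \<le> K" "K \<le> N"
  shows "g N - g (N - k) \<le> K / Suc (N - K)"
proof -
  have "g (N - k + k) - g (N - k) \<le> k / Suc (N - k)" by (rule g_diff_le)
  also have "\<dots> \<le> K / Suc (N - K)" using assms by (intro frac_le) auto
  finally show ?thesis using assms by simp
qed

text \<open>Dominated convergence: \<open>g N - g (N - k)\<close> is at most \<open>2 * g k\<close> and tends to 0 as \<open>N \<rightarrow> \<infinity>\<close>.\<close>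

lemma mean_g_drop_tendsto_0:
  fixes A :: "nat \<Rightarrow> 'a set" and N :: "nat \<Rightarrow> nat"
  assumes A: "\<And>\<nu>. finite (A \<nu>)" "filterlim (\<lambda>\<nu>. card (A \<nu>)) at_top sequentially"
    and N: "filterlim N at_top sequentially" and le: "\<And>\<nu> i. i \<in> A \<nu> \<Longrightarrow> \<kappa> \<nu> i \<le> N \<nu>"
    and f: "(\<lambda>\<nu>. l1g_norm (\<lambda>j. empirical (A \<nu>) (\<kappa> \<nu>) j - pmf f j)) \<longlonglongrightarrow> 0"
  shows "(\<lambda>\<nu>. (\<Sum>i\<in>A \<nu>. g (N \<nu>) - g (N \<nu> - \<kappa> \<nu> i)) / card (A \<nu>)) \<longlonglongrightarrow> 0"
proof (rule tendstoI)
  fix e :: real assume e: "0 < e"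
  note lims = empirical_g_limit[OF A(1) f]
  define F where "F = (\<Sum>j. pmf f j * g j)"
  have "(\<lambda>K. \<Sum>j<K. pmf f j * g j) \<longlonglongrightarrow> F" unfolding F_def by (rule summable_LIMSEQ[OF lims(1)])
  from order_tendstoD(1)[OF this, of "F - e / 8"]
  obtain K where K: "F - e / 8 < (\<Sum>j<K. pmf f j * g j)" using e by (auto simp: eventually_sequentially)
  \<comment> \<open>The empirical tail beyond \<open>K\<close>, eventually below
    \<open>e / 8\<close> because its limit is. Degrees below \<open>K\<close> will contribute at
    most \<open>e / 2\<close> and the others at most \<open>2 * W\<close>.\<close>
  define W where "W = (\<lambda>\<nu>. (\<Sum>i\<in>A \<nu>. g (\<kappa> \<nu> i)) / card (A \<nu>) - (\<Sum>j<K. empirical (A \<nu>) (\<kappa> \<nu>) j * g j))"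
  have "W \<longlonglongrightarrow> F - (\<Sum>j<K. pmf f j * g j)"
    unfolding W_def F_def by (intro tendsto_diff tendsto_sum lims)
  then have ev1: "\<forall>\<^sub>F \<nu> in sequentially. W \<nu> < e / 8" using K by (intro order_tendstoD(2)) auto
  have "filterlim (\<lambda>\<nu>. N \<nu> - K) at_top sequentially"
    by (rule filterlim_compose[OF _ N]) (rule filterlim_minus_const_nat_at_top)
  then have "(\<lambda>\<nu>. real K / Suc (N \<nu> - K)) \<longlonglongrightarrow> 0"
    by (intro filterlim_compose[OF _ \<open>filterlim (\<lambda>\<nu>. N \<nu> - K) at_top sequentially\<close>, of "\<lambda>n. real K / Suc n"] lim_const_over_n[THEN LIMSEQ_Suc])
  then have ev2: "\<forall>\<^sub>F \<nu> in sequentially. K / Suc (N \<nu> - K) < e / 2" using e by (intro order_tendstoD(2)) auto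
  have ev3: "\<forall>\<^sub>F \<nu> in sequentially. K \<le> N \<nu>" using N by (simp add: filterlim_at_top)
  have ev4: "\<forall>\<^sub>F \<nu> in sequentially. 1 \<le> card (A \<nu>)" using A(2) by (simp add: filterlim_at_top)
  show "\<forall>\<^sub>F \<nu> in sequentially. dist ((\<Sum>i\<in>A \<nu>. g (N \<nu>) - g (N \<nu> - \<kappa> \<nu> i)) / card (A \<nu>)) 0 < e"
    using ev1 ev2 ev3 ev4
  proof eventually_elim
    case (elim \<nu>)
    define c where "c = real (card (A \<nu>))"
    have c: "0 < c" using elim by (simp add: c_def)
    define t where "t = (\<lambda>j. if j < K then 0 else g j)"
    have bound: "g (N \<nu>) - g (N \<nu> - \<kappa> \<nu> i) \<le> K / Suc (N \<nu> - K) + 2 * t (\<kappa> \<nu> i)" if "i \<in> A \<nu>" for i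
    proof (cases "\<kappa> \<nu> i < K")
      case True
      then show ?thesis using g_drop_le_small[of "\<kappa> \<nu> i" K "N \<nu>"] elim by (simp add: t_def)
    next
      case False
      have "0 \<le> K / Suc (N \<nu> - K)" by simp
      moreover have "t (\<kappa> \<nu> i) = g (\<kappa> \<nu> i)" using False by (simp add: t_def)
      ultimately show ?thesis using g_drop_le[OF le[OF that]] by linarith
    qed
    have tsum: "(\<Sum>i\<in>A \<nu>. t (\<kappa> \<nu> i)) / c = W \<nu>"
    proof -
      have "(\<lambda>j. empirical (A \<nu>) (\<kappa> \<nu>) j * (g j - t j)) sums ((\<Sum>i\<in>A \<nu>. g (\<kappa> \<nu> i) - t (\<kappa> \<nu> i)) / c)"
        unfolding c_def by (rule empirical_sums[OF A(1)])
      moreover have "(\<lambda>j. empirical (A \<nu>) (\<kappa> \<nu>) j * (g j - t j)) sums (\<Sum>j<K. empirical (A \<nu>) (\<kappa> \<nu>) j * (g j - t j))"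
        by (rule sums_finite) (auto simp: t_def)
      ultimately have "(\<Sum>i\<in>A \<nu>. g (\<kappa> \<nu> i) - t (\<kappa> \<nu> i)) / c = (\<Sum>j<K. empirical (A \<nu>) (\<kappa> \<nu>) j * (g j - t j))"
        by (rule sums_unique2)
      also have "\<dots> = (\<Sum>j<K. empirical (A \<nu>) (\<kappa> \<nu>) j * g j)"
        by (intro sum.cong) (auto simp: t_def)
      finally show ?thesis unfolding W_def c_def by (simp add: sum_subtractf diff_divide_distrib)
    qed
    have "(\<Sum>i\<in>A \<nu>. g (N \<nu>) - g (N \<nu> - \<kappa> \<nu> i)) \<le> (\<Sum>i\<in>A \<nu>. K / Suc (N \<nu> - K) + 2 * t (\<kappa> \<nu> i))"
      by (intro sum_mono bound)
    also have "\<dots> = c * (K / Suc (N \<nu> - K)) + 2 * (\<Sum>i\<in>A \<nu>. t (\<kappa> \<nu> i))"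
      by (simp add: sum.distrib c_def flip: sum_distrib_left)
    finally have "(\<Sum>i\<in>A \<nu>. g (N \<nu>) - g (N \<nu> - \<kappa> \<nu> i)) / c \<le> (c * (K / Suc (N \<nu> - K)) + 2 * (\<Sum>i\<in>A \<nu>. t (\<kappa> \<nu> i))) / c"
      using c by (intro divide_right_mono) auto
    also have "\<dots> = K / Suc (N \<nu> - K) + 2 * W \<nu>"
      using c by (simp add: add_divide_distrib tsum[symmetric])
    also have "\<dots> < e" using elim e by linarith
    finally have "(\<Sum>i\<in>A \<nu>. g (N \<nu>) - g (N \<nu> - \<kappa> \<nu> i)) / c < e" .
    moreover have "0 \<le> (\<Sum>i\<in>A \<nu>. g (N \<nu>) - g (N \<nu> - \<kappa> \<nu> i)) / c"
      using c by (intro divide_nonneg_nonneg sum_nonneg) (auto intro: g_mono)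
    ultimately show ?case by (simp add: c_def)
  qed
qed

section \<open>Asymptotics of a single block\<close>

definition asymptotic_gap :: "(nat \<Rightarrow> 'a set set) \<Rightarrow> (nat \<Rightarrow> 'a set) \<Rightarrow> (nat \<Rightarrow> 'a \<Rightarrow> nat) \<Rightarrow> (nat \<Rightarrow> real) \<Rightarrow> bool" where
  "asymptotic_gap E V \<kappa> N \<longleftrightarrow> (\<exists>err. (\<lambda>\<nu>. err \<nu> / N \<nu>) \<longlonglongrightarrow> 0 \<and>
     (\<forall>\<^sub>F \<nu> in sequentially.
       (\<forall>p. feasible (E \<nu>) (V \<nu>) (\<kappa> \<nu>) p \<longrightarrow>
          entropy_gap (E \<nu>) (V \<nu>) (\<kappa> \<nu>) p \<le> (\<Sum>i\<in>V \<nu>. g (\<kappa> \<nu> i)) + err \<nu>) \<and>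
       (\<exists>p. feasible (E \<nu>) (V \<nu>) (\<kappa> \<nu>) p \<and>
          (\<Sum>i\<in>V \<nu>. g (\<kappa> \<nu> i)) - err \<nu> \<le> entropy_gap (E \<nu>) (V \<nu>) (\<kappa> \<nu>) p)))"

lemma asymptotic_gapI:
  assumes "(\<lambda>\<nu>. err \<nu> / N \<nu>) \<longlonglongrightarrow> 0"
    and "\<forall>\<^sub>F \<nu> in sequentially. \<forall>p. feasible (E \<nu>) (V \<nu>) (\<kappa> \<nu>) p \<longrightarrow>
      entropy_gap (E \<nu>) (V \<nu>) (\<kappa> \<nu>) p \<le> (\<Sum>i\<in>V \<nu>. g (\<kappa> \<nu> i)) + err \<nu>"
    and "\<forall>\<^sub>F \<nu> in sequentially. \<exists>p. feasible (E \<nu>) (V \<nu>) (\<kappa> \<nu>) p \<and>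
      (\<Sum>i\<in>V \<nu>. g (\<kappa> \<nu> i)) - err \<nu> \<le> entropy_gap (E \<nu>) (V \<nu>) (\<kappa> \<nu>) p"
  shows "asymptotic_gap E V \<kappa> N"
  unfolding asymptotic_gap_def
  by (intro exI[of _ err] conjI eventually_conj assms)

text \<open>Passes from the size of the layers in a block to the total number of nodes, by which the
  relative entropy is divided.\<close>

lemma asymptotic_gap_mono:
  assumes "asymptotic_gap E V \<kappa> N" and "\<forall>\<^sub>F \<nu> in sequentially. 0 < N \<nu> \<and> N \<nu> \<le> N' \<nu>"
  shows "asymptotic_gap E V \<kappa> N'"
proof -
  obtain err where err: "(\<lambda>\<nu>. err \<nu> / N \<nu>) \<longlonglongrightarrow> 0"
    and ev: "\<forall>\<^sub>F \<nu> in sequentially.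
       (\<forall>p. feasible (E \<nu>) (V \<nu>) (\<kappa> \<nu>) p \<longrightarrow>
          entropy_gap (E \<nu>) (V \<nu>) (\<kappa> \<nu>) p \<le> (\<Sum>i\<in>V \<nu>. g (\<kappa> \<nu> i)) + err \<nu>) \<and>
       (\<exists>p. feasible (E \<nu>) (V \<nu>) (\<kappa> \<nu>) p \<and>
          (\<Sum>i\<in>V \<nu>. g (\<kappa> \<nu> i)) - err \<nu> \<le> entropy_gap (E \<nu>) (V \<nu>) (\<kappa> \<nu>) p)"
    using assms(1) by (auto simp: asymptotic_gap_def)
  have "(\<lambda>\<nu>. err \<nu> / N' \<nu>) \<longlonglongrightarrow> 0"
  proof (rule Lim_null_comparison[OF _ tendsto_rabs_zero[OF err]])
    show "\<forall>\<^sub>F \<nu> in sequentially. norm (err \<nu> / N' \<nu>) \<le> \<bar>err \<nu> / N \<nu>\<bar>"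
      using assms(2)
    proof eventually_elim
      case (elim \<nu>)
      have "\<bar>err \<nu>\<bar> / N' \<nu> \<le> \<bar>err \<nu>\<bar> / N \<nu>" using elim by (intro divide_left_mono) auto
      then show ?case using elim by simp
    qed
  qed
  then show ?thesis using ev unfolding asymptotic_gap_def by blast
qed

lemma asymptotic_gap_free:
  assumes "\<And>\<nu>. finite (E \<nu>)"
  shows "asymptotic_gap E (\<lambda>_. {}) \<kappa> N"
  by (rule asymptotic_gapI[where err = "\<lambda>_. 0"])
    (use entropy_gap_free[OF assms] in auto)

lemma ln_over_at_top:
  fixes N :: "nat \<Rightarrow> real"
  assumes "filterlim N at_top sequentially"
  shows "(\<lambda>\<nu>. ln (N \<nu>) / N \<nu>) \<longlonglongrightarrow> 0" "(\<lambda>\<nu>. 1 / N \<nu>) \<longlonglongrightarrow> 0"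
proof -
  have "((\<lambda>x::real. ln x / x) \<longlongrightarrow> 0) at_top" "((\<lambda>x::real. 1 / x) \<longlongrightarrow> 0) at_top" by real_asymp+
  then show "(\<lambda>\<nu>. ln (N \<nu>) / N \<nu>) \<longlonglongrightarrow> 0" "(\<lambda>\<nu>. 1 / N \<nu>) \<longlonglongrightarrow> 0"
    using assms by (auto intro: filterlim_compose)
qed

lemma asymptotic_gap_one_sided:
  fixes A B :: "nat \<Rightarrow> 'a set"
  assumes AB: "\<And>\<nu>. finite (A \<nu>)" "\<And>\<nu>. finite (B \<nu>)" "\<And>\<nu>. A \<nu> \<inter> B \<nu> = {}"
    and card: "filterlim (\<lambda>\<nu>. card (A \<nu>)) at_top sequentially" "filterlim (\<lambda>\<nu>. card (B \<nu>)) at_top sequentially"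
    and ne: "\<And>\<nu>. degree_class (links (A \<nu>) (B \<nu>)) (A \<nu>) (\<kappa> \<nu>) \<noteq> {}"
    and f: "(\<lambda>\<nu>. l1g_norm (\<lambda>j. empirical (A \<nu>) (\<kappa> \<nu>) j - pmf f j)) \<longlonglongrightarrow> 0"
  shows "asymptotic_gap (\<lambda>\<nu>. links (A \<nu>) (B \<nu>)) A \<kappa> (\<lambda>\<nu>. card (A \<nu>))"
proof -
  define err where "err = (\<lambda>\<nu>. \<Sum>i\<in>A \<nu>. g (card (B \<nu>)) - g (card (B \<nu>) - \<kappa> \<nu> i))"
  have le: "\<kappa> \<nu> i \<le> card (B \<nu>)" if i: "i \<in> A \<nu>" for \<nu> i
  proof -
    obtain G where G: "G \<in> degree_class (links (A \<nu>) (B \<nu>)) (A \<nu>) (\<kappa> \<nu>)" using ne by blast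
    note E = is_link_setD[OF is_link_set_links[OF AB(1,2)]]
    have "nbrs G i \<subseteq> nbrs (links (A \<nu>) (B \<nu>)) i" using degree_classD(1)[OF G] by (auto simp: nbrs_def)
    then have "nbrs G i \<subseteq> B \<nu>" using nbrs_links_left[OF AB(3) i] by simp
    moreover have "card (nbrs G i) = \<kappa> \<nu> i"
      using degree_classD[OF G] i E(3) by (subst card_nbrs) auto
    ultimately show ?thesis using card_mono[OF AB(2)] by metis
  qed
  have err0: "0 \<le> err \<nu>" for \<nu> unfolding err_def by (intro sum_nonneg) (auto intro: g_mono)
  have B0: "\<forall>\<^sub>F \<nu> in sequentially. 0 < card (B \<nu>)"
    using card(2)[unfolded filterlim_at_top, rule_format, of 1] by (rule eventually_mono) simp
  show ?thesis
  proof (rule asymptotic_gapI[where err = err])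
    show "(\<lambda>\<nu>. err \<nu> / real (card (A \<nu>))) \<longlonglongrightarrow> 0"
      unfolding err_def by (rule mean_g_drop_tendsto_0[OF AB(1) card le f])
    show "\<forall>\<^sub>F \<nu> in sequentially. \<forall>p. feasible (links (A \<nu>) (B \<nu>)) (A \<nu>) (\<kappa> \<nu>) p \<longrightarrow>
        entropy_gap (links (A \<nu>) (B \<nu>)) (A \<nu>) (\<kappa> \<nu>) p \<le> (\<Sum>i\<in>A \<nu>. g (\<kappa> \<nu> i)) + err \<nu>"
      using B0
    proof eventually_elim
      case (elim \<nu>)
      obtain G where G: "G \<in> degree_class (links (A \<nu>) (B \<nu>)) (A \<nu>) (\<kappa> \<nu>)" using ne by blast
      show ?case using entropy_gap_one_sided(1)[OF AB refl elim G] err0[of \<nu>]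
        by (fastforce simp: err_def sum_subtractf)
    qed
    show "\<forall>\<^sub>F \<nu> in sequentially. \<exists>p. feasible (links (A \<nu>) (B \<nu>)) (A \<nu>) (\<kappa> \<nu>) p \<and>
        (\<Sum>i\<in>A \<nu>. g (\<kappa> \<nu> i)) - err \<nu> \<le> entropy_gap (links (A \<nu>) (B \<nu>)) (A \<nu>) (\<kappa> \<nu>) p"
      using B0
    proof eventually_elim
      case (elim \<nu>)
      obtain G where G: "G \<in> degree_class (links (A \<nu>) (B \<nu>)) (A \<nu>) (\<kappa> \<nu>)" using ne by blast
      show ?case using entropy_gap_one_sided(2)[OF AB refl elim G]
        unfolding err_def sum_subtractf[symmetric] .
    qed
  qed
qed

lemma asymptotic_gap_bip:
  fixes A B :: "nat \<Rightarrow> 'a set" and m m' :: "nat \<Rightarrow> nat"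
  assumes AB: "\<And>\<nu>. finite (A \<nu>)" "\<And>\<nu>. finite (B \<nu>)" "\<And>\<nu>. A \<nu> \<inter> B \<nu> = {}"
    and card: "filterlim (\<lambda>\<nu>. card (A \<nu>)) at_top sequentially"
    and ne: "\<And>\<nu>. degree_class (links (A \<nu>) (B \<nu>)) (A \<nu> \<union> B \<nu>) (\<kappa> \<nu>) \<noteq> {}"
    and m: "\<And>\<nu> i. i \<in> A \<nu> \<Longrightarrow> \<kappa> \<nu> i \<le> m \<nu>" "\<And>\<nu> j. j \<in> B \<nu> \<Longrightarrow> \<kappa> \<nu> j \<le> m' \<nu>"
    and small: "(\<lambda>\<nu>. real (m \<nu>) * real (m' \<nu>)) \<in> o(\<lambda>\<nu>. real (\<Sum>i\<in>A \<nu>. \<kappa> \<nu> i) powr (2 / 3))"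
  shows "asymptotic_gap (\<lambda>\<nu>. links (A \<nu>) (B \<nu>)) (\<lambda>\<nu>. A \<nu> \<union> B \<nu>) \<kappa> (\<lambda>\<nu>. real (card (A \<nu>)) + card (B \<nu>))"
proof -
  define N where "N = (\<lambda>\<nu>. real (card (A \<nu>)) + card (B \<nu>))"
  define L where "L = (\<lambda>\<nu>. \<Sum>i\<in>A \<nu>. \<kappa> \<nu> i)"
  define err where "err = (\<lambda>\<nu>. 16 * real (m \<nu> * m' \<nu>) + g (L \<nu>))"
  have "\<forall>\<nu>. \<exists>G. G \<in> degree_class (links (A \<nu>) (B \<nu>)) (A \<nu> \<union> B \<nu>) (\<kappa> \<nu>)" using ne by blast
  from choice[OF this] obtain G where G: "\<And>\<nu>. G \<nu> \<in> degree_class (links (A \<nu>) (B \<nu>)) (A \<nu> \<union> B \<nu>) (\<kappa> \<nu>)" by blast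
  have LG: "L \<nu> = card (G \<nu>)" "(\<Sum>j\<in>B \<nu>. \<kappa> \<nu> j) = L \<nu>" for \<nu>
    using degree_class_bip_sums[OF AB G] by (simp_all add: L_def)
  have Ninf: "filterlim N at_top sequentially"
  proof (rule filterlim_at_top_mono)
    show "filterlim (\<lambda>\<nu>. real (card (A \<nu>))) at_top sequentially"
      by (rule filterlim_compose[OF filterlim_real_sequentially card])
  qed (simp add: N_def)
  have L1: "real (L \<nu>) \<le> card (A \<nu>) * m \<nu>" "real (L \<nu>) \<le> card (B \<nu>) * m' \<nu>" for \<nu>
  proof -
    have "L \<nu> \<le> card (A \<nu>) * m \<nu>" unfolding L_def using sum_bounded_above[of "A \<nu>" "\<kappa> \<nu>" "m \<nu>"] m by simp
    then show "real (L \<nu>) \<le> card (A \<nu>) * m \<nu>" by (simp only: of_nat_le_iff)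
    have "L \<nu> \<le> card (B \<nu>) * m' \<nu>" unfolding LG(2)[symmetric] using sum_bounded_above[of "B \<nu>" "\<kappa> \<nu>" "m' \<nu>"] m by simp
    then show "real (L \<nu>) \<le> card (B \<nu>) * m' \<nu>" by (simp only: of_nat_le_iff)
  qed
  have ab: "real (card (A \<nu>)) * card (B \<nu>) \<le> (N \<nu>)\<^sup>2" for \<nu>
    by (simp add: N_def power2_eq_square algebra_simps)
  have ev: "\<forall>\<^sub>F \<nu> in sequentially. real (m \<nu> * m' \<nu>) \<le> c * real (L \<nu>) powr (2 / 3)" if "0 < c" for c
    using landau_o.smallD[OF small that] by (auto simp: L_def elim: eventually_mono)
  have powr_le: "real (L \<nu>) powr (2 / 3) \<le> L \<nu>" for \<nu>
  proof (cases "L \<nu> = 0")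
    case False
    then have "real (L \<nu>) powr (2 / 3) \<le> real (L \<nu>) powr 1" by (intro powr_mono) auto
    then show ?thesis using False by simp
  qed simp
  have mm: "real (m \<nu> * m' \<nu>) \<le> c * N \<nu>"
    if c: "0 < c" "c \<le> 1" and le: "real (m \<nu> * m' \<nu>) \<le> c * real (L \<nu>) powr (2 / 3)" for c \<nu>
  proof -
    define x where "x = real (L \<nu>) powr (2 / 3)"
    have x0: "0 \<le> x" by (simp add: x_def)
    have N0: "0 \<le> N \<nu>" by (simp add: N_def)
    \<comment> \<open>Here the exponent 2/3 acts: both sides bound the number of links, so \<open>x
      ^ 3 = L\<^sup>2 \<le> card A * card B * m * m' \<le> N\<^sup>2 * x\<close>, using
      \<open>m * m' \<le> x\<close>.\<close>
    have "x \<le> N \<nu>"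
    proof (cases "x = 0")
      case False
      then have "0 < x" using x0 by simp
      have L0: "0 < real (L \<nu>)" using False by (cases "L \<nu> = 0") (auto simp: x_def)
      have "x * x\<^sup>2 = x ^ 3" by (simp add: power2_eq_square power3_eq_cube)
      also have "\<dots> = real (L \<nu>) powr (2 / 3 * 3)"
        unfolding x_def using L0 by (simp add: powr_powr flip: powr_numeral)
      also have "\<dots> = (real (L \<nu>))\<^sup>2" using L0 by (simp add: powr_numeral)
      also have "\<dots> \<le> real (card (A \<nu>) * m \<nu>) * real (card (B \<nu>) * m' \<nu>)"
        unfolding power2_eq_square using L1[of \<nu>] by (intro mult_mono) auto
      also have "\<dots> = (real (card (A \<nu>)) * card (B \<nu>)) * real (m \<nu> * m' \<nu>)" by simp
      also have "\<dots> \<le> (N \<nu>)\<^sup>2 * (1 * x)"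
      proof (rule mult_mono[OF ab])
        have "c * x \<le> 1 * x" using c x0 by (intro mult_right_mono) auto
        then show "real (m \<nu> * m' \<nu>) \<le> 1 * x" using le unfolding x_def by linarith
      qed auto
      finally have "x * x\<^sup>2 \<le> x * (N \<nu>)\<^sup>2" by (simp add: mult.commute)
      then have "x\<^sup>2 \<le> (N \<nu>)\<^sup>2" using \<open>0 < x\<close> by simp
      then show ?thesis using N0 by (rule power2_le_imp_le)
    qed (use N0 in simp)
    then have "c * x \<le> c * N \<nu>" using c by (intro mult_left_mono) auto
    then show ?thesis using le unfolding x_def by linarith
  qed
  have lim1: "(\<lambda>\<nu>. real (m \<nu> * m' \<nu>) / N \<nu>) \<longlonglongrightarrow> 0"
  proof (rule tendstoI)
    fix e :: real assume e: "0 < e"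
    define c where "c = min 1 (e / 2)"
    have c: "0 < c" "c \<le> 1" "c < e" using e by (auto simp: c_def)
    have "\<forall>\<^sub>F \<nu> in sequentially. 0 < N \<nu>" using Ninf by (simp add: filterlim_at_top_dense)
    then show "\<forall>\<^sub>F \<nu> in sequentially. dist (real (m \<nu> * m' \<nu>) / N \<nu>) 0 < e"
      using ev[OF c(1)]
    proof eventually_elim
      case (elim \<nu>)
      have "real (m \<nu> * m' \<nu>) / N \<nu> \<le> c" using mm[OF c(1,2) elim(2)] elim(1) by (simp add: divide_le_eq)
      then show ?case using c elim(1) by (simp add: abs_of_nonneg)
    qed
  qed
  have N1: "\<forall>\<^sub>F \<nu> in sequentially. 1 < N \<nu>" using Ninf by (simp add: filterlim_at_top_dense)
  have LN: "real (L \<nu>) \<le> (N \<nu>)\<^sup>2" for \<nu>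
  proof -
    have "card (links (A \<nu>) (B \<nu>)) = card (A \<nu>) * card (B \<nu>)"
      using sum_links_bip[OF AB(3), of "\<lambda>_. 1::nat"] by simp
    moreover have "card (G \<nu>) \<le> card (links (A \<nu>) (B \<nu>))"
      using degree_classD(1)[OF G] is_link_setD(2)[OF is_link_set_links[OF AB(1,2)]] by (intro card_mono) auto
    ultimately have "L \<nu> \<le> card (A \<nu>) * card (B \<nu>)" using LG by simp
    then have "real (L \<nu>) \<le> real (card (A \<nu>) * card (B \<nu>))" by (simp only: of_nat_le_iff)
    then show ?thesis using ab[of \<nu>] by simp
  qed
  \<comment> \<open>\<open>g\<close> grows logarithmically, and \<open>L \<le> N\<^sup>2\<close>
    because parallel links are absent.\<close>
  have lim2: "(\<lambda>\<nu>. g (L \<nu>) / N \<nu>) \<longlonglongrightarrow> 0"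
  proof (rule Lim_null_comparison)
    show "(\<lambda>\<nu>. 1 / N \<nu> + 2 * (ln (N \<nu>) / N \<nu>)) \<longlonglongrightarrow> 0"
      using tendsto_add[OF ln_over_at_top(2)[OF Ninf] tendsto_mult_left[OF ln_over_at_top(1)[OF Ninf], of 2]] by simp
    show "\<forall>\<^sub>F \<nu> in sequentially. norm (g (L \<nu>) / N \<nu>) \<le> 1 / N \<nu> + 2 * (ln (N \<nu>) / N \<nu>)"
      using N1
    proof eventually_elim
      case (elim \<nu>)
      have "g (L \<nu>) \<le> 1 + 2 * ln (N \<nu>)"
      proof (cases "L \<nu> = 0")
        case False
        have "ln (L \<nu>) \<le> ln ((N \<nu>)\<^sup>2)" using LN[of \<nu>] False elim by (subst ln_le_cancel_iff) auto
        then show ?thesis using g_le_ln[of "L \<nu>"] False elim by (simp add: ln_realpow)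
      qed (use elim in simp)
      then have "g (L \<nu>) / N \<nu> \<le> (1 + 2 * ln (N \<nu>)) / N \<nu>" using elim by (intro divide_right_mono) auto
      then show ?case using elim g_nonneg[of "L \<nu>"] by (simp add: add_divide_distrib)
    qed
  qed
  have ev16: "\<forall>\<^sub>F \<nu> in sequentially. 16 * (m \<nu> * m' \<nu>) \<le> card (G \<nu>)"
    using ev[of "1/16", simplified]
  proof eventually_elim
    case (elim \<nu>)
    then have "16 * real (m \<nu> * m' \<nu>) \<le> L \<nu>" using powr_le[of \<nu>] by simp
    then have "real (16 * (m \<nu> * m' \<nu>)) \<le> real (card (G \<nu>))" unfolding LG by simp
    then show ?case by (simp only: of_nat_le_iff)
  qed
  have "asymptotic_gap (\<lambda>\<nu>. links (A \<nu>) (B \<nu>)) (\<lambda>\<nu>. A \<nu> \<union> B \<nu>) \<kappa> N"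
  proof (rule asymptotic_gapI[where err = err])
    have "(\<lambda>\<nu>. 16 * (real (m \<nu> * m' \<nu>) / N \<nu>) + g (L \<nu>) / N \<nu>) \<longlonglongrightarrow> 0"
      using tendsto_add[OF tendsto_mult_left[OF lim1, of 16] lim2] by simp
    then show "(\<lambda>\<nu>. err \<nu> / N \<nu>) \<longlonglongrightarrow> 0" by (simp add: err_def add_divide_distrib)
    show "\<forall>\<^sub>F \<nu> in sequentially. \<forall>p. feasible (links (A \<nu>) (B \<nu>)) (A \<nu> \<union> B \<nu>) (\<kappa> \<nu>) p \<longrightarrow>
        entropy_gap (links (A \<nu>) (B \<nu>)) (A \<nu> \<union> B \<nu>) (\<kappa> \<nu>) p \<le> (\<Sum>i\<in>A \<nu> \<union> B \<nu>. g (\<kappa> \<nu> i)) + err \<nu>"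
      using ev16
    proof eventually_elim
      case (elim \<nu>)
      show ?case
      proof (intro allI impI)
        fix p assume p: "feasible (links (A \<nu>) (B \<nu>)) (A \<nu> \<union> B \<nu>) (\<kappa> \<nu>) p"
        show "entropy_gap (links (A \<nu>) (B \<nu>)) (A \<nu> \<union> B \<nu>) (\<kappa> \<nu>) p \<le> (\<Sum>i\<in>A \<nu> \<union> B \<nu>. g (\<kappa> \<nu> i)) + err \<nu>"
          using entropy_gap_bip(1)[OF AB G m elim p] g_nonneg[of "L \<nu>"] by (simp add: err_def)
      qed
    qed
    show "\<forall>\<^sub>F \<nu> in sequentially. \<exists>p. feasible (links (A \<nu>) (B \<nu>)) (A \<nu> \<union> B \<nu>) (\<kappa> \<nu>) p \<and>
        (\<Sum>i\<in>A \<nu> \<union> B \<nu>. g (\<kappa> \<nu> i)) - err \<nu> \<le> entropy_gap (links (A \<nu>) (B \<nu>)) (A \<nu> \<union> B \<nu>) (\<kappa> \<nu>) p"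
      using ev16
    proof eventually_elim
      case (elim \<nu>)
      obtain p where p: "feasible (links (A \<nu>) (B \<nu>)) (A \<nu> \<union> B \<nu>) (\<kappa> \<nu>) p"
        "(\<Sum>i\<in>A \<nu> \<union> B \<nu>. g (\<kappa> \<nu> i)) - g (card (G \<nu>)) - real (m \<nu> * m' \<nu>)
          \<le> entropy_gap (links (A \<nu>) (B \<nu>)) (A \<nu> \<union> B \<nu>) (\<kappa> \<nu>) p"
        using entropy_gap_bip(2)[OF AB G m elim] by blast
      have "0 \<le> real (m \<nu> * m' \<nu>)" by simp
      then have "(\<Sum>i\<in>A \<nu> \<union> B \<nu>. g (\<kappa> \<nu> i)) - err \<nu> \<le> entropy_gap (links (A \<nu>) (B \<nu>)) (A \<nu> \<union> B \<nu>) (\<kappa> \<nu>) p"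
        using p(2) unfolding err_def LG(1) by linarith
      then show ?case using p(1) by blast
    qed
  qed
  then show ?thesis by (simp add: N_def)
qed

text \<open>\<open>y\<close> relates the bound on the total degree in the sparse regime to the
  number of nodes. It tends to 0 as \<open>m\<close> is o(sqrt N), and \<open>sparse_loss\<close>
  divided by \<open>N\<close> is \<open>y * (ln (32 / y) + 1)\<close>, which then vanishes
  too.\<close>

lemma asymptotic_gap_self:
  fixes A :: "nat \<Rightarrow> 'a set" and m :: "nat \<Rightarrow> nat"
  assumes A: "\<And>\<nu>. finite (A \<nu>)" and card: "filterlim (\<lambda>\<nu>. card (A \<nu>)) at_top sequentially"
    and ne: "\<And>\<nu>. degree_class (links (A \<nu>) (A \<nu>)) (A \<nu>) (\<kappa> \<nu>) \<noteq> {}"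
    and m: "\<And>\<nu> i. i \<in> A \<nu> \<Longrightarrow> \<kappa> \<nu> i \<le> m \<nu>"
    and small: "(\<lambda>\<nu>. real (m \<nu>)) \<in> o(\<lambda>\<nu>. real (card (A \<nu>)) powr (1 / 2))"
  shows "asymptotic_gap (\<lambda>\<nu>. links (A \<nu>) (A \<nu>)) A \<kappa> (\<lambda>\<nu>. card (A \<nu>))"
proof -
  define N where "N = (\<lambda>\<nu>. real (card (A \<nu>)))"
  \<comment> \<open>The bounds for one layer assume a maximal degree of at least 1, and
    \<open>y\<close> must be positive; a layer without links has neither.\<close>
  define q where "q = (\<lambda>\<nu>. max 1 (m \<nu>))"
  define y where "y = (\<lambda>\<nu>. 16 * (real (q \<nu>))\<^sup>2 / N \<nu>)"
  define err where "err = (\<lambda>\<nu>. 80 * (real (q \<nu>))\<^sup>2 + 720 * ln (N \<nu>) + sparse_loss (N \<nu>) (16 * (real (q \<nu>))\<^sup>2)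
    + (1 + 6 * (real (q \<nu>))\<^sup>2))"
  have "\<forall>\<nu>. \<exists>G. G \<in> degree_class (links (A \<nu>) (A \<nu>)) (A \<nu>) (\<kappa> \<nu>)" using ne by blast
  from choice[OF this] obtain G where G: "\<And>\<nu>. G \<nu> \<in> degree_class (links (A \<nu>) (A \<nu>)) (A \<nu>) (\<kappa> \<nu>)" by blast
  have q: "1 \<le> q \<nu>" "\<And>i. i \<in> A \<nu> \<Longrightarrow> \<kappa> \<nu> i \<le> q \<nu>" for \<nu>
    using m[of _ \<nu>] by (auto simp: q_def intro: le_max_iff_disj[THEN iffD2])
  have Ninf: "filterlim N at_top sequentially"
    unfolding N_def by (rule filterlim_compose[OF filterlim_real_sequentially card])
  have N1: "\<forall>\<^sub>F \<nu> in sequentially. 1 < N \<nu>" using Ninf by (simp add: filterlim_at_top_dense)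
  have "(\<lambda>\<nu>. real (m \<nu>) / N \<nu> powr (1 / 2)) \<longlonglongrightarrow> 0"
    unfolding N_def by (rule smalloD_tendsto[OF small])
  from tendsto_add[OF tendsto_mult_left[OF tendsto_power[OF this, of 2], of 16]
      tendsto_mult_left[OF ln_over_at_top(2)[OF Ninf], of 16]]
  have "(\<lambda>\<nu>. 16 * (real (m \<nu>) / N \<nu> powr (1 / 2))\<^sup>2 + 16 * (1 / N \<nu>)) \<longlonglongrightarrow> 0" by simp
  then have ylim: "y \<longlonglongrightarrow> 0"
  proof (rule Lim_null_comparison[rotated])
    show "\<forall>\<^sub>F \<nu> in sequentially. norm (y \<nu>) \<le> 16 * (real (m \<nu>) / N \<nu> powr (1 / 2))\<^sup>2 + 16 * (1 / N \<nu>)"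
      using N1
    proof eventually_elim
      case (elim \<nu>)
      have "(N \<nu> powr (1 / 2))\<^sup>2 = N \<nu>" using elim by (simp add: powr_half_sqrt)
      then have "(real (m \<nu>) / N \<nu> powr (1 / 2))\<^sup>2 = (real (m \<nu>))\<^sup>2 / N \<nu>" by (simp add: power_divide)
      moreover have "(real (q \<nu>))\<^sup>2 \<le> (real (m \<nu>))\<^sup>2 + 1" by (auto simp: q_def max_def)
      then have "16 * (real (q \<nu>))\<^sup>2 / N \<nu> \<le> 16 * ((real (m \<nu>))\<^sup>2 + 1) / N \<nu>"
        using elim by (intro divide_right_mono) auto
      ultimately show ?case using elim by (simp add: y_def add_divide_distrib)
    qed
  qed
  have y0: "\<forall>\<^sub>F \<nu> in sequentially. 0 < y \<nu>"
    using N1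
  proof eventually_elim
    case (elim \<nu>)
    have "0 < real (q \<nu>)" using q(1)[of \<nu>] by linarith
    then show ?case using elim by (simp add: y_def)
  qed
  have y1: "\<forall>\<^sub>F \<nu> in sequentially. y \<nu> < 1" using ylim by (rule order_tendstoD) simp
  have "filterlim y (at_right 0) sequentially" unfolding filterlim_at
    using ylim eventually_mono[OF y0, of "\<lambda>\<nu>. y \<nu> \<in> {0<..} \<and> y \<nu> \<noteq> 0"] by simp
  moreover have "((\<lambda>y::real. y * (ln (32 / y) + 1)) \<longlongrightarrow> 0) (at_right 0)" by real_asymp
  ultimately have ylog: "(\<lambda>\<nu>. y \<nu> * (ln (32 / y \<nu>) + 1)) \<longlonglongrightarrow> 0" by (rule filterlim_compose[rotated])
  have ev: "\<forall>\<^sub>F \<nu> in sequentially. 1 \<le> N \<nu> \<and> 16 * (real (q \<nu>))\<^sup>2 \<le> N \<nu>"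
    using N1 y1 by eventually_elim (simp add: y_def divide_less_eq)
  show ?thesis
    unfolding N_def[symmetric]
  proof (rule asymptotic_gapI[where err = err])
    have "(\<lambda>\<nu>. 5 * y \<nu> + 720 * (ln (N \<nu>) / N \<nu>) + y \<nu> * (ln (32 / y \<nu>) + 1) + (1 / N \<nu> + 3 / 8 * y \<nu>)) \<longlonglongrightarrow> 0"
      using tendsto_add[OF tendsto_add[OF tendsto_add[OF tendsto_mult_left[OF ylim, of 5]
              tendsto_mult_left[OF ln_over_at_top(1)[OF Ninf], of 720]] ylog]
          tendsto_add[OF ln_over_at_top(2)[OF Ninf] tendsto_mult_left[OF ylim, of "3 / 8"]]] by simp
    moreover have "\<forall>\<^sub>F \<nu> in sequentially. 5 * y \<nu> + 720 * (ln (N \<nu>) / N \<nu>) + y \<nu> * (ln (32 / y \<nu>) + 1)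
        + (1 / N \<nu> + 3 / 8 * y \<nu>) = err \<nu> / N \<nu>"
      using N1 by eventually_elim (simp add: err_def y_def sparse_loss_def add_divide_distrib)
    ultimately show "(\<lambda>\<nu>. err \<nu> / N \<nu>) \<longlonglongrightarrow> 0" by (rule Lim_transform_eventually)
    show "\<forall>\<^sub>F \<nu> in sequentially. \<forall>p. feasible (links (A \<nu>) (A \<nu>)) (A \<nu>) (\<kappa> \<nu>) p \<longrightarrow>
        entropy_gap (links (A \<nu>) (A \<nu>)) (A \<nu>) (\<kappa> \<nu>) p \<le> (\<Sum>i\<in>A \<nu>. g (\<kappa> \<nu> i)) + err \<nu>"
      using ev
    proof eventually_elim
      case (elim \<nu>)
      have E: "is_link_set (A \<nu>) (links (A \<nu>) (A \<nu>))" using is_link_set_links[OF A A, of \<nu> \<nu>] by simp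
      have ln: "ln (2 * card (G \<nu>)) \<le> 2 * ln (N \<nu>)"
      proof (cases "card (G \<nu>) = 0")
        case False
        have "2 * card (G \<nu>) = (\<Sum>i\<in>A \<nu>. \<kappa> \<nu> i)" using degree_class_card[OF E G] by simp
        also have "\<dots> \<le> card (A \<nu>) * q \<nu>" using sum_bounded_above[of "A \<nu>" "\<kappa> \<nu>" "q \<nu>"] q by simp
        finally have "real (2 * card (G \<nu>)) \<le> real (card (A \<nu>) * q \<nu>)" by (simp only: of_nat_le_iff)
        also have "\<dots> \<le> N \<nu> * N \<nu>"
        proof -
          have "real (q \<nu>) \<le> (real (q \<nu>))\<^sup>2" using q(1)[of \<nu>] by (simp add: power2_eq_square)
          moreover have "0 \<le> (real (q \<nu>))\<^sup>2" by simp
          ultimately have "real (q \<nu>) \<le> N \<nu>" using elim by linarith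
          then show ?thesis by (simp add: N_def mult_left_mono)
        qed
        finally have "ln (2 * card (G \<nu>)) \<le> ln (N \<nu> * N \<nu>)"
          using False elim by (subst ln_le_cancel_iff) auto
        then show ?thesis using elim by (simp add: ln_mult)
      qed (use elim in simp)
      show ?case
      proof (intro allI impI)
        fix p assume p: "feasible (links (A \<nu>) (A \<nu>)) (A \<nu>) (\<kappa> \<nu>) p"
        have "entropy_gap (links (A \<nu>) (A \<nu>)) (A \<nu>) (\<kappa> \<nu>) p \<le> (\<Sum>i\<in>A \<nu>. g (\<kappa> \<nu> i))
          + (80 * (real (q \<nu>))\<^sup>2 + 360 * ln (2 * card (G \<nu>)) + sparse_loss (N \<nu>) (16 * (real (q \<nu>))\<^sup>2))"
          by (rule entropy_gap_self(1)[OF A G q(2) q(1) _ _ p]) (use elim in auto)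
        moreover have "0 \<le> (real (q \<nu>))\<^sup>2" by simp
        ultimately show "entropy_gap (links (A \<nu>) (A \<nu>)) (A \<nu>) (\<kappa> \<nu>) p \<le> (\<Sum>i\<in>A \<nu>. g (\<kappa> \<nu> i)) + err \<nu>"
          using ln unfolding err_def by linarith
      qed
    qed
    show "\<forall>\<^sub>F \<nu> in sequentially. \<exists>p. feasible (links (A \<nu>) (A \<nu>)) (A \<nu>) (\<kappa> \<nu>) p \<and>
        (\<Sum>i\<in>A \<nu>. g (\<kappa> \<nu> i)) - err \<nu> \<le> entropy_gap (links (A \<nu>) (A \<nu>)) (A \<nu>) (\<kappa> \<nu>) p"
      using ev
    proof eventually_elim
      case (elim \<nu>)
      have "\<exists>p. feasible (links (A \<nu>) (A \<nu>)) (A \<nu>) (\<kappa> \<nu>) p \<and>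
          (\<Sum>i\<in>A \<nu>. g (\<kappa> \<nu> i)) - (1 + 6 * (real (q \<nu>))\<^sup>2) \<le> entropy_gap (links (A \<nu>) (A \<nu>)) (A \<nu>) (\<kappa> \<nu>) p"
        by (rule entropy_gap_self(2)[OF A G q(2) q(1), of _ "N \<nu>"]) (use elim in auto)
      then obtain p where p: "feasible (links (A \<nu>) (A \<nu>)) (A \<nu>) (\<kappa> \<nu>) p"
        "(\<Sum>i\<in>A \<nu>. g (\<kappa> \<nu> i)) - (1 + 6 * (real (q \<nu>))\<^sup>2) \<le> entropy_gap (links (A \<nu>) (A \<nu>)) (A \<nu>) (\<kappa> \<nu>) p"
        by blast
      have "0 \<le> sparse_loss (N \<nu>) (16 * (real (q \<nu>))\<^sup>2)"
        using sparse_loss_mono[of 0 "16 * (real (q \<nu>))\<^sup>2" "N \<nu>"] elim by simp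
      moreover have "0 \<le> ln (N \<nu>)" "0 \<le> (real (q \<nu>))\<^sup>2" using elim by auto
      ultimately have "1 + 6 * (real (q \<nu>))\<^sup>2 \<le> err \<nu>" unfolding err_def by linarith
      then show ?case using p by (intro exI[of _ p]) auto
    qed
  qed
qed

section \<open>Multi-layer graphs\<close>

definition blocks :: "nat \<Rightarrow> (nat \<Rightarrow> nat \<Rightarrow> nat) \<Rightarrow> (nat \<times> nat) set" where
  "blocks M \<gamma> = {(s, t). s \<in> {1..M} \<and> t \<in> {1..M} \<and> s \<le> t \<and> \<gamma> s t = 1}"

definition block_links :: "(nat \<Rightarrow> nat) \<Rightarrow> nat \<times> nat \<Rightarrow> node set set" where
  "block_links n c = links (layer n (fst c)) (layer n (snd c))"

text \<open>The constrained nodes of a block fill none, one or both of its layers, according to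
  their classes.\<close>

definition block_nodes :: "(nat \<Rightarrow> nat \<Rightarrow> nat) \<Rightarrow> nat set \<Rightarrow> nat set \<Rightarrow> (nat \<Rightarrow> nat) \<Rightarrow> nat \<times> nat \<Rightarrow> node set" where
  "block_nodes \<gamma> M1 M2 n c =
     {i. \<exists>s t. (s, t) \<in> constrained_pairs \<gamma> M1 M2 \<and> i \<in> layer n s \<and> c = (min s t, max s t)}"

text \<open>The target is the layer of the block opposite to the node; for a block within one layer
  the two agree.\<close>

definition block_degree :: "(node \<Rightarrow> nat \<Rightarrow> nat) \<Rightarrow> nat \<times> nat \<Rightarrow> node \<Rightarrow> nat" where
  "block_degree k c i = k i (if fst i = fst c then snd c else fst c)"

text \<open>The map \<open>\<alpha>\<close> for the splitting into blocks.\<close>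

definition block_index :: "node \<times> nat \<Rightarrow> (nat \<times> nat) \<times> node" where
  "block_index x = ((min (fst (fst x)) (snd x), max (fst (fst x)) (snd x)), fst x)"

lemma layer_fst: "i \<in> layer n s \<Longrightarrow> fst i = s" by (auto simp: layer_def)

lemma finite_layer [simp]: "finite (layer n s)" by (simp add: layer_def)

lemma card_layer [simp]: "card (layer n s) = n s"
  by (simp add: layer_def card_cartesian_product_singleton)

lemma layer_disjoint: "s \<noteq> t \<Longrightarrow> layer n s \<inter> layer n t = {}" by (auto simp: layer_def)

lemma block_links_minmax: "block_links n (min s t, max s t) = links (layer n s) (layer n t)"
proof (cases "s \<le> t")
  case True
  then show ?thesis by (simp add: block_links_def)
next
  case False
  then have "min s t = t" "max s t = s" by auto
  then show ?thesis unfolding block_links_def by (simp only: fst_conv snd_conv) (rule links_commute)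
qed

lemma block_degree_eq: "i \<in> layer n s \<Longrightarrow> block_degree k (min s t, max s t) i = k i t"
  by (auto simp: block_degree_def layer_fst min_def max_def)

lemma finite_block_links [simp]: "finite (block_links n c)"
  unfolding block_links_def by (rule is_link_setD(2)[OF is_link_set_links]) auto

lemma finite_blocks: "finite (blocks M \<gamma>)"
  by (rule finite_subset[of _ "{1..M} \<times> {1..M}"]) (auto simp: blocks_def)

lemma multilayer_graphs_eq:
  assumes "master_graph M \<gamma>"
  shows "multilayer_graphs M \<gamma> n = Pow (\<Union>c\<in>blocks M \<gamma>. block_links n c)"
proof -
  have "(\<exists>s\<in>{1..M}. \<exists>t\<in>{1..M}. \<gamma> s t = 1 \<and> (\<exists>i\<in>layer n s. \<exists>j\<in>layer n t. i \<noteq> j \<and> e = {i, j}))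
      \<longleftrightarrow> e \<in> (\<Union>c\<in>blocks M \<gamma>. block_links n c)" (is "?L \<longleftrightarrow> ?R") for e
  proof
    assume ?L
    then obtain s t i j where *: "s \<in> {1..M}" "t \<in> {1..M}" "\<gamma> s t = 1" "i \<in> layer n s" "j \<in> layer n t" "i \<noteq> j" "e = {i, j}"
      by blast
    then have "e \<in> block_links n (min s t, max s t)" unfolding block_links_minmax by (auto intro: linksI)
    moreover have "(min s t, max s t) \<in> blocks M \<gamma>"
      using * assms by (auto simp: blocks_def master_graph_def min_def max_def)
    ultimately show ?R by blast
  next
    assume ?R
    then show ?L by (fastforce simp: blocks_def block_links_def elim!: linksE)
  qed
  then show ?thesis by (auto simp: multilayer_graphs_def)
qed

text \<open>The sorted layer numbers of the ends of a link determine its block.\<close>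

lemma block_links_disjoint:
  assumes "c \<in> blocks M \<gamma>" "d \<in> blocks M \<gamma>" "c \<noteq> d"
  shows "block_links n c \<inter> block_links n d = {}"
proof (rule ccontr)
  assume "block_links n c \<inter> block_links n d \<noteq> {}"
  then obtain e where e: "e \<in> block_links n c" "e \<in> block_links n d" by blast
  have mm: "fst c = Min (fst ` e) \<and> snd c = Max (fst ` e)"
    if ec: "e \<in> block_links n c" "c \<in> blocks M \<gamma>" for c
  proof -
    obtain i j where ij: "e = {i, j}" "i \<in> layer n (fst c)" "j \<in> layer n (snd c)"
      using ec(1) unfolding block_links_def by (rule linksE)
    have "fst c \<le> snd c" using ec(2) by (auto simp: blocks_def)
    then show ?thesis using ij layer_fst by (auto simp: min_def max_def)
  qed
  show False using mm[OF e(1) assms(1)] mm[OF e(2) assms(2)] assms(3) by (simp add: prod_eq_iff)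
qed

lemma targeted_degree_eq:
  assumes "G \<subseteq> (\<Union>c\<in>blocks M \<gamma>. block_links n c)" "i \<in> layer n s"
  shows "targeted_degree n G t i = vdeg (G \<inter> block_links n (min s t, max s t)) i"
proof -
  let ?H = "G \<inter> links (layer n s) (layer n t)"
  have H: "card e = 2" if "e \<in> ?H" for e
    using that is_link_setD(3)[OF is_link_set_links, of "layer n s" "layer n t"] by auto
  have nl: "i \<noteq> j" if ij: "{i, j} \<in> G" for j
  proof -
    obtain c where "{i, j} \<in> block_links n c" using assms(1) ij by auto
    then show ?thesis by (simp add: block_links_def mem_links_iff)
  qed
  have "nbrs ?H i = {j \<in> layer n t. {i, j} \<in> G}"
    using assms(2) nl layer_fst by (fastforce simp: nbrs_def mem_links_iff layer_def)
  moreover have "card (nbrs ?H i) = vdeg ?H i" by (rule card_nbrs) (use H in blast)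
  ultimately have "vdeg ?H i = card {j \<in> layer n t. {i, j} \<in> G}" by simp
  then show ?thesis by (simp add: targeted_degree_def adj_def block_links_minmax sum.If_cases of_bool_def Int_def)
qed

lemma constrained_pairs_block:
  assumes "master_graph M \<gamma>" "M1 \<union> M2 = {1..M}" "(s, t) \<in> constrained_pairs \<gamma> M1 M2"
  shows "(min s t, max s t) \<in> blocks M \<gamma>"
proof -
  have "s \<in> {1..M}" "t \<in> {1..M}" "\<gamma> s t = 1" using assms by (auto simp: constrained_pairs_def)
  then show ?thesis using assms(1) by (auto simp: blocks_def master_graph_def min_def max_def)
qed

lemma block_index_image:
  assumes "master_graph M \<gamma>" "M1 \<union> M2 = {1..M}"
  shows "block_index ` constraint_index \<gamma> M1 M2 n = Sigma (blocks M \<gamma>) (block_nodes \<gamma> M1 M2 n)"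
proof (intro equalityI subsetI)
  fix x assume "x \<in> block_index ` constraint_index \<gamma> M1 M2 n"
  then obtain i t s where *: "x = block_index (i, t)" "(s, t) \<in> constrained_pairs \<gamma> M1 M2" "i \<in> layer n s"
    by (auto simp: constraint_index_def)
  then show "x \<in> Sigma (blocks M \<gamma>) (block_nodes \<gamma> M1 M2 n)"
    using constrained_pairs_block[OF assms *(2)] by (auto simp: block_index_def layer_fst block_nodes_def)
next
  fix x assume "x \<in> Sigma (blocks M \<gamma>) (block_nodes \<gamma> M1 M2 n)"
  then obtain c i s t where *: "x = (c, i)" "(s, t) \<in> constrained_pairs \<gamma> M1 M2" "i \<in> layer n s" "c = (min s t, max s t)"
    by (auto simp: block_nodes_def)
  then have "x = block_index (i, t)" "(i, t) \<in> constraint_index \<gamma> M1 M2 n"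
    by (auto simp: block_index_def layer_fst constraint_index_def)
  then show "x \<in> block_index ` constraint_index \<gamma> M1 M2 n" by blast
qed

lemma finite_constrained_pairs:
  assumes "M1 \<union> M2 = {1..M}"
  shows "finite (constrained_pairs \<gamma> M1 M2)"
proof (rule finite_subset)
  show "constrained_pairs \<gamma> M1 M2 \<subseteq> (M1 \<union> M2) \<times> (M1 \<union> M2)" by (auto simp: constrained_pairs_def)
qed (simp add: assms)

text \<open>Directed constrained pairs are regrouped by blocks. The map \<open>\<beta>\<close> is
  injective because a node determines its own layer, and the block then determines the target. A
  block with two constrained layers thus yields two terms, a block within one layer a single
  term.\<close>

lemma sum_block_nodes:
  fixes h :: "nat \<Rightarrow> real"
  assumes "master_graph M \<gamma>" "M1 \<union> M2 = {1..M}"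
  shows "(\<Sum>c\<in>blocks M \<gamma>. \<Sum>i\<in>block_nodes \<gamma> M1 M2 n c. h (block_degree k c i))
    = (\<Sum>(s, t)\<in>constrained_pairs \<gamma> M1 M2. \<Sum>i\<in>layer n s. h (k i t))"
proof -
  let ?CP = "constrained_pairs \<gamma> M1 M2"
  have finCP: "finite ?CP" by (rule finite_constrained_pairs[OF assms(2)])
  have finV: "finite (block_nodes \<gamma> M1 M2 n c)" for c
  proof (rule finite_subset)
    show "block_nodes \<gamma> M1 M2 n c \<subseteq> (\<Union>p\<in>?CP. layer n (fst p))" by (force simp: block_nodes_def)
  qed (use finCP in simp)
  define \<beta> where "\<beta> = (\<lambda>((s :: nat, t :: nat), i :: node). ((min s t, max s t), i))"
  have "bij_betw \<beta> (SIGMA p:?CP. layer n (fst p)) (Sigma (blocks M \<gamma>) (block_nodes \<gamma> M1 M2 n))"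
    unfolding bij_betw_def
  proof
    show "inj_on \<beta> (SIGMA p:?CP. layer n (fst p))"
    proof (rule inj_onI)
      fix x y assume x: "x \<in> (SIGMA p:?CP. layer n (fst p))" and y: "y \<in> (SIGMA p:?CP. layer n (fst p))" and eq: "\<beta> x = \<beta> y"
      obtain s t i where x': "x = ((s, t), i)" by (cases x) auto
      obtain s' t' i' where y': "y = ((s', t'), i')" by (cases y) auto
      have "i = i'" "min s t = min s' t'" "max s t = max s' t'" using eq by (auto simp: \<beta>_def x' y')
      moreover have "i \<in> layer n s" "i' \<in> layer n s'" using x y by (auto simp: x' y')
      then have "fst i = s" "fst i' = s'" by (metis layer_fst)+
      ultimately show "x = y" by (auto simp: x' y' min_def max_def split: if_splits)
    qed
    have "\<beta> ` (SIGMA p:?CP. layer n (fst p)) = block_index ` constraint_index \<gamma> M1 M2 n"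
    proof (intro equalityI subsetI)
      fix x assume "x \<in> \<beta> ` (SIGMA p:?CP. layer n (fst p))"
      then obtain s t i where *: "(s, t) \<in> ?CP" "i \<in> layer n s" "x = \<beta> ((s, t), i)" by auto
      then have "x = block_index (i, t)" by (simp add: \<beta>_def block_index_def layer_fst)
      then show "x \<in> block_index ` constraint_index \<gamma> M1 M2 n" using * by (auto simp: constraint_index_def)
    next
      fix x assume "x \<in> block_index ` constraint_index \<gamma> M1 M2 n"
      then obtain s t i where *: "(s, t) \<in> ?CP" "i \<in> layer n s" "x = block_index (i, t)"
        by (auto simp: constraint_index_def)
      then have "x = \<beta> ((s, t), i)" by (simp add: \<beta>_def block_index_def layer_fst)
      then show "x \<in> \<beta> ` (SIGMA p:?CP. layer n (fst p))" using * by (intro image_eqI) auto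
    qed
    then show "\<beta> ` (SIGMA p:?CP. layer n (fst p)) = Sigma (blocks M \<gamma>) (block_nodes \<gamma> M1 M2 n)"
      by (simp add: block_index_image[OF assms])
  qed
  note reindex = sum.reindex_bij_betw[OF this, of "\<lambda>(c, i). h (block_degree k c i)"]
  have "(\<Sum>x\<in>(SIGMA p:?CP. layer n (fst p)). case \<beta> x of (c, i) \<Rightarrow> h (block_degree k c i))
      = (\<Sum>x\<in>(SIGMA p:?CP. layer n (fst p)). h (k (snd x) (snd (fst x))))"
    by (intro sum.cong refl) (auto simp: \<beta>_def block_degree_eq)
  from trans[OF reindex[symmetric] this]
  have "(\<Sum>(c, i)\<in>Sigma (blocks M \<gamma>) (block_nodes \<gamma> M1 M2 n). h (block_degree k c i))
      = (\<Sum>x\<in>(SIGMA p:?CP. layer n (fst p)). h (k (snd x) (snd (fst x))))" .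
  also have "\<dots> = (\<Sum>p\<in>?CP. \<Sum>i\<in>layer n (fst p). h (k i (snd p)))"
    using finCP by (subst sum.Sigma) (auto simp: split_beta)
  finally show ?thesis using finV finite_blocks[of M \<gamma>] by (subst sum.Sigma) (auto simp: split_beta)
qed

lemma realisable_block:
  assumes "master_graph M \<gamma>" "realisable M \<gamma> M1 M2 n k" "c \<in> blocks M \<gamma>"
  shows "degree_class (block_links n c) (block_nodes \<gamma> M1 M2 n c) (block_degree k c) \<noteq> {}"
proof -
  obtain G where G: "G \<in> multilayer_graphs M \<gamma> n"
    "\<And>s t i. (s, t) \<in> constrained_pairs \<gamma> M1 M2 \<Longrightarrow> i \<in> layer n s \<Longrightarrow> targeted_degree n G t i = k i t"
    using assms(2) unfolding realisable_def by fast
  have GU: "G \<subseteq> (\<Union>c\<in>blocks M \<gamma>. block_links n c)" using G(1) by (simp add: multilayer_graphs_eq[OF assms(1)])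
  have "vdeg (G \<inter> block_links n c) i = block_degree k c i" if "i \<in> block_nodes \<gamma> M1 M2 n c" for i
  proof -
    obtain s t where *: "(s, t) \<in> constrained_pairs \<gamma> M1 M2" "i \<in> layer n s" "c = (min s t, max s t)"
      using \<open>i \<in> _\<close> by (auto simp: block_nodes_def)
    show ?thesis using targeted_degree_eq[OF GU *(2), of t] G(2)[OF *(1,2)] block_degree_eq[OF *(2), of k t] *(3) by simp
  qed
  then have "G \<inter> block_links n c \<in> degree_class (block_links n c) (block_nodes \<gamma> M1 M2 n c) (block_degree k c)"
    by (simp add: degree_class_def)
  then show ?thesis by blast
qed

lemma relative_entropy_multilayer:
  assumes "master_graph M \<gamma>" "M1 \<union> M2 = {1..M}" "realisable M \<gamma> M1 M2 n k"
  defines "R \<equiv> relative_entropy (multilayer_graphs M \<gamma> n) (P_mic M \<gamma> M1 M2 n k) (P_can M \<gamma> M1 M2 n k)"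
  shows "\<exists>p. (\<forall>c\<in>blocks M \<gamma>. feasible (block_links n c) (block_nodes \<gamma> M1 M2 n c) (block_degree k c) p) \<and>
      R \<le> (\<Sum>c\<in>blocks M \<gamma>. entropy_gap (block_links n c) (block_nodes \<gamma> M1 M2 n c) (block_degree k c) p)"
    and "(\<And>c. c \<in> blocks M \<gamma> \<Longrightarrow> feasible (block_links n c) (block_nodes \<gamma> M1 M2 n c) (block_degree k c) (q c)) \<Longrightarrow>
      (\<Sum>c\<in>blocks M \<gamma>. entropy_gap (block_links n c) (block_nodes \<gamma> M1 M2 n c) (block_degree k c) (q c)) \<le> R"
proof -
  let ?I = "constraint_index \<gamma> M1 M2 n"
  have C: "degree_constraint n G x = real (vdeg (G \<inter> block_links n (fst (block_index x))) (snd (block_index x)))"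
    if Gx: "G \<subseteq> (\<Union>c\<in>blocks M \<gamma>. block_links n c)" "x \<in> ?I" for G x
  proof -
    obtain i t s where *: "x = (i, t)" "(s, t) \<in> constrained_pairs \<gamma> M1 M2" "i \<in> layer n s"
      using Gx(2) by (auto simp: constraint_index_def)
    then show ?thesis using targeted_degree_eq[OF Gx(1) *(3), of t]
      by (simp add: degree_constraint_def block_index_def layer_fst)
  qed
  have cs: "(\<lambda>(i, t). real (k i t)) x = real (block_degree k (fst (block_index x)) (snd (block_index x)))"
    if xI: "x \<in> ?I" for x
  proof -
    obtain i t s where *: "x = (i, t)" "i \<in> layer n s"
      using xI by (auto simp: constraint_index_def)
    then show ?thesis using block_degree_eq[OF *(2), of k t] by (simp add: block_index_def layer_fst)
  qed
  have ne: "\<exists>G\<in>multilayer_graphs M \<gamma> n. \<forall>x\<in>?I. degree_constraint n G x = (\<lambda>(i, t). real (k i t)) x"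
    using assms(3) by (fastforce simp: realisable_def constraint_index_def degree_constraint_def)
  note blocks = finite_blocks finite_block_links block_links_disjoint block_index_image[OF assms(1,2)]
      C cs multilayer_graphs_eq[OF assms(1)] ne
  show "\<exists>p. (\<forall>c\<in>blocks M \<gamma>. feasible (block_links n c) (block_nodes \<gamma> M1 M2 n c) (block_degree k c) p) \<and>
      R \<le> (\<Sum>c\<in>blocks M \<gamma>. entropy_gap (block_links n c) (block_nodes \<gamma> M1 M2 n c) (block_degree k c) p)"
    unfolding R_def P_mic_def P_can_def
    by (rule relative_entropy_blocks(1)[where V = "block_nodes \<gamma> M1 M2 n" and \<kappa> = "block_degree k", OF blocks])
      assumption+
  show "(\<Sum>c\<in>blocks M \<gamma>. entropy_gap (block_links n c) (block_nodes \<gamma> M1 M2 n c) (block_degree k c) (q c)) \<le> R"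
    if q: "\<And>c. c \<in> blocks M \<gamma> \<Longrightarrow> feasible (block_links n c) (block_nodes \<gamma> M1 M2 n c) (block_degree k c) (q c)"
    unfolding R_def P_mic_def P_can_def
    by (rule relative_entropy_blocks(2)[where V = "block_nodes \<gamma> M1 M2 n" and \<kappa> = "block_degree k", OF blocks])
      (assumption | rule q)+
qed

text \<open>The classes of the two layers decide which nodes are constrained and hence which
  estimate applies. The one-sided case occurs twice, because blocks are sorted by layer number and
  not by class.\<close>

lemma asymptotic_gap_block:
  fixes f :: "nat \<Rightarrow> nat \<Rightarrow> nat pmf"
  assumes \<gamma>: "master_graph M \<gamma>" and M: "M1 \<union> M2 = {1..M}" "M1 \<inter> M2 = {}"
    and n: "\<And>s. s \<in> {1..M} \<Longrightarrow> filterlim (\<lambda>\<nu>. n \<nu> s) at_top sequentially"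
    and real: "\<And>\<nu>. realisable M \<gamma> M1 M2 (n \<nu>) (k \<nu>)"
    and bip: "\<And>s t. s \<in> M1 \<Longrightarrow> t \<in> M1 \<Longrightarrow> \<gamma> s t = 1 \<Longrightarrow> s \<noteq> t \<Longrightarrow>
           (\<lambda>\<nu>. real (max_degree (n \<nu>) (k \<nu>) s t) * real (max_degree (n \<nu>) (k \<nu>) t s))
             \<in> o(\<lambda>\<nu>. real (num_links (n \<nu>) (k \<nu>) s t) powr (2 / 3))"
    and self: "\<And>s. s \<in> M1 \<Longrightarrow> \<gamma> s s = 1 \<Longrightarrow>
           (\<lambda>\<nu>. real (max_degree (n \<nu>) (k \<nu>) s s)) \<in> o(\<lambda>\<nu>. real (n \<nu> s) powr (1 / 2))"
    and f: "\<And>s t. s \<in> M1 \<Longrightarrow> t \<in> M1 \<union> M2 \<Longrightarrow> \<gamma> s t = 1 \<Longrightarrow>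
           (\<lambda>\<nu>. l1g_norm (\<lambda>j. empirical (layer (n \<nu>) s) (\<lambda>i. k \<nu> i t) j - pmf (f s t) j)) \<longlonglongrightarrow> 0"
    and c: "c \<in> blocks M \<gamma>"
  shows "asymptotic_gap (\<lambda>\<nu>. block_links (n \<nu>) c) (\<lambda>\<nu>. block_nodes \<gamma> M1 M2 (n \<nu>) c)
    (\<lambda>\<nu>. block_degree (k \<nu>) c) (\<lambda>\<nu>. real (\<Sum>r=1..M. n \<nu> r))"
proof -
  obtain s t where st: "c = (s, t)" "s \<in> {1..M}" "t \<in> {1..M}" "s \<le> t" "\<gamma> s t = 1"
    using c by (auto simp: blocks_def)
  have "\<gamma> s t = \<gamma> t s" using \<gamma> st(2,3) unfolding master_graph_def by blast
  then have \<gamma>ts: "\<gamma> t s = 1" using st(5) by simp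
  have "s \<in> M1 \<union> M2" "t \<in> M1 \<union> M2" unfolding M(1) by (fact st)+
  then have part: "s \<in> M1 \<or> s \<in> M2" "t \<in> M1 \<or> t \<in> M2" by blast+
  have excl: "x \<notin> M2" if "x \<in> M1" for x using M(2) that by blast
  have nodes: "block_nodes \<gamma> M1 M2 m c = (if s \<in> M1 then layer m s else {}) \<union> (if t \<in> M1 then layer m t else {})" for m
  proof (intro equalityI subsetI)
    fix i assume "i \<in> block_nodes \<gamma> M1 M2 m c"
    then obtain a b where ab: "(a, b) \<in> constrained_pairs \<gamma> M1 M2" "i \<in> layer m a" "(s, t) = (min a b, max a b)"
      unfolding st(1) block_nodes_def by blast
    then have "a \<in> M1" "a = s \<or> a = t" by (auto simp: constrained_pairs_def min_def max_def split: if_splits)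
    then show "i \<in> (if s \<in> M1 then layer m s else {}) \<union> (if t \<in> M1 then layer m t else {})" using ab(2) by auto
  next
    fix i assume i: "i \<in> (if s \<in> M1 then layer m s else {}) \<union> (if t \<in> M1 then layer m t else {})"
    then consider "s \<in> M1" "i \<in> layer m s" | "t \<in> M1" "i \<in> layer m t" by (auto split: if_splits)
    then show "i \<in> block_nodes \<gamma> M1 M2 m c"
    proof cases
      case 1
      then have "(s, t) \<in> constrained_pairs \<gamma> M1 M2" using st part by (auto simp: constrained_pairs_def)
      then show ?thesis using 1 st unfolding block_nodes_def by force
    next
      case 2
      then have "(t, s) \<in> constrained_pairs \<gamma> M1 M2" using \<gamma>ts part by (auto simp: constrained_pairs_def)
      then show ?thesis using 2 st unfolding block_nodes_def by force
    qed
  qed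
  have links: "block_links m c = links (layer m s) (layer m t)" "block_links m c = links (layer m t) (layer m s)" for m
    using links_commute by (auto simp: block_links_def st(1))
  have deg_s: "block_degree k' c i = k' i t" if "i \<in> layer m s" for i k' m
    using block_degree_eq[OF that, of k' t] st(1,4) by simp
  have deg_t: "block_degree k' c i = k' i s" if "i \<in> layer m t" for i k' m
    using block_degree_eq[OF that, of k' s] st(1,4) by (simp add: min_def max_def split: if_splits)
  have ne: "degree_class (block_links (n \<nu>) c) (block_nodes \<gamma> M1 M2 (n \<nu>) c) (block_degree (k \<nu>) c) \<noteq> {}" for \<nu>
    by (rule realisable_block[OF \<gamma> real c])
  have max_s: "block_degree (k \<nu>) c i \<le> max_degree (n \<nu>) (k \<nu>) s t" if "i \<in> layer (n \<nu>) s" for \<nu> i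
    unfolding max_degree_def deg_s[OF that] using that by (intro Max_ge) auto
  have max_t: "block_degree (k \<nu>) c i \<le> max_degree (n \<nu>) (k \<nu>) t s" if "i \<in> layer (n \<nu>) t" for \<nu> i
    unfolding max_degree_def deg_t[OF that] using that by (intro Max_ge) auto
  have emp_s: "empirical (layer (n \<nu>) s) (block_degree (k \<nu>) c) = empirical (layer (n \<nu>) s) (\<lambda>i. k \<nu> i t)" for \<nu>
    by (intro ext) (simp add: empirical_def deg_s cong: sum.cong)
  have emp_t: "empirical (layer (n \<nu>) t) (block_degree (k \<nu>) c) = empirical (layer (n \<nu>) t) (\<lambda>i. k \<nu> i s)" for \<nu>
    by (intro ext) (simp add: empirical_def deg_t cong: sum.cong)
  have le: "\<forall>\<^sub>F \<nu> in sequentially. 0 < real (n \<nu> r) \<and> real (n \<nu> r) \<le> real (\<Sum>r=1..M. n \<nu> r)" if "r \<in> {1..M}" for r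
  proof -
    have "n \<nu> r \<le> (\<Sum>r=1..M. n \<nu> r)" for \<nu> using that by (intro member_le_sum) auto
    then show ?thesis
      using n[OF that, unfolded filterlim_at_top, rule_format, of 1]
      by (elim eventually_mono) (auto simp flip: of_nat_sum)
  qed
  consider "s \<in> M2" "t \<in> M2" | "s \<in> M1" "t \<in> M2" | "s \<in> M2" "t \<in> M1" | "s \<in> M1" "t \<in> M1" "s = t" | "s \<in> M1" "t \<in> M1" "s \<noteq> t"
    using part by blast
  then show ?thesis
  proof cases
    case 1
    then have nodes0: "block_nodes \<gamma> M1 M2 m c = {}" for m using nodes excl by auto
    show ?thesis unfolding nodes0 by (rule asymptotic_gap_free) simp
  next
    case 2
    then have nodes': "block_nodes \<gamma> M1 M2 m c = layer m s" for m using nodes excl by auto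
    have "s \<noteq> t" using 2 excl by auto
    have "asymptotic_gap (\<lambda>\<nu>. links (layer (n \<nu>) s) (layer (n \<nu>) t)) (\<lambda>\<nu>. layer (n \<nu>) s)
        (\<lambda>\<nu>. block_degree (k \<nu>) c) (\<lambda>\<nu>. card (layer (n \<nu>) s))"
    proof (rule asymptotic_gap_one_sided[where f = "f s t"])
      show "degree_class (links (layer (n \<nu>) s) (layer (n \<nu>) t)) (layer (n \<nu>) s) (block_degree (k \<nu>) c) \<noteq> {}" for \<nu>
        using ne[of \<nu>] unfolding nodes' links(1) .
      show "(\<lambda>\<nu>. l1g_norm (\<lambda>j. empirical (layer (n \<nu>) s) (block_degree (k \<nu>) c) j - pmf (f s t) j)) \<longlonglongrightarrow> 0"
        unfolding emp_s using 2 st by (intro f) auto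
    qed (use n st layer_disjoint[OF \<open>s \<noteq> t\<close>] in auto)
    then show ?thesis unfolding nodes' links(1)
      by (rule asymptotic_gap_mono) (use le[OF st(2)] in simp)
  next
    case 3
    then have nodes': "block_nodes \<gamma> M1 M2 m c = layer m t" for m using nodes excl by auto
    have "t \<noteq> s" using 3 excl by auto
    have "asymptotic_gap (\<lambda>\<nu>. links (layer (n \<nu>) t) (layer (n \<nu>) s)) (\<lambda>\<nu>. layer (n \<nu>) t)
        (\<lambda>\<nu>. block_degree (k \<nu>) c) (\<lambda>\<nu>. card (layer (n \<nu>) t))"
    proof (rule asymptotic_gap_one_sided[where f = "f t s"])
      show "degree_class (links (layer (n \<nu>) t) (layer (n \<nu>) s)) (layer (n \<nu>) t) (block_degree (k \<nu>) c) \<noteq> {}" for \<nu>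
        using ne[of \<nu>] unfolding nodes' links(2) .
      show "(\<lambda>\<nu>. l1g_norm (\<lambda>j. empirical (layer (n \<nu>) t) (block_degree (k \<nu>) c) j - pmf (f t s) j)) \<longlonglongrightarrow> 0"
        unfolding emp_t using 3 \<gamma>ts by (intro f) auto
    qed (use n st layer_disjoint[OF \<open>t \<noteq> s\<close>] in auto)
    then show ?thesis unfolding nodes' links(2)
      by (rule asymptotic_gap_mono) (use le[OF st(3)] in simp)
  next
    case 4
    then have nodes': "block_nodes \<gamma> M1 M2 m c = layer m s" for m using nodes by auto
    have links': "block_links m c = links (layer m s) (layer m s)" for m using links(1) 4 by simp
    have "asymptotic_gap (\<lambda>\<nu>. links (layer (n \<nu>) s) (layer (n \<nu>) s)) (\<lambda>\<nu>. layer (n \<nu>) s)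
        (\<lambda>\<nu>. block_degree (k \<nu>) c) (\<lambda>\<nu>. card (layer (n \<nu>) s))"
    proof (rule asymptotic_gap_self[where m = "\<lambda>\<nu>. max_degree (n \<nu>) (k \<nu>) s t"])
      show "degree_class (links (layer (n \<nu>) s) (layer (n \<nu>) s)) (layer (n \<nu>) s) (block_degree (k \<nu>) c) \<noteq> {}" for \<nu>
        using ne[of \<nu>] unfolding nodes' links' .
      show "(\<lambda>\<nu>. real (max_degree (n \<nu>) (k \<nu>) s t)) \<in> o(\<lambda>\<nu>. real (card (layer (n \<nu>) s)) powr (1 / 2))"
        using self[of s] 4 st(5) by simp
    qed (use n st max_s in auto)
    then show ?thesis unfolding nodes' links'
      by (rule asymptotic_gap_mono) (use le[OF st(2)] in simp)
  next
    case 5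
    then have nodes': "block_nodes \<gamma> M1 M2 m c = layer m s \<union> layer m t" for m using nodes by auto
    have num: "num_links (n \<nu>) (k \<nu>) s t = (\<Sum>i\<in>layer (n \<nu>) s. block_degree (k \<nu>) c i)" for \<nu>
      unfolding num_links_def by (intro sum.cong) (auto simp: deg_s)
    have "asymptotic_gap (\<lambda>\<nu>. links (layer (n \<nu>) s) (layer (n \<nu>) t)) (\<lambda>\<nu>. layer (n \<nu>) s \<union> layer (n \<nu>) t)
        (\<lambda>\<nu>. block_degree (k \<nu>) c) (\<lambda>\<nu>. real (card (layer (n \<nu>) s)) + card (layer (n \<nu>) t))"
    proof (rule asymptotic_gap_bip[where m = "\<lambda>\<nu>. max_degree (n \<nu>) (k \<nu>) s t" and m' = "\<lambda>\<nu>. max_degree (n \<nu>) (k \<nu>) t s"])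
      show "degree_class (links (layer (n \<nu>) s) (layer (n \<nu>) t)) (layer (n \<nu>) s \<union> layer (n \<nu>) t) (block_degree (k \<nu>) c) \<noteq> {}" for \<nu>
        using ne[of \<nu>] unfolding nodes' links(1) .
      show "(\<lambda>\<nu>. real (max_degree (n \<nu>) (k \<nu>) s t) * real (max_degree (n \<nu>) (k \<nu>) t s))
          \<in> o(\<lambda>\<nu>. real (\<Sum>i\<in>layer (n \<nu>) s. block_degree (k \<nu>) c i) powr (2 / 3))"
        unfolding num[symmetric] using bip[of s t] 5 st(5) by simp
    qed (use n st max_s max_t layer_disjoint[OF 5(3)] in auto)
    moreover have "real (n \<nu> s) + real (n \<nu> t) \<le> real (\<Sum>r=1..M. n \<nu> r)" for \<nu>
    proof -
      have "n \<nu> s + n \<nu> t = (\<Sum>r\<in>{s, t}. n \<nu> r)" using 5 by simp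
      also have "\<dots> \<le> (\<Sum>r=1..M. n \<nu> r)" using st by (intro sum_mono2) auto
      finally show ?thesis by (simp flip: of_nat_add of_nat_sum)
    qed
    ultimately show ?thesis unfolding nodes' links(1)
      by (elim asymptotic_gap_mono) (use le[OF st(2)] in \<open>auto elim!: eventually_mono\<close>)
  qed
qed

theorem theorem1p10:
  fixes M :: nat and \<gamma> :: "nat \<Rightarrow> nat \<Rightarrow> nat" and M1 M2 :: "nat set"
    and n :: "nat \<Rightarrow> nat \<Rightarrow> nat"
    and k :: "nat \<Rightarrow> node \<Rightarrow> nat \<Rightarrow> nat"
    and A :: "nat \<Rightarrow> real"
    and f :: "nat \<Rightarrow> nat \<Rightarrow> nat pmf"
  assumes "1 \<le> M" and "master_graph M \<gamma>"
    and "M1 \<union> M2 = {1..M}" and "M1 \<inter> M2 = {}"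
    and "\<And>s. s \<in> {1..M} \<Longrightarrow> filterlim (\<lambda>\<nu>. n \<nu> s) at_top sequentially"
    and "\<And>\<nu>. realisable M \<gamma> M1 M2 (n \<nu>) (k \<nu>)"
    and "\<And>s. s \<in> {1..M} \<Longrightarrow>
           (\<lambda>\<nu>. real (n \<nu> s) / real (\<Sum>r=1..M. n \<nu> r)) \<longlonglongrightarrow> A s"
    and "\<And>s t. s \<in> M1 \<Longrightarrow> t \<in> M1 \<Longrightarrow> \<gamma> s t = 1 \<Longrightarrow> s \<noteq> t \<Longrightarrow>
           (\<lambda>\<nu>. real (max_degree (n \<nu>) (k \<nu>) s t) * real (max_degree (n \<nu>) (k \<nu>) t s))
             \<in> o(\<lambda>\<nu>. real (num_links (n \<nu>) (k \<nu>) s t) powr (2 / 3))"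
    and "\<And>s. s \<in> M1 \<Longrightarrow> \<gamma> s s = 1 \<Longrightarrow>
           (\<lambda>\<nu>. real (max_degree (n \<nu>) (k \<nu>) s s)) \<in> o(\<lambda>\<nu>. real (n \<nu> s) powr (1 / 2))"
    and "\<And>s t. s \<in> M1 \<Longrightarrow> t \<in> M1 \<union> M2 \<Longrightarrow> \<gamma> s t = 1 \<Longrightarrow>
           (\<lambda>\<nu>. l1g_norm (\<lambda>j. empirical_degree_dist (n \<nu>) (k \<nu>) s t j - pmf (f s t) j))
             \<longlonglongrightarrow> 0"
  shows "(\<lambda>\<nu>. ereal (relative_entropy (multilayer_graphs M \<gamma> (n \<nu>))
                       (P_mic M \<gamma> M1 M2 (n \<nu>) (k \<nu>)) (P_can M \<gamma> M1 M2 (n \<nu>) (k \<nu>))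
                     / real (\<Sum>s=1..M. n \<nu> s)))
           \<longlonglongrightarrow> (\<Sum>(s, t)\<in>constrained_pairs \<gamma> M1 M2.
                  ereal (A s) * enn2ereal (l1g_norm (pmf (f s t))))"
proof -
  define N where "N = (\<lambda>\<nu>. real (\<Sum>r=1..M. n \<nu> r))"
  define R where "R = (\<lambda>\<nu>. relative_entropy (multilayer_graphs M \<gamma> (n \<nu>))
    (P_mic M \<gamma> M1 M2 (n \<nu>) (k \<nu>)) (P_can M \<gamma> M1 M2 (n \<nu>) (k \<nu>)))"
  let ?J = "blocks M \<gamma>" and ?CP = "constrained_pairs \<gamma> M1 M2"
  let ?E = "\<lambda>\<nu>. block_links (n \<nu>)" and ?V = "\<lambda>\<nu>. block_nodes \<gamma> M1 M2 (n \<nu>)" and ?\<kappa> = "\<lambda>\<nu>. block_degree (k \<nu>)"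
  \<comment> \<open>The leading term: it differs from \<open>R\<close> by o(n), and its own limit is
    computed layer by layer after regrouping.\<close>
  define T where "T = (\<lambda>\<nu>. \<Sum>c\<in>?J. \<Sum>i\<in>?V \<nu> c. g (?\<kappa> \<nu> c i))"
  have f: "(\<lambda>\<nu>. l1g_norm (\<lambda>j. empirical (layer (n \<nu>) s) (\<lambda>i. k \<nu> i t) j - pmf (f s t) j)) \<longlonglongrightarrow> 0"
    if "s \<in> M1" "t \<in> M1 \<union> M2" "\<gamma> s t = 1" for s t
    using assms(10)[OF that] by (simp add: empirical_degree_dist_def[abs_def] empirical_def[abs_def])
  have "\<forall>c\<in>?J. asymptotic_gap (\<lambda>\<nu>. ?E \<nu> c) (\<lambda>\<nu>. ?V \<nu> c) (\<lambda>\<nu>. ?\<kappa> \<nu> c) N"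
    unfolding N_def using asymptotic_gap_block[OF assms(2-6,8,9) f] by blast
  then have "\<forall>c\<in>?J. \<exists>err. (\<lambda>\<nu>. err \<nu> / N \<nu>) \<longlonglongrightarrow> 0 \<and>
     (\<forall>\<^sub>F \<nu> in sequentially.
       (\<forall>p. feasible (?E \<nu> c) (?V \<nu> c) (?\<kappa> \<nu> c) p \<longrightarrow>
          entropy_gap (?E \<nu> c) (?V \<nu> c) (?\<kappa> \<nu> c) p \<le> (\<Sum>i\<in>?V \<nu> c. g (?\<kappa> \<nu> c i)) + err \<nu>) \<and>
       (\<exists>p. feasible (?E \<nu> c) (?V \<nu> c) (?\<kappa> \<nu> c) p \<and>
          (\<Sum>i\<in>?V \<nu> c. g (?\<kappa> \<nu> c i)) - err \<nu> \<le> entropy_gap (?E \<nu> c) (?V \<nu> c) (?\<kappa> \<nu> c) p))"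
    unfolding asymptotic_gap_def .
  from bchoice[OF this] obtain err where err: "\<And>c. c \<in> ?J \<Longrightarrow> (\<lambda>\<nu>. err c \<nu> / N \<nu>) \<longlonglongrightarrow> 0"
    and ev: "\<And>c. c \<in> ?J \<Longrightarrow> \<forall>\<^sub>F \<nu> in sequentially.
       (\<forall>p. feasible (?E \<nu> c) (?V \<nu> c) (?\<kappa> \<nu> c) p \<longrightarrow>
          entropy_gap (?E \<nu> c) (?V \<nu> c) (?\<kappa> \<nu> c) p \<le> (\<Sum>i\<in>?V \<nu> c. g (?\<kappa> \<nu> c i)) + err c \<nu>) \<and>
       (\<exists>p. feasible (?E \<nu> c) (?V \<nu> c) (?\<kappa> \<nu> c) p \<and>
          (\<Sum>i\<in>?V \<nu> c. g (?\<kappa> \<nu> c i)) - err c \<nu> \<le> entropy_gap (?E \<nu> c) (?V \<nu> c) (?\<kappa> \<nu> c) p)"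
    by blast
  define Err where "Err = (\<lambda>\<nu>. \<Sum>c\<in>?J. err c \<nu>)"
  have "(\<lambda>\<nu>. \<Sum>c\<in>?J. err c \<nu> / N \<nu>) \<longlonglongrightarrow> (\<Sum>c\<in>?J. 0)" by (intro tendsto_sum err)
  then have Err: "(\<lambda>\<nu>. Err \<nu> / N \<nu>) \<longlonglongrightarrow> 0" by (simp add: Err_def sum_divide_distrib)
  have "\<forall>\<^sub>F \<nu> in sequentially. \<forall>c\<in>?J.
       (\<forall>p. feasible (?E \<nu> c) (?V \<nu> c) (?\<kappa> \<nu> c) p \<longrightarrow>
          entropy_gap (?E \<nu> c) (?V \<nu> c) (?\<kappa> \<nu> c) p \<le> (\<Sum>i\<in>?V \<nu> c. g (?\<kappa> \<nu> c i)) + err c \<nu>) \<and>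
       (\<exists>p. feasible (?E \<nu> c) (?V \<nu> c) (?\<kappa> \<nu> c) p \<and>
          (\<Sum>i\<in>?V \<nu> c. g (?\<kappa> \<nu> c i)) - err c \<nu> \<le> entropy_gap (?E \<nu> c) (?V \<nu> c) (?\<kappa> \<nu> c) p)"
    by (intro eventually_ball_finite finite_blocks ballI ev)
  then have bound: "\<forall>\<^sub>F \<nu> in sequentially. \<bar>R \<nu> - T \<nu>\<bar> \<le> Err \<nu>"
  proof eventually_elim
    case (elim \<nu>)
    note rel = relative_entropy_multilayer[OF assms(2,3) assms(6)[of \<nu>], folded R_def]
    obtain p where p: "\<forall>c\<in>?J. feasible (?E \<nu> c) (?V \<nu> c) (?\<kappa> \<nu> c) p"
      "R \<nu> \<le> (\<Sum>c\<in>?J. entropy_gap (?E \<nu> c) (?V \<nu> c) (?\<kappa> \<nu> c) p)"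
      using rel(1) by (auto simp: R_def)
    have "(\<Sum>c\<in>?J. entropy_gap (?E \<nu> c) (?V \<nu> c) (?\<kappa> \<nu> c) p) \<le> (\<Sum>c\<in>?J. (\<Sum>i\<in>?V \<nu> c. g (?\<kappa> \<nu> c i)) + err c \<nu>)"
      using elim p(1) by (intro sum_mono) blast
    then have up: "R \<nu> \<le> T \<nu> + Err \<nu>" using p(2) by (simp add: T_def Err_def sum.distrib)
    have "\<forall>c\<in>?J. \<exists>p. feasible (?E \<nu> c) (?V \<nu> c) (?\<kappa> \<nu> c) p \<and>
          (\<Sum>i\<in>?V \<nu> c. g (?\<kappa> \<nu> c i)) - err c \<nu> \<le> entropy_gap (?E \<nu> c) (?V \<nu> c) (?\<kappa> \<nu> c) p"
      using elim by blast
    from bchoice[OF this] obtain q where q: "\<And>c. c \<in> ?J \<Longrightarrow> feasible (?E \<nu> c) (?V \<nu> c) (?\<kappa> \<nu> c) (q c)"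
      "\<And>c. c \<in> ?J \<Longrightarrow> (\<Sum>i\<in>?V \<nu> c. g (?\<kappa> \<nu> c i)) - err c \<nu> \<le> entropy_gap (?E \<nu> c) (?V \<nu> c) (?\<kappa> \<nu> c) (q c)"
      by blast
    have "(\<Sum>c\<in>?J. (\<Sum>i\<in>?V \<nu> c. g (?\<kappa> \<nu> c i)) - err c \<nu>) \<le> (\<Sum>c\<in>?J. entropy_gap (?E \<nu> c) (?V \<nu> c) (?\<kappa> \<nu> c) (q c))"
      by (intro sum_mono q(2))
    also have "\<dots> \<le> R \<nu>" unfolding R_def
      by (rule relative_entropy_multilayer(2)[OF assms(2,3) assms(6)]) (rule q(1))
    finally have "T \<nu> - Err \<nu> \<le> R \<nu>" by (simp add: T_def Err_def sum_subtractf)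
    then show ?case using up by linarith
  qed
  have "(\<lambda>\<nu>. R \<nu> / N \<nu> - T \<nu> / N \<nu>) \<longlonglongrightarrow> 0"
  proof (rule Lim_null_comparison[OF _ Err])
    show "\<forall>\<^sub>F \<nu> in sequentially. norm (R \<nu> / N \<nu> - T \<nu> / N \<nu>) \<le> Err \<nu> / N \<nu>"
      using bound
    proof eventually_elim
      case (elim \<nu>)
      have N0: "0 \<le> N \<nu>" unfolding N_def by (rule of_nat_0_le_iff)
      have "\<bar>R \<nu> - T \<nu>\<bar> / N \<nu> \<le> Err \<nu> / N \<nu>" using elim N0 by (rule divide_right_mono)
      then show ?case using N0 by (simp flip: diff_divide_distrib)
    qed
  qed
  moreover have "(\<lambda>\<nu>. T \<nu> / N \<nu>) \<longlonglongrightarrow> (\<Sum>(s, t)\<in>?CP. A s * (\<Sum>j. pmf (f s t) j * g j))"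
  proof -
    have "T \<nu> / N \<nu> = (\<Sum>(s, t)\<in>?CP. real (n \<nu> s) / N \<nu> * ((\<Sum>i\<in>layer (n \<nu>) s. g (k \<nu> i t)) / card (layer (n \<nu>) s)))" for \<nu>
    proof -
      have "T \<nu> / N \<nu> = (\<Sum>(s, t)\<in>?CP. (\<Sum>i\<in>layer (n \<nu>) s. g (k \<nu> i t)) / N \<nu>)"
        unfolding T_def sum_block_nodes[OF assms(2,3)] by (simp add: sum_divide_distrib split_beta)
      also have "\<dots> = (\<Sum>(s, t)\<in>?CP. real (n \<nu> s) / N \<nu> * ((\<Sum>i\<in>layer (n \<nu>) s. g (k \<nu> i t)) / card (layer (n \<nu>) s)))"
      proof (intro sum.cong refl, clarify)
        fix s t
        \<comment> \<open>A layer may still be empty for small \<open>\<nu>\<close>; both sides are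
          then 0.\<close>
        show "(\<Sum>i\<in>layer (n \<nu>) s. g (k \<nu> i t)) / N \<nu>
          = real (n \<nu> s) / N \<nu> * ((\<Sum>i\<in>layer (n \<nu>) s. g (k \<nu> i t)) / card (layer (n \<nu>) s))"
          by (cases "n \<nu> s = 0") (auto simp: layer_def)
      qed
      finally show ?thesis .
    qed
    moreover have "(\<lambda>\<nu>. \<Sum>(s, t)\<in>?CP. real (n \<nu> s) / N \<nu> * ((\<Sum>i\<in>layer (n \<nu>) s. g (k \<nu> i t)) / card (layer (n \<nu>) s)))
      \<longlonglongrightarrow> (\<Sum>(s, t)\<in>?CP. A s * (\<Sum>j. pmf (f s t) j * g j))"
    proof (rule tendsto_sum)
      fix x assume x: "x \<in> ?CP"
      obtain s t where st: "x = (s, t)" "s \<in> M1" "t \<in> M1 \<union> M2" "\<gamma> s t = 1" using x by (auto simp: constrained_pairs_def)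
      have "s \<in> {1..M}" using st(2) assms(3) by blast
      show "(\<lambda>\<nu>. case x of (s, t) \<Rightarrow> real (n \<nu> s) / N \<nu> * ((\<Sum>i\<in>layer (n \<nu>) s. g (k \<nu> i t)) / card (layer (n \<nu>) s)))
        \<longlonglongrightarrow> (case x of (s, t) \<Rightarrow> A s * (\<Sum>j. pmf (f s t) j * g j))"
        unfolding st(1) prod.case N_def
        by (intro tendsto_mult assms(7) \<open>s \<in> {1..M}\<close> empirical_g_limit(2) f st finite_layer)
    qed
    ultimately show ?thesis by simp
  qed
  ultimately have "(\<lambda>\<nu>. (R \<nu> / N \<nu> - T \<nu> / N \<nu>) + T \<nu> / N \<nu>) \<longlonglongrightarrow> 0 + (\<Sum>(s, t)\<in>?CP. A s * (\<Sum>j. pmf (f s t) j * g j))"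
    by (rule tendsto_add)
  then have lim: "(\<lambda>\<nu>. R \<nu> / N \<nu>) \<longlonglongrightarrow> (\<Sum>(s, t)\<in>?CP. A s * (\<Sum>j. pmf (f s t) j * g j))" by simp
  \<comment> \<open>Convergence in the norm forces the norms of the limits to be finite, so the
    extended right side is a real sum.\<close>
  have "(\<Sum>(s, t)\<in>?CP. ereal (A s) * enn2ereal (l1g_norm (pmf (f s t))))
      = (\<Sum>(s, t)\<in>?CP. ereal (A s * (\<Sum>j. pmf (f s t) j * g j)))"
  proof (intro sum.cong refl, clarify)
    fix s t assume "(s, t) \<in> ?CP"
    then have st: "s \<in> M1" "t \<in> M1 \<union> M2" "\<gamma> s t = 1" by (auto simp: constrained_pairs_def)
    have sum: "summable (\<lambda>j. pmf (f s t) j * g j)" by (rule empirical_g_limit(1)[OF finite_layer f[OF st]])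
    have "0 \<le> (\<Sum>j. pmf (f s t) j * g j)" using sum by (intro suminf_nonneg) (auto simp: g_nonneg)
    then show "ereal (A s) * enn2ereal (l1g_norm (pmf (f s t))) = ereal (A s * (\<Sum>j. pmf (f s t) j * g j))"
      by (simp add: l1g_norm_pmf[OF sum])
  qed
  also have "\<dots> = ereal (\<Sum>(s, t)\<in>?CP. A s * (\<Sum>j. pmf (f s t) j * g j))"
    by (simp add: split_beta)
  finally show ?thesis using lim by (simp add: R_def N_def)
qed

end
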